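(* Let $S_1$ and $S_2$ be two Morse tiled (resp. Morse shelled) sets with tame tilings (resp. shellings) $\tau_1$ and $\tau_2$. Then $S_1\times S_2$ carries primitive triangulations equipped with tame Morse tilings (resp. tame Morse shellings) whose critical vector is $c(\tau_1)c(\tau_2)$. Moreover, if $\tau_1$ and $\tau_2$ are pure dimensional, the $h$-vector of these tilings is palindromic provided $h(\tau_1)$ and $h(\tau_2)$ are palindromic.
   Context: A facet of a simplex is a codimension one face (the empty set is regarded as the unique facet of a $0$-simplex). A Morse tile of dimension $n$ and order $k\in\{0,\dots,n+1\}$ is a closed $n$-simplex $\sigma$ (its underlying simplex) deprived of $k$ of its facets together with, if $k\ge 1$, a possibly empty face $\mu$ of codimension at least two (the Morse face); when $\mu$ is non-empty it is understood not to be contained in the removed facets, so that $k-1\le\dim\mu\le n-2$. Critical tiles: the closed simplex is critical of index $0$; the open $n$-simplex (order $n+1$) is critical of index $n$; a Morse tile of order $k$, $1\le k\le n-1$, whose Morse face has dimension $k-1$ is critical of index $k$; all other Morse tiles are regular. Let $K$ be a finite simplicial complex. A Morse tiling of a subset $S\subset|K|$ is a partition of $S$ by Morse tiles, each obtained from a simplex of $K$, such that for every $j\ge 0$ the union of the tiles of dimension $\ge j$ is closed in $S$; the closure of $S$ in $K$ is called the underlying simplicial complex. A Morse tiled subset of $S$ is a union of tiles closed in $S$. A Morse shelling of $S$ is a Morse tiling together with a filtration $\emptyset\subset S_1\subset\dots\subset S_N=S$ by Morse tiled subsets such that $S_1$ and each $S_i\setminus S_{i-1}$ ($2\le i\le N$)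 is a single tile. A tiling is pure dimensional if all tiles have the same dimension. For an $n$-dimensional Morse tiling $\tau$ (i.e. with maximal tile dimension $n$), $h(\tau)=(h_0(\tau),\dots,h_{n+1}(\tau))$ and $c(\tau)=(c_0(\tau),\dots,c_n(\tau))$ where $h_k(\tau)$ is the number of tiles of order $k$ and $c_k(\tau)$ the number of critical tiles of index $k$; $c(\tau)$ is also called the critical vector. The product of $u=(u_0,\dots,u_n)$ and $v=(v_0,\dots,v_m)$ is $uv=(w_0,\dots,w_{n+m})$, $w_k=\sum_{j}u_jv_{k-j}$ (product of polynomials). A vector $(v_0,\dots,v_N)$ is palindromic if $v_i=v_{N-i}$ for all $i$. A Morse tiling (or shelling) is tame if there is an orientation of all edges of the underlying simplicial complex such that (1) no triangle of the complex has boundary an oriented one-cycle; (2) for every tile with underlying simplex $\sigma$ and non-empty Morse face $\mu$, all edges joining a vertex of $\sigma$ not in $\mu$ to a vertex of $\mu$ are oriented towards $\mu$. If $K_1,K_2$ are the simplicial complexes underlying $S_1,S_2$, then $K_1\times K_2$ is a polyhedral complex whose cells are products of simplices. A primitive triangulation of it is a triangulation (each cell being a union of affine simplices) having the same set of vertices. A triangulation of $S_1\times S_2$ means a triangulation of $K_1\times K_2$, and the tilings or shellings are those of the subset $S_1\times S_2$. *)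

theory Defs
  imports "HOL-Analysis.Analysis" "HOL-Library.Disjoint_Sets"
begin

(* Unlike the library's facet_of, this admits the empty facet of a 0-simplex
   (aff_dim {} = -1), as the theory of Morse tiles requires. *)
definition facets :: "'a::euclidean_space set \<Rightarrow> 'a set set" where
  "facets \<sigma> = {F. F face_of \<sigma> \<and> aff_dim F = aff_dim \<sigma> - 1}"

definition vertices :: "'a::euclidean_space set \<Rightarrow> 'a set" where
  "vertices P = {v. v extreme_point_of P}"

(* A tile is kept as the data (simplex, removed facets, Morse face) and not only as the
   subset it covers: the closed 0-simplex (order 0) and the open 0-simplex (order 1) cover
   the same point but have different orders. *)
datatype 'a tile =
  Tile (tile_simplex: "'a set") (removed_facets: "'a set set") (morse_face: "'a set")

definition tile_set :: "'a tile \<Rightarrow> 'a set" where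
  "tile_set t = tile_simplex t - \<Union>(removed_facets t) - morse_face t"

definition tile_dim :: "'a::euclidean_space tile \<Rightarrow> int" where
  "tile_dim t = aff_dim (tile_simplex t)"

definition tile_order :: "'a tile \<Rightarrow> nat" where
  "tile_order t = card (removed_facets t)"

definition morse_tile :: "'a::euclidean_space tile \<Rightarrow> bool" where
  "morse_tile t \<longleftrightarrow>
     (\<exists>n\<ge>0. n simplex tile_simplex t) \<and>
     removed_facets t \<subseteq> facets (tile_simplex t) \<and>
     (morse_face t \<noteq> {} \<longrightarrow>
        tile_order t \<ge> 1 \<and>
        morse_face t face_of tile_simplex t \<and>
        aff_dim (morse_face t) \<le> tile_dim t - 2 \<and>
        (\<forall>F\<in>removed_facets t. \<not> morse_face t \<subseteq> F))"

definition critical_of_index :: "'a::euclidean_space tile \<Rightarrow> nat \<Rightarrow> bool" where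
  "critical_of_index t k \<longleftrightarrow>
     (tile_order t = 0 \<and> k = 0) \<or>
     (int (tile_order t) = tile_dim t + 1 \<and> int k = tile_dim t) \<or>
     (1 \<le> tile_order t \<and> int (tile_order t) \<le> tile_dim t - 1 \<and>
        aff_dim (morse_face t) = int (tile_order t) - 1 \<and> k = tile_order t)"

definition morse_tiling ::
  "'a::euclidean_space set set \<Rightarrow> 'a set \<Rightarrow> 'a tile set \<Rightarrow> bool" where
  "morse_tiling K S \<tau> \<longleftrightarrow>
     (\<forall>t\<in>\<tau>. morse_tile t \<and> tile_simplex t \<in> K) \<and>
     disjoint_family_on tile_set \<tau> \<and>
     \<Union>(tile_set ` \<tau>) = S \<and>
     (\<forall>j::nat. closedin (top_of_set S) (\<Union>(tile_set ` {t\<in>\<tau>. int j \<le> tile_dim t})))"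

definition morse_tiled_subset :: "'a::euclidean_space set \<Rightarrow> 'a tile set \<Rightarrow> 'a set \<Rightarrow> bool" where
  "morse_tiled_subset S \<tau> A \<longleftrightarrow>
     (\<exists>\<tau>'\<subseteq>\<tau>. A = \<Union>(tile_set ` \<tau>')) \<and> closedin (top_of_set S) A"

(* The filtration is F 1, ..., F N, preceded by F 0 = {}, so that the condition on S_1 is the
   case i = 0 of the condition on differences; N = 0 occurs exactly for S = {}. *)
definition morse_shelling ::
  "'a::euclidean_space set set \<Rightarrow> 'a set \<Rightarrow> 'a tile set \<Rightarrow> nat \<Rightarrow> (nat \<Rightarrow> 'a set) \<Rightarrow> bool" where
  "morse_shelling K S \<tau> N F \<longleftrightarrow>
     morse_tiling K S \<tau> \<and>
     F 0 = {} \<and> F N = S \<and>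
     (\<forall>i<N. F i \<subset> F (Suc i) \<and>
        morse_tiled_subset S \<tau> (F (Suc i)) \<and>
        (\<exists>t\<in>\<tau>. F (Suc i) - F i = tile_set t))"

definition underlying_complex ::
  "'a::euclidean_space set set \<Rightarrow> 'a set \<Rightarrow> 'a set set" where
  "underlying_complex K S = {\<sigma>\<in>K. \<sigma> \<subseteq> closure S}"

definition edge_orientation :: "'a::euclidean_space set set \<Rightarrow> ('a \<times> 'a) set \<Rightarrow> bool" where
  "edge_orientation L A \<longleftrightarrow>
     (\<forall>(a, b)\<in>A. a \<noteq> b \<and> closed_segment a b \<in> L) \<and>
     (\<forall>a b. a \<noteq> b \<and> closed_segment a b \<in> L \<longrightarrow> ((a, b) \<in> A \<longleftrightarrow> (b, a) \<notin> A))"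

definition tame :: "'a::euclidean_space set set \<Rightarrow> 'a set \<Rightarrow> 'a tile set \<Rightarrow> bool" where
  "tame K S \<tau> \<longleftrightarrow>
     (\<exists>A. edge_orientation (underlying_complex K S) A \<and>
        (\<forall>\<Delta>\<in>underlying_complex K S. 2 simplex \<Delta> \<longrightarrow>
           \<not> (\<exists>a\<in>vertices \<Delta>. \<exists>b\<in>vertices \<Delta>. \<exists>c\<in>vertices \<Delta>.
                (a, b) \<in> A \<and> (b, c) \<in> A \<and> (c, a) \<in> A)) \<and>
        (\<forall>t\<in>\<tau>. morse_face t \<noteq> {} \<longrightarrow>
           (\<forall>v \<in> vertices (tile_simplex t) - morse_face t. \<forall>w \<in> vertices (morse_face t).
              (v, w) \<in> A)))"

(* Empty tilings get dimension -1, hence empty c-vector and h-vector [0]. *)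
definition tiling_dim :: "'a::euclidean_space tile set \<Rightarrow> int" where
  "tiling_dim \<tau> = Max (insert (-1) (tile_dim ` \<tau>))"

definition pure_dimensional :: "'a::euclidean_space tile set \<Rightarrow> bool" where
  "pure_dimensional \<tau> \<longleftrightarrow> (\<forall>t\<in>\<tau>. \<forall>u\<in>\<tau>. tile_dim t = tile_dim u)"

(* The vectors (v_0, ..., v_N) are lists of length N + 1. *)
definition h_vector :: "'a::euclidean_space tile set \<Rightarrow> nat list" where
  "h_vector \<tau> = map (\<lambda>k. card {t\<in>\<tau>. tile_order t = k}) [0..<nat (tiling_dim \<tau> + 2)]"

definition c_vector :: "'a::euclidean_space tile set \<Rightarrow> nat list" where
  "c_vector \<tau> = map (\<lambda>k. card {t\<in>\<tau>. critical_of_index t k}) [0..<nat (tiling_dim \<tau> + 1)]"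

(* Coefficient list of the product polynomial; the empty list stands for the zero polynomial. *)
definition vector_product :: "nat list \<Rightarrow> nat list \<Rightarrow> nat list" where
  "vector_product u v =
     (if u = [] \<or> v = [] then []
      else map (\<lambda>k. \<Sum>j | j \<le> k \<and> j < length u \<and> k - j < length v. u ! j * v ! (k - j))
             [0..<length u + length v - 1])"

definition palindromic :: "nat list \<Rightarrow> bool" where
  "palindromic v \<longleftrightarrow> (\<forall>i<length v. v ! i = v ! (length v - 1 - i))"

definition product_cells ::
  "'a::euclidean_space set set \<Rightarrow> 'b::euclidean_space set set \<Rightarrow> ('a \<times> 'b) set set" where
  "product_cells K1 K2 = {P \<times> Q |P Q. P \<in> K1 \<and> Q \<in> K2}"

definition primitive_triangulation ::
  "'a::euclidean_space set set \<Rightarrow> 'a set set \<Rightarrow> bool" where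
  "primitive_triangulation C T \<longleftrightarrow>
     simplicial_complex T \<and>
     \<Union>T = \<Union>C \<and>
     (\<forall>P\<in>C. \<exists>U\<subseteq>T. P = \<Union>U) \<and>
     {x. {x} \<in> T} = {x. {x} \<in> C}"

end

theory Submission
  imports Defs
begin

text \<open>
  A tameness orientation orders the vertices of every simplex linearly: it orients every edge and
  has no cyclic triangle. The product of two simplices with ordered vertices is triangulated by the
  chains of the product of the two vertex orders (the staircase triangulation), and orders that
  agree on common faces give triangulations that agree on common faces
  (\<open>chain_complex_geometric\<close>). Everything below happens inside this one triangulation; it
  remains to cut the product of two tiles into tiles supported on the maximal chains.

  A tile is encoded by its vertex set \<open>W\<close>, the set \<open>R\<close> of vertices opposite to the removed facets and
  the vertex set \<open>M\<close> of the Morse face: a point belongs to the tile iff its carrier \<open>C\<close> (the vertex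
  set of the smallest simplex containing it) satisfies \<open>R \<subseteq> C \<subseteq> W\<close> and \<open>\<not> C \<subseteq> M\<close>. Tameness says
  that \<open>M\<close> is a final segment of the ordered set \<open>W\<close>. In a product, the carrier of \<open>(x, y)\<close> is a
  chain whose projections are the carriers of \<open>x\<close> and \<open>y\<close>, so membership in a product of tiles, too,
  is a condition on the chain alone.

  Maximal chains of a product of an \<open>n1\<close>-simplex and an \<open>n2\<close>-simplex are staircase paths, that is,
  shuffles of \<open>n1\<close> horizontal and \<open>n2\<close> vertical steps. Label the steps by distinct real numbers, the
  labels of a factor being chosen such that they descend exactly at the vertices in \<open>R\<close> (a common
  label \<open>s\<close> before the first step and a common label \<open>e\<close> after the last one take care of the two
  end vertices; \<open>word_with_descents_exists\<close>). Let a path remove the facets opposite to its own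
  descents. Then every chain that meets all columns in \<open>R1\<close> and all rows in \<open>R2\<close> lies in exactly one
  half-open path simplex (\<open>stairs_select\<close>), and it is the first path containing the chain in an
  explicit order, which is why the construction also yields shellings. The Morse face of a path consists
  of its points outside the box \<open>{..<a1} \<times> {..<a2}\<close>, where \<open>{a1..n1}\<close> and \<open>{a2..n2}\<close> are the Morse
  faces of the factors.

  A path tile with Morse face is critical iff its descents are exactly its points outside the box.
  This forces both words to ascend up to one point and to descend after it, and such a path exists,
  and is unique, precisely when both factors are critical; the indices add up
  (\<open>count_critical_paths\<close>). If only one factor has a Morse face, some label of the other one is chosen to exceed
  all labels of the first wherever its word could turn, since otherwise regular factors could produce
  critical paths. The product of
  a closed and an open simplex needs a separate treatment
  (\<open>subdivides_well_closed_open\<close>): no common \<open>s\<close> and \<open>e\<close> exist for it.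

  The number of paths with \<open>d\<close> descents depends only on the dimensions and orders \<open>k1\<close>, \<open>k2\<close> of the
  factors: it is \<open>(n1 + k2 - k1) choose (d - k1)\<close> times \<open>(n2 + k1 - k2) choose (d - k2)\<close>
  (\<open>desc_count_stairs\<close>). It is invariant under complementing the orders and \<open>d\<close>
  (\<open>product_order_reflect\<close>), which gives palindromic h-vectors.
\<close>

section \<open>Staircase paths and their descents\<close>

definition chain2 :: "(nat \<times> nat) set \<Rightarrow> bool" where
  "chain2 C \<longleftrightarrow> (\<forall>p\<in>C. \<forall>q\<in>C. fst p \<le> fst q \<and> snd p \<le> snd q \<or> fst q \<le> fst p \<and> snd q \<le> snd p)"

text \<open>
  The descents of the word \<open>s, xs, e\<close>. Letter number \<open>i\<close> is the step from vertex \<open>i\<close> to vertex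
  \<open>i + 1\<close>, so the descent at a vertex compares the step leaving it with the step arriving there.
\<close>

fun desc :: "real \<Rightarrow> real \<Rightarrow> nat \<Rightarrow> real list \<Rightarrow> nat set" where
  "desc e s i [] = (if e < s then {i} else {})"
| "desc e s i (x # xs) = (if x < s then {i} else {}) \<union> desc e x (Suc i) xs"

definition in_order :: "bool \<Rightarrow> 'a list \<Rightarrow> 'a list \<Rightarrow> 'a list" where
  "in_order b A B = (if b then A @ B else B @ A)"

lemma set_in_order [simp]: "set (in_order b A B) = set A \<union> set B"
  by (auto simp: in_order_def)

text \<open>
  All shuffles of \<open>xs\<close> (steps to the right) and \<open>ys\<close> (steps up) as paths from \<open>(i, j)\<close>. Every point
  of a path carries a flag that tells whether the path descends there; \<open>s\<close> is the label of the step
  arriving at \<open>(i, j)\<close> and \<open>e\<close> the label after the last step. Paths that take the smaller label first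
  are listed first. Hence at a descending corner, where a larger label of one word precedes a smaller one of the other,
  exchanging the two steps gives an earlier path that contains all other points: this is the common
  facet that the later path has to give up.
\<close>

fun stairs :: "real \<Rightarrow> real \<Rightarrow> nat \<Rightarrow> real list \<Rightarrow> nat \<Rightarrow> real list \<Rightarrow> ((nat \<times> nat) \<times> bool) list list" where
  "stairs e s i [] j [] = [[((i, j), e < s)]]"
| "stairs e s i (x # xs) j [] = map (Cons ((i, j), x < s)) (stairs e x (Suc i) xs j [])"
| "stairs e s i [] j (y # ys) = map (Cons ((i, j), y < s)) (stairs e y i [] (Suc j) ys)"
| "stairs e s i (x # xs) j (y # ys) =
    in_order (x < y)
       (map (Cons ((i, j), x < s)) (stairs e x (Suc i) xs j (y # ys)))
       (map (Cons ((i, j), y < s)) (stairs e y i (x # xs) (Suc j) ys))"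

definition pts :: "((nat \<times> nat) \<times> bool) list \<Rightarrow> (nat \<times> nat) set" where
  "pts f = fst ` set f"

definition rem :: "((nat \<times> nat) \<times> bool) list \<Rightarrow> (nat \<times> nat) set" where
  "rem f = {p. (p, True) \<in> set f}"

lemma pts_Cons [simp]: "pts ((p, r) # f) = insert p (pts f)"
  and pts_Nil [simp]: "pts [] = {}"
  by (auto simp: pts_def)

lemma rem_Cons [simp]: "rem ((p, r) # f) = (if r then {p} else {}) \<union> rem f"
  and rem_Nil [simp]: "rem [] = {}"
  by (auto simp: rem_def)

lemma rem_subset_pts: "rem f \<subseteq> pts f"
  by (force simp: rem_def pts_def)

lemma desc_subset: "desc e s i xs \<subseteq> {i..i + length xs}"
  by (induction xs arbitrary: s i) (auto split: if_splits, (metis Suc_leD atLeastAtMost_iff in_mono add_Suc)+)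

lemma stairs_pts_grid:
  "f \<in> set (stairs e s i xs j ys) \<Longrightarrow> pts f \<subseteq> {i..i + length xs} \<times> {j..j + length ys}"
proof (induction e s i xs j ys arbitrary: f rule: stairs.induct)
  case (2 e s i x xs j)
  then show ?case by fastforce
next
  case (3 e s i j y ys)
  then show ?case by fastforce
next
  case (4 e s i x xs j y ys)
  from 4(3) consider g where "f = ((i, j), x < s) # g" "g \<in> set (stairs e x (Suc i) xs j (y # ys))"
    | g where "f = ((i, j), y < s) # g" "g \<in> set (stairs e y i (x # xs) (Suc j) ys)"
    by (auto simp: split: if_splits)
  then show ?case
    using 4(1,2) by cases fastforce+
qed auto

lemma stairs_start: "f \<in> set (stairs e s i xs j ys) \<Longrightarrow> (i, j) \<in> pts f"
  by (induction e s i xs j ys rule: stairs.induct) (auto simp: split: if_splits)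

lemma stairs_end: "f \<in> set (stairs e s i xs j ys) \<Longrightarrow> (i + length xs, j + length ys) \<in> pts f"
  by (induction e s i xs j ys arbitrary: f rule: stairs.induct) (fastforce simp: split: if_splits)+

lemma stairs_cases:
  assumes "f \<in> set (stairs e s i xs j ys)"
  obtains "xs = []" "ys = []" "f = [((i, j), e < s)]"
  | x xs' g where "xs = x # xs'" "f = ((i, j), x < s) # g" "g \<in> set (stairs e x (Suc i) xs' j ys)"
  | y ys' g where "ys = y # ys'" "f = ((i, j), y < s) # g" "g \<in> set (stairs e y i xs (Suc j) ys')"
  using assms by (cases "(e, s, i, xs, j, ys)" rule: stairs.cases) (auto simp: split: if_splits)

lemma stairs_chain: "f \<in> set (stairs e s i xs j ys) \<Longrightarrow> chain2 (pts f)"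
proof (induction "length xs + length ys" arbitrary: f s i xs j ys)
  case 0 then show ?case by (auto simp: chain2_def)
next
  case (Suc n)
  from Suc(3) show ?case
  proof (cases rule: stairs_cases)
    case 1 with Suc(2) show ?thesis by simp
  next
    case (2 x xs' g)
    have "chain2 (pts g)" using Suc(1)[OF _ 2(3)] Suc(2) 2(1) by simp
    with stairs_pts_grid[OF 2(3)] show ?thesis unfolding 2(2) chain2_def by fastforce
  next
    case (3 y ys' g)
    have "chain2 (pts g)" using Suc(1)[OF _ 3(3)] Suc(2) 3(1) by simp
    with stairs_pts_grid[OF 3(3)] show ?thesis unfolding 3(2) chain2_def by fastforce
  qed
qed

lemma stairs_first_notin:
  "g \<in> set (stairs e x (Suc i) xs j ys) \<Longrightarrow> (i, j) \<notin> pts g"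
  "g \<in> set (stairs e x i xs (Suc j) ys) \<Longrightarrow> (i, j) \<notin> pts g"
  using stairs_pts_grid by fastforce+

lemma stairs_distinct: "f \<in> set (stairs e s i xs j ys) \<Longrightarrow>
  distinct (map fst f) \<and> length f = length xs + length ys + 1"
proof (induction "length xs + length ys" arbitrary: f s i xs j ys)
  case 0 then show ?case by auto
next
  case (Suc n)
  from Suc(3) show ?case
  proof (cases rule: stairs_cases)
    case 1 with Suc(2) show ?thesis by simp
  next
    case (2 x xs' g)
    then show ?thesis using Suc(1)[OF _ 2(3)] Suc(2) stairs_first_notin(1)[OF 2(3)]
      by (auto simp: pts_def)
  next
    case (3 y ys' g)
    then show ?thesis using Suc(1)[OF _ 3(3)] Suc(2) stairs_first_notin(2)[OF 3(3)]
      by (auto simp: pts_def)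
  qed
qed

lemma stairs_card_pts: "f \<in> set (stairs e s i xs j ys) \<Longrightarrow> card (pts f) = length xs + length ys + 1"
  using stairs_distinct[of f] distinct_card[of "map fst f"] by (simp add: pts_def)

lemma stairs_card_rem: 
  assumes "f \<in> set (stairs e s i xs j ys)"
  shows "card (rem f) = length (filter snd f)"
proof -
  have d: "distinct (map fst (filter snd f))"
    using stairs_distinct[OF assms] distinct_map_filter by blast
  have "rem f = set (map fst (filter snd f))" by (force simp: rem_def)
  then show ?thesis using distinct_card[OF d] by simp
qed


lemma desc_start: "desc e s j ys \<subseteq> desc e x j ys \<union> (if x < s then {j} else {})"
  by (cases ys) auto

text \<open>
  If the word \<open>xs\<close> descends at \<open>i\<close>, the labels along column \<open>i\<close> of the path run from a
  larger to a smaller value, so the path descends somewhere in this column. A chain containing all descents of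
  the path therefore meets the column.
\<close>

lemma stairs_admissible:
  assumes "f \<in> set (stairs e s i xs j ys)" "rem f \<subseteq> C" "C \<subseteq> pts f"
  shows "desc e s i xs \<subseteq> fst ` C \<and> desc e s j ys \<subseteq> snd ` C"
  using assms
proof (induction "length xs + length ys" arbitrary: f s i xs j ys C)
  case 0 then show ?case by (auto split: if_splits) 
next
  case (Suc n)
  from Suc(3) show ?case
  proof (cases rule: stairs_cases)
    case 1 with Suc(2) show ?thesis by simp
  next
    case (2 x xs' g)
    note ni = stairs_first_notin(1)[OF 2(3)]
    have "rem g \<subseteq> C - {(i,j)}" using Suc(4) 2(2) ni rem_subset_pts[of g] by auto
    moreover have "C - {(i,j)} \<subseteq> pts g" using Suc(5) 2(2) by auto
    ultimately have IH: "desc e x (Suc i) xs' \<subseteq> fst ` (C - {(i,j)})" "desc e x j ys \<subseteq> snd ` (C - {(i,j)})"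
      using Suc(1)[OF _ 2(3)] Suc(2) 2(1) by auto
    have C: "x < s \<Longrightarrow> (i,j) \<in> C" using Suc(4) 2(2) by auto
    have "x < s \<Longrightarrow> i \<in> fst ` C" "x < s \<Longrightarrow> j \<in> snd ` C" using C by force+
    moreover have "desc e x (Suc i) xs' \<subseteq> fst ` C" "desc e x j ys \<subseteq> snd ` C" using IH by blast+
    ultimately show ?thesis using desc_start[of e s j ys x] 2(1) by (cases "x < s") auto
  next
    case (3 x ys' g)
    note ni = stairs_first_notin(2)[OF 3(3)]
    have "rem g \<subseteq> C - {(i,j)}" using Suc(4) 3(2) ni rem_subset_pts[of g] by auto
    moreover have "C - {(i,j)} \<subseteq> pts g" using Suc(5) 3(2) by auto
    ultimately have IH: "desc e x (Suc j) ys' \<subseteq> snd ` (C - {(i,j)})" "desc e x i xs \<subseteq> fst ` (C - {(i,j)})"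
      using Suc(1)[OF _ 3(3)] Suc(2) 3(1) by auto
    have C: "x < s \<Longrightarrow> (i,j) \<in> C" using Suc(4) 3(2) by auto
    have "x < s \<Longrightarrow> i \<in> fst ` C" "x < s \<Longrightarrow> j \<in> snd ` C" using C by force+
    moreover have "desc e x (Suc j) ys' \<subseteq> snd ` C" "desc e x i xs \<subseteq> fst ` C" using IH by blast+
    ultimately show ?thesis using desc_start[of e s i xs x] 3(1) by (cases "x < s") auto
  qed
qed

text \<open>
  The list acts as a half-open decomposition: a path is the first one to contain \<open>C\<close> and the only
  one whose half-open simplex contains it. That no earlier path contains \<open>C\<close> is what makes initial
  segments of the list closed.
\<close>

definition selects :: "((nat \<times> nat) \<times> bool) list list \<Rightarrow> (nat \<times> nat) set \<Rightarrow> bool" where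
  "selects L C \<longleftrightarrow> (\<exists>A f B. L = A @ f # B \<and> rem f \<subseteq> C \<and> C \<subseteq> pts f \<and>
      (\<forall>g\<in>set A. \<not> C \<subseteq> pts g) \<and> (\<forall>g\<in>set B. \<not> (rem g \<subseteq> C \<and> C \<subseteq> pts g)))"

lemma selects_appendI1:
  assumes "selects L C" "\<And>g. g \<in> set L' \<Longrightarrow> rem g \<subseteq> C \<Longrightarrow> C \<subseteq> pts g \<Longrightarrow> False"
  shows "selects (L @ L') C"
proof -
  from assms(1) obtain A f B where "L = A @ f # B" "rem f \<subseteq> C" "C \<subseteq> pts f"
      "\<forall>g\<in>set A. \<not> C \<subseteq> pts g" "\<forall>g\<in>set B. \<not> (rem g \<subseteq> C \<and> C \<subseteq> pts g)"
    unfolding selects_def by blast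
  with assms(2) show ?thesis unfolding selects_def
    by (intro exI[of _ A] exI[of _ f] exI[of _ "B @ L'"]) auto
qed

lemma selects_appendI2:
  assumes "selects L C" "\<And>g. g \<in> set L' \<Longrightarrow> C \<subseteq> pts g \<Longrightarrow> False"
  shows "selects (L' @ L) C"
proof -
  from assms(1) obtain A f B where "L = A @ f # B" "rem f \<subseteq> C" "C \<subseteq> pts f"
      "\<forall>g\<in>set A. \<not> C \<subseteq> pts g" "\<forall>g\<in>set B. \<not> (rem g \<subseteq> C \<and> C \<subseteq> pts g)"
    unfolding selects_def by blast
  with assms(2) show ?thesis unfolding selects_def
    by (intro exI[of _ "L' @ A"] exI[of _ f] exI[of _ B]) auto
qed

lemma selects_map_Cons:
  assumes "selects L (C - {p})" "r \<Longrightarrow> p \<in> C" "\<And>g. g \<in> set L \<Longrightarrow> p \<notin> pts g"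
  shows "selects (map (Cons (p, r)) L) C"
proof -
  from assms(1) obtain A f B where L: "L = A @ f # B" "rem f \<subseteq> C - {p}" "C - {p} \<subseteq> pts f"
      "\<forall>g\<in>set A. \<not> C - {p} \<subseteq> pts g" "\<forall>g\<in>set B. \<not> (rem g \<subseteq> C - {p} \<and> C - {p} \<subseteq> pts g)"
    unfolding selects_def by blast
  have "\<And>g. g \<in> set B \<Longrightarrow> p \<notin> rem g" using assms(3) rem_subset_pts L(1) by fastforce
  then have B: "\<And>g. g \<in> set B \<Longrightarrow> rem g \<subseteq> C - {p} \<longleftrightarrow> rem g \<subseteq> C" by blast
  have "\<not> C \<subseteq> pts g" if g: "g \<in> set (map (Cons (p, r)) A)" for g
  proof -
    obtain g' where g': "g' \<in> set A" "g = (p, r) # g'" using g by auto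
    then have "\<not> C - {p} \<subseteq> pts g'" using L(4) by blast
    then show ?thesis unfolding g'(2) pts_Cons by blast
  qed
  moreover have "\<not> (rem g \<subseteq> C \<and> C \<subseteq> pts g)" if g: "g \<in> set (map (Cons (p, r)) B)" for g
  proof -
    obtain g' where g': "g' \<in> set B" "g = (p, r) # g'" using g by auto
    then have "\<not> (rem g' \<subseteq> C \<and> C - {p} \<subseteq> pts g')" using L(5) B[of g'] by blast
    then show ?thesis unfolding g'(2) rem_Cons pts_Cons by blast
  qed
  moreover have "rem ((p, r) # f) \<subseteq> C" using L(2) assms(2) by auto
  moreover have "C \<subseteq> pts ((p, r) # f)" using L(3) by auto
  moreover have "map (Cons (p, r)) L = map (Cons (p, r)) A @ ((p,r) # f) # map (Cons (p, r)) B"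
    using L(1) by simp
  ultimately show ?thesis unfolding selects_def by blast
qed

definition admissible :: "real \<Rightarrow> real \<Rightarrow> nat \<Rightarrow> real list \<Rightarrow> nat \<Rightarrow> real list \<Rightarrow> (nat \<times> nat) set \<Rightarrow> bool" where
  "admissible e s i xs j ys C \<longleftrightarrow> chain2 C \<and> C \<subseteq> {i..i + length xs} \<times> {j..j + length ys} \<and>
     desc e s i xs \<subseteq> fst ` C \<and> desc e s j ys \<subseteq> snd ` C"

lemma desc_nonempty: "e < s \<Longrightarrow> desc e s i xs \<noteq> {}"
proof (induction xs arbitrary: s i)
  case (Cons x xs)
  then show ?case by (cases "x < s") auto
qed simp

lemma admissible_right:
  assumes "admissible e s i (x # xs) j ys C" "i \<notin> fst ` (C - {(i, j)})"
    "ys \<noteq> [] \<Longrightarrow> x < hd ys \<or> j \<in> snd ` (C - {(i, j)})"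
  shows "admissible e x (Suc i) xs j ys (C - {(i, j)})" "x < s \<Longrightarrow> (i, j) \<in> C"
proof -
  let ?C = "C - {(i, j)}"
  have A: "chain2 C" "C \<subseteq> {i..Suc (i + length xs)} \<times> {j..j + length ys}"
     "desc e s i (x # xs) \<subseteq> fst ` C" "desc e s j ys \<subseteq> snd ` C"
    using assms(1) by (auto simp: admissible_def)
  have ch: "chain2 ?C" using A(1) by (auto simp: chain2_def)
  have sub: "?C \<subseteq> {Suc i..Suc i + length xs} \<times> {j..j + length ys}"
  proof
    fix p assume p: "p \<in> ?C"
    then have "fst p \<noteq> i" using assms(2) by blast
    then show "p \<in> {Suc i..Suc i + length xs} \<times> {j..j + length ys}" using p A(2) by force
  qed
  have d1: "desc e x (Suc i) xs \<subseteq> fst ` ?C"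
  proof
    fix k assume k: "k \<in> desc e x (Suc i) xs"
    then have "k \<in> fst ` C" "k \<noteq> i" using A(3) desc_subset[of e x "Suc i" xs] by auto
    then show "k \<in> fst ` ?C" by force
  qed
  have tl: "k \<in> desc e s j ys" if "k \<in> desc e x j ys" "k \<noteq> j" for k
    using that by (cases ys) (auto split: if_splits)
  have d2: "desc e x j ys \<subseteq> snd ` ?C"
  proof
    fix k assume k: "k \<in> desc e x j ys"
    show "k \<in> snd ` ?C"
    proof (cases "k = j")
      case False
      then have "k \<in> snd ` C" using tl[OF k] A(4) by blast
      then show ?thesis using False by force
    next
      case True
      show ?thesis
      proof (cases ys)
        case Nil
        then have "e < x" using k by (auto split: if_splits)
        then obtain a where "a \<in> fst ` ?C" using desc_nonempty[of e x "Suc i" xs] d1 by blast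
        then obtain p where p: "p \<in> ?C" by blast
        then have "snd p = j" using sub Nil by fastforce
        then show ?thesis using p True by force
      next
        case (Cons y ys')
        have "desc e y (Suc j) ys' \<subseteq> {Suc j..}" using desc_subset[of e y "Suc j" ys'] by auto
        then have "y < x" using k True Cons by (auto split: if_splits)
        then show ?thesis using assms(3) Cons True by auto
      qed
    qed
  qed
  show "admissible e x (Suc i) xs j ys ?C" using ch sub d1 d2 by (simp add: admissible_def)
  show "(i, j) \<in> C" if "x < s"
  proof -
    have "i \<in> fst ` C" using that A(3) by auto
    then show ?thesis using assms(2) by force
  qed
qed

lemma admissible_swap: "admissible e s j ys i xs (prod.swap ` C) \<longleftrightarrow> admissible e s i xs j ys C"
  unfolding admissible_def chain2_def by (auto simp: image_image)

lemma admissible_up: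
  assumes "admissible e s i xs j (y # ys) C" "j \<notin> snd ` (C - {(i, j)})"
    "xs \<noteq> [] \<Longrightarrow> y < hd xs \<or> i \<in> fst ` (C - {(i, j)})"
  shows "admissible e y i xs (Suc j) ys (C - {(i, j)})" "y < s \<Longrightarrow> (i, j) \<in> C"
proof -
  have eq: "prod.swap ` C - {(j, i)} = prod.swap ` (C - {(i, j)})" by auto
  have a: "admissible e s j (y # ys) i xs (prod.swap ` C)" using assms(1) admissible_swap by blast
  have b: "j \<notin> fst ` (prod.swap ` C - {(j, i)})" "xs \<noteq> [] \<Longrightarrow> y < hd xs \<or> i \<in> snd ` (prod.swap ` C - {(j, i)})"
    using assms(2,3) unfolding eq by (simp_all add: image_image)
  show "admissible e y i xs (Suc j) ys (C - {(i, j)})"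
    using admissible_right(1)[OF a b] admissible_swap unfolding eq by blast
  show "y < s \<Longrightarrow> (i, j) \<in> C" using admissible_right(2)[OF a b] by auto
qed

lemma rem_subset_remove: "rem f \<subseteq> C \<Longrightarrow> p \<notin> pts f \<Longrightarrow> rem f \<subseteq> C - {p}"
  using rem_subset_pts[of f] by auto

text \<open>
  Induction along the paths: apart from \<open>(i, j)\<close> the chain cannot meet both column \<open>i\<close> and row \<open>j\<close>. If it
  meets one of them, the first step of every path containing the chain is determined; if it meets
  neither, the path taking the smaller label first is the right one, because the other
  choice would create a descent in the column or row that the chain avoids.
\<close>

theorem stairs_select:
  assumes "admissible e s i xs j ys C" "set xs \<inter> set ys = {}"
  shows "selects (stairs e s i xs j ys) C"
  using assms
proof (induction e s i xs j ys arbitrary: C rule: stairs.induct)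
  case (1 e s i j)
  then have "C \<subseteq> {(i,j)}" "e < s \<Longrightarrow> (i,j) \<in> C" by (auto simp: admissible_def)
  then show ?case
    unfolding selects_def by (intro exI[of _ "[]"] exI[of _ "[((i, j), e < s)]"]) auto
next
  case (2 e s i x xs j)
  show ?case
  proof (cases "i \<in> fst ` (C - {(i, j)})")
    case True
    then obtain p where "p \<in> C" "p \<noteq> (i, j)" "fst p = i" by blast
    moreover have "snd p = j" 
    proof -
      have "C \<subseteq> {i..i + length (x # xs)} \<times> {j..j + length ([] :: real list)}" using 2(2) unfolding admissible_def by blast
      with \<open>p \<in> C\<close> have "p \<in> {i..i + length (x # xs)} \<times> {j..j}" by auto
      then show ?thesis unfolding mem_Times_iff atLeastAtMost_iff by linarith
    qed
    ultimately have False by (metis prod.collapse)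
    then show ?thesis ..
  next
    case False
    have *: "admissible e x (Suc i) xs j [] (C - {(i, j)})" "x < s \<Longrightarrow> (i, j) \<in> C"
      by (rule admissible_right[OF 2(2) False]; simp)+
    have "selects (stairs e x (Suc i) xs j []) (C - {(i, j)})" by (rule 2(1)[OF *(1)]) simp
    then show ?thesis unfolding stairs.simps
      by (rule selects_map_Cons) (erule *(2), erule stairs_first_notin(1))
  qed
next
  case (3 e s i j y ys)
  show ?case
  proof (cases "j \<in> snd ` (C - {(i, j)})")
    case True
    then obtain p where "p \<in> C" "p \<noteq> (i, j)" "snd p = j" by blast
    moreover have "fst p = i" 
    proof -
      have "C \<subseteq> {i..i + length ([] :: real list)} \<times> {j..j + length (y # ys)}" using 3(2) unfolding admissible_def by blast
      with \<open>p \<in> C\<close> have "p \<in> {i..i} \<times> {j..j + length (y # ys)}" by auto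
      then show ?thesis unfolding mem_Times_iff atLeastAtMost_iff by linarith
    qed
    ultimately have False by (metis prod.collapse)
    then show ?thesis ..
  next
    case False
    have *: "admissible e y i [] (Suc j) ys (C - {(i, j)})" "y < s \<Longrightarrow> (i, j) \<in> C"
      by (rule admissible_up[OF 3(2) False]; simp)+
    have "selects (stairs e y i [] (Suc j) ys) (C - {(i, j)})" by (rule 3(1)[OF *(1)]) simp
    then show ?thesis unfolding stairs.simps
      by (rule selects_map_Cons) (erule *(2), erule stairs_first_notin(2))
  qed
next
  case (4 e s i x xs j y ys)
  let ?C = "C - {(i, j)}"
  let ?A = "map (Cons ((i, j), x < s)) (stairs e x (Suc i) xs j (y # ys))"
  let ?B = "map (Cons ((i, j), y < s)) (stairs e y i (x # xs) (Suc j) ys)"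
  have xy: "x \<noteq> y" using 4(4) by auto
  \<comment> \<open>Points of the chain in column i and in row j other than the corner would be incomparable.\<close>
  have both: "\<not> (i \<in> fst ` ?C \<and> j \<in> snd ` ?C)"
  proof
    assume "i \<in> fst ` ?C \<and> j \<in> snd ` ?C"
    then obtain p q where p: "p \<in> C" "p \<noteq> (i, j)" "fst p = i" and q: "q \<in> C" "q \<noteq> (i, j)" "snd q = j" by blast
    have ge: "j \<le> snd p" "i \<le> fst q" using p(1) q(1) 4(3) by (auto simp: admissible_def)
    have "j \<noteq> snd p" "i \<noteq> fst q" using p q by (auto simp: prod_eq_iff)
    with ge have "j < snd p" "i < fst q" by simp_all
    moreover have "fst p \<le> fst q \<and> snd p \<le> snd q \<or> fst q \<le> fst p \<and> snd q \<le> snd p"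
      using 4(3) p(1) q(1) unfolding admissible_def chain2_def by blast
    ultimately show False using p(3) q(3) by linarith
  qed
  have Asub: "i \<notin> fst ` ?C" if h: "g \<in> set ?A" "C \<subseteq> pts g" for g
  proof -
    obtain g' where g': "g = ((i,j), x < s) # g'" "g' \<in> set (stairs e x (Suc i) xs j (y # ys))"
      using h(1) by auto
    then have "?C \<subseteq> pts g'" using h(2) by auto
    then show ?thesis using stairs_pts_grid[OF g'(2)] by fastforce
  qed
  have Bsub: "j \<notin> snd ` ?C" if h: "g \<in> set ?B" "C \<subseteq> pts g" for g
  proof -
    obtain g' where g': "g = ((i,j), y < s) # g'" "g' \<in> set (stairs e y i (x # xs) (Suc j) ys)"
      using h(1) by auto
    then have "?C \<subseteq> pts g'" using h(2) by auto
    then show ?thesis using stairs_pts_grid[OF g'(2)] by fastforce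
  qed
  have Arem: "j \<in> snd ` ?C" if h: "g \<in> set ?A" "rem g \<subseteq> C" "C \<subseteq> pts g" "y < x" for g
  proof -
    obtain g' where g': "g = ((i,j), x < s) # g'" "g' \<in> set (stairs e x (Suc i) xs j (y # ys))"
      using h(1) by auto
    have "rem g' \<subseteq> ?C" using rem_subset_remove[of g' C] stairs_first_notin(1)[OF g'(2)] h(2) g'(1) by auto
    moreover have "?C \<subseteq> pts g'" using h(3) g' by auto
    ultimately have "desc e x j (y # ys) \<subseteq> snd ` ?C" using stairs_admissible[OF g'(2), of ?C] by blast
    moreover have "j \<in> desc e x j (y # ys)" using h(4) by simp
    ultimately show ?thesis by blast
  qed
  have Brem: "i \<in> fst ` ?C" if h: "g \<in> set ?B" "rem g \<subseteq> C" "C \<subseteq> pts g" "x < y" for g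
  proof -
    obtain g' where g': "g = ((i,j), y < s) # g'" "g' \<in> set (stairs e y i (x # xs) (Suc j) ys)"
      using h(1) by auto
    have "rem g' \<subseteq> ?C" using rem_subset_remove[of g' C] stairs_first_notin(2)[OF g'(2)] h(2) g'(1) by auto
    moreover have "?C \<subseteq> pts g'" using h(3) g' by auto
    ultimately have "desc e y i (x # xs) \<subseteq> fst ` ?C" using stairs_admissible[OF g'(2), of ?C] by blast
    moreover have "i \<in> desc e y i (x # xs)" using h(4) by simp
    ultimately show ?thesis by blast
  qed
  have right: "selects ?A C" if "i \<notin> fst ` ?C" "x < y \<or> j \<in> snd ` ?C"
  proof -
    have *: "admissible e x (Suc i) xs j (y # ys) ?C" "x < s \<Longrightarrow> (i, j) \<in> C"
      by (rule admissible_right[OF 4(3)]; use that in simp)+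
    have "set xs \<inter> set (y # ys) = {}" using 4(4) by auto
    with *(1) have "selects (stairs e x (Suc i) xs j (y # ys)) ?C" by (rule 4(1))
    then show ?thesis
      by (rule selects_map_Cons) (erule *(2), erule stairs_first_notin(1))
  qed
  have up: "selects ?B C" if "j \<notin> snd ` ?C" "y < x \<or> i \<in> fst ` ?C"
  proof -
    have *: "admissible e y i (x # xs) (Suc j) ys ?C" "y < s \<Longrightarrow> (i, j) \<in> C"
      by (rule admissible_up[OF 4(3)]; use that in simp)+
    have "set (x # xs) \<inter> set ys = {}" using 4(4) by auto
    with *(1) have "selects (stairs e y i (x # xs) (Suc j) ys) ?C" by (rule 4(2))
    then show ?thesis
      by (rule selects_map_Cons) (erule *(2), erule stairs_first_notin(2))
  qed
  show ?case
  proof (cases "x < y")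
    case True
    then have eq: "stairs e s i (x # xs) j (y # ys) = ?A @ ?B" by (simp add: in_order_def)
    show ?thesis unfolding eq
    proof (cases "i \<in> fst ` ?C")
      case True
      with both have "selects ?B C" by (intro up) auto
      then show "selects (?A @ ?B) C" by (rule selects_appendI2) (use Asub True in blast)
    next
      case False
      with \<open>x < y\<close> have "selects ?A C" by (intro right) auto
      then show "selects (?A @ ?B) C" by (rule selects_appendI1) (use Brem False \<open>x < y\<close> in blast)
    qed
  next
    case False
    with xy have yx: "y < x" by auto
    then have eq: "stairs e s i (x # xs) j (y # ys) = ?B @ ?A" by (simp add: in_order_def)
    show ?thesis unfolding eq
    proof (cases "j \<in> snd ` ?C")
      case True
      with both have "selects ?A C" by (intro right) auto
      then show "selects (?B @ ?A) C" by (rule selects_appendI2) (use Bsub True in blast)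
    next
      case False
      with yx have "selects ?B C" by (intro up) auto
      then show "selects (?B @ ?A) C" by (rule selects_appendI1) (use Arem False yx in blast)
    qed
  qed
qed

section \<open>The number of paths with a given number of descents\<close>

lemma finite_desc [simp]: "finite (desc e s i xs)"
  by (rule finite_subset[OF desc_subset]) simp

lemma card_desc_rec: "card (desc e s i (x # xs)) = of_bool (x < s) + card (desc e x (Suc i) xs)"
proof -
  have "i \<notin> desc e x (Suc i) xs"
    using subsetD[OF desc_subset, of i e x "Suc i" xs] by fastforce
  then show ?thesis by (cases "x < s") simp_all
qed

lemma card_desc_le: "card (desc e s i xs) \<le> Suc (length xs)"
  using card_mono[OF _ desc_subset[of e s i xs]] by simp

lemma card_desc_pos: "e < s \<Longrightarrow> 0 < card (desc e s i xs)"
  using desc_nonempty by (simp add: card_gt_0_iff)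

lemma desc_all_less: "card (desc e s i xs) = Suc (length xs) \<Longrightarrow> e < s"
proof (induction xs arbitrary: s i)
  case (Cons x xs)
  have "card (desc e x (Suc i) xs) \<le> Suc (length xs)" by (rule card_desc_le)
  then have "x < s" "card (desc e x (Suc i) xs) = Suc (length xs)"
    using Cons.prems by (cases "x < s"; simp add: card_desc_rec del: desc.simps)+
  with Cons.IH show ?case by force
qed (simp split: if_splits)

text \<open>
  The binomial coefficient \<open>m choose (d - k)\<close> for integral \<open>d - k\<close>.
\<close>

definition choose_from :: "nat \<Rightarrow> nat \<Rightarrow> nat \<Rightarrow> nat" where
  "choose_from m d k = (if k \<le> d then m choose (d - k) else 0)"

lemma choose_from_Pascal: "choose_from (Suc m) d k = choose_from m d k + choose_from m d (Suc k)"
proof (cases "k < d")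
  case True
  then obtain q where "d = Suc (k + q)" using less_iff_Suc_add by auto
  then show ?thesis by (simp add: choose_from_def)
qed (auto simp: choose_from_def)

lemma choose_from_Suc: "choose_from m (Suc d) (Suc k) = choose_from m d k"
  by (simp add: choose_from_def)

lemma choose_from_0: "choose_from m 0 (Suc k) = 0"
  by (simp add: choose_from_def)

definition path_count :: "nat \<Rightarrow> nat \<Rightarrow> nat \<Rightarrow> nat \<Rightarrow> nat \<Rightarrow> nat" where
  "path_count n1 n2 k1 k2 d = choose_from (n1 + k2 - k1) d k1 * choose_from (n2 + k1 - k2) d k2"

definition desc_count :: "((nat \<times> nat) \<times> bool) list list \<Rightarrow> nat \<Rightarrow> nat" where
  "desc_count L d = length (filter (\<lambda>f. length (filter snd f) = d) L)"

lemma desc_count_append: "desc_count (A @ B) d = desc_count A d + desc_count B d"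
  by (simp add: desc_count_def)

lemma desc_count_Cons: "desc_count (map (Cons (p, r)) L) d =
    (if r then case d of 0 \<Rightarrow> 0 | Suc d' \<Rightarrow> desc_count L d' else desc_count L d)"
  by (cases d) (simp_all add: desc_count_def filter_map o_def)

text \<open>
  The recursion that counting paths by their first step produces. It is Pascal's rule applied to
  both factors; the hypotheses keep the truncated differences in \<open>path_count\<close> equal to the
  integral ones.
\<close>

lemma path_count_rec:
  assumes "a \<le> Suc n1" "c \<le> Suc n2" "a = Suc n1 \<Longrightarrow> x < y \<Longrightarrow> c > 0" "c = Suc n2 \<Longrightarrow> y < x \<Longrightarrow> a > 0"
    and "(x::real) \<noteq> y"
  shows "path_count (Suc n1) (Suc n2) (of_bool (x < s) + a) (of_bool (y < s) + c) d =
     (if x < s then case d of 0 \<Rightarrow> 0 | Suc d' \<Rightarrow> path_count n1 (Suc n2) a (of_bool (y < x) + c) d'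
      else path_count n1 (Suc n2) a (of_bool (y < x) + c) d) +
     (if y < s then case d of 0 \<Rightarrow> 0 | Suc d' \<Rightarrow> path_count (Suc n1) n2 (of_bool (x < y) + a) c d'
      else path_count (Suc n1) n2 (of_bool (x < y) + a) c d)"
proof (cases "x < y")
  case True
  have "a < Suc n1 + c"
    using assms(1,3) True by (cases "a = Suc n1") auto
  then obtain A where "Suc n1 + c = Suc (a + A)" using less_iff_Suc_add by auto
  then have A: "Suc n1 + c - a = Suc A" "n1 + c - a = A" by simp_all
  obtain B where "Suc n2 + a = c + B" using assms(2) by (metis le_iff_add trans_le_add1)
  then have B: "Suc n2 + a - c = B" "Suc (Suc n2 + a) - c = Suc B" by simp_all
  show ?thesis
    using True A B choose_from_Pascal[of A d a] choose_from_Pascal[of A "d - 1" a] choose_from_Pascal[of B d c]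
    by (cases d) (auto simp: path_count_def choose_from_Suc choose_from_0 algebra_simps)
next
  case False
  with assms(5) have yx: "y < x" by simp
  have "c < Suc n2 + a"
    using assms(2,4) yx by (cases "c = Suc n2") auto
  then obtain A where "Suc n2 + a = Suc (c + A)" using less_iff_Suc_add by auto
  then have A: "Suc n2 + a - c = Suc A" "n2 + a - c = A" by simp_all
  obtain B where "Suc n1 + c = a + B" using assms(1) by (metis le_iff_add trans_le_add1)
  then have B: "Suc n1 + c - a = B" "Suc (Suc n1 + c) - a = Suc B" by simp_all
  show ?thesis
    using yx A B choose_from_Pascal[of A d c] choose_from_Pascal[of A "d - 1" c] choose_from_Pascal[of B d a]
    by (cases d) (auto simp: path_count_def choose_from_Suc choose_from_0 algebra_simps)
qed

lemma path_count_sym: "path_count n1 n2 k1 k2 d = path_count n2 n1 k2 k1 d"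
  by (simp add: path_count_def mult.commute)

lemma path_count_0:
  assumes "a \<le> Suc n1" "e < s \<Longrightarrow> 0 < a" "a = Suc n1 \<Longrightarrow> (e::real) < s"
  shows "path_count n1 0 a (of_bool (e < s)) d = of_bool (d = a)"
  using assms by (cases "e < s"; cases "d < a"; cases "d = a")
    (auto simp: path_count_def choose_from_def intro!: binomial_eq_0)

lemma path_count_desc_0:
  "path_count (length xs) 0 (card (desc e s i xs)) (of_bool (e < s)) d = of_bool (d = card (desc e s i xs))"
  by (rule path_count_0) (use card_desc_le card_desc_pos desc_all_less in auto)

text \<open>
  The count depends on the words only through their lengths and numbers of descents, and not on how
  the labels of the two words are interleaved. This is the reason why orders of tiles multiply in a controlled way.
\<close>

theorem desc_count_stairs:
  assumes "set xs \<inter> set ys = {}"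
  shows "desc_count (stairs e s i xs j ys) d =
    path_count (length xs) (length ys) (card (desc e s i xs)) (card (desc e s j ys)) d"
  using assms
proof (induction e s i xs j ys arbitrary: d rule: stairs.induct)
  case (1 e s i j)
  then show ?case by (auto simp: desc_count_def path_count_def choose_from_def)
next
  case (2 e s i x xs j)
  let ?a = "card (desc e x (Suc i) xs)"
  have IH: "desc_count (stairs e x (Suc i) xs j []) d = of_bool (d = ?a)" for d
    using 2(1)[of d] path_count_desc_0[of xs e x "Suc i" d] by auto
  have "path_count (Suc (length xs)) 0 (of_bool (x < s) + ?a) (of_bool (e < s)) d = of_bool (d = of_bool (x < s) + ?a)"
    using path_count_desc_0[of "x # xs" e s i d]
    by (simp add: card_desc_rec del: desc.simps)
  moreover have "desc_count (stairs e s i (x # xs) j []) d = of_bool (d = of_bool (x < s) + ?a)"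
    by (cases d) (auto simp: desc_count_Cons IH)
  moreover have "card (desc e s j []) = of_bool (e < s)" by simp
  ultimately show ?case by (simp add: card_desc_rec del: desc.simps)
next
  case (3 e s i j y ys)
  let ?c = "card (desc e y (Suc j) ys)"
  have IH: "desc_count (stairs e y i [] (Suc j) ys) d = of_bool (d = ?c)" for d
    using 3(1)[of d] path_count_desc_0[of ys e y "Suc j" d]
    by (auto simp: path_count_sym[of 0])
  have "path_count 0 (Suc (length ys)) (of_bool (e < s)) (of_bool (y < s) + ?c) d = of_bool (d = of_bool (y < s) + ?c)"
    using path_count_desc_0[of "y # ys" e s j d]
    by (simp add: card_desc_rec path_count_sym[of 0] del: desc.simps)
  moreover have "desc_count (stairs e s i [] j (y # ys)) d = of_bool (d = of_bool (y < s) + ?c)"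
    by (cases d) (auto simp: desc_count_Cons IH)
  moreover have "card (desc e s i []) = of_bool (e < s)" by simp
  ultimately show ?case by (simp add: card_desc_rec del: desc.simps)
next
  case (4 e s i x xs j y ys)
  have xy: "x \<noteq> y" using 4(3) by auto
  let ?a = "card (desc e x (Suc i) xs)" and ?c = "card (desc e y (Suc j) ys)"
  have c1: "0 < ?c" if "?a = Suc (length xs)" "x < y"
    using card_desc_pos[of e y] desc_all_less[OF that(1)] that(2) by (meson order.strict_trans)
  have c2: "0 < ?a" if "?c = Suc (length ys)" "y < x"
    using card_desc_pos[of e x] desc_all_less[OF that(1)] that(2) by (meson order.strict_trans)
  have IH1: "desc_count (stairs e x (Suc i) xs j (y # ys)) d = path_count (length xs) (Suc (length ys)) ?a (of_bool (y < x) + ?c) d" for d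
    using 4(1)[of d] 4(3) by (simp add: card_desc_rec del: desc.simps)
  have IH2: "desc_count (stairs e y i (x # xs) (Suc j) ys) d = path_count (Suc (length xs)) (length ys) (of_bool (x < y) + ?a) ?c d" for d
    using 4(2)[of d] 4(3) by (simp add: card_desc_rec del: desc.simps)
  have "desc_count (stairs e s i (x # xs) j (y # ys)) d =
     desc_count (map (Cons ((i, j), x < s)) (stairs e x (Suc i) xs j (y # ys))) d +
     desc_count (map (Cons ((i, j), y < s)) (stairs e y i (x # xs) (Suc j) ys)) d"
    by (simp add: in_order_def desc_count_append)
  also have "\<dots> = path_count (Suc (length xs)) (Suc (length ys)) (of_bool (x < s) + ?a) (of_bool (y < s) + ?c) d"
    unfolding desc_count_Cons IH1 IH2
    by (rule path_count_rec[symmetric, OF card_desc_le card_desc_le c1 c2 xy])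
  finally show ?case by (simp add: card_desc_rec del: desc.simps)
qed

section \<open>Paths whose descents fill the complement of a box\<close>

definition count_if :: "('a \<Rightarrow> bool) \<Rightarrow> 'a list \<Rightarrow> nat" where
  "count_if Q L = length (filter Q L)"

lemma count_if_simps [simp]: "count_if Q [] = 0" "count_if Q (x # L) = of_bool (Q x) + count_if Q L"
  by (simp_all add: count_if_def)

lemma count_map_Cons:
  assumes "\<And>g. g \<in> set L \<Longrightarrow> Q (h # g) \<longleftrightarrow> c \<and> Q' g"
  shows "count_if Q (map (Cons h) L) = of_bool c * count_if Q' L"
proof -
  have "filter (Q \<circ> Cons h) L = filter (\<lambda>g. c \<and> Q' g) L"
    by (rule filter_cong) (use assms in auto)
  then show ?thesis by (cases c) (simp_all add: count_if_def filter_map)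
qed

lemma count_in_order: "count_if Q (in_order b A B) = count_if Q A + count_if Q B"
  by (simp add: count_if_def in_order_def)

lemma desc_full_Cons:
  "desc e s i (x # xs) = {i..Suc (i + length xs)} \<longleftrightarrow> x < s \<and> desc e x (Suc i) xs = {Suc i..Suc i + length xs}"
proof -
  have "i \<notin> desc e x (Suc i) xs"
    using subsetD[OF desc_subset, of i e x "Suc i" xs] by fastforce
  moreover have "{i..Suc (i + length xs)} = insert i {Suc i..Suc i + length xs}" by auto
  moreover have "i \<notin> {Suc i..Suc i + length xs}" by simp
  ultimately show ?thesis
    by (cases "x < s") (simp_all add: insert_ident del: atLeastAtMost_iff, blast)
qed

lemma desc_final_Cons:
  assumes "j \<le> k"
  shows "desc e s j (y # ys) = {Suc k..m} \<longleftrightarrow> \<not> y < s \<and> desc e y (Suc j) ys = {Suc k..m}"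
proof -
  have n: "j \<notin> {Suc k..m}" using assms by simp
  show ?thesis
  proof (cases "y < s")
    case True
    then have "j \<in> desc e s j (y # ys)" by simp
    then have "desc e s j (y # ys) \<noteq> {Suc k..m}" using n by metis
    with True show ?thesis by blast
  qed simp
qed

lemma desc_but_Cons:
  assumes "i < k"
  shows "desc e s i (x # xs) - {k} = {Suc k..m} \<longleftrightarrow> \<not> x < s \<and> desc e x (Suc i) xs - {k} = {Suc k..m}"
proof -
  have n: "i \<notin> {Suc k..m}" "i \<noteq> k" using assms by simp_all
  show ?thesis
  proof (cases "x < s")
    case True
    then have "i \<in> desc e s i (x # xs) - {k}" using n(2) by simp
    then have "desc e s i (x # xs) - {k} \<noteq> {Suc k..m}" using n(1) by metis
    with True show ?thesis by blast
  qed simp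
qed

lemma desc_but_first:
  "desc e s i (x # xs) - {i} = desc e x (Suc i) xs"
proof -
  have "i \<notin> desc e x (Suc i) xs"
    using subsetD[OF desc_subset, of i e x "Suc i" xs] by fastforce
  then show ?thesis by auto
qed

fun all_desc :: "real \<Rightarrow> real \<Rightarrow> real list \<Rightarrow> bool" where
  "all_desc e s [] \<longleftrightarrow> e < s"
| "all_desc e s (x # xs) \<longleftrightarrow> x < s \<and> all_desc e x xs"

text \<open>
  The word \<open>s, xs, e\<close> ascends up to letter number \<open>m\<close>, its peak, and descends from there on.
\<close>

fun up_down :: "real \<Rightarrow> nat \<Rightarrow> real \<Rightarrow> real list \<Rightarrow> bool" where
  "up_down e m s [] \<longleftrightarrow> False"
| "up_down e 0 s (x # xs) \<longleftrightarrow> \<not> x < s \<and> all_desc e x xs"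
| "up_down e (Suc m) s (x # xs) \<longleftrightarrow> \<not> x < s \<and> up_down e m x xs"

text \<open>
  As \<open>up_down\<close>, but for a vertex \<open>m\<close> instead of a letter: the word ascends before vertex \<open>m\<close> and descends after
  it, with no condition at \<open>m\<close> itself.
\<close>

fun up_free_down :: "real \<Rightarrow> nat \<Rightarrow> real \<Rightarrow> real list \<Rightarrow> bool" where
  "up_free_down e 0 s [] \<longleftrightarrow> True"
| "up_free_down e (Suc m) s [] \<longleftrightarrow> False"
| "up_free_down e 0 s (x # xs) \<longleftrightarrow> all_desc e x xs"
| "up_free_down e (Suc m) s (x # xs) \<longleftrightarrow> \<not> x < s \<and> up_free_down e m x xs"

lemma all_desc_iff: "all_desc e s xs \<longleftrightarrow> desc e s i xs = {i..i + length xs}"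
proof (induction xs arbitrary: s i)
  case (Cons x xs)
  have e: "i + length (x # xs) = Suc (i + length xs)" by simp
  show ?case unfolding e desc_full_Cons all_desc.simps Cons.IH[of x "Suc i"] ..
qed simp

lemma up_down_iff: "up_down e m s xs \<longleftrightarrow> m < length xs \<and> desc e s i xs = {Suc (i + m)..i + length xs}"
proof (induction e m s xs arbitrary: i rule: up_down.induct)
  case (2 e s x xs)
  have e: "i + length (x # xs) = Suc i + length xs" "i + 0 = i" by simp_all
  have l: "0 < length (x # xs)" by simp
  show ?case unfolding e desc_final_Cons[OF order_refl] up_down.simps all_desc_iff[of e x xs "Suc i"] using l by blast
next
  case (3 e m s x xs)
  have e: "i + length (x # xs) = Suc i + length xs" "i + Suc m = Suc i + m" by simp_all
  have l: "Suc m < length (x # xs) \<longleftrightarrow> m < length xs" by simp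
  have i: "i \<le> Suc i + m" by simp
  show ?case unfolding e desc_final_Cons[OF i] up_down.simps 3[of "Suc i"] l by blast
qed simp

lemma up_free_down_iff: "up_free_down e m s xs \<longleftrightarrow>
   m \<le> length xs \<and> desc e s i xs - {i + m} = {Suc (i + m)..i + length xs}"
proof (induction e m s xs arbitrary: i rule: up_free_down.induct)
  case (1 e s)
  then show ?case by simp
next
  case (2 e m s)
  then show ?case by simp
next
  case (3 e s x xs)
  have e: "i + length (x # xs) = Suc i + length xs" "i + 0 = i" by simp_all
  have l: "0 \<le> length (x # xs)" by simp
  show ?case unfolding e desc_but_first up_free_down.simps all_desc_iff[of e x xs "Suc i"] using l by blast
next
  case (4 e m s x xs)
  have e: "i + length (x # xs) = Suc i + length xs" "i + Suc m = Suc i + m" by simp_all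
  have l: "Suc m \<le> length (x # xs) \<longleftrightarrow> m \<le> length xs" by simp
  have i: "i < Suc i + m" by simp
  show ?case unfolding e desc_but_Cons[OF i] up_free_down.simps 4[of "Suc i"] l by blast
qed

lemma all_desc_less: "all_desc e s xs \<Longrightarrow> e < s \<and> (\<forall>x\<in>set xs. x < s)"
  by (induction xs arbitrary: s) (simp, fastforce)

lemma up_down_nth_ge: "up_down e m s ys \<Longrightarrow> s \<le> ys ! m"
  by (induction e m s ys rule: up_down.induct) fastforce+

lemma rem_eq_pts_Cons: "(i, j) \<notin> pts g \<Longrightarrow> rem (((i, j), r) # g) = pts (((i, j), r) # g) \<longleftrightarrow> r \<and> rem g = pts g"
  using rem_subset_pts[of g] by auto

lemma count_stairs:
  assumes "\<And>x xs' g. xs = x # xs' \<Longrightarrow> g \<in> set (stairs e x (Suc i) xs' j ys) \<Longrightarrow>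
      Q (((i, j), x < s) # g) \<longleftrightarrow> c1 x \<and> Q1 g"
    and "\<And>y ys' g. ys = y # ys' \<Longrightarrow> g \<in> set (stairs e y i xs (Suc j) ys') \<Longrightarrow>
      Q (((i, j), y < s) # g) \<longleftrightarrow> c2 y \<and> Q2 g"
    and "xs \<noteq> [] \<or> ys \<noteq> []"
  shows "count_if Q (stairs e s i xs j ys) =
     (case xs of [] \<Rightarrow> 0 | x # xs' \<Rightarrow> of_bool (c1 x) * count_if Q1 (stairs e x (Suc i) xs' j ys)) +
     (case ys of [] \<Rightarrow> 0 | y # ys' \<Rightarrow> of_bool (c2 y) * count_if Q2 (stairs e y i xs (Suc j) ys'))"
proof -
  have 1: "count_if Q (map (Cons ((i, j), x < s)) (stairs e x (Suc i) xs' j ys)) =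
     of_bool (c1 x) * count_if Q1 (stairs e x (Suc i) xs' j ys)" if "xs = x # xs'" for x xs'
    by (rule count_map_Cons) (use assms(1) that in blast)
  have 2: "count_if Q (map (Cons ((i, j), y < s)) (stairs e y i xs (Suc j) ys')) =
     of_bool (c2 y) * count_if Q2 (stairs e y i xs (Suc j) ys')" if "ys = y # ys'" for y ys'
    by (rule count_map_Cons) (use assms(2) that in blast)
  show ?thesis
    by (cases xs; cases ys) (use 1 2 assms(3) in \<open>simp_all add: count_in_order\<close>)
qed

text \<open>
  A path all of whose points are descents lists the labels in decreasing order, so it is unique.
\<close>

lemma count_all_removed:
  assumes "set xs \<inter> set ys = {}"
  shows "count_if (\<lambda>f. rem f = pts f) (stairs e s i xs j ys) = of_bool (all_desc e s xs \<and> all_desc e s ys)"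
  using assms
proof (induction "length xs + length ys" arbitrary: s i xs j ys)
  case 0
  then have e: "xs = []" "ys = []" by simp_all
  show ?case unfolding e by (cases "e < s") simp_all
next
  case (Suc n)
  let ?Q = "\<lambda>f. rem f = pts f"
  have "count_if ?Q (stairs e s i xs j ys) =
     (case xs of [] \<Rightarrow> 0 | x # xs' \<Rightarrow> of_bool (x < s) * count_if ?Q (stairs e x (Suc i) xs' j ys)) +
     (case ys of [] \<Rightarrow> 0 | y # ys' \<Rightarrow> of_bool (y < s) * count_if ?Q (stairs e y i xs (Suc j) ys'))"
  proof (rule count_stairs)
    show "xs \<noteq> [] \<or> ys \<noteq> []" using Suc(2) by auto
  qed (rule rem_eq_pts_Cons, erule stairs_first_notin)+
  also have "\<dots> = (case xs of [] \<Rightarrow> 0 | x # xs' \<Rightarrow> of_bool (x < s \<and> all_desc e x xs' \<and> all_desc e x ys)) +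
     (case ys of [] \<Rightarrow> 0 | y # ys' \<Rightarrow> of_bool (y < s \<and> all_desc e y xs \<and> all_desc e y ys'))"
  proof -
    have "count_if ?Q (stairs e x (Suc i) xs' j ys) = of_bool (all_desc e x xs' \<and> all_desc e x ys)" 
      if "xs = x # xs'" for x xs'
      by (rule Suc(1)) (use Suc(2,3) that in auto)
    moreover have "count_if ?Q (stairs e y i xs (Suc j) ys') = of_bool (all_desc e y xs \<and> all_desc e y ys')" 
      if "ys = y # ys'" for y ys'
      by (rule Suc(1)) (use Suc(2,3) that in auto)
    ultimately show ?thesis by (cases xs; cases ys) simp_all
  qed
  also have "\<dots> = of_bool (all_desc e s xs \<and> all_desc e s ys)"
  proof (cases xs)
    case Nil
    then obtain y ys' where ys: "ys = y # ys'" using Suc(2) by (cases ys) auto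
    show ?thesis unfolding Nil ys using all_desc_less[of e y ys'] by auto
  next
    case xs: (Cons x xs')
    show ?thesis
    proof (cases ys)
      case Nil
      show ?thesis unfolding Nil xs using all_desc_less[of e x xs'] by auto
    next
      case ys: (Cons y ys')
      have "x \<noteq> y" using Suc(3) xs ys by auto
      then show ?thesis unfolding ys xs by (cases "x < y") auto
    qed
  qed
  finally show ?case .
qed

text \<open>
  The path leaves the box \<open>{..k} \<times> {..l}\<close> by the upward step at \<open>(k, l)\<close>, and its descents are its points
  outside this box.
\<close>

definition exits_up :: "nat \<Rightarrow> nat \<Rightarrow> ((nat \<times> nat) \<times> bool) list \<Rightarrow> bool" where
  "exits_up k l f \<longleftrightarrow> rem f = pts f - {..k} \<times> {..l} \<and> (k, l) \<in> pts f \<and> (k, Suc l) \<in> pts f"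

lemma exits_up_right:
  assumes "g \<in> set (stairs e x (Suc i) xs j ys)" "i \<le> k" "j \<le> l"
  shows "exits_up k l (((i, j), r) # g) \<longleftrightarrow> (i < k \<and> \<not> r) \<and> exits_up k l g"
proof (cases "i < k")
  case True
  have "(i, j) \<notin> rem g" "(i, j) \<notin> pts g" using stairs_first_notin(1)[OF assms(1)] rem_subset_pts by auto
  moreover have "(i, j) \<in> {..k} \<times> {..l}" using assms by simp
  ultimately show ?thesis using True unfolding exits_up_def by auto
next
  case False
  then have "(k, Suc l) \<notin> pts (((i, j), r) # g)"
    using stairs_pts_grid[OF assms(1)] assms(2,3) by auto
  then show ?thesis using False by (simp add: exits_up_def)
qed

lemma exits_up_up:
  assumes "g \<in> set (stairs e y i xs (Suc j) ys)" "i \<le> k" "j \<le> l"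
  shows "exits_up k l (((i, j), r) # g) \<longleftrightarrow>
     (if j < l then \<not> r \<and> exits_up k l g else (i = k \<and> \<not> r) \<and> rem g = pts g)"
proof -
  have n: "(i, j) \<notin> rem g" "(i, j) \<notin> pts g" "(i, j) \<in> {..k} \<times> {..l}"
    using stairs_first_notin(2)[OF assms(1)] rem_subset_pts assms by auto
  show ?thesis
  proof (cases "j < l")
    case True
    then show ?thesis using n unfolding exits_up_def by auto
  next
    case False
    then have "pts g - {..k} \<times> {..l} = pts g" "i \<noteq> k \<Longrightarrow> (k, l) \<notin> pts (((i, j), r) # g)"
      using stairs_pts_grid[OF assms(1)] assms(2,3) by fastforce+
    moreover have "pts (((i, j), r) # g) - {..k} \<times> {..l} = pts g - {..k} \<times> {..l}" using n by auto
    moreover have "rem (((i, j), r) # g) = pts g \<longleftrightarrow> \<not> r \<and> rem g = pts g" using n by auto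
    moreover have "i = k \<Longrightarrow> \<not> j < l \<Longrightarrow> (k, l) \<in> pts (((i, j), r) # g) \<and> (k, Suc l) \<in> pts (((i, j), r) # g)"
      using stairs_start[OF assms(1)] assms by auto
    ultimately show ?thesis using False unfolding exits_up_def by auto
  qed
qed

text \<open>
  Such a path ascends up to the step leaving the box and descends afterwards. That step carries the
  letter \<open>ys ! l\<close>, which is therefore the largest of all labels, and the two sorted halves of the shuffle are determined.
\<close>

lemma count_exits_up:
  assumes "set xs \<inter> set ys = {}"
  shows "count_if (exits_up (i + k) (j + l)) (stairs e s i xs j ys) =
    of_bool (up_free_down e k s xs \<and> up_down e l s ys \<and> (\<forall>x\<in>set xs. x < ys ! l))"
  using assms
proof (induction "length xs + length ys" arbitrary: s i xs j ys k l)
  case 0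
  then have e: "xs = []" "ys = []" by simp_all
  show ?case unfolding e by (simp add: exits_up_def)
next
  case (Suc n)
  have "count_if (exits_up (i + k) (j + l)) (stairs e s i xs j ys) =
     (case xs of [] \<Rightarrow> 0 | x # xs' \<Rightarrow> of_bool (0 < k \<and> \<not> x < s) * count_if (exits_up (i + k) (j + l)) (stairs e x (Suc i) xs' j ys)) +
     (case ys of [] \<Rightarrow> 0 | y # ys' \<Rightarrow> of_bool (\<not> y < s \<and> (l = 0 \<longrightarrow> k = 0)) *
       count_if (if 0 < l then exits_up (i + k) (j + l) else (\<lambda>f. rem f = pts f)) (stairs e y i xs (Suc j) ys'))"
    by (rule count_stairs) (use Suc(2) in \<open>auto simp: exits_up_right exits_up_up\<close>)
  also have "\<dots> = (case xs of [] \<Rightarrow> 0 | x # xs' \<Rightarrow> of_bool (0 < k \<and> \<not> x < s \<and> 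
       up_free_down e (k - 1) x xs' \<and> up_down e l x ys \<and> (\<forall>x\<in>set xs'. x < ys ! l))) +
     (case ys of [] \<Rightarrow> 0 | y # ys' \<Rightarrow> of_bool (\<not> y < s \<and> 
        (if l = 0 then k = 0 \<and> all_desc e y xs \<and> all_desc e y ys' else
         up_free_down e k y xs \<and> up_down e (l - 1) y ys' \<and> (\<forall>x\<in>set xs. x < ys' ! (l - 1)))))"
  proof -
    have R: "count_if (exits_up (i + k) (j + l)) (stairs e x (Suc i) xs' j ys) =
      of_bool (up_free_down e (k - 1) x xs' \<and> up_down e l x ys \<and> (\<forall>x\<in>set xs'. x < ys ! l))" 
      if "xs = x # xs'" "0 < k" for x xs'
      using Suc(1)[of xs' ys "Suc i" "k - 1" j l x] Suc(2,3) that by simp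
    have U: "count_if (exits_up (i + k) (j + l)) (stairs e y i xs (Suc j) ys') =
      of_bool (up_free_down e k y xs \<and> up_down e (l - 1) y ys' \<and> (\<forall>x\<in>set xs. x < ys' ! (l - 1)))" 
      if "ys = y # ys'" "0 < l" for y ys'
      using Suc(1)[of xs ys' i k "Suc j" "l - 1" y] Suc(2,3) that by simp
    have D: "count_if (\<lambda>f. rem f = pts f) (stairs e y i xs (Suc j) ys') = of_bool (all_desc e y xs \<and> all_desc e y ys')" 
      if "ys = y # ys'" for y ys'
      by (rule count_all_removed) (use Suc(3) that in auto)
    show ?thesis
    proof (rule arg_cong2[where f = "(+)"], goal_cases)
      case 1
      show ?case
      proof (cases xs)
        case (Cons x xs')
        show ?thesis unfolding Cons list.case using R[OF Cons] by (cases "0 < k"; cases "x < s") simp_all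
      qed simp
    next
      case 2
      show ?case
      proof (cases ys)
        case (Cons y ys')
        show ?thesis unfolding Cons list.case using U[OF Cons] D[OF Cons] 
          by (cases "0 < l"; cases "k = 0"; cases "y < s") simp_all
      qed simp
    qed
  qed
  also have "\<dots> = of_bool (up_free_down e k s xs \<and> up_down e l s ys \<and> (\<forall>x\<in>set xs. x < ys ! l))"
  proof (cases ys)
    case Nil
    then show ?thesis using Suc(2) by (cases xs) simp_all
  next
    case ys: (Cons y ys')
    show ?thesis
    proof (cases xs)
      case xs: Nil
      show ?thesis unfolding xs ys using all_desc_less[of e y ys'] by (cases k; cases l) auto
    next
      case xs: (Cons x xs')
      have ne: "x \<noteq> y" using Suc(3) xs ys by auto
      have peak: "up_down e l' y ys' \<Longrightarrow> x < y \<Longrightarrow> x < ys' ! l'" for l'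
        using up_down_nth_ge[of e l' y ys'] by linarith
      have down: "all_desc e x xs' \<Longrightarrow> x < y \<Longrightarrow> \<forall>z\<in>set xs'. z < y"
        using all_desc_less[of e x xs'] by force
      show ?thesis
      proof (cases k)
        case 0
        show ?thesis unfolding xs ys 0
          by (cases l) (use all_desc_less[of e y ys'] down in auto)
      next
        case k: (Suc k')
        show ?thesis
        proof (cases l)
          case 0
          show ?thesis unfolding xs ys k 0 using ne by (cases "x < y") auto
        next
          case l: (Suc l')
          show ?thesis unfolding xs ys k l using ne peak[of l'] by (cases "x < y") auto
        qed
      qed
    qed
  qed
  finally show ?case .
qed

lemma avoid_finite:
  fixes a b :: real
  assumes "a < b" "finite Z"
  obtains x where "a < x" "x < b" "x \<notin> Z"
proof -
  have "infinite {a<..<b}" using assms(1) by simp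
  then have "\<not> {a<..<b} \<subseteq> Z" using assms(2) finite_subset by blast
  then obtain x where "x \<in> {a<..<b}" "x \<notin> Z" by blast
  then have "a < x" "x < b" by simp_all
  then show ?thesis using that \<open>x \<notin> Z\<close> by blast
qed

text \<open>
  The labels are chosen one after the other. The only constraint on \<open>s\<close> and \<open>e\<close> comes from the words
  without descents and those that descend everywhere. The set \<open>Z\<close> keeps the letters distinct from those of the other factor, and
  \<open>B\<close> makes one letter of an ascending-descending word exceed them.
\<close>

lemma word_with_descents_exists:
  fixes s e B :: real
  assumes "R \<subseteq> {i..i + n}" "R = {} \<Longrightarrow> s < e" "R = {i..i + n} \<Longrightarrow> e < s" "finite Z"
  shows "\<exists>xs. length xs = n \<and> desc e s i xs = R \<and> set xs \<inter> Z = {} \<and>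
     ((\<exists>p>i. p \<le> i + n \<and> R = {p..i + n}) \<longrightarrow> (\<exists>x\<in>set xs. B < x))"
  using assms(1-3)
proof (induction n arbitrary: i s R)
  case 0
  then have "desc e s i [] = R" by (cases "R = {}") auto
  then show ?case by (intro exI[of _ "[]"]) auto
next
  case (Suc n)
  have fi: "{i..i + Suc n} = insert i {Suc i..Suc i + n}" by auto
  show ?case
  proof (cases "i \<in> R")
    case False
    then have sub: "R \<subseteq> {Suc i..Suc i + n}" using Suc(2)[unfolded fi] by blast
    obtain x where x: "s < x" "x \<notin> Z" "R = {} \<Longrightarrow> x < e" "R \<noteq> {} \<Longrightarrow> e < x \<and> B < x"
    proof (cases "R = {}")
      case True
      obtain x where "s < x" "x < e" "x \<notin> Z" using avoid_finite[OF _ assms(4)] Suc(3)[OF True] by blast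
      then show ?thesis using that True by blast
    next
      case R: False
      obtain x where "max s (max e B) < x" "x \<notin> Z"
        using avoid_finite[OF less_add_one assms(4)] by blast
      then have "s < x" "e < x" "B < x" by simp_all
      then show ?thesis using that R \<open>x \<notin> Z\<close> by blast
    qed
    obtain xs where xs: "length xs = n" "desc e x (Suc i) xs = R" "set xs \<inter> Z = {}"
      using Suc(1)[OF sub, of x] x(3,4) by auto
    have "desc e s i (x # xs) = R" using xs(2) x(1) by simp
    moreover have "\<exists>z\<in>set (x # xs). B < z" if "\<exists>p>i. p \<le> i + Suc n \<and> R = {p..i + Suc n}"
    proof -
      have "R \<noteq> {}" using that by auto
      then show ?thesis using x(4) by simp
    qed
    moreover have "length (x # xs) = Suc n" "set (x # xs) \<inter> Z = {}" using xs(1,3) x(2) by simp_all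
    ultimately show ?thesis by (intro exI[of _ "x # xs"]) blast
  next
    case True
    have sub: "R - {i} \<subseteq> {Suc i..Suc i + n}"
    proof
      fix k assume k: "k \<in> R - {i}"
      then have "k \<in> {i..i + Suc n}" "k \<noteq> i" using Suc(2) by (blast, simp)
      then show "k \<in> {Suc i..Suc i + n}" by simp
    qed
    obtain x where x: "x < s" "x \<notin> Z" "R - {i} = {} \<Longrightarrow> x < e" "R - {i} = {Suc i..Suc i + n} \<Longrightarrow> e < x"
    proof (cases "R - {i} = {Suc i..Suc i + n}")
      case full: True
      then have "R = {i..i + Suc n}" unfolding fi using True by (metis insert_Diff)
      then obtain x where "e < x" "x < s" "x \<notin> Z" using avoid_finite[OF _ assms(4)] Suc(4) by blast
      moreover have "R - {i} \<noteq> {}" unfolding full by simp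
      ultimately show ?thesis using that by blast
    next
      case R: False
      have "min s e - 1 < min s e" by linarith
      then obtain x where "x < min s e" "x \<notin> Z" 
        using avoid_finite[OF _ assms(4)] by blast
      then have "x < s" "x < e" by simp_all
      then show ?thesis using that R \<open>x \<notin> Z\<close> by blast
    qed
    obtain xs where xs: "length xs = n" "desc e x (Suc i) xs = R - {i}" "set xs \<inter> Z = {}"
      using Suc(1)[OF sub, of x] x(3,4) by auto
    have "desc e s i (x # xs) = R" using xs(2) x(1) True by auto
    moreover have "\<not> (\<exists>p>i. p \<le> i + Suc n \<and> R = {p..i + Suc n})" using True by auto
    moreover have "length (x # xs) = Suc n" "set (x # xs) \<inter> Z = {}" using xs(1,3) x(2) by simp_all
    ultimately show ?thesis by (intro exI[of _ "x # xs"]) blast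
  qed
qed

definition flip :: "((nat \<times> nat) \<times> bool) list \<Rightarrow> ((nat \<times> nat) \<times> bool) list" where
  "flip = map (\<lambda>(p, r). (prod.swap p, r))"

lemma flip_simps [simp]: "flip [] = []" "flip ((p, r) # f) = (prod.swap p, r) # flip f"
  by (simp_all add: flip_def)

lemma pts_flip [simp]: "pts (flip f) = prod.swap ` pts f"
  and rem_flip [simp]: "rem (flip f) = prod.swap ` rem f"
  by (induction f) (auto simp: image_Un split: if_splits)

lemma count_if_map: "count_if Q (map h L) = count_if (Q \<circ> h) L"
  by (induction L) simp_all

lemma count_stairs_flip: "count_if Q (stairs e s j ys i xs) = count_if (Q \<circ> flip) (stairs e s i xs j ys)"
proof (induction e s i xs j ys arbitrary: Q rule: stairs.induct)
  case (4 e s i x xs j y ys)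
  have "count_if (Q \<circ> Cons ((j, i), x < s)) (stairs e x j (y # ys) (Suc i) xs) =
        count_if (Q \<circ> flip \<circ> Cons ((i, j), x < s)) (stairs e x (Suc i) xs j (y # ys))"
    unfolding 4(1) by (simp add: o_def)
  moreover have "count_if (Q \<circ> Cons ((j, i), y < s)) (stairs e y (Suc j) ys i (x # xs)) =
        count_if (Q \<circ> flip \<circ> Cons ((i, j), y < s)) (stairs e y i (x # xs) (Suc j) ys)"
    unfolding 4(2) by (simp add: o_def)
  ultimately show ?case by (simp add: count_in_order count_if_map o_def)
qed (simp_all add: count_if_map o_def)

lemma stairs_exit:
  assumes "f \<in> set (stairs e s i xs j ys)" "i < a1" "j < a2" "a1 \<le> i + length xs \<or> a2 \<le> j + length ys"
  shows "\<exists>k l. k < a1 \<and> l < a2 \<and> (k, l) \<in> pts f \<and>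
    (Suc k = a1 \<and> (Suc k, l) \<in> pts f \<or> Suc l = a2 \<and> (k, Suc l) \<in> pts f)"
  using assms
proof (induction "length xs + length ys" arbitrary: f s i xs j ys)
  case 0
  then show ?case by simp
next
  case (Suc n)
  from Suc(3) show ?case
  proof (cases rule: stairs_cases)
    case 1 with Suc(2) show ?thesis by simp
  next
    case (2 x xs' g)
    show ?thesis
    proof (cases "Suc i = a1")
      case True
      then show ?thesis using 2 stairs_start[OF 2(3)] Suc(4,5) by auto
    next
      case False
      then obtain k l where "k < a1 \<and> l < a2 \<and> (k, l) \<in> pts g \<and>
         (Suc k = a1 \<and> (Suc k, l) \<in> pts g \<or> Suc l = a2 \<and> (k, Suc l) \<in> pts g)"
        using Suc(1)[OF _ 2(3)] Suc(2,4-6) 2(1) by auto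
      then show ?thesis unfolding 2(2) by auto
    qed
  next
    case (3 y ys' g)
    show ?thesis
    proof (cases "Suc j = a2")
      case True
      then show ?thesis using 3 stairs_start[OF 3(3)] Suc(4,5) by auto
    next
      case False
      then obtain k l where "k < a1 \<and> l < a2 \<and> (k, l) \<in> pts g \<and>
         (Suc k = a1 \<and> (Suc k, l) \<in> pts g \<or> Suc l = a2 \<and> (k, Suc l) \<in> pts g)"
        using Suc(1)[OF _ 3(3)] Suc(2,4-6) 3(1) by auto
      then show ?thesis unfolding 3(2) by auto
    qed
  qed
qed

definition exits_right :: "nat \<Rightarrow> nat \<Rightarrow> ((nat \<times> nat) \<times> bool) list \<Rightarrow> bool" where
  "exits_right k l f \<longleftrightarrow> rem f = pts f - {..k} \<times> {..l} \<and> (k, l) \<in> pts f \<and> (Suc k, l) \<in> pts f"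

lemma exits_right_flip: "exits_right k l (flip f) \<longleftrightarrow> exits_up l k f"
proof -
  have "prod.swap ` pts f - {..k} \<times> {..l} = prod.swap ` (pts f - {..l} \<times> {..k})" by auto
  moreover have "(a, b) \<in> prod.swap ` pts f \<longleftrightarrow> (b, a) \<in> pts f" for a b by force
  moreover have "inj (prod.swap :: nat \<times> nat \<Rightarrow> nat \<times> nat)" by simp
  ultimately show ?thesis unfolding exits_right_def exits_up_def
    by (simp add: inj_image_eq_iff)
qed

definition removes_outside :: "nat \<Rightarrow> nat \<Rightarrow> ((nat \<times> nat) \<times> bool) list \<Rightarrow> bool" where
  "removes_outside a1 a2 f \<longleftrightarrow> rem f = pts f - {..<a1} \<times> {..<a2}"

lemma pts_outside:
  assumes "chain2 (pts f)" "k < a1" "l < a2" "(k, l) \<in> pts f"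
    "Suc k = a1 \<and> (Suc k, l) \<in> pts f \<or> Suc l = a2 \<and> (k, Suc l) \<in> pts f"
  shows "pts f - {..<a1} \<times> {..<a2} = pts f - {..k} \<times> {..l}"
proof -
  have "p \<in> {..k} \<times> {..l}" if "p \<in> pts f" "p \<in> {..<a1} \<times> {..<a2}" for p
  proof -
    obtain p1 p2 where p: "p = (p1, p2)" by (cases p)
    have 1: "p1 \<le> k \<and> p2 \<le> l \<or> k \<le> p1 \<and> l \<le> p2"
      using assms(1,4) that(1) p unfolding chain2_def by fastforce
    have 2: "Suc k = a1 \<and> (p1 \<le> Suc k \<and> p2 \<le> l \<or> Suc k \<le> p1 \<and> l \<le> p2) \<or>
        Suc l = a2 \<and> (p1 \<le> k \<and> p2 \<le> Suc l \<or> k \<le> p1 \<and> Suc l \<le> p2)"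
      using assms(1,5) that(1) p unfolding chain2_def by fastforce
    have "p1 < a1" "p2 < a2" using that(2) p by auto
    then show ?thesis using 1 2 p by auto
  qed
  moreover have "{..k} \<times> {..l} \<subseteq> {..<a1} \<times> {..<a2}" using assms(2,3) by auto
  ultimately show ?thesis by blast
qed


text \<open>
  A path leaves the box through its top row or its right column, at exactly one point.
\<close>

lemma removes_outside_exit:
  assumes "f \<in> set (stairs e s 0 xs 0 ys)" "0 < a1" "0 < a2" "a1 \<le> length xs \<or> a2 \<le> length ys"
  shows "of_bool (removes_outside a1 a2 f) =
     (\<Sum>k<a1. of_bool (exits_up k (a2 - 1) f)) + (\<Sum>l<a2. of_bool (exits_right (a1 - 1) l f) :: nat)"
proof -
  obtain k l where kl: "k < a1" "l < a2" "(k, l) \<in> pts f"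
     "Suc k = a1 \<and> (Suc k, l) \<in> pts f \<or> Suc l = a2 \<and> (k, Suc l) \<in> pts f"
    using stairs_exit[OF assms(1), of a1 a2] assms(2-4) by auto
  have ch: "chain2 (pts f)" by (rule stairs_chain[OF assms(1)])
  have cmp: "p1 \<le> q1 \<and> p2 \<le> q2 \<or> q1 \<le> p1 \<and> q2 \<le> p2" if "(p1, p2) \<in> pts f" "(q1, q2) \<in> pts f" for p1 p2 q1 q2
    using ch that unfolding chain2_def by fastforce
  have eq: "pts f - {..<a1} \<times> {..<a2} = pts f - {..k'} \<times> {..l'}"
    if "k' < a1" "l' < a2" "(k', l') \<in> pts f" "Suc k' = a1 \<and> (Suc k', l') \<in> pts f \<or> Suc l' = a2 \<and> (k', Suc l') \<in> pts f" for k' l'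
    using pts_outside[OF ch that] .
  show ?thesis
  proof (cases "removes_outside a1 a2 f")
    case False
    have "\<not> exits_up k' (a2 - 1) f" if "k' < a1" for k'
    proof
      assume "exits_up k' (a2 - 1) f"
      then show False using False eq[of k' "a2 - 1"] that assms(3) by (auto simp: exits_up_def removes_outside_def)
    qed
    moreover have "\<not> exits_right (a1 - 1) l' f" if "l' < a2" for l'
    proof
      assume "exits_right (a1 - 1) l' f"
      then show False using False eq[of "a1 - 1" l'] that assms(2) by (auto simp: exits_right_def removes_outside_def)
    qed
    ultimately show ?thesis using False by simp
  next
    case True
    then have rem: "rem f = pts f - {..k} \<times> {..l}" using eq[OF kl] by (simp add: removes_outside_def)
    from kl(4) show ?thesis
    proof
      assume r: "Suc k = a1 \<and> (Suc k, l) \<in> pts f"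
      have "\<not> exits_up k' (a2 - 1) f" if "k' < a1" for k'
      proof
        assume "exits_up k' (a2 - 1) f"
        then have "(k', Suc (a2 - 1)) \<in> pts f" by (simp add: exits_up_def)
        with r have "k' \<le> Suc k \<and> Suc (a2 - 1) \<le> l \<or> Suc k \<le> k' \<and> l \<le> Suc (a2 - 1)" by (intro cmp) auto
        then show False using r that kl(2) by auto
      qed
      moreover have "exits_right (a1 - 1) l' f \<longleftrightarrow> l' = l" if "l' < a2" for l'
      proof
        assume "exits_right (a1 - 1) l' f"
        moreover have "a1 - 1 = k" using r by auto
        ultimately have p: "(k, l') \<in> pts f" "(Suc k, l') \<in> pts f" by (simp_all add: exits_right_def)
        have "k \<le> Suc k \<and> l' \<le> l \<or> Suc k \<le> k \<and> l \<le> l'" by (rule cmp) (use p r in auto)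
        moreover have "k \<le> Suc k \<and> l \<le> l' \<or> Suc k \<le> k \<and> l' \<le> l" by (rule cmp) (use p kl in auto)
        ultimately show "l' = l" by auto
      next
        have "a1 - 1 = k" using r by auto
        then show "exits_right (a1 - 1) l' f" if "l' = l"
          unfolding exits_right_def that using rem conjunct2[OF r] kl(3) by simp
      qed
      ultimately have "(\<Sum>k<a1. of_bool (exits_up k (a2 - 1) f) :: nat) = 0"
          "(\<Sum>l'<a2. of_bool (exits_right (a1 - 1) l' f) :: nat) = (\<Sum>l'<a2. if l' = l then 1 else 0)"
        by (simp, intro sum.cong refl) simp
      then show ?thesis using True kl(2) by simp
    next
      assume r: "Suc l = a2 \<and> (k, Suc l) \<in> pts f"
      have "\<not> exits_right (a1 - 1) l' f" if "l' < a2" for l'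
      proof
        assume "exits_right (a1 - 1) l' f"
        then have "(Suc (a1 - 1), l') \<in> pts f" by (simp add: exits_right_def)
        with r have "Suc (a1 - 1) \<le> k \<and> l' \<le> Suc l \<or> k \<le> Suc (a1 - 1) \<and> Suc l \<le> l'" by (intro cmp) auto
        then show False using r that kl(1) by auto
      qed
      moreover have "exits_up k' (a2 - 1) f \<longleftrightarrow> k' = k" if "k' < a1" for k'
      proof
        assume "exits_up k' (a2 - 1) f"
        moreover have "a2 - 1 = l" using r by auto
        ultimately have p: "(k', l) \<in> pts f" "(k', Suc l) \<in> pts f" by (simp_all add: exits_up_def)
        have "k' \<le> k \<and> l \<le> Suc l \<or> k \<le> k' \<and> Suc l \<le> l" by (rule cmp) (use p r in auto)
        moreover have "k \<le> k' \<and> l \<le> Suc l \<or> k' \<le> k \<and> Suc l \<le> l" by (rule cmp) (use p kl in auto)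
        ultimately show "k' = k" by auto
      next
        have "a2 - 1 = l" using r by auto
        then show "exits_up k' (a2 - 1) f" if "k' = k"
          unfolding exits_up_def that using rem conjunct2[OF r] kl(3) by simp
      qed
      ultimately have "(\<Sum>l<a2. of_bool (exits_right (a1 - 1) l f) :: nat) = 0"
          "(\<Sum>k'<a1. of_bool (exits_up k' (a2 - 1) f) :: nat) = (\<Sum>k'<a1. if k' = k then 1 else 0)"
        by (simp, intro sum.cong refl) simp
      then show ?thesis using True kl(1) by simp
    qed
  qed
qed

lemma count_if_sum:
  assumes "\<And>f. f \<in> set L \<Longrightarrow> of_bool (Q f) = (\<Sum>k\<in>A. of_bool (P k f)) + (\<Sum>l\<in>B. of_bool (P' l f) :: nat)"
  shows "count_if Q L = (\<Sum>k\<in>A. count_if (P k) L) + (\<Sum>l\<in>B. count_if (P' l) L)"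
  using assms by (induction L) (simp_all add: sum.distrib)

lemma stairs_card_beyond:
  assumes "f \<in> set (stairs e s i xs j ys)" "(i + k, j + l) \<in> pts f"
  shows "card (pts f - {..i + k} \<times> {..j + l}) = (length xs - k) + (length ys - l)"
  using assms
proof (induction "length xs + length ys" arbitrary: f s i xs j ys k l)
  case 0
  then have e: "xs = []" "ys = []" by simp_all
  then show ?case using 0(2) by simp
next
  case (Suc n)
  from Suc(3) show ?case
  proof (cases rule: stairs_cases)
    case 1 with Suc(2) show ?thesis by simp
  next
    case (2 x xs' g)
    note ni = stairs_first_notin(1)[OF 2(3)]
    have pf: "pts f - {..i + k} \<times> {..j + l} = pts g - {..i + k} \<times> {..j + l}" unfolding 2(2) by auto
    show ?thesis
    proof (cases k)
      case 0
      have "l = 0"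
      proof (rule ccontr)
        assume "l \<noteq> 0"
        then have "(i, j + l) \<in> pts g" using Suc(4) unfolding 2(2) 0 by simp
        then show False using stairs_pts_grid[OF 2(3)] by auto
      qed
      have "pts g - {..i + k} \<times> {..j + l} = pts g" using stairs_pts_grid[OF 2(3)] 0 by fastforce
      then show ?thesis unfolding pf using stairs_card_pts[OF 2(3)] 2(1) 0 \<open>l = 0\<close> by simp
    next
      case k: (Suc k')
      then have "(Suc i + k', j + l) \<in> pts g" using Suc(4) unfolding 2(2) by simp
      moreover have "n = length xs' + length ys" using Suc(2) 2(1) by simp
      ultimately have "card (pts g - {..Suc i + k'} \<times> {..j + l}) = (length xs' - k') + (length ys - l)"
        using Suc(1)[OF _ 2(3)] by blast
      then show ?thesis unfolding pf unfolding k 2(1) by simp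
    qed
  next
    case (3 y ys' g)
    note ni = stairs_first_notin(2)[OF 3(3)]
    have pf: "pts f - {..i + k} \<times> {..j + l} = pts g - {..i + k} \<times> {..j + l}" unfolding 3(2) by auto
    show ?thesis
    proof (cases l)
      case 0
      have "k = 0"
      proof (rule ccontr)
        assume "k \<noteq> 0"
        then have "(i + k, j) \<in> pts g" using Suc(4) unfolding 3(2) 0 by simp
        then show False using stairs_pts_grid[OF 3(3)] by auto
      qed
      have "pts g - {..i + k} \<times> {..j + l} = pts g" using stairs_pts_grid[OF 3(3)] 0 by fastforce
      then show ?thesis unfolding pf using stairs_card_pts[OF 3(3)] 3(1) 0 \<open>k = 0\<close> by simp
    next
      case l: (Suc l')
      then have "(i + k, Suc j + l') \<in> pts g" using Suc(4) unfolding 3(2) by simp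
      moreover have "n = length xs + length ys'" using Suc(2) 3(1) by simp
      ultimately have "card (pts g - {..i + k} \<times> {..Suc j + l'}) = (length xs - k) + (length ys' - l')"
        using Suc(1)[OF _ 3(3)] by blast
      then show ?thesis unfolding pf unfolding l 3(1) by simp
    qed
  qed
qed

lemma count_if_cong: "(\<And>f. f \<in> set L \<Longrightarrow> Q f = Q' f) \<Longrightarrow> count_if Q L = count_if Q' L"
  by (induction L) simp_all

lemma count_if_conj: "count_if (\<lambda>f. Q f \<and> c) L = of_bool c * count_if Q L"
  by (cases c) (simp_all add: count_if_def)

lemma count_if_sum_index:
  assumes "\<And>f. f \<in> set L \<Longrightarrow> of_bool (Q f) = (\<Sum>k\<in>A. of_bool (P k f)) + (\<Sum>l\<in>B. of_bool (P' l f) :: nat)"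
    and "\<And>k f. f \<in> set L \<Longrightarrow> k \<in> A \<Longrightarrow> P k f \<Longrightarrow> g f = p k"
    and "\<And>l f. f \<in> set L \<Longrightarrow> l \<in> B \<Longrightarrow> P' l f \<Longrightarrow> g f = p' l"
  shows "count_if (\<lambda>f. Q f \<and> g f = d) L = (\<Sum>k\<in>A. of_bool (p k = d) * count_if (P k) L) + (\<Sum>l\<in>B. of_bool (p' l = d) * count_if (P' l) L)"
proof -
  have "count_if (\<lambda>f. Q f \<and> g f = d) L = (\<Sum>k\<in>A. count_if (\<lambda>f. P k f \<and> p k = d) L) + (\<Sum>l\<in>B. count_if (\<lambda>f. P' l f \<and> p' l = d) L)"
  proof (rule count_if_sum)
    fix f assume f: "f \<in> set L"
    have 1: "(\<Sum>k\<in>A. of_bool (P k f \<and> p k = d) :: nat) = of_bool (g f = d) * (\<Sum>k\<in>A. of_bool (P k f))"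
      unfolding sum_distrib_left by (rule sum.cong) (use assms(2)[OF f] in auto)
    have 2: "(\<Sum>l\<in>B. of_bool (P' l f \<and> p' l = d) :: nat) = of_bool (g f = d) * (\<Sum>l\<in>B. of_bool (P' l f))"
      unfolding sum_distrib_left by (rule sum.cong) (use assms(3)[OF f] in auto)
    show "of_bool (Q f \<and> g f = d) = (\<Sum>k\<in>A. of_bool (P k f \<and> p k = d)) + (\<Sum>l\<in>B. of_bool (P' l f \<and> p' l = d) :: nat)"
      unfolding 1 2 distrib_left[symmetric] assms(1)[OF f, symmetric] by auto
  qed
  then show ?thesis by (simp only: count_if_conj)
qed

lemma desc_empty_between: "desc e s i xs = {} \<Longrightarrow> s \<le> e \<and> (\<forall>x\<in>set xs. x \<le> e)"
proof (induction xs arbitrary: s i)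
  case (Cons x xs)
  then have "desc e x (Suc i) xs = {}" "s \<le> x" by (auto split: if_splits)
  with Cons.IH[of x "Suc i"] show ?case by auto
qed (simp split: if_splits)

lemma up_down_peak: "up_down e m s ys \<Longrightarrow> e < ys ! m \<and> s \<le> ys ! m \<and> (\<forall>y\<in>set ys. y \<le> ys ! m) \<and> m < length ys"
proof (induction e m s ys rule: up_down.induct)
  case (2 e s x xs)
  then show ?case using all_desc_less[of e x xs] by (auto simp: less_imp_le)
next
  case (3 e m s x xs)
  then have "s \<le> x" "up_down e m x xs" by auto
  with 3(1) have "e < xs ! m \<and> x \<le> xs ! m \<and> (\<forall>y\<in>set xs. y \<le> xs ! m) \<and> m < length xs" by blast
  then show ?case using \<open>s \<le> x\<close> by auto
qed simp

lemma sum_of_bool_single: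
  assumes "finite A" "k0 \<in> A" "\<And>k. k \<in> A \<Longrightarrow> P k \<longleftrightarrow> k = k0 \<and> c"
  shows "(\<Sum>k\<in>A. of_bool (P k) :: nat) = of_bool c"
proof -
  have "(\<Sum>k\<in>A. of_bool (P k) :: nat) = (\<Sum>k\<in>A. if k = k0 then of_bool c else 0)"
    by (rule sum.cong) (use assms(3) in auto)
  then show ?thesis using assms(1,2) by simp
qed

lemma sum_of_bool_none:
  assumes "\<And>k. k \<in> A \<Longrightarrow> \<not> P k"
  shows "(\<Sum>k\<in>A. of_bool (P k) :: nat) = 0"
  by (rule sum.neutral) (use assms in auto)

text \<open>
  With a Morse face \<open>{a..n}\<close> in the first factor, the word ascends before \<open>a\<close>, so only the last column of the box contributes.
\<close>

lemma sum_exits_box: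
  assumes "0 < a" "a \<le> length xs" "desc e s 0 xs \<subseteq> {a..length xs}"
  shows "(\<Sum>k<a. of_bool (c1 k \<and> up_free_down e k s xs \<and> c) :: nat) =
     of_bool (c1 (a - 1) \<and> desc e s 0 xs = {a..length xs} \<and> c)"
proof (rule sum_of_bool_single[where ?k0.0 = "a - 1"])
  show "finite {..<a}" "a - 1 \<in> {..<a}" using assms(1) by auto
  fix k assume k: "k \<in> {..<a}"
  then have "k \<notin> desc e s 0 xs" using assms(3) by auto
  then have d: "desc e s 0 xs - {k} = desc e s 0 xs" by blast
  have "up_free_down e k s xs \<longleftrightarrow> k \<le> length xs \<and> desc e s 0 xs = {Suc k..length xs}"
    using up_free_down_iff[of e k s xs 0] unfolding add_0 d .
  also have "\<dots> \<longleftrightarrow> k = a - 1 \<and> desc e s 0 xs = {a..length xs}"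
  proof
    assume h: "k \<le> length xs \<and> desc e s 0 xs = {Suc k..length xs}"
    have "Suc k \<in> {Suc k..length xs}" using k assms(2) by simp
    then have "Suc k \<in> {a..length xs}" using h assms(3) by blast
    then have "Suc k = a" using k by simp
    then show "k = a - 1 \<and> desc e s 0 xs = {a..length xs}" using h by auto
  next
    assume h: "k = a - 1 \<and> desc e s 0 xs = {a..length xs}"
    then have "Suc k = a" using assms(1) by simp
    then show "k \<le> length xs \<and> desc e s 0 xs = {Suc k..length xs}" using h assms(2) by simp
  qed
  finally show "c1 k \<and> up_free_down e k s xs \<and> c \<longleftrightarrow> k = a - 1 \<and> c1 (a - 1) \<and> desc e s 0 xs = {a..length xs} \<and> c"
    by auto
qed

text \<open>
  Without a Morse face the word has its turning point anywhere. The closed and the open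
  simplex are the extreme cases; every other turning point is excluded by assumption.
\<close>

lemma sum_exits_full:
  assumes "\<And>p. c \<Longrightarrow> 0 < p \<Longrightarrow> p \<le> length xs \<Longrightarrow> desc e s 0 xs \<noteq> {p..length xs}"
  shows "(\<Sum>k<Suc (length xs). of_bool (c1 k \<and> up_free_down e k s xs \<and> c) :: nat) =
     of_bool ((desc e s 0 xs = {} \<and> c1 (length xs) \<or> desc e s 0 xs = {..length xs} \<and> c1 0) \<and> c)"
proof (cases c)
  case c: True
  let ?R = "desc e s 0 xs" and ?n = "length xs"
  have u: "up_free_down e k s xs \<longleftrightarrow> k \<le> ?n \<and> ?R - {k} = {Suc k..?n}" for k
    using up_free_down_iff[of e k s xs 0] by simp
  have full: "{..?n} = insert 0 {Suc 0..?n}" by auto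
  have imp: "k = ?n \<and> ?R = {} \<or> k = 0 \<and> ?R = {..?n}" if k: "k \<le> ?n" "?R - {k} = {Suc k..?n}" for k
  proof (cases "k \<in> ?R")
    case True
    then have R: "?R = insert k {Suc k..?n}" using k(2) by blast
    also have "\<dots> = {k..?n}" using k(1) by auto
    finally have "\<not> 0 < k" using assms[OF c] k(1) by blast
    then show ?thesis using R full by simp
  next
    case False
    then have R: "?R = {Suc k..?n}" using k(2) by blast
    then have "\<not> Suc k \<le> ?n" using assms[OF c, of "Suc k"] by blast
    then show ?thesis using R k(1) by simp
  qed
  consider (empty) "?R = {}" | (full) "?R = {..?n}" | (other) "?R \<noteq> {}" "?R \<noteq> {..?n}" by blast
  then show ?thesis
  proof cases
    case empty
    have "(\<Sum>k<Suc ?n. of_bool (c1 k \<and> up_free_down e k s xs \<and> c) :: nat) = of_bool (c1 ?n)"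
    proof (rule sum_of_bool_single[where ?k0.0 = ?n])
      fix k assume "k \<in> {..<Suc ?n}"
      then have "up_free_down e k s xs \<longleftrightarrow> k = ?n" unfolding u empty by auto
      then show "c1 k \<and> up_free_down e k s xs \<and> c \<longleftrightarrow> k = ?n \<and> c1 ?n" using c by auto
    qed auto
    then show ?thesis using empty c by simp
  next
    case full': full
    have "(\<Sum>k<Suc ?n. of_bool (c1 k \<and> up_free_down e k s xs \<and> c) :: nat) = of_bool (c1 0)"
    proof (rule sum_of_bool_single[where ?k0.0 = 0])
      fix k assume k: "k \<in> {..<Suc ?n}"
      have "{..?n} - {0} = {Suc 0..?n}" by auto
      then have "up_free_down e 0 s xs" unfolding u full' by simp
      moreover have "k = 0" if "up_free_down e k s xs"
      proof -
        have "{..?n} \<noteq> {}" by simp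
        then show ?thesis using imp[of k] that full' unfolding u by metis
      qed
      ultimately show "c1 k \<and> up_free_down e k s xs \<and> c \<longleftrightarrow> k = 0 \<and> c1 0" using c by blast
    qed auto
    moreover have "{..?n} \<noteq> {}" by simp
    ultimately show ?thesis using full' c by simp
  next
    case other
    have "(\<Sum>k<Suc ?n. of_bool (c1 k \<and> up_free_down e k s xs \<and> c) :: nat) = 0"
      by (rule sum_of_bool_none) (use imp other u in blast)
    then show ?thesis using other by simp
  qed
qed simp


text \<open>
  A tile on the vertices \<open>{..n}\<close> with removed vertices \<open>R\<close> and Morse face \<open>{a..n}\<close> is critical of
  index \<open>d\<close>; \<open>a = Suc n\<close> encodes the absence of a Morse face.
\<close>

definition critical_index :: "nat \<Rightarrow> nat set \<Rightarrow> nat \<Rightarrow> nat \<Rightarrow> bool" where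
  "critical_index n R a d \<longleftrightarrow> a = Suc n \<and> (R = {} \<and> d = 0 \<or> R = {..n} \<and> d = n) \<or>
     a \<le> n \<and> R = {a..n} \<and> d = Suc n - a"

text \<open>
  The two sums count the paths leaving the box upwards and to the right. If both factors have Morse faces and are critical,
  the peaks of the two words differ and exactly one of the two sums contributes. If the first factor has none,
  only the first sum survives, and \<open>high\<close> makes the largest label lie in the first word whenever
  that word could turn at an inner vertex, which is incompatible with leaving the box upwards.
\<close>

lemma sum_exits_critical:
  assumes len: "length xs = n1" "length ys = n2" and R: "desc e s 0 xs = R1" "desc e s 0 ys = R2"
    and dis: "set xs \<inter> set ys = {}"
    and t1: "0 < a1 \<and> a1 \<le> n1 \<and> R1 \<subseteq> {a1..n1} \<or> a1 = Suc n1"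
    and t2: "0 < a2" "a2 \<le> n2" "R2 \<subseteq> {a2..n2}"
    and high: "\<And>p. a1 = Suc n1 \<Longrightarrow> 0 < p \<Longrightarrow> p \<le> n1 \<Longrightarrow> R1 = {p..n1} \<Longrightarrow> \<exists>x\<in>set xs. \<forall>y\<in>set ys. y < x"
  shows "(\<Sum>k<a1. of_bool ((n1 - k) + (n2 - (a2 - 1)) = d) * of_bool (up_free_down e k s xs \<and> up_down e (a2 - 1) s ys \<and> (\<forall>x\<in>set xs. x < ys ! (a2 - 1)))) +
     (\<Sum>l<a2. of_bool ((n1 - (a1 - 1)) + (n2 - l) = d) * of_bool (up_free_down e l s ys \<and> up_down e (a1 - 1) s xs \<and> (\<forall>y\<in>set ys. y < xs ! (a1 - 1)))) =
    (of_bool (\<exists>d1 d2. critical_index n1 R1 a1 d1 \<and> critical_index n2 R2 a2 d2 \<and> d = d1 + d2) :: nat)"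
    (is "?S1 + ?S2 = _")
proof -
  define cA where "cA \<longleftrightarrow> up_down e (a2 - 1) s ys \<and> (\<forall>x\<in>set xs. x < ys ! (a2 - 1))"
  define cB where "cB \<longleftrightarrow> up_down e (a1 - 1) s xs \<and> (\<forall>y\<in>set ys. y < xs ! (a1 - 1))"
  have S1: "?S1 = (\<Sum>k<a1. of_bool ((n1 - k) + (n2 - (a2 - 1)) = d \<and> up_free_down e k s xs \<and> cA))"
    unfolding cA_def by (rule sum.cong) auto
  have S2: "?S2 = (\<Sum>l<a2. of_bool ((n1 - (a1 - 1)) + (n2 - l) = d \<and> up_free_down e l s ys \<and> cB))"
    unfolding cB_def by (rule sum.cong) auto
  have ud: "up_down e (a2 - 1) s ys \<longleftrightarrow> R2 = {a2..n2}"
    using up_down_iff[of e "a2 - 1" s ys 0] t2 len(2) R(2) by (simp add: less_eq_Suc_le)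
  have ci2: "critical_index n2 R2 a2 d2 \<longleftrightarrow> R2 = {a2..n2} \<and> d2 = Suc n2 - a2" for d2
    using t2 by (auto simp: critical_index_def)
  have n2: "n2 - (a2 - 1) = Suc n2 - a2" using t2 by simp
  from t1 show ?thesis
  proof
    assume m: "0 < a1 \<and> a1 \<le> n1 \<and> R1 \<subseteq> {a1..n1}"
    have ux: "up_down e (a1 - 1) s xs \<longleftrightarrow> R1 = {a1..n1}"
      using up_down_iff[of e "a1 - 1" s xs 0] m len(1) R(1) by (simp add: less_eq_Suc_le)
    have ci1: "critical_index n1 R1 a1 d1 \<longleftrightarrow> R1 = {a1..n1} \<and> d1 = Suc n1 - a1" for d1
      using m by (auto simp: critical_index_def)
    have n1: "n1 - (a1 - 1) = Suc n1 - a1" using m by simp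
    have 1: "?S1 = of_bool ((n1 - (a1 - 1)) + (n2 - (a2 - 1)) = d \<and> R1 = {a1..n1} \<and> cA)"
    proof -
      have "(\<Sum>k<a1. of_bool ((n1 - k) + (n2 - (a2 - 1)) = d \<and> up_free_down e k s xs \<and> cA) :: nat) =
        of_bool ((n1 - (a1 - 1)) + (n2 - (a2 - 1)) = d \<and> desc e s 0 xs = {a1..length xs} \<and> cA)"
        by (rule sum_exits_box[where ?c1.0 = "\<lambda>k. (n1 - k) + (n2 - (a2 - 1)) = d"]) (use m len R in auto)
      then show ?thesis unfolding S1 R(1) len(1) .
    qed
    have 2: "?S2 = of_bool ((n1 - (a1 - 1)) + (n2 - (a2 - 1)) = d \<and> R2 = {a2..n2} \<and> cB)"
    proof -
      have "(\<Sum>l<a2. of_bool ((n1 - (a1 - 1)) + (n2 - l) = d \<and> up_free_down e l s ys \<and> cB) :: nat) =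
        of_bool ((n1 - (a1 - 1)) + (n2 - (a2 - 1)) = d \<and> desc e s 0 ys = {a2..length ys} \<and> cB)"
        by (rule sum_exits_box[where ?c1.0 = "\<lambda>l. (n1 - (a1 - 1)) + (n2 - l) = d"]) (use t2 len R in auto)
      then show ?thesis unfolding S2 R(2) len(2) .
    qed
    have 12: "?S1 + ?S2 = of_bool ((n1 - (a1 - 1)) + (n2 - (a2 - 1)) = d \<and> R1 = {a1..n1} \<and> cA) +
       of_bool ((n1 - (a1 - 1)) + (n2 - (a2 - 1)) = d \<and> R2 = {a2..n2} \<and> cB)"
      by (simp only: 1 2)
    have AB: "cA \<longleftrightarrow> \<not> cB" if "R1 = {a1..n1}" "R2 = {a2..n2}"
    proof -
      have px: "(\<forall>x\<in>set xs. x \<le> xs ! (a1 - 1)) \<and> a1 - 1 < length xs" 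
        using up_down_peak[of e "a1 - 1" s xs] ux that by blast
      have py: "(\<forall>x\<in>set ys. x \<le> ys ! (a2 - 1)) \<and> a2 - 1 < length ys" 
        using up_down_peak[of e "a2 - 1" s ys] ud that by blast
      have mx: "xs ! (a1 - 1) \<in> set xs" and my: "ys ! (a2 - 1) \<in> set ys" using px py by auto
      then have ne: "xs ! (a1 - 1) \<noteq> ys ! (a2 - 1)" using dis by auto
      have "cA \<longleftrightarrow> xs ! (a1 - 1) < ys ! (a2 - 1)" unfolding cA_def ud using that px mx by fastforce
      moreover have "cB \<longleftrightarrow> ys ! (a2 - 1) < xs ! (a1 - 1)" unfolding cB_def ux using that py my by fastforce
      ultimately show ?thesis using ne by auto
    qed
    have cAB: "cA \<Longrightarrow> R2 = {a2..n2}" "cB \<Longrightarrow> R1 = {a1..n1}" unfolding cA_def cB_def ud ux by blast+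
    have ex: "(\<exists>d1 d2. critical_index n1 R1 a1 d1 \<and> critical_index n2 R2 a2 d2 \<and> d = d1 + d2) \<longleftrightarrow>
       R1 = {a1..n1} \<and> R2 = {a2..n2} \<and> (n1 - (a1 - 1)) + (n2 - (a2 - 1)) = d"
      unfolding ci1 ci2 n1 n2 by blast
    show ?thesis unfolding 12 ex
    proof (cases "R1 = {a1..n1} \<and> R2 = {a2..n2}")
      case True
      then have "cA \<longleftrightarrow> \<not> cB" using AB by blast
      then show "of_bool ((n1 - (a1 - 1)) + (n2 - (a2 - 1)) = d \<and> R1 = {a1..n1} \<and> cA) +
         of_bool ((n1 - (a1 - 1)) + (n2 - (a2 - 1)) = d \<and> R2 = {a2..n2} \<and> cB) =
         (of_bool (R1 = {a1..n1} \<and> R2 = {a2..n2} \<and> (n1 - (a1 - 1)) + (n2 - (a2 - 1)) = d) :: nat)"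
        using True by (cases cB) (simp_all only: simp_thms of_bool_eq add_0 add_0_right)
    next
      case False
      then have "\<not> (R1 = {a1..n1} \<and> cA)" "\<not> (R2 = {a2..n2} \<and> cB)" using cAB by blast+
      then show "of_bool ((n1 - (a1 - 1)) + (n2 - (a2 - 1)) = d \<and> R1 = {a1..n1} \<and> cA) +
         of_bool ((n1 - (a1 - 1)) + (n2 - (a2 - 1)) = d \<and> R2 = {a2..n2} \<and> cB) =
         (of_bool (R1 = {a1..n1} \<and> R2 = {a2..n2} \<and> (n1 - (a1 - 1)) + (n2 - (a2 - 1)) = d) :: nat)"
        using False by (simp only: of_bool_def) (simp, blast)
    qed
  next
    assume m: "a1 = Suc n1"
    have "\<not> cB" unfolding cB_def using up_down_peak[of e "a1 - 1" s xs] m len by auto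
    then have 2: "?S2 = 0" unfolding S2 by simp
    have S1': "?S1 = of_bool ((R1 = {} \<and> Suc n2 - a2 = d \<or> R1 = {..n1} \<and> n1 + (Suc n2 - a2) = d) \<and> cA)"
    proof -
      have "R1 \<noteq> {p..n1}" if h: "cA" "0 < p" "p \<le> n1" for p
      proof
        assume "R1 = {p..n1}"
        then obtain x where x: "x \<in> set xs" "\<forall>y\<in>set ys. y < x" using high[OF m h(2,3)] by blast
        have "a2 - 1 < length ys" using t2 len(2) by simp
        then have "ys ! (a2 - 1) < x" using x(2) by simp
        moreover have "x < ys ! (a2 - 1)" using h(1) x(1) unfolding cA_def by blast
        ultimately show False by simp
      qed
      then have "(\<Sum>k<Suc (length xs). of_bool ((n1 - k) + (n2 - (a2 - 1)) = d \<and> up_free_down e k s xs \<and> cA) :: nat) =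
        of_bool ((desc e s 0 xs = {} \<and> (n1 - length xs) + (n2 - (a2 - 1)) = d \<or> desc e s 0 xs = {..length xs} \<and> (n1 - 0) + (n2 - (a2 - 1)) = d) \<and> cA)"
        by (intro sum_exits_full[where ?c1.0 = "\<lambda>k. (n1 - k) + (n2 - (a2 - 1)) = d"]) (use len R in auto)
      then show ?thesis unfolding S1 unfolding R(1) len(1) n2 m by simp
    qed
    have A1: "cA \<longleftrightarrow> R2 = {a2..n2}" if "R1 = {} \<or> R1 = {..n1}"
    proof -
      have "\<forall>x\<in>set xs. x < ys ! (a2 - 1)" if "R2 = {a2..n2}"
      proof -
        have py: "e < ys ! (a2 - 1)" "s \<le> ys ! (a2 - 1)" 
          using up_down_peak[of e "a2 - 1" s ys] ud that by blast+
        from \<open>R1 = {} \<or> R1 = {..n1}\<close> show ?thesis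
        proof
          assume "R1 = {}"
          then show ?thesis using desc_empty_between[of e s 0 xs] R(1) py by fastforce
        next
          assume "R1 = {..n1}"
          then have "all_desc e s xs" using all_desc_iff[of e s xs 0] R(1) len(1) by (simp add: atLeast0AtMost)
          then show ?thesis using all_desc_less[of e s xs] py by fastforce
        qed
      qed
      then show ?thesis unfolding cA_def ud by blast
    qed
    have ci1: "critical_index n1 R1 a1 d1 \<longleftrightarrow> (R1 = {} \<and> d1 = 0 \<or> R1 = {..n1} \<and> d1 = n1)" for d1
      using m by (auto simp: critical_index_def)
    have ex: "(\<exists>d1 d2. critical_index n1 R1 a1 d1 \<and> critical_index n2 R2 a2 d2 \<and> d = d1 + d2) \<longleftrightarrow>
       (R1 = {} \<and> Suc n2 - a2 = d \<or> R1 = {..n1} \<and> n1 + (Suc n2 - a2) = d) \<and> R2 = {a2..n2}"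
      unfolding ci1 ci2 by fastforce
    have "(R1 = {} \<and> Suc n2 - a2 = d \<or> R1 = {..n1} \<and> n1 + (Suc n2 - a2) = d) \<and> cA \<longleftrightarrow>
      (R1 = {} \<and> Suc n2 - a2 = d \<or> R1 = {..n1} \<and> n1 + (Suc n2 - a2) = d) \<and> R2 = {a2..n2}"
      using A1 by blast
    with S1' show ?thesis unfolding 2 ex by (simp only: add_0_right)
  qed
qed

text \<open>
  The condition \<open>removes_outside a1 a2 f\<close> says that the descents of the path are exactly the vertices of its Morse face;
  critical tiles of the factors produce one such path, regular tiles none.
\<close>

theorem count_critical_paths:
  assumes len: "length xs = n1" "length ys = n2" and R: "desc e s 0 xs = R1" "desc e s 0 ys = R2"
    and dis: "set xs \<inter> set ys = {}"
    and t1: "0 < a1 \<and> a1 \<le> n1 \<and> R1 \<subseteq> {a1..n1} \<or> a1 = Suc n1"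
    and t2: "0 < a2 \<and> a2 \<le> n2 \<and> R2 \<subseteq> {a2..n2} \<or> a2 = Suc n2"
    and proper: "a1 \<le> n1 \<or> a2 \<le> n2"
    and high1: "\<And>p. a1 = Suc n1 \<Longrightarrow> 0 < p \<Longrightarrow> p \<le> n1 \<Longrightarrow> R1 = {p..n1} \<Longrightarrow> \<exists>x\<in>set xs. \<forall>y\<in>set ys. y < x"
    and high2: "\<And>p. a2 = Suc n2 \<Longrightarrow> 0 < p \<Longrightarrow> p \<le> n2 \<Longrightarrow> R2 = {p..n2} \<Longrightarrow> \<exists>y\<in>set ys. \<forall>x\<in>set xs. x < y"
  shows "count_if (\<lambda>f. removes_outside a1 a2 f \<and> card (rem f) = d) (stairs e s 0 xs 0 ys) =
    of_bool (\<exists>d1 d2. critical_index n1 R1 a1 d1 \<and> critical_index n2 R2 a2 d2 \<and> d = d1 + d2)"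
proof -
  have pos: "0 < a1" "0 < a2" using t1 t2 by auto
  let ?L = "stairs e s 0 xs 0 ys"
  have u: "count_if (exits_up k (a2 - 1)) ?L =
     of_bool (up_free_down e k s xs \<and> up_down e (a2 - 1) s ys \<and> (\<forall>x\<in>set xs. x < ys ! (a2 - 1)))" for k
    using count_exits_up[OF dis, of 0 k 0 "a2 - 1" e s] by (simp only: add_0)
  have r: "count_if (exits_right (a1 - 1) l) ?L =
     of_bool (up_free_down e l s ys \<and> up_down e (a1 - 1) s xs \<and> (\<forall>y\<in>set ys. y < xs ! (a1 - 1)))" for l
  proof -
    have "exits_right (a1 - 1) l \<circ> flip = exits_up l (a1 - 1)" by (auto simp: exits_right_flip)
    moreover have "set ys \<inter> set xs = {}" using dis by auto
    ultimately show ?thesis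
      using count_exits_up[of ys xs 0 l 0 "a1 - 1" e s] count_stairs_flip[of "exits_right (a1 - 1) l" e s 0 xs 0 ys]
      by (simp only: add_0)
  qed
  have "count_if (\<lambda>f. removes_outside a1 a2 f \<and> card (rem f) = d) ?L =
     (\<Sum>k<a1. of_bool ((n1 - k) + (n2 - (a2 - 1)) = d) * count_if (exits_up k (a2 - 1)) ?L) +
     (\<Sum>l<a2. of_bool ((n1 - (a1 - 1)) + (n2 - l) = d) * count_if (exits_right (a1 - 1) l) ?L)"
  proof (rule count_if_sum_index)
    show "of_bool (removes_outside a1 a2 f) = (\<Sum>k<a1. of_bool (exits_up k (a2 - 1) f)) + (\<Sum>l<a2. of_bool (exits_right (a1 - 1) l f) :: nat)"
      if "f \<in> set ?L" for f
      by (rule removes_outside_exit[OF that pos]) (use proper len in simp)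
    show "card (rem f) = (n1 - k) + (n2 - (a2 - 1))" if "f \<in> set ?L" "exits_up k (a2 - 1) f" for f k
      using stairs_card_beyond[of f e s 0 xs 0 ys k "a2 - 1"] that len unfolding exits_up_def by simp
    show "card (rem f) = (n1 - (a1 - 1)) + (n2 - l)" if "f \<in> set ?L" "exits_right (a1 - 1) l f" for f l
      using stairs_card_beyond[of f e s 0 xs 0 ys "a1 - 1" l] that len unfolding exits_right_def by simp
  qed
  also have "\<dots> = of_bool (\<exists>d1 d2. critical_index n1 R1 a1 d1 \<and> critical_index n2 R2 a2 d2 \<and> d = d1 + d2)"
  proof (cases "a2 \<le> n2")
    case True
    then have "0 < a2" "a2 \<le> n2" "R2 \<subseteq> {a2..n2}" using t2 by auto
    from sum_exits_critical[OF len R dis t1 this high1, where d = d] show ?thesis unfolding u r .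
  next
    case False
    then have a2: "a2 = Suc n2" using t2 by simp
    then have a1: "0 < a1" "a1 \<le> n1" "R1 \<subseteq> {a1..n1}" using t1 proper by auto
    have dis': "set ys \<inter> set xs = {}" using dis by auto
    have eq: "(\<exists>d1 d2. critical_index n1 R1 a1 d1 \<and> critical_index n2 R2 a2 d2 \<and> d = d1 + d2) \<longleftrightarrow>
      (\<exists>d2 d1. critical_index n2 R2 a2 d2 \<and> critical_index n1 R1 a1 d1 \<and> d = d2 + d1)"
      by (auto simp: add.commute) 
    show ?thesis unfolding u r eq
      using sum_exits_critical[OF len(2,1) R(2,1) dis' t2 a1 high2, where d = d]
      by (simp only: add.commute)
  qed
  finally show ?thesis .
qed

section \<open>The tiles cut out by staircase paths\<close>

definition valid_tile :: "'v set \<Rightarrow> 'v set \<Rightarrow> 'v set \<Rightarrow> bool" where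
  "valid_tile W R M \<longleftrightarrow> finite W \<and> W \<noteq> {} \<and> R \<subseteq> W \<and> M \<subseteq> W \<and>
     (M \<noteq> {} \<longrightarrow> R \<noteq> {} \<and> R \<subseteq> M \<and> card M + 2 \<le> card W)"

definition critical_tile :: "'v set \<Rightarrow> 'v set \<Rightarrow> 'v set \<Rightarrow> nat \<Rightarrow> bool" where
  "critical_tile W R M k \<longleftrightarrow> R = {} \<and> k = 0 \<or> R = W \<and> Suc k = card W \<or> M \<noteq> {} \<and> R = M \<and> k = card R"

text \<open>
  A tile as vertex set, vertices opposite to the removed facets, and vertices of the Morse face.
\<close>

type_synonym 'v cell = "'v set \<times> 'v set \<times> 'v set"

text \<open>
  Whether the relative interior of the simplex spanned by \<open>C\<close> lies in the tile.
\<close>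

definition in_cell :: "'v cell \<Rightarrow> 'v set \<Rightarrow> bool" where
  "in_cell t C \<longleftrightarrow> (case t of (P, R, M) \<Rightarrow> R \<subseteq> C \<and> C \<subseteq> P \<and> \<not> C \<subseteq> M)"

text \<open>
  The points outside the box form the Morse face, with two exceptions. If a descent lies inside the box, no
  carrier containing the descents lies outside the box, so there is nothing to remove. If the points outside the
  box miss only the origin, they span a facet, which counts among the removed ones and not as a Morse face.
\<close>

definition path_cell :: "nat \<Rightarrow> nat \<Rightarrow> ((nat \<times> nat) \<times> bool) list \<Rightarrow> (nat \<times> nat) cell" where
  "path_cell a1 a2 f = (let M = pts f - {..<a1} \<times> {..<a2} in
     if \<not> rem f \<subseteq> M then (pts f, rem f, {})
     else if Suc (card M) = card (pts f) then (pts f, insert (0, 0) (rem f), {})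
     else (pts f, rem f, M))"

lemma fst_path_cell [simp]: "fst (path_cell a1 a2 f) = pts f"
  by (simp add: path_cell_def Let_def)

lemma finite_pts [simp]: "finite (pts f)"
  by (simp add: pts_def)

lemma codim_one:
  assumes "finite P" "p \<in> P" "p \<in> B" "Suc (card (P - B)) = card P"
  shows "P - B = P - {p}"
proof -
  have "P - B \<subseteq> P - {p}" using assms(3) by blast
  moreover have "card (P - {p}) = card (P - B)" using assms by (simp add: card_Diff_singleton)
  ultimately show ?thesis using assms(1) by (metis card_subset_eq finite_Diff)
qed

lemma in_path_cell:
  assumes f: "f \<in> set (stairs e s 0 xs 0 ys)" and a: "0 < a1" "0 < a2"
  shows "in_cell (path_cell a1 a2 f) C \<longleftrightarrow> rem f \<subseteq> C \<and> C \<subseteq> pts f \<and> \<not> C \<subseteq> pts f - {..<a1} \<times> {..<a2}"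
proof -
  let ?M = "pts f - {..<a1} \<times> {..<a2}"
  have 0: "(0, 0) \<in> pts f" by (rule stairs_start[OF f])
  consider "\<not> rem f \<subseteq> ?M" | "rem f \<subseteq> ?M" "Suc (card ?M) = card (pts f)" | "rem f \<subseteq> ?M" "Suc (card ?M) \<noteq> card (pts f)"
    by blast
  then show ?thesis
  proof cases
    case 1
    then have "path_cell a1 a2 f = (pts f, rem f, {})" by (simp add: path_cell_def)
    moreover have "rem f \<subseteq> pts f" by (rule rem_subset_pts)
    ultimately show ?thesis using 1 by (auto simp: in_cell_def)
  next
    case 2
    then have t: "path_cell a1 a2 f = (pts f, insert (0, 0) (rem f), {})" by (simp add: path_cell_def)
    have "?M = pts f - {(0, 0)}" by (rule codim_one) (use 0 a 2 in auto)
    then show ?thesis unfolding t in_cell_def by auto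
  next
    case 3
    then show ?thesis by (simp add: path_cell_def in_cell_def)
  qed
qed

text \<open>
  The carrier condition for a tile with vertices \<open>{..n}\<close> and Morse face \<open>{a..n}\<close>.
\<close>

definition admits :: "nat \<Rightarrow> nat set \<Rightarrow> nat \<Rightarrow> nat set \<Rightarrow> bool" where
  "admits n R a D \<longleftrightarrow> R \<subseteq> D \<and> \<not> D \<subseteq> {a..n}"

definition subdivides :: "nat \<Rightarrow> nat set \<Rightarrow> nat \<Rightarrow> nat \<Rightarrow> nat set \<Rightarrow> nat \<Rightarrow> (nat \<times> nat) cell list \<Rightarrow> bool" where
  "subdivides n1 R1 a1 n2 R2 a2 L \<longleftrightarrow>
     (\<forall>(P, R, M)\<in>set L. valid_tile P R M \<and> P \<subseteq> {..n1} \<times> {..n2} \<and> chain2 P \<and> card P = Suc (n1 + n2) \<and>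
        (\<forall>p\<in>P - M. \<forall>q\<in>M. fst p \<le> fst q \<and> snd p \<le> snd q)) \<and>
     (\<forall>C. C \<noteq> {} \<and> chain2 C \<and> C \<subseteq> {..n1} \<times> {..n2} \<and> admits n1 R1 a1 (fst ` C) \<and> admits n2 R2 a2 (snd ` C) \<longrightarrow>
        (\<exists>A t B. L = A @ t # B \<and> in_cell t C \<and> (\<forall>g\<in>set A. \<not> C \<subseteq> fst g) \<and> (\<forall>g\<in>set B. \<not> in_cell g C))) \<and>
     (\<forall>t\<in>set L. \<forall>C. in_cell t C \<longrightarrow> admits n1 R1 a1 (fst ` C) \<and> admits n2 R2 a2 (snd ` C))"

text \<open>
  The least element of a chain realizes the minima of both projections. So neither projection of a chain lies in the Morse
  face of its factor iff the chain meets the box, which is the condition \<open>in_path_cell\<close>. The last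
  hypothesis prevents a Morse face on a tile that is otherwise closed.
\<close>

lemma stairs_subdivides:
  assumes len: "length xs = n1" "length ys = n2" and R: "desc e s 0 xs = R1" "desc e s 0 ys = R2"
    and dis: "set xs \<inter> set ys = {}" and a: "0 < a1" "a1 \<le> Suc n1" "0 < a2" "a2 \<le> Suc n2"
    and ne: "a1 \<le> n1 \<or> a2 \<le> n2 \<Longrightarrow> R1 \<noteq> {} \<or> R2 \<noteq> {}"
  shows "subdivides n1 R1 a1 n2 R2 a2 (map (path_cell a1 a2) (stairs e s 0 xs 0 ys))"
proof -
  let ?L = "stairs e s 0 xs 0 ys" and ?B = "{..<a1} \<times> {..<a2}"
  have grid: "pts f \<subseteq> {..n1} \<times> {..n2}" if "f \<in> set ?L" for f
    using stairs_pts_grid[OF that] len by (simp add: atLeast0AtMost)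
  have valid: "valid_tile P R M \<and> P \<subseteq> {..n1} \<times> {..n2} \<and> chain2 P \<and> card P = Suc (n1 + n2) \<and>
        (\<forall>p\<in>P - M. \<forall>q\<in>M. fst p \<le> fst q \<and> snd p \<le> snd q)"
    if f: "f \<in> set ?L" and t: "path_cell a1 a2 f = (P, R, M)" for f P R M
  proof -
    have P: "P = pts f" using t fst_path_cell by (metis fst_conv)
    have ch: "chain2 P" unfolding P by (rule stairs_chain[OF f])
    have card: "card P = Suc (n1 + n2)" unfolding P using stairs_card_pts[OF f] len by simp
    have 0: "(0, 0) \<in> P" unfolding P by (rule stairs_start[OF f])
    have sub: "rem f \<subseteq> P" unfolding P by (rule rem_subset_pts)
    consider "R \<subseteq> P" "M = {}" | "R = rem f" "M = P - ?B" "rem f \<subseteq> M" "Suc (card M) \<noteq> card P"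
      using t sub 0 P unfolding path_cell_def Let_def by (auto split: if_splits)
    then have "R \<subseteq> P \<and> M \<subseteq> P \<and> (M \<noteq> {} \<longrightarrow> R \<noteq> {} \<and> R \<subseteq> M \<and> card M + 2 \<le> card P) \<and>
        (\<forall>p\<in>P - M. \<forall>q\<in>M. fst p \<le> fst q \<and> snd p \<le> snd q)"
    proof cases
      case 1
      then show ?thesis by simp
    next
      case 2
      have "R \<noteq> {}" if M: "M \<noteq> {}"
      proof
        assume "R = {}"
        then have "R1 = {} \<and> R2 = {}" using stairs_admissible[OF f, of "{}"] R 2(1) by auto
        then have "\<not> (a1 \<le> n1 \<or> a2 \<le> n2)" using ne by blast
        then have "a1 = Suc n1 \<and> a2 = Suc n2" using a by linarith
        then show False using M 2(2) grid[OF f] P by auto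
      qed
      moreover have "card M + 2 \<le> card P"
      proof -
        have "M \<subset> P" using 2(2) 0 a by auto
        then have "card M < card P" using P by (intro psubset_card_mono) simp_all
        then show ?thesis using 2(4) by simp
      qed
      moreover have "fst p \<le> fst q \<and> snd p \<le> snd q" if pq: "p \<in> P - M" "q \<in> M" for p q
      proof -
        have "fst p \<le> fst q \<and> snd p \<le> snd q \<or> fst q \<le> fst p \<and> snd q \<le> snd p"
          using ch pq 2(2) unfolding chain2_def by blast
        moreover have "p \<in> ?B" "q \<notin> ?B" using pq 2(2) by auto
        ultimately show ?thesis by (auto simp: mem_Times_iff)
      qed
      ultimately show ?thesis using 2 sub by auto
    qed
    then show ?thesis using ch card grid[OF f] P 0 unfolding valid_tile_def by auto
  qed
  have conv: "admits n1 R1 a1 (fst ` C) \<and> admits n2 R2 a2 (snd ` C)"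
    if f: "f \<in> set ?L" and C: "in_cell (path_cell a1 a2 f) C" for f C
  proof -
    have *: "rem f \<subseteq> C" "C \<subseteq> pts f" "\<not> C \<subseteq> pts f - ?B"
      using C unfolding in_path_cell[OF f a(1,3)] by blast+
    then obtain c where "c \<in> C" "c \<in> ?B" by blast
    then have "fst c \<in> fst ` C - {a1..n1}" "snd c \<in> snd ` C - {a2..n2}" by auto
    then show ?thesis using stairs_admissible[OF f *(1,2)] R unfolding admits_def by blast
  qed
  have select: "\<exists>A t B. map (path_cell a1 a2) ?L = A @ t # B \<and> in_cell t C \<and> (\<forall>g\<in>set A. \<not> C \<subseteq> fst g) \<and> (\<forall>g\<in>set B. \<not> in_cell g C)"
    if C: "C \<noteq> {}" "chain2 C" "C \<subseteq> {..n1} \<times> {..n2}" "admits n1 R1 a1 (fst ` C)" "admits n2 R2 a2 (snd ` C)" for C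
  proof -
    have "admissible e s 0 xs 0 ys C"
      using C R len unfolding admissible_def admits_def by (simp add: atLeast0AtMost)
    then obtain A f B where L: "?L = A @ f # B" "rem f \<subseteq> C" "C \<subseteq> pts f"
       "\<forall>g\<in>set A. \<not> C \<subseteq> pts g" "\<forall>g\<in>set B. \<not> (rem g \<subseteq> C \<and> C \<subseteq> pts g)"
      using stairs_select[OF _ dis] unfolding selects_def by blast
    obtain c1 c2 where c: "c1 \<in> C" "fst c1 \<notin> {a1..n1}" "c2 \<in> C" "snd c2 \<notin> {a2..n2}"
      using C(4,5) unfolding admits_def by blast
    have "c1 \<in> {..n1} \<times> {..n2}" "c2 \<in> {..n1} \<times> {..n2}" using C(3) c by blast+
    then have lt: "fst c1 < a1" "snd c2 < a2" using c by (auto simp: mem_Times_iff)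
    have "fst c1 \<le> fst c2 \<and> snd c1 \<le> snd c2 \<or> fst c2 \<le> fst c1 \<and> snd c2 \<le> snd c1"
      using C(2) c unfolding chain2_def by blast
    then have "c1 \<in> ?B \<or> c2 \<in> ?B" using lt by (auto simp: mem_Times_iff)
    then have nM: "\<not> C \<subseteq> pts f - ?B" using c by blast
    have mem: "f \<in> set ?L" "\<And>g. g \<in> set B \<Longrightarrow> g \<in> set ?L" unfolding L(1) by auto
    have "in_cell (path_cell a1 a2 f) C" unfolding in_path_cell[OF mem(1) a(1,3)] using L nM by blast
    moreover have "\<not> in_cell (path_cell a1 a2 g) C" if "g \<in> set B" for g
      unfolding in_path_cell[OF mem(2)[OF that] a(1,3)] using L(5) that by blast
    ultimately show ?thesis
      using L(4) by (intro exI[of _ "map (path_cell a1 a2) A"] exI[of _ "path_cell a1 a2 f"] exI[of _ "map (path_cell a1 a2) B"])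
        (auto simp: L(1))
  qed
  show ?thesis unfolding subdivides_def
  proof (intro conjI)
    show "\<forall>(P, R, M)\<in>set (map (path_cell a1 a2) ?L). valid_tile P R M \<and> P \<subseteq> {..n1} \<times> {..n2} \<and> chain2 P \<and> card P = Suc (n1 + n2) \<and>
        (\<forall>p\<in>P - M. \<forall>q\<in>M. fst p \<le> fst q \<and> snd p \<le> snd q)"
    proof
      fix t assume "t \<in> set (map (path_cell a1 a2) ?L)"
      then obtain f where f: "f \<in> set ?L" "t = path_cell a1 a2 f" by auto
      obtain P R M where t: "path_cell a1 a2 f = (P, R, M)" by (cases "path_cell a1 a2 f")
      show "case t of (P, R, M) \<Rightarrow> valid_tile P R M \<and> P \<subseteq> {..n1} \<times> {..n2} \<and> chain2 P \<and> card P = Suc (n1 + n2) \<and>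
        (\<forall>p\<in>P - M. \<forall>q\<in>M. fst p \<le> fst q \<and> snd p \<le> snd q)"
        unfolding f(2) t prod.case by (rule valid[OF f(1) t])
    qed
  qed (use select in blast, use conv in simp)
qed


lemma count_if_zero: "count_if Q L = 0 \<longleftrightarrow> (\<forall>f\<in>set L. \<not> Q f)"
  by (simp add: count_if_def filter_empty_conv)

lemma count_none_removed:
  assumes R: "desc e s 0 xs = R1" "desc e s 0 ys = R2" and dis: "set xs \<inter> set ys = {}"
  shows "count_if (\<lambda>f. rem f = {}) (stairs e s 0 xs 0 ys) = of_bool (R1 = {} \<and> R2 = {})"
proof (cases "R1 = {} \<and> R2 = {}")
  case True
  then have "admissible e s 0 xs 0 ys {}" using R by (simp add: admissible_def chain2_def)
  from stairs_select[OF this dis] obtain A f B where L: "stairs e s 0 xs 0 ys = A @ f # B" "rem f = {}"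
     "\<forall>g\<in>set A. \<not> {} \<subseteq> pts g" "\<forall>g\<in>set B. \<not> (rem g \<subseteq> {} \<and> {} \<subseteq> pts g)"
    unfolding selects_def by blast
  have "A = []" using L(3) by (cases A) auto
  moreover have "count_if (\<lambda>f. rem f = {}) B = 0" unfolding count_if_zero using L(4) by blast
  ultimately show ?thesis using True L(1,2) by simp
next
  case False
  have "count_if (\<lambda>f. rem f = {}) (stairs e s 0 xs 0 ys) = 0" unfolding count_if_zero
  proof
    fix f assume f: "f \<in> set (stairs e s 0 xs 0 ys)"
    show "rem f \<noteq> {}"
    proof
      assume "rem f = {}"
      then have "R1 = {} \<and> R2 = {}" using stairs_admissible[OF f, of "{}"] R by auto
      then show False using False by blast
    qed
  qed
  then show ?thesis using False by simp
qed

lemma count_open_paths: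
  assumes len: "length xs = n1" "length ys = n2" and R: "desc e s 0 xs = R1" "desc e s 0 ys = R2" and dis: "set xs \<inter> set ys = {}"
  shows "count_if (\<lambda>f. rem f = pts f) (stairs e s 0 xs 0 ys) = of_bool (R1 = {..n1} \<and> R2 = {..n2})"
  using count_all_removed[OF dis, of e s 0 0] all_desc_iff[of e s xs 0] all_desc_iff[of e s ys 0] len R
  by (simp only: add_0 atLeast0AtMost)

text \<open>
  Closed and open paths are excluded by the last two hypotheses, so that only Morse faces can make a path critical.
\<close>

lemma path_cell_critical:
  assumes len: "length xs = n1" "length ys = n2" and R: "desc e s 0 xs = R1" "desc e s 0 ys = R2"
    and dis: "set xs \<inter> set ys = {}"
    and f: "f \<in> set (stairs e s 0 xs 0 ys)" and t: "path_cell a1 a2 f = (P, R, M)"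
    and a: "0 < a1" "0 < a2" "a1 \<le> n1 \<or> a2 \<le> n2"
    and ne: "R1 \<noteq> {} \<or> R2 \<noteq> {}" and nf: "\<not> (R1 = {..n1} \<and> R2 = {..n2})"
  shows "critical_tile P R M d \<longleftrightarrow> removes_outside a1 a2 f \<and> card (rem f) = d"
proof -
  let ?M = "pts f - {..<a1} \<times> {..<a2}"
  have 0: "(0, 0) \<in> pts f" "(0, 0) \<notin> ?M" using stairs_start[OF f] a by auto
  have z: "(n1, n2) \<in> ?M" using stairs_end[OF f] a(3) len by auto
  have rne: "rem f \<noteq> {}"
  proof
    assume "rem f = {}"
    then have "R1 = {} \<and> R2 = {}" using stairs_admissible[OF f, of "{}"] R by auto
    then show False using ne by blast
  qed
  have sub: "rem f \<subseteq> pts f" by (rule rem_subset_pts)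
  have "rem f \<noteq> pts f"
  proof
    assume "rem f = pts f"
    then have "count_if (\<lambda>f. rem f = pts f) (stairs e s 0 xs 0 ys) \<noteq> 0"
      using f unfolding count_if_zero by blast
    then show False unfolding count_open_paths[OF len R dis] using nf by simp
  qed
  consider (1) "\<not> rem f \<subseteq> ?M" | (2) "rem f \<subseteq> ?M" "Suc (card ?M) = card (pts f)" | (3) "rem f \<subseteq> ?M" "Suc (card ?M) \<noteq> card (pts f)"
    by blast
  then show ?thesis
  proof cases
    case 1
    then have t': "P = pts f" "R = rem f" "M = {}" using t by (auto simp: path_cell_def)
    have "rem f \<noteq> ?M" using 1 by blast
    then show ?thesis unfolding t' critical_tile_def removes_outside_def using rne \<open>rem f \<noteq> pts f\<close> by blast
  next
    case 2
    then have t': "P = pts f" "R = insert (0, 0) (rem f)" "M = {}" using t by (auto simp: path_cell_def)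
    have M: "?M = pts f - {(0, 0)}" by (rule codim_one) (use 0 a 2 in auto)
    have "insert (0, 0) (rem f) = pts f \<longleftrightarrow> rem f = ?M" using 2(1) M 0 by auto
    moreover have "Suc d = card (pts f) \<longleftrightarrow> card ?M = d" using 2(2) by auto
    ultimately show ?thesis unfolding t' critical_tile_def removes_outside_def by auto
  next
    case 3
    then have t': "P = pts f" "R = rem f" "M = ?M" using t by (auto simp: path_cell_def)
    have "?M \<noteq> {}" using z by blast
    then show ?thesis unfolding t' critical_tile_def removes_outside_def using rne \<open>rem f \<noteq> pts f\<close> by auto
  qed
qed

lemma length_stairs: "length (stairs e s i xs j ys) = (length xs + length ys) choose length xs"
proof (induction e s i xs j ys rule: stairs.induct)
  case (4 e s i x xs j y ys)
  then show ?case by (simp add: in_order_def add.commute)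
qed simp_all


definition critical_count :: "'v cell list \<Rightarrow> nat \<Rightarrow> nat" where
  "critical_count L d = count_if (\<lambda>(P, R, M). critical_tile P R M d) L"

definition order_count :: "'v cell list \<Rightarrow> nat \<Rightarrow> nat" where
  "order_count L d = count_if (\<lambda>(P, R, M). card R = d) L"

lemma critical_count_paths:
  assumes len: "length xs = n1" "length ys = n2" and R: "desc e s 0 xs = R1" "desc e s 0 ys = R2"
    and dis: "set xs \<inter> set ys = {}"
    and t1: "0 < a1 \<and> a1 \<le> n1 \<and> R1 \<subseteq> {a1..n1} \<or> a1 = Suc n1"
    and t2: "0 < a2 \<and> a2 \<le> n2 \<and> R2 \<subseteq> {a2..n2} \<or> a2 = Suc n2"
    and proper: "a1 \<le> n1 \<or> a2 \<le> n2"
    and high1: "\<And>p. a1 = Suc n1 \<Longrightarrow> 0 < p \<Longrightarrow> p \<le> n1 \<Longrightarrow> R1 = {p..n1} \<Longrightarrow> \<exists>x\<in>set xs. \<forall>y\<in>set ys. y < x"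
    and high2: "\<And>p. a2 = Suc n2 \<Longrightarrow> 0 < p \<Longrightarrow> p \<le> n2 \<Longrightarrow> R2 = {p..n2} \<Longrightarrow> \<exists>y\<in>set ys. \<forall>x\<in>set xs. x < y"
    and ne: "R1 \<noteq> {} \<or> R2 \<noteq> {}"
  shows "critical_count (map (path_cell a1 a2) (stairs e s 0 xs 0 ys)) d =
     of_bool (\<exists>d1 d2. critical_index n1 R1 a1 d1 \<and> critical_index n2 R2 a2 d2 \<and> d = d1 + d2)"
proof -
  have a: "0 < a1" "0 < a2" using t1 t2 by auto
  have nf: "\<not> (R1 = {..n1} \<and> R2 = {..n2})"
  proof
    assume f: "R1 = {..n1} \<and> R2 = {..n2}"
    then have "0 \<in> R1" "0 \<in> R2" by auto
    then show False using t1 t2 proper by fastforce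
  qed
  have "critical_count (map (path_cell a1 a2) (stairs e s 0 xs 0 ys)) d =
    count_if (\<lambda>f. removes_outside a1 a2 f \<and> card (rem f) = d) (stairs e s 0 xs 0 ys)"
    unfolding critical_count_def count_if_map
  proof (rule count_if_cong)
    fix f assume f: "f \<in> set (stairs e s 0 xs 0 ys)"
    obtain P R M where t: "path_cell a1 a2 f = (P, R, M)" by (cases "path_cell a1 a2 f")
    show "((\<lambda>(P, R, M). critical_tile P R M d) \<circ> path_cell a1 a2) f = (removes_outside a1 a2 f \<and> card (rem f) = d)"
      using path_cell_critical[OF len R dis f t a proper ne nf] t by simp
  qed
  also have "\<dots> = of_bool (\<exists>d1 d2. critical_index n1 R1 a1 d1 \<and> critical_index n2 R2 a2 d2 \<and> d = d1 + d2)"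
    by (rule count_critical_paths[OF len R dis t1 t2 proper high1 high2])
  finally show ?thesis .
qed

text \<open>
  Without Morse faces critical tiles are the closed and the open ones, and these occur only if both
  factors are closed or both are open.
\<close>

lemma critical_count_no_face:
  assumes len: "length xs = n1" "length ys = n2" and R: "desc e s 0 xs = R1" "desc e s 0 ys = R2"
    and dis: "set xs \<inter> set ys = {}" and pos: "0 < n1 + n2"
    and ex: "\<not> (R1 = {} \<and> R2 = {..n2})" "\<not> (R1 = {..n1} \<and> R2 = {})"
  shows "critical_count (map (path_cell (Suc n1) (Suc n2)) (stairs e s 0 xs 0 ys)) d =
     of_bool (\<exists>d1 d2. critical_index n1 R1 (Suc n1) d1 \<and> critical_index n2 R2 (Suc n2) d2 \<and> d = d1 + d2)"
proof -
  let ?L = "stairs e s 0 xs 0 ys"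
  have "critical_count (map (path_cell (Suc n1) (Suc n2)) ?L) d =
    count_if (\<lambda>f. (rem f = {} \<and> d = 0) \<or> (rem f = pts f \<and> d = n1 + n2)) ?L"
    unfolding critical_count_def count_if_map
  proof (rule count_if_cong)
    fix f assume f: "f \<in> set ?L"
    have c: "card (pts f) = Suc (n1 + n2)" using stairs_card_pts[OF f] len by simp
    have M: "pts f - {..<Suc n1} \<times> {..<Suc n2} = {}" using stairs_pts_grid[OF f] len by fastforce
    have "path_cell (Suc n1) (Suc n2) f = (pts f, rem f, {})"
    proof -
      have "Suc (card ({} :: (nat \<times> nat) set)) \<noteq> card (pts f)" using c pos by (simp only: card.empty)
      then show ?thesis unfolding path_cell_def Let_def M by (simp only: if_False if_cancel)
    qed
    then show "((\<lambda>(P, R, M). critical_tile P R M d) \<circ> path_cell (Suc n1) (Suc n2)) f =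
       ((rem f = {} \<and> d = 0) \<or> (rem f = pts f \<and> d = n1 + n2))"
      using c by (auto simp: critical_tile_def)
  qed
  also have "\<dots> = count_if (\<lambda>f. rem f = {} \<and> d = 0) ?L + count_if (\<lambda>f. rem f = pts f \<and> d = n1 + n2) ?L"
  proof -
    have "count_if (\<lambda>f. Q f \<or> Q' f) L = count_if Q L + count_if Q' L" if "\<forall>f\<in>set L. \<not> (Q f \<and> Q' f)" for Q Q' and L :: "((nat \<times> nat) \<times> bool) list list"
      using that by (induction L) auto
    then show ?thesis using pos by auto
  qed
  also have "\<dots> = of_bool (d = 0 \<and> R1 = {} \<and> R2 = {}) + of_bool (d = n1 + n2 \<and> R1 = {..n1} \<and> R2 = {..n2})"
    unfolding count_if_conj count_none_removed[OF R dis] count_open_paths[OF len R dis] by simp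
  also have "\<dots> = of_bool (\<exists>d1 d2. critical_index n1 R1 (Suc n1) d1 \<and> critical_index n2 R2 (Suc n2) d2 \<and> d = d1 + d2)"
  proof -
    have n: "{..n1} \<noteq> {}" "{..n2} \<noteq> {}" by auto
    have "(\<exists>d1 d2. critical_index n1 R1 (Suc n1) d1 \<and> critical_index n2 R2 (Suc n2) d2 \<and> d = d1 + d2) \<longleftrightarrow>
       (d = 0 \<and> R1 = {} \<and> R2 = {}) \<or> (d = n1 + n2 \<and> R1 = {..n1} \<and> R2 = {..n2})"
      unfolding critical_index_def using ex by auto
    moreover have "\<not> ((d = 0 \<and> R1 = {} \<and> R2 = {}) \<and> (d = n1 + n2 \<and> R1 = {..n1} \<and> R2 = {..n2}))" using n by blast
    ultimately show ?thesis by (simp only: of_bool_def) auto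
  qed
  finally show ?thesis .
qed

lemma order_count_paths:
  assumes len: "length xs = n1" "length ys = n2" and R: "desc e s 0 xs = R1" "desc e s 0 ys = R2"
    and dis: "set xs \<inter> set ys = {}" and a: "2 \<le> a1" "2 \<le> a2" and pos: "0 < n1 + n2"
  shows "order_count (map (path_cell a1 a2) (stairs e s 0 xs 0 ys)) d = path_count n1 n2 (card R1) (card R2) d"
proof -
  let ?L = "stairs e s 0 xs 0 ys"
  have "order_count (map (path_cell a1 a2) ?L) d = count_if (\<lambda>f. card (rem f) = d) ?L"
    unfolding order_count_def count_if_map
  proof (rule count_if_cong)
    fix f assume f: "f \<in> set ?L"
    let ?M = "pts f - {..<a1} \<times> {..<a2}"
    have 0: "(0, 0) \<in> pts f" by (rule stairs_start[OF f])
    have "\<exists>p\<in>pts f \<inter> {..<a1} \<times> {..<a2}. p \<noteq> (0, 0)"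
      using f
    proof (cases rule: stairs_cases)
      case 1
      then show ?thesis using pos len by simp
    next
      case (2 x xs' g)
      then have "(Suc 0, 0) \<in> pts f" using stairs_start[OF 2(3)] by simp
      then show ?thesis using a by (intro bexI[of _ "(Suc 0, 0)"]) auto
    next
      case (3 y ys' g)
      then have "(0, Suc 0) \<in> pts f" using stairs_start[OF 3(3)] by simp
      then show ?thesis using a by (intro bexI[of _ "(0, Suc 0)"]) auto
    qed
    then obtain p where p: "p \<in> pts f" "p \<in> {..<a1} \<times> {..<a2}" "p \<noteq> (0, 0)" by blast
    have "Suc (card ?M) \<noteq> card (pts f)"
    proof
      assume "Suc (card ?M) = card (pts f)"
      then have "?M = pts f - {(0, 0)}" by (intro codim_one) (use 0 a in auto)
      then show False using p by blast
    qed
    then show "((\<lambda>(P, R, M). card R = d) \<circ> path_cell a1 a2) f = (card (rem f) = d)"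
      by (simp add: path_cell_def Let_def)
  qed
  also have "\<dots> = count_if (\<lambda>f. length (filter snd f) = d) ?L"
    by (rule count_if_cong) (simp only: stairs_card_rem)
  also have "\<dots> = desc_count ?L d" by (simp only: desc_count_def count_if_def)
  also have "\<dots> = path_count n1 n2 (card R1) (card R2) d"
    using desc_count_stairs[OF dis, of e s 0 0 d] len R by simp
  finally show ?thesis .
qed

text \<open>
  All paths have the same number of descents; those starting upwards lose the facet opposite to the
  origin in addition.
\<close>

lemma order_count_closed_open:
  assumes len: "length xs = n1" "length ys = n2" and R: "desc e s 0 xs = {}" "desc e s 0 ys = {1..n2}"
    and dis: "set xs \<inter> set ys = {}" and pos: "0 < n1" "0 < n2"
  shows "order_count (map (path_cell (Suc n1) 1) (stairs e s 0 xs 0 ys)) d =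
     of_bool (d = n2) * ((n1 + n2 - 1) choose n2) + of_bool (d = Suc n2) * ((n1 + n2 - 1) choose n1)"
proof -
  let ?L = "stairs e s 0 xs 0 ys"
  have rem: "card (rem f) = n2" if f: "f \<in> set ?L" for f
  proof (rule ccontr)
    assume ne: "card (rem f) \<noteq> n2"
    have "desc_count ?L (card (rem f)) = path_count n1 n2 0 n2 (card (rem f))"
      using desc_count_stairs[OF dis, of e s 0 0 "card (rem f)"] len R by simp
    also have "\<dots> = 0" using ne by (simp add: path_count_def choose_from_def)
    finally have "count_if (\<lambda>g. length (filter snd g) = card (rem f)) ?L = 0"
      unfolding desc_count_def count_if_def .
    then show False using f stairs_card_rem[OF f] unfolding count_if_zero by metis
  qed
  obtain x xs' where xs: "xs = x # xs'" using len pos by (cases xs) auto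
  obtain y ys' where ys: "ys = y # ys'" using len pos by (cases ys) auto
  have sy: "\<not> y < s"
  proof
    assume "y < s"
    then have "0 \<in> desc e s 0 ys" unfolding ys by simp
    then show False using R(2) by auto
  qed
  have "order_count (map (path_cell (Suc n1) 1) ?L) d = count_if ((\<lambda>(P, R, M). card R = d) \<circ> path_cell (Suc n1) 1) ?L"
    unfolding order_count_def count_if_map ..
  also have "\<dots> = (case xs of [] \<Rightarrow> 0 | x # xs' \<Rightarrow> of_bool (d = n2) * count_if (\<lambda>_. True) (stairs e x (Suc 0) xs' 0 ys)) +
     (case ys of [] \<Rightarrow> 0 | y # ys' \<Rightarrow> of_bool (d = Suc n2) * count_if (\<lambda>_. True) (stairs e y 0 xs (Suc 0) ys'))"
  proof (rule count_stairs)
    fix x' xs'' g assume x': "xs = x' # xs''" and g: "g \<in> set (stairs e x' (Suc 0) xs'' 0 ys)"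
    let ?f = "((0, 0), x' < s) # g"
    have f: "?f \<in> set ?L" using g ys x' by simp
    have "(Suc 0, 0) \<in> pts ?f" using stairs_start[OF g] by simp
    have "Suc (card (pts ?f - {..<Suc n1} \<times> {..<1})) \<noteq> card (pts ?f)"
    proof
      assume c: "Suc (card (pts ?f - {..<Suc n1} \<times> {..<1})) = card (pts ?f)"
      have "pts ?f - {..<Suc n1} \<times> {..<1} = pts ?f - {(0, 0)}"
        by (rule codim_one[OF _ _ _ c]) auto
      moreover have "(Suc 0, 0) \<in> pts ?f - {(0, 0)}" using \<open>(Suc 0, 0) \<in> pts ?f\<close> by simp
      ultimately have "(Suc 0, 0) \<notin> {..<Suc n1} \<times> {..<1::nat}" by (metis DiffD2)
      then show False using pos by simp
    qed
    then show "((\<lambda>(P, R, M). card R = d) \<circ> path_cell (Suc n1) 1) ?f \<longleftrightarrow> d = n2 \<and> True"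
      using rem[OF f] by (auto simp: path_cell_def Let_def)
  next
    fix y' ys'' g assume y': "ys = y' # ys''" and g: "g \<in> set (stairs e y' 0 xs (Suc 0) ys'')"
    let ?f = "((0, 0), y' < s) # g"
    let ?M = "pts ?f - {..<Suc n1} \<times> {..<1}"
    have f: "?f \<in> set ?L" using g xs y' by simp
    have g0: "(0, 0) \<notin> pts g" by (rule stairs_first_notin(2)[OF g])
    have M: "?M = pts g" using stairs_pts_grid[OF g] by fastforce
    have "rem ?f = rem g" using sy y' ys by simp
    then have "rem ?f \<subseteq> ?M" unfolding M using rem_subset_pts by simp
    moreover have "Suc (card ?M) = card (pts ?f)" unfolding M using g0 by simp
    ultimately have "path_cell (Suc n1) 1 ?f = (pts ?f, insert (0, 0) (rem ?f), {})" unfolding path_cell_def Let_def by simp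
    moreover have "(0, 0) \<notin> rem ?f" using \<open>rem ?f = rem g\<close> g0 rem_subset_pts by blast
    moreover have "finite (rem ?f)" using rem_subset_pts finite_pts by (rule finite_subset)
    ultimately show "((\<lambda>(P, R, M). card R = d) \<circ> path_cell (Suc n1) 1) ?f \<longleftrightarrow> d = Suc n2 \<and> True"
      using rem[OF f] by auto
  qed (use xs in simp)
  also have "\<dots> = of_bool (d = n2) * ((n1 + n2 - 1) choose n2) + of_bool (d = Suc n2) * ((n1 + n2 - 1) choose n1)"
  proof -
    have T: "count_if (\<lambda>_. True) L = length L" for L :: "((nat \<times> nat) \<times> bool) list list" by (simp add: count_if_def)
    have l: "length xs' = n1 - 1" "length ys' = n2 - 1" using len xs ys by auto
    have "(n1 - 1 + n2) choose (n1 - 1) = (n1 + n2 - 1) choose n2"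
      using pos binomial_symmetric[of n2 "n1 + n2 - 1"] by (cases n1) auto
    moreover have "n1 + (n2 - 1) = n1 + n2 - 1" using pos by simp
    ultimately show ?thesis unfolding T xs ys list.case length_stairs
      using len l xs ys by (simp only: list.size)
  qed
  finally show ?thesis .
qed

section \<open>A list of tiles for every pair of tiles\<close>

text \<open>
  The bound \<open>2 \<le> a\<close> expresses that a Morse face has codimension at least two.
\<close>

definition factor_tile :: "nat \<Rightarrow> nat set \<Rightarrow> nat \<Rightarrow> bool" where
  "factor_tile n R a \<longleftrightarrow> R \<subseteq> {..n} \<and> (a = Suc n \<or> 2 \<le> a \<and> a \<le> n \<and> R \<noteq> {} \<and> R \<subseteq> {a..n})"

text \<open>
  The number of tiles of order \<open>d\<close> in the product of tiles of dimensions \<open>n1\<close>, \<open>n2\<close> and orders \<open>k1\<close>, \<open>k2\<close>.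
\<close>

definition product_order :: "nat \<Rightarrow> nat \<Rightarrow> nat \<Rightarrow> nat \<Rightarrow> nat \<Rightarrow> nat" where
  "product_order n1 n2 k1 k2 d =
    (if n1 = 0 then of_bool (d = k2)
     else if n2 = 0 then of_bool (d = k1)
     else if k1 = 0 \<and> k2 = Suc n2 then of_bool (d = n2) * ((n1 + n2 - 1) choose n2) + of_bool (d = Suc n2) * ((n1 + n2 - 1) choose n1)
     else if k1 = Suc n1 \<and> k2 = 0 then of_bool (d = n1) * ((n1 + n2 - 1) choose n1) + of_bool (d = Suc n1) * ((n1 + n2 - 1) choose n2)
     else path_count n1 n2 k1 k2 d)"

definition subdivides_well :: "nat \<Rightarrow> nat set \<Rightarrow> nat \<Rightarrow> nat \<Rightarrow> nat set \<Rightarrow> nat \<Rightarrow> (nat \<times> nat) cell list \<Rightarrow> bool" where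
  "subdivides_well n1 R1 a1 n2 R2 a2 L \<longleftrightarrow> subdivides n1 R1 a1 n2 R2 a2 L \<and>
     (\<forall>d. critical_count L d = of_bool (\<exists>d1 d2. critical_index n1 R1 a1 d1 \<and> critical_index n2 R2 a2 d2 \<and> d = d1 + d2)) \<and>
     (\<forall>d. order_count L d = product_order n1 n2 (card R1) (card R2) d)"

lemma subdivides_cell:
  assumes "subdivides n1 R1 a1 n2 R2 a2 L" "(P, R, M) \<in> set L"
  shows "valid_tile P R M \<and> P \<subseteq> {..n1} \<times> {..n2} \<and> chain2 P \<and> card P = Suc (n1 + n2) \<and>
        (\<forall>p\<in>P - M. \<forall>q\<in>M. fst p \<le> fst q \<and> snd p \<le> snd q)"
  using bspec[OF conjunct1[OF assms(1)[unfolded subdivides_def]] assms(2)] unfolding prod.case .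

lemma subdivides_select:
  assumes "subdivides n1 R1 a1 n2 R2 a2 L" "C \<noteq> {}" "chain2 C" "C \<subseteq> {..n1} \<times> {..n2}"
    "admits n1 R1 a1 (fst ` C)" "admits n2 R2 a2 (snd ` C)"
  shows "\<exists>A t B. L = A @ t # B \<and> in_cell t C \<and> (\<forall>g\<in>set A. \<not> C \<subseteq> fst g) \<and> (\<forall>g\<in>set B. \<not> in_cell g C)"
  by (rule mp[OF spec[OF conjunct1[OF conjunct2[OF assms(1)[unfolded subdivides_def]]]]]) (use assms(2-) in blast)

lemma subdivides_admits:
  assumes "subdivides n1 R1 a1 n2 R2 a2 L" "t \<in> set L" "in_cell t C"
  shows "admits n1 R1 a1 (fst ` C)" "admits n2 R2 a2 (snd ` C)"
  using conjunct2[OF conjunct2[OF assms(1)[unfolded subdivides_def]]] assms(2,3) by blast+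

lemma subdividesI:
  assumes "\<And>P R M. (P, R, M) \<in> set L \<Longrightarrow> valid_tile P R M \<and> P \<subseteq> {..n1} \<times> {..n2} \<and> chain2 P \<and> card P = Suc (n1 + n2) \<and>
        (\<forall>p\<in>P - M. \<forall>q\<in>M. fst p \<le> fst q \<and> snd p \<le> snd q)"
    and "\<And>C. C \<noteq> {} \<Longrightarrow> chain2 C \<Longrightarrow> C \<subseteq> {..n1} \<times> {..n2} \<Longrightarrow> admits n1 R1 a1 (fst ` C) \<Longrightarrow> admits n2 R2 a2 (snd ` C) \<Longrightarrow>
        \<exists>A t B. L = A @ t # B \<and> in_cell t C \<and> (\<forall>g\<in>set A. \<not> C \<subseteq> fst g) \<and> (\<forall>g\<in>set B. \<not> in_cell g C)"
    and "\<And>t C. t \<in> set L \<Longrightarrow> in_cell t C \<Longrightarrow> admits n1 R1 a1 (fst ` C) \<and> admits n2 R2 a2 (snd ` C)"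
  shows "subdivides n1 R1 a1 n2 R2 a2 L"
  unfolding subdivides_def
proof (intro conjI)
  show "\<forall>(P, R, M)\<in>set L. valid_tile P R M \<and> P \<subseteq> {..n1} \<times> {..n2} \<and> chain2 P \<and> card P = Suc (n1 + n2) \<and>
        (\<forall>p\<in>P - M. \<forall>q\<in>M. fst p \<le> fst q \<and> snd p \<le> snd q)"
    by (intro ballI) (simp only: split_paired_all prod.case, rule assms(1))
qed (use assms(2) in blast, use assms(3) in blast)

text \<open>
  Different encodings of the same half-open simplex have the same subdivisions.
\<close>

lemma subdivides_cong:
  assumes "\<And>D. D \<noteq> {} \<Longrightarrow> D \<subseteq> {..n1} \<Longrightarrow> admits n1 R1 a1 D \<longleftrightarrow> admits n1 R1' a1' D"
    and "\<And>D. D \<noteq> {} \<Longrightarrow> D \<subseteq> {..n2} \<Longrightarrow> admits n2 R2 a2 D \<longleftrightarrow> admits n2 R2' a2' D"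
    and sub: "subdivides n1 R1 a1 n2 R2 a2 L"
  shows "subdivides n1 R1' a1' n2 R2' a2' L"
proof -
  have eq: "admits n1 R1 a1 (fst ` C) \<longleftrightarrow> admits n1 R1' a1' (fst ` C)" "admits n2 R2 a2 (snd ` C) \<longleftrightarrow> admits n2 R2' a2' (snd ` C)"
    if "C \<noteq> {}" "C \<subseteq> {..n1} \<times> {..n2}" for C
  proof -
    have "fst ` C \<noteq> {}" "fst ` C \<subseteq> {..n1}" "snd ` C \<noteq> {}" "snd ` C \<subseteq> {..n2}" using that by auto
    then show "admits n1 R1 a1 (fst ` C) \<longleftrightarrow> admits n1 R1' a1' (fst ` C)" "admits n2 R2 a2 (snd ` C) \<longleftrightarrow> admits n2 R2' a2' (snd ` C)"
      by (simp_all only: assms(1)[of "fst ` C"] assms(2)[of "snd ` C"] not_False_eq_True)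
  qed
  have cell: "C \<noteq> {} \<and> C \<subseteq> {..n1} \<times> {..n2}" if "t \<in> set L" "in_cell t C" for t C
  proof -
    obtain P R M where t: "t = (P, R, M)" by (cases t)
    have "P \<subseteq> {..n1} \<times> {..n2}" using subdivides_cell[OF sub that(1)[unfolded t]] by blast
    then show ?thesis using that(2) unfolding t in_cell_def by auto
  qed
  show ?thesis
  proof (rule subdividesI)
    fix t C assume t: "t \<in> set L" "in_cell t C"
    then show "admits n1 R1' a1' (fst ` C) \<and> admits n2 R2' a2' (snd ` C)"
      using subdivides_admits[OF sub t] cell[OF t] eq[of C] by blast
  next
    fix C assume "C \<noteq> {}" "chain2 C" "C \<subseteq> {..n1} \<times> {..n2}" "admits n1 R1' a1' (fst ` C)" "admits n2 R2' a2' (snd ` C)"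
    then show "\<exists>A t B. L = A @ t # B \<and> in_cell t C \<and> (\<forall>g\<in>set A. \<not> C \<subseteq> fst g) \<and> (\<forall>g\<in>set B. \<not> in_cell g C)"
      using eq[of C] by (intro subdivides_select[OF sub]) blast+
  qed (rule subdivides_cell[OF sub])
qed

definition swap_cell :: "(nat \<times> nat) cell \<Rightarrow> (nat \<times> nat) cell" where
  "swap_cell t = (case t of (P, R, M) \<Rightarrow> (prod.swap ` P, prod.swap ` R, prod.swap ` M))"

lemma swap_image_swap [simp]: "prod.swap ` prod.swap ` A = A"
  by (simp add: image_image)

lemma swap_image_subset: "prod.swap ` A \<subseteq> B \<longleftrightarrow> A \<subseteq> prod.swap ` B"
  by (metis image_mono swap_image_swap)

lemma chain2_swap: "chain2 (prod.swap ` C) \<longleftrightarrow> chain2 C"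
  unfolding chain2_def by auto

lemma in_swap_cell: "in_cell (swap_cell t) C \<longleftrightarrow> in_cell t (prod.swap ` C)"
proof -
  obtain P R M where t: "t = (P, R, M)" by (cases t)
  show ?thesis unfolding t in_cell_def swap_cell_def prod.case
    by (metis swap_image_subset swap_image_swap)
qed

lemma card_swap [simp]: "card (prod.swap ` (A :: ('a \<times> 'b) set)) = card A"
  by (rule card_image) simp

lemma swap_image_eq_iff [simp]: "prod.swap ` A = prod.swap ` B \<longleftrightarrow> A = B"
  by (metis swap_image_swap)

lemma swap_image_mono [simp]: "prod.swap ` A \<subseteq> prod.swap ` B \<longleftrightarrow> A \<subseteq> B"
  by (metis swap_image_swap swap_image_subset)

lemma valid_tile_swap: "valid_tile (prod.swap ` P) (prod.swap ` R) (prod.swap ` M) \<longleftrightarrow> valid_tile P R M"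
  unfolding valid_tile_def by (auto simp: finite_image_iff)

lemma critical_tile_swap: "critical_tile (prod.swap ` P) (prod.swap ` R) (prod.swap ` M) d \<longleftrightarrow> critical_tile P R M d"
  unfolding critical_tile_def by simp

lemma subdivides_swap:
  assumes sub: "subdivides n1 R1 a1 n2 R2 a2 L"
  shows "subdivides n2 R2 a2 n1 R1 a1 (map swap_cell L)"
proof (rule subdividesI)
  fix P' R' M' assume t': "(P', R', M') \<in> set (map swap_cell L)"
  obtain P R M where t: "(P, R, M) \<in> set L" "P' = prod.swap ` P" "R' = prod.swap ` R" "M' = prod.swap ` M"
  proof -
    obtain u where "u \<in> set L" "(P', R', M') = swap_cell u" using t' by auto
    moreover obtain P R M where u: "u = (P, R, M)" by (cases u)
    ultimately show ?thesis using that[of P R M] by (simp only: u swap_cell_def prod.case prod.inject simp_thms)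
  qed
  have p: "valid_tile P R M" "P \<subseteq> {..n1} \<times> {..n2}" "chain2 P" "card P = Suc (n1 + n2)"
     "\<forall>p\<in>P - M. \<forall>q\<in>M. fst p \<le> fst q \<and> snd p \<le> snd q"
    using subdivides_cell[OF sub t(1)] by blast+
  have "prod.swap ` P \<subseteq> {..n2} \<times> {..n1}" using p(2) by auto
  moreover have "fst p \<le> fst q \<and> snd p \<le> snd q" if pq: "p \<in> prod.swap ` P - prod.swap ` M" "q \<in> prod.swap ` M" for p q
  proof -
    obtain p' where p': "p = prod.swap p'" "p' \<in> P - M" using pq(1) by blast
    obtain q' where q': "q = prod.swap q'" "q' \<in> M" using pq(2) by blast
    have "fst p' \<le> fst q' \<and> snd p' \<le> snd q'" using p(5) p'(2) q'(2) by blast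
    then show ?thesis unfolding p'(1) q'(1) by simp
  qed
  ultimately show "valid_tile P' R' M' \<and> P' \<subseteq> {..n2} \<times> {..n1} \<and> chain2 P' \<and> card P' = Suc (n2 + n1) \<and>
        (\<forall>p\<in>P' - M'. \<forall>q\<in>M'. fst p \<le> fst q \<and> snd p \<le> snd q)"
    unfolding t(2-4) valid_tile_swap chain2_swap card_swap using p(1,3,4) by (simp add: add.commute)
next
  fix C :: "(nat \<times> nat) set"
  assume C: "C \<noteq> {}" "chain2 C" "C \<subseteq> {..n2} \<times> {..n1}" "admits n2 R2 a2 (fst ` C)" "admits n1 R1 a1 (snd ` C)"
  let ?C = "prod.swap ` C"
  have i: "fst ` ?C = snd ` C" "snd ` ?C = fst ` C" by (simp_all add: image_image)
  have "?C \<noteq> {}" "chain2 ?C" "?C \<subseteq> {..n1} \<times> {..n2}" "admits n1 R1 a1 (fst ` ?C)" "admits n2 R2 a2 (snd ` ?C)"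
    unfolding i chain2_swap using C by auto
  from subdivides_select[OF sub this] obtain A t B where L: "L = A @ t # B" "in_cell t ?C" "\<forall>g\<in>set A. \<not> ?C \<subseteq> fst g" "\<forall>g\<in>set B. \<not> in_cell g ?C"
    by blast
  have f: "fst (swap_cell g) = prod.swap ` fst g" for g by (simp add: swap_cell_def split: prod.split)
  have "map swap_cell L = map swap_cell A @ swap_cell t # map swap_cell B" using L(1) by simp
  moreover have "in_cell (swap_cell t) C" unfolding in_swap_cell by (rule L(2))
  moreover have "\<forall>g\<in>set (map swap_cell A). \<not> C \<subseteq> fst g" using L(3) by (simp add: f swap_image_subset)
  moreover have "\<forall>g\<in>set (map swap_cell B). \<not> in_cell g C" using L(4) by (simp add: in_swap_cell)
  ultimately show "\<exists>A t B. map swap_cell L = A @ t # B \<and> in_cell t C \<and> (\<forall>g\<in>set A. \<not> C \<subseteq> fst g) \<and> (\<forall>g\<in>set B. \<not> in_cell g C)"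
    by blast
next
  fix t C assume t: "t \<in> set (map swap_cell L)" and C: "in_cell t C"
  then obtain u where u: "u \<in> set L" "in_cell u (prod.swap ` C)" by (auto simp: in_swap_cell)
  have i: "fst ` prod.swap ` C = snd ` C" "snd ` prod.swap ` C = fst ` C" by (simp_all add: image_image)
  show "admits n2 R2 a2 (fst ` C) \<and> admits n1 R1 a1 (snd ` C)" using subdivides_admits[OF sub u] unfolding i by blast
qed

lemma product_order_swap:
  "n1 \<noteq> 0 \<or> n2 \<noteq> 0 \<Longrightarrow> product_order n1 n2 k1 k2 d = product_order n2 n1 k2 k1 d"
  unfolding product_order_def path_count_sym[of n2 n1] add.commute[of n2 n1]
  by (cases "n1 = 0"; cases "n2 = 0") (simp_all only: simp_thms if_True if_False HOL.refl nat.distinct, auto)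

lemma subdivides_well_swap:
  assumes "subdivides_well n1 R1 a1 n2 R2 a2 L" "n1 \<noteq> 0 \<or> n2 \<noteq> 0"
  shows "subdivides_well n2 R2 a2 n1 R1 a1 (map swap_cell L)"
proof -
  have "critical_count (map swap_cell L) d = critical_count L d" for d
    unfolding critical_count_def count_if_map
    by (rule count_if_cong) (auto simp: swap_cell_def critical_tile_swap split: prod.split)
  moreover have "order_count (map swap_cell L) d = order_count L d" for d
    unfolding order_count_def count_if_map
    by (rule count_if_cong) (auto simp: swap_cell_def split: prod.split)
  moreover have "(\<exists>d1 d2. critical_index n1 R1 a1 d1 \<and> critical_index n2 R2 a2 d2 \<and> d = d1 + d2) \<longleftrightarrow>
     (\<exists>d1 d2. critical_index n2 R2 a2 d1 \<and> critical_index n1 R1 a1 d2 \<and> d = d1 + d2)" for d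
    by (metis add.commute)
  ultimately show ?thesis using assms(1) subdivides_swap product_order_swap[OF assms(2), of "card R1" "card R2"]
    unfolding subdivides_well_def by simp
qed

lemma subdivides_well_point:
  assumes t1: "factor_tile 0 R1 a1" and t2: "factor_tile n2 R2 a2"
  shows "subdivides_well 0 R1 a1 n2 R2 a2 [({0} \<times> {..n2}, {0} \<times> R2, {0} \<times> {a2..n2})]"
proof -
  have a1: "a1 = 1" "R1 \<subseteq> {0}" using t1 by (auto simp: factor_tile_def)
  have a2: "a2 \<le> Suc n2" "R2 \<subseteq> {..n2}" using t2 by (auto simp: factor_tile_def)
  have c: "card ({0::nat} \<times> A) = card (A :: nat set)" for A by (rule card_cartesian_product_singleton)
  have f: "a2 \<le> n2 \<Longrightarrow> 2 \<le> a2 \<and> R2 \<noteq> {} \<and> R2 \<subseteq> {a2..n2}" using t2 by (auto simp: factor_tile_def)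
  let ?t = "({0} \<times> {..n2}, {0} \<times> R2, {0} \<times> {a2..n2}) :: (nat \<times> nat) cell"
  have valid: "valid_tile ({0::nat} \<times> {..n2}) ({0} \<times> R2) ({0} \<times> {a2..n2})"
    unfolding valid_tile_def c
    using f a2 by (cases "a2 \<le> n2") auto
  have cell: "in_cell ?t C \<longleftrightarrow> C \<subseteq> {0} \<times> {..n2} \<and> R2 \<subseteq> snd ` C \<and> \<not> snd ` C \<subseteq> {a2..n2}" for C
  proof -
    have sing: "{0::nat} \<times> A \<subseteq> {0} \<times> B \<longleftrightarrow> A \<subseteq> B" for A B :: "nat set" by fast
    show ?thesis
    proof (cases "C \<subseteq> {0} \<times> {..n2}")
      case True
      then have "C = {0} \<times> snd ` C" by force
      then obtain D where D: "C = {0} \<times> D" "snd ` C = D" by blast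
      show ?thesis unfolding D(2) unfolding in_cell_def prod.case D(1) sing by blast
    qed (simp add: in_cell_def)
  qed
  have adm: "admits 0 R1 a1 (fst ` C)" if "C \<subseteq> {0} \<times> {..n2}" "C \<noteq> {}" for C
  proof -
    have "fst ` C = {0}" using that by force
    then show ?thesis using a1 by (simp add: admits_def)
  qed
  have "subdivides 0 R1 a1 n2 R2 a2 [?t]"
  proof (rule subdividesI)
    fix C :: "(nat \<times> nat) set"
    assume "C \<noteq> {}" "chain2 C" "C \<subseteq> {..0} \<times> {..n2}" "admits 0 R1 a1 (fst ` C)" "admits n2 R2 a2 (snd ` C)"
    then have "in_cell ?t C" unfolding cell admits_def by auto
    then show "\<exists>A t B. [?t] = A @ t # B \<and> in_cell t C \<and> (\<forall>g\<in>set A. \<not> C \<subseteq> fst g) \<and> (\<forall>g\<in>set B. \<not> in_cell g C)"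
      by (intro exI[of _ "[]"] exI[of _ ?t]) simp
  next
    fix t C assume "t \<in> set [?t]" "in_cell t C"
    then have "C \<subseteq> {0} \<times> {..n2} \<and> R2 \<subseteq> snd ` C \<and> \<not> snd ` C \<subseteq> {a2..n2}" using cell by simp
    then show "admits 0 R1 a1 (fst ` C) \<and> admits n2 R2 a2 (snd ` C)" using adm[of C] by (auto simp: admits_def)
  qed (use valid in \<open>auto simp: chain2_def\<close>)
  moreover have "critical_count [?t] d = of_bool (\<exists>d1 d2. critical_index 0 R1 a1 d1 \<and> critical_index n2 R2 a2 d2 \<and> d = d1 + d2)" for d
  proof -
    have "critical_index 0 R1 a1 d1 \<longleftrightarrow> d1 = 0" for d1 using a1 by (auto simp: critical_index_def)
    moreover have "critical_tile ({0::nat} \<times> {..n2}) ({0} \<times> R2) ({0} \<times> {a2..n2}) d \<longleftrightarrow> critical_index n2 R2 a2 d"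
    proof -
      have e: "{0::nat} \<times> A = {0} \<times> B \<longleftrightarrow> A = B" for A B :: "nat set"
        by (metis snd_image_times insert_not_empty)
      have e0: "{0::nat} \<times> A = {} \<longleftrightarrow> A = {}" for A :: "nat set" by blast
      show ?thesis
      proof (cases "a2 \<le> n2")
        case True
        then have R2: "R2 \<noteq> {}" "0 \<notin> R2" using f by auto
        then have n: "R2 \<noteq> {..n2}" by auto
        have "card {a2..n2} = Suc n2 - a2" by simp
        moreover have "{a2..n2} \<noteq> {}" "a2 \<noteq> Suc n2" using True by auto
        ultimately show ?thesis
          unfolding critical_tile_def critical_index_def e e0 c using R2(1) n True by metis
      next
        case False
        then have "a2 = Suc n2" "{a2..n2} = {}" "card {..n2} = Suc n2" using a2 by auto
        then show ?thesis
          unfolding critical_tile_def critical_index_def e e0 c using False by (metis nat.inject)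
      qed
    qed
    ultimately show ?thesis by (simp add: critical_count_def)
  qed
  moreover have "order_count [?t] d = product_order 0 n2 (card R1) (card R2) d" for d
    by (auto simp: order_count_def product_order_def c)
  ultimately show ?thesis unfolding subdivides_well_def by blast
qed

text \<open>
  No common labels \<open>s\<close> and \<open>e\<close> fit a word without descents (\<open>s < e\<close>) and a word descending everywhere (\<open>e < s\<close>). The open
  simplex is therefore described differently: the facet opposite to its first vertex is removed as if it were a Morse
  face \<open>{1..n2}\<close>. It is then of codimension one, a case that \<open>path_cell\<close> allows for.
\<close>

lemma subdivides_well_closed_open:
  assumes pos: "0 < n1" "0 < n2"
  shows "\<exists>L. subdivides_well n1 {} (Suc n1) n2 {..n2} (Suc n2) L"
proof -
  obtain xs where xs: "length xs = n1" "desc 1 0 0 xs = {}"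
    using word_with_descents_exists[of "{}" 0 n1 0 1 "{}" 0] pos by auto
  obtain ys where ys: "length ys = n2" "desc 1 0 0 ys = {1..n2}" "set ys \<inter> set xs = {}"
    using word_with_descents_exists[of "{1..n2}" 0 n2 0 1 "set xs" 0] pos by auto
  have dis: "set xs \<inter> set ys = {}" using ys(3) by auto
  let ?L = "map (path_cell (Suc n1) 1) (stairs 1 0 0 xs 0 ys)"
  have sub: "subdivides n1 {} (Suc n1) n2 {1..n2} 1 ?L"
    by (rule stairs_subdivides[OF xs(1) ys(1) xs(2) ys(2) dis]) (use pos in auto)
  have adm: "admits n2 {1..n2} 1 D \<longleftrightarrow> admits n2 {..n2} (Suc n2) D" if "D \<noteq> {}" "D \<subseteq> {..n2}" for D
  proof -
    have i: "{..n2} = insert 0 {1..n2}" by auto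
    show ?thesis
    proof
      assume "admits n2 {1..n2} 1 D"
      then have "{1..n2} \<subseteq> D" "\<not> D \<subseteq> {1..n2}" by (auto simp: admits_def)
      then obtain z where z: "z \<in> D" "z \<notin> {1..n2}" by blast
      have "z \<in> {..n2}" using z(1) that(2) by blast
      then have "z = 0" using z(2) by simp
      then have "{..n2} \<subseteq> D" unfolding i using z(1) \<open>{1..n2} \<subseteq> D\<close> by simp
      then show "admits n2 {..n2} (Suc n2) D" using that(1) by (simp add: admits_def)
    next
      assume "admits n2 {..n2} (Suc n2) D"
      then have D: "{..n2} \<subseteq> D" unfolding admits_def by blast
      then have "0 \<in> D" "{1..n2} \<subseteq> D" by auto
      moreover have "0 \<notin> {1..n2}" by simp
      ultimately show "admits n2 {1..n2} 1 D" unfolding admits_def by blast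
    qed
  qed
  have "subdivides n1 {} (Suc n1) n2 {..n2} (Suc n2) ?L" by (rule subdivides_cong[OF _ adm sub]) simp
  moreover have "critical_count ?L d = of_bool (\<exists>d1 d2. critical_index n1 {} (Suc n1) d1 \<and> critical_index n2 {..n2} (Suc n2) d2 \<and> d = d1 + d2)" for d
  proof -
    have "critical_count ?L d = of_bool (\<exists>d1 d2. critical_index n1 {} (Suc n1) d1 \<and> critical_index n2 {1..n2} 1 d2 \<and> d = d1 + d2)"
      by (rule critical_count_paths[OF xs(1) ys(1) xs(2) ys(2) dis]) (use pos in auto)
    moreover have "critical_index n2 {1..n2} 1 d2 \<longleftrightarrow> critical_index n2 {..n2} (Suc n2) d2" for d2
      using pos by (auto simp: critical_index_def)
    ultimately show ?thesis by simp
  qed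
  moreover have "order_count ?L d = product_order n1 n2 (card ({} :: nat set)) (card {..n2}) d" for d
    using order_count_closed_open[OF xs(1) ys(1) xs(2) ys(2) dis pos] pos by (simp add: product_order_def)
  ultimately show ?thesis unfolding subdivides_well_def by blast
qed

theorem product_cells_exist:
  assumes t1: "factor_tile n1 R1 a1" and t2: "factor_tile n2 R2 a2"
  shows "\<exists>L. subdivides_well n1 R1 a1 n2 R2 a2 L"
proof -
  have nf: "a \<le> n \<Longrightarrow> R \<noteq> {..n} \<and> R \<noteq> {}" if "factor_tile n R a" for n R a
    using that by (fastforce simp: factor_tile_def)
  consider (pt1) "n1 = 0" | (pt2) "n1 \<noteq> 0" "n2 = 0"
    | (co) "n1 \<noteq> 0" "n2 \<noteq> 0" "R1 = {}" "R2 = {..n2}" | (oc) "n1 \<noteq> 0" "n2 \<noteq> 0" "R1 = {..n1}" "R2 = {}"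
    | (gen) "n1 \<noteq> 0" "n2 \<noteq> 0" "\<not> (R1 = {} \<and> R2 = {..n2})" "\<not> (R1 = {..n1} \<and> R2 = {})" by blast
  then show ?thesis
  proof cases
    case pt1
    then show ?thesis using subdivides_well_point t1 t2 by blast
  next
    case pt2
    then show ?thesis using subdivides_well_swap subdivides_well_point t1 t2 by blast
  next
    case co
    then have "a1 = Suc n1" "a2 = Suc n2" using nf[OF t1] nf[OF t2] t1 t2 by (auto simp: factor_tile_def)
    then show ?thesis using subdivides_well_closed_open co by blast
  next
    case oc
    then have "a1 = Suc n1" "a2 = Suc n2" using nf[OF t1] nf[OF t2] t1 t2 by (auto simp: factor_tile_def)
    then show ?thesis using subdivides_well_closed_open[of n2 n1] subdivides_well_swap oc by blast
  next
    case gen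
    \<comment> \<open>A word descending everywhere needs e < s, a word without descents needs s < e; the excluded closed times open case is the only conflict.\<close>
    define s e where "s = (if R1 = {..n1} \<or> R2 = {..n2} then 1 else 0 :: real)"
      and "e = (if R1 = {..n1} \<or> R2 = {..n2} then 0 else 1 :: real)"
    have ord1: "R1 = {} \<Longrightarrow> s < e" "R1 = {0..0 + n1} \<Longrightarrow> e < s" and ord2: "R2 = {} \<Longrightarrow> s < e" "R2 = {0..0 + n2} \<Longrightarrow> e < s"
      using gen unfolding s_def e_def by (auto simp: atLeast0AtMost)
    have sub: "R1 \<subseteq> {0..0 + n1}" "R2 \<subseteq> {0..0 + n2}" using t1 t2 by (auto simp: factor_tile_def)
    have "\<exists>xs ys. length xs = n1 \<and> length ys = n2 \<and> desc e s 0 xs = R1 \<and> desc e s 0 ys = R2 \<and> set xs \<inter> set ys = {} \<and>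
       (a1 \<le> n1 \<or> a2 \<le> n2 \<longrightarrow> (\<forall>p. a1 = Suc n1 \<longrightarrow> 0 < p \<longrightarrow> p \<le> n1 \<longrightarrow> R1 = {p..n1} \<longrightarrow> (\<exists>x\<in>set xs. \<forall>y\<in>set ys. y < x)) \<and>
        (\<forall>p. a2 = Suc n2 \<longrightarrow> 0 < p \<longrightarrow> p \<le> n2 \<longrightarrow> R2 = {p..n2} \<longrightarrow> (\<exists>y\<in>set ys. \<forall>x\<in>set xs. x < y)))"
    proof (cases "a1 = Suc n1")
      case True
      obtain ys where ys: "length ys = n2" "desc e s 0 ys = R2"
        using word_with_descents_exists[OF sub(2) ord2, of "{}" 0] by auto
      obtain xs where xs: "length xs = n1" "desc e s 0 xs = R1" "set xs \<inter> set ys = {}"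
         "(\<exists>p>0. p \<le> 0 + n1 \<and> R1 = {p..0 + n1}) \<longrightarrow> (\<exists>x\<in>set xs. Max (insert 0 (set ys)) < x)"
        using word_with_descents_exists[OF sub(1) ord1, of "set ys" "Max (insert 0 (set ys))"] by blast
      have "\<exists>x\<in>set xs. \<forall>y\<in>set ys. y < x" if p: "0 < p" "p \<le> n1" "R1 = {p..n1}" for p
      proof -
        have "\<exists>p>0. p \<le> 0 + n1 \<and> R1 = {p..0 + n1}" using p by (intro exI[of _ p]) simp
        then obtain x where x: "x \<in> set xs" "Max (insert 0 (set ys)) < x" using xs(4) by blast
        have "y < x" if "y \<in> set ys" for y
        proof -
          have "y \<le> Max (insert 0 (set ys))" using that by (intro Max_ge) auto
          then show ?thesis using x(2) by linarith
        qed
        then show ?thesis using x(1) by blast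
      qed
      then show ?thesis using xs ys True by (intro exI[of _ xs] exI[of _ ys]) auto
    next
      case False
      then have a1: "a1 \<le> n1" using t1 by (auto simp: factor_tile_def)
      obtain xs where xs: "length xs = n1" "desc e s 0 xs = R1"
        using word_with_descents_exists[OF sub(1) ord1, of "{}" 0] by auto
      obtain ys where ys: "length ys = n2" "desc e s 0 ys = R2" "set ys \<inter> set xs = {}"
         "(\<exists>p>0. p \<le> 0 + n2 \<and> R2 = {p..0 + n2}) \<longrightarrow> (\<exists>y\<in>set ys. Max (insert 0 (set xs)) < y)"
        using word_with_descents_exists[OF sub(2) ord2, of "set xs" "Max (insert 0 (set xs))"] by blast
      have "\<exists>y\<in>set ys. \<forall>x\<in>set xs. x < y" if p: "0 < p" "p \<le> n2" "R2 = {p..n2}" for p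
      proof -
        have "\<exists>p>0. p \<le> 0 + n2 \<and> R2 = {p..0 + n2}" using p by (intro exI[of _ p]) simp
        then obtain y where y: "y \<in> set ys" "Max (insert 0 (set xs)) < y" using ys(4) by blast
        have "x < y" if "x \<in> set xs" for x
        proof -
          have "x \<le> Max (insert 0 (set xs))" using that by (intro Max_ge) auto
          then show ?thesis using y(2) by linarith
        qed
        then show ?thesis using y(1) by blast
      qed
      then show ?thesis using xs ys False by (intro exI[of _ xs] exI[of _ ys]) auto
    qed
    then obtain xs ys where len: "length xs = n1" "length ys = n2" and R: "desc e s 0 xs = R1" "desc e s 0 ys = R2"
      and dis: "set xs \<inter> set ys = {}"
      and high: "a1 \<le> n1 \<or> a2 \<le> n2 \<Longrightarrow> (\<forall>p. a1 = Suc n1 \<longrightarrow> 0 < p \<longrightarrow> p \<le> n1 \<longrightarrow> R1 = {p..n1} \<longrightarrow> (\<exists>x\<in>set xs. \<forall>y\<in>set ys. y < x)) \<and>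
        (\<forall>p. a2 = Suc n2 \<longrightarrow> 0 < p \<longrightarrow> p \<le> n2 \<longrightarrow> R2 = {p..n2} \<longrightarrow> (\<exists>y\<in>set ys. \<forall>x\<in>set xs. x < y))"
      by blast
    let ?L = "map (path_cell a1 a2) (stairs e s 0 xs 0 ys)"
    have a: "2 \<le> a1" "a1 \<le> Suc n1" "2 \<le> a2" "a2 \<le> Suc n2" using t1 t2 gen(1,2) by (auto simp: factor_tile_def)
    have ne: "R1 \<noteq> {} \<or> R2 \<noteq> {}" if "a1 \<le> n1 \<or> a2 \<le> n2" using that nf[OF t1] nf[OF t2] by blast
    have "subdivides n1 R1 a1 n2 R2 a2 ?L"
      by (rule stairs_subdivides[OF len R dis]) (use a ne in auto)
    moreover have "critical_count ?L d = of_bool (\<exists>d1 d2. critical_index n1 R1 a1 d1 \<and> critical_index n2 R2 a2 d2 \<and> d = d1 + d2)" for d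
    proof (cases "a1 \<le> n1 \<or> a2 \<le> n2")
      case True
      have 1: "0 < a1 \<and> a1 \<le> n1 \<and> R1 \<subseteq> {a1..n1} \<or> a1 = Suc n1" using t1 by (auto simp: factor_tile_def)
      have 2: "0 < a2 \<and> a2 \<le> n2 \<and> R2 \<subseteq> {a2..n2} \<or> a2 = Suc n2" using t2 by (auto simp: factor_tile_def)
      show ?thesis
        by (rule critical_count_paths[OF len R dis 1 2 True]) (use high[OF True] ne[OF True] in blast)+
    next
      case False
      then have "a1 = Suc n1" "a2 = Suc n2" using a by auto
      then show ?thesis using critical_count_no_face[OF len R dis _ gen(3,4)] gen(1) by simp
    qed
    moreover have "order_count ?L d = product_order n1 n2 (card R1) (card R2) d" for d
    proof -
      have count: "order_count ?L d = path_count n1 n2 (card R1) (card R2) d"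
        by (rule order_count_paths[OF len R dis a(1,3)]) (use gen in simp)
      have full: "card R = Suc n \<longleftrightarrow> R = {..n}" if "R \<subseteq> {0..0 + n}" for R :: "nat set" and n
      proof
        assume "card R = Suc n"
        then show "R = {..n}" using that card_subset_eq[of "{..n}" R] by (simp add: atLeast0AtMost)
      qed simp
      have empty: "card R = 0 \<longleftrightarrow> R = {}" if "R \<subseteq> {0..0 + n}" for R :: "nat set" and n
      proof -
        have "finite R" by (rule finite_subset[OF that]) simp
        then show ?thesis by simp
      qed
      have "\<not> (card R1 = 0 \<and> card R2 = Suc n2)" "\<not> (card R1 = Suc n1 \<and> card R2 = 0)"
        using gen(3,4) full[OF sub(1)] full[OF sub(2)] empty[OF sub(1)] empty[OF sub(2)] by blast+
      then have "product_order n1 n2 (card R1) (card R2) d = path_count n1 n2 (card R1) (card R2) d"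
        unfolding product_order_def using gen(1,2) by (simp only: if_False)
      with count show ?thesis by simp
    qed
    ultimately show ?thesis unfolding subdivides_well_def by blast
  qed
qed

section \<open>Simplicial complexes through vertex sets\<close>

text \<open>
  The vertex sets of the simplices of a finite simplicial complex, with the empty simplex included.
\<close>

definition geometric :: "'a::euclidean_space set set \<Rightarrow> bool" where
  "geometric \<Delta> \<longleftrightarrow> finite \<Delta> \<and> (\<forall>W\<in>\<Delta>. finite W \<and> \<not> affine_dependent W) \<and> (\<forall>W\<in>\<Delta>. \<forall>U\<subseteq>W. U \<in> \<Delta>) \<and>
     (\<forall>W\<in>\<Delta>. \<forall>U\<in>\<Delta>. convex hull W \<inter> convex hull U \<subseteq> convex hull (W \<inter> U))"

text \<open>
  The vertex set of the smallest simplex containing \<open>x\<close>.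
\<close>

definition carrier :: "'a::euclidean_space set set \<Rightarrow> 'a \<Rightarrow> 'a set" where
  "carrier \<Delta> x = \<Inter>{U \<in> \<Delta>. x \<in> convex hull U}"

lemma geometricD:
  assumes "geometric \<Delta>"
  shows "finite \<Delta>" "W \<in> \<Delta> \<Longrightarrow> finite W" "W \<in> \<Delta> \<Longrightarrow> \<not> affine_dependent W"
    "W \<in> \<Delta> \<Longrightarrow> U \<subseteq> W \<Longrightarrow> U \<in> \<Delta>"
    "W \<in> \<Delta> \<Longrightarrow> U \<in> \<Delta> \<Longrightarrow> x \<in> convex hull W \<Longrightarrow> x \<in> convex hull U \<Longrightarrow> x \<in> convex hull (W \<inter> U)"
  using assms unfolding geometric_def by blast+

lemma carrier_in:
  assumes \<Delta>: "geometric \<Delta>" and U: "U \<in> \<Delta>" "x \<in> convex hull U"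
  shows "carrier \<Delta> x \<in> \<Delta>" "x \<in> convex hull (carrier \<Delta> x)"
proof -
  have "\<Inter>G \<in> \<Delta> \<and> x \<in> convex hull (\<Inter>G)" if "finite G" "G \<noteq> {}" "G \<subseteq> {U \<in> \<Delta>. x \<in> convex hull U}" for G
    using that
  proof (induction rule: finite_ne_induct)
    case (insert W G)
    then have IH: "\<Inter>G \<in> \<Delta>" "x \<in> convex hull \<Inter>G" and W: "W \<in> \<Delta>" "x \<in> convex hull W" by auto
    then have "W \<inter> \<Inter>G \<in> \<Delta>" using geometricD(4)[OF \<Delta> W(1)] by blast
    moreover have "x \<in> convex hull (W \<inter> \<Inter>G)" using geometricD(5)[OF \<Delta> W(1) IH(1) W(2) IH(2)] .
    ultimately show ?case by simp
  qed simp
  moreover have "finite {U \<in> \<Delta>. x \<in> convex hull U}" using geometricD(1)[OF \<Delta>] by simp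
  moreover have "{U \<in> \<Delta>. x \<in> convex hull U} \<noteq> {}" using U by blast
  ultimately show "carrier \<Delta> x \<in> \<Delta>" "x \<in> convex hull (carrier \<Delta> x)" unfolding carrier_def by blast+
qed

lemma in_hull_iff_carrier:
  assumes \<Delta>: "geometric \<Delta>" and U: "U \<in> \<Delta>" "x \<in> convex hull U" and W: "W \<in> \<Delta>"
  shows "x \<in> convex hull W \<longleftrightarrow> carrier \<Delta> x \<subseteq> W"
proof
  assume "x \<in> convex hull W"
  then show "carrier \<Delta> x \<subseteq> W" unfolding carrier_def using W by blast
next
  assume "carrier \<Delta> x \<subseteq> W"
  then show "x \<in> convex hull W" using carrier_in(2)[OF \<Delta> U] hull_mono by blast
qed

lemma notin_hull_remove:
  assumes "\<not> affine_dependent W" "a \<in> W"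
  shows "a \<notin> convex hull (W - {a})"
  using assms convex_hull_subset_affine_hull[of "W - {a}"] unfolding affine_dependent_def by blast

lemma hull_subset_iff:
  assumes "\<not> affine_dependent W" "A \<subseteq> W" "B \<subseteq> W"
  shows "convex hull A \<subseteq> convex hull B \<longleftrightarrow> A \<subseteq> B"
proof
  assume h: "convex hull A \<subseteq> convex hull B"
  show "A \<subseteq> B"
  proof
    fix a assume a: "a \<in> A"
    show "a \<in> B"
    proof (rule ccontr)
      assume "a \<notin> B"
      then have "B \<subseteq> W - {a}" using assms(3) by blast
      moreover have "a \<in> convex hull B" using h a hull_inc by fast
      ultimately have "a \<in> convex hull (W - {a})" using hull_mono by blast
      then show False using notin_hull_remove[OF assms(1)] a assms(2) by blast
    qed
  qed
qed (rule hull_mono)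

lemma hull_eq_iff:
  assumes "\<not> affine_dependent W" "A \<subseteq> W" "B \<subseteq> W"
  shows "convex hull A = convex hull B \<longleftrightarrow> A = B"
  using hull_subset_iff[OF assms] hull_subset_iff[OF assms(1,3,2)] by blast

lemma vertices_hull:
  assumes "\<not> affine_dependent W"
  shows "vertices (convex hull W) = W"
  unfolding vertices_def using extreme_point_of_convex_hull_affine_independent[OF assms] by blast

lemma simplicial_complex_geometric:
  assumes K: "simplicial_complex K"
  shows "geometric {W. finite W \<and> \<not> affine_dependent W \<and> convex hull W \<in> K}"
    "(\<lambda>W. convex hull W) ` {W. finite W \<and> \<not> affine_dependent W \<and> convex hull W \<in> K} = K"
proof -
  let ?D = "{W. finite W \<and> \<not> affine_dependent W \<and> convex hull W \<in> K}"
  have Kd: "finite K" "\<And>S. S \<in> K \<Longrightarrow> \<exists>n. n simplex S" "\<And>F S. S \<in> K \<Longrightarrow> F face_of S \<Longrightarrow> F \<in> K"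
    "\<And>S S'. S \<in> K \<Longrightarrow> S' \<in> K \<Longrightarrow> (S \<inter> S') face_of S"
    using K unfolding simplicial_complex_def by blast+
  have "inj_on (\<lambda>W. convex hull W) ?D"
  proof (rule inj_onI)
    fix A B assume "A \<in> ?D" "B \<in> ?D" "convex hull A = convex hull B"
    then show "A = B" using vertices_hull by (metis (no_types, lifting) mem_Collect_eq)
  qed
  moreover have "finite ((\<lambda>W. convex hull W) ` ?D)"
    by (rule finite_subset[OF _ Kd(1)]) blast
  ultimately have fin: "finite ?D" using finite_imageD by blast
  show "geometric ?D" unfolding geometric_def
  proof (intro conjI ballI allI impI)
    fix W U assume W: "W \<in> ?D" and U: "U \<subseteq> W"
    have "convex hull U face_of convex hull W"
      using W U by (auto simp: face_of_convex_hull_affine_independent)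
    then have "convex hull U \<in> K" using W Kd(3) by blast
    then show "U \<in> ?D" using W U finite_subset affine_independent_subset by blast
  next
    fix W U assume W: "W \<in> ?D" and U: "U \<in> ?D"
    have "(convex hull W \<inter> convex hull U) face_of convex hull W" "(convex hull U \<inter> convex hull W) face_of convex hull U"
      using Kd(4) W U by blast+
    then obtain c d where c: "c \<subseteq> W" "convex hull W \<inter> convex hull U = convex hull c"
       and d: "d \<subseteq> U" "convex hull U \<inter> convex hull W = convex hull d"
      using W U by (auto simp: face_of_convex_hull_affine_independent)
    have "convex hull c = convex hull d" using c(2) d(2) by (simp add: Int_commute)
    moreover have "\<not> affine_dependent c" "\<not> affine_dependent d" using W U c(1) d(1) affine_independent_subset by blast+
    ultimately have "c = d" using vertices_hull by metis
    then have "c \<subseteq> W \<inter> U" using c(1) d(1) by blast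
    then show "convex hull W \<inter> convex hull U \<subseteq> convex hull (W \<inter> U)" unfolding c(2) by (rule hull_mono)
  qed (use fin in auto)
  show "(\<lambda>W. convex hull W) ` ?D = K"
  proof
    show "K \<subseteq> (\<lambda>W. convex hull W) ` ?D"
    proof
      fix S assume S: "S \<in> K"
      then obtain C where "\<not> affine_dependent C" "S = convex hull C" using Kd(2) unfolding simplex_def by blast
      then show "S \<in> (\<lambda>W. convex hull W) ` ?D" using S aff_independent_finite by blast
    qed
  qed blast
qed

lemma geometric_simplicial_complex:
  assumes \<Delta>: "geometric \<Delta>"
  shows "simplicial_complex ((\<lambda>W. convex hull W) ` \<Delta>)"
  unfolding simplicial_complex_def
proof (intro conjI ballI allI impI)
  show "finite ((\<lambda>W. convex hull W) ` \<Delta>)" using geometricD(1)[OF \<Delta>] by simp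
next
  fix S assume "S \<in> (\<lambda>W. convex hull W) ` \<Delta>"
  then obtain W where W: "W \<in> \<Delta>" "S = convex hull W" by blast
  then have "(int (card W) - 1) simplex S" unfolding simplex_def using geometricD(3)[OF \<Delta>] by (intro exI[of _ W]) auto
  then show "\<exists>n. n simplex S" by blast
next
  fix F S assume "S \<in> (\<lambda>W. convex hull W) ` \<Delta> \<and> F face_of S"
  then obtain W where W: "W \<in> \<Delta>" "F face_of convex hull W" by blast
  then obtain c where "c \<subseteq> W" "F = convex hull c"
    using face_of_convex_hull_affine_independent[OF geometricD(3)[OF \<Delta> W(1)]] by blast
  then show "F \<in> (\<lambda>W. convex hull W) ` \<Delta>" using geometricD(4)[OF \<Delta> W(1)] by blast
next
  fix S S' assume "S \<in> (\<lambda>W. convex hull W) ` \<Delta> \<and> S' \<in> (\<lambda>W. convex hull W) ` \<Delta>"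
  then obtain W U where W: "W \<in> \<Delta>" "U \<in> \<Delta>" "S = convex hull W" "S' = convex hull U" by blast
  have "S \<inter> S' = convex hull (W \<inter> U)"
    using W geometricD(5)[OF \<Delta> W(1,2)] hull_mono[of "W \<inter> U" W] hull_mono[of "W \<inter> U" U] by blast
  then show "S \<inter> S' face_of S" unfolding W(3)
    using face_of_convex_hull_affine_independent[OF geometricD(3)[OF \<Delta> W(1)]] by blast
qed

definition linear_on :: "('a \<Rightarrow> 'a \<Rightarrow> bool) \<Rightarrow> 'a set \<Rightarrow> bool" where
  "linear_on lt W \<longleftrightarrow> (\<forall>a\<in>W. \<not> lt a a) \<and> (\<forall>a\<in>W. \<forall>b\<in>W. a = b \<or> lt a b \<or> lt b a) \<and>
     (\<forall>a\<in>W. \<forall>b\<in>W. \<forall>c\<in>W. lt a b \<longrightarrow> lt b c \<longrightarrow> lt a c)"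

lemma linear_onI:
  assumes "\<And>a. a \<in> W \<Longrightarrow> \<not> lt a a" "\<And>a b. a \<in> W \<Longrightarrow> b \<in> W \<Longrightarrow> a = b \<or> lt a b \<or> lt b a"
    "\<And>a b c. a \<in> W \<Longrightarrow> b \<in> W \<Longrightarrow> c \<in> W \<Longrightarrow> lt a b \<Longrightarrow> lt b c \<Longrightarrow> lt a c"
  shows "linear_on lt W"
  unfolding linear_on_def by (intro conjI ballI impI; (rule assms; assumption))

lemma linear_onD:
  assumes "linear_on lt W"
  shows "a \<in> W \<Longrightarrow> \<not> lt a a" "a \<in> W \<Longrightarrow> b \<in> W \<Longrightarrow> a = b \<or> lt a b \<or> lt b a"
    "a \<in> W \<Longrightarrow> b \<in> W \<Longrightarrow> c \<in> W \<Longrightarrow> lt a b \<Longrightarrow> lt b c \<Longrightarrow> lt a c"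
proof -
  note d = assms[unfolded linear_on_def]
  show "a \<in> W \<Longrightarrow> \<not> lt a a" by (rule bspec[OF conjunct1[OF d]])
  show "a \<in> W \<Longrightarrow> b \<in> W \<Longrightarrow> a = b \<or> lt a b \<or> lt b a"
    by (rule bspec[OF bspec[OF conjunct1[OF conjunct2[OF d]]]])
  show "a \<in> W \<Longrightarrow> b \<in> W \<Longrightarrow> c \<in> W \<Longrightarrow> lt a b \<Longrightarrow> lt b c \<Longrightarrow> lt a c"
    by (rule mp[OF mp[OF bspec[OF bspec[OF bspec[OF conjunct2[OF conjunct2[OF d]]]]]]])
qed

lemma linear_on_subset:
  assumes "linear_on lt W" "U \<subseteq> W"
  shows "linear_on lt U"
proof (rule linear_onI)
  show "\<not> lt a a" if "a \<in> U" for a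
    by (rule linear_onD(1)[OF assms(1) subsetD[OF assms(2) that]])
  show "a = b \<or> lt a b \<or> lt b a" if "a \<in> U" "b \<in> U" for a b
    by (rule linear_onD(2)[OF assms(1) subsetD[OF assms(2) that(1)] subsetD[OF assms(2) that(2)]])
  show "lt a c" if "a \<in> U" "b \<in> U" "c \<in> U" "lt a b" "lt b c" for a b c
    by (rule linear_onD(3)[OF assms(1) subsetD[OF assms(2) that(1)] subsetD[OF assms(2) that(2)] subsetD[OF assms(2) that(3)] that(4,5)])
qed

lemma linear_on_asym: "linear_on lt W \<Longrightarrow> a \<in> W \<Longrightarrow> b \<in> W \<Longrightarrow> lt a b \<Longrightarrow> \<not> lt b a"
  using linear_onD(1)[of lt W a] linear_onD(3)[of lt W a b a] by argo

lemma linear_on_min: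
  assumes "finite W" "W \<noteq> {}" "linear_on lt W"
  shows "\<exists>m\<in>W. \<forall>w\<in>W. w = m \<or> lt m w"
  using assms
proof (induction rule: finite_ne_induct)
  case (insert x F)
  have "linear_on lt F" by (rule linear_on_subset[OF insert.prems]) auto
  then obtain m where m: "m \<in> F" "\<forall>w\<in>F. w = m \<or> lt m w" using insert.IH by blast
  have ins: "x \<in> insert x F" "m \<in> insert x F" "\<And>w. w \<in> F \<Longrightarrow> w \<in> insert x F" using m(1) by auto
  from linear_onD(2)[OF insert.prems ins(1,2)] consider "x = m \<or> lt m x" | "lt x m" by blast
  then show ?case
  proof cases
    case 1
    then have "\<forall>w\<in>insert x F. w = m \<or> lt m w" using m(2) by simp
    then show ?thesis using ins(2) by blast
  next
    case 2
    have "lt x w" if w: "w \<in> F" for w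
    proof (cases "w = m")
      case False
      then have "lt m w" using m(2) w by blast
      then show ?thesis using linear_onD(3)[OF insert.prems ins(1,2) ins(3)[OF w] 2] by blast
    qed (use 2 in simp)
    then have "\<forall>w\<in>insert x F. w = x \<or> lt x w" by simp
    then show ?thesis using ins(1) by blast
  qed
qed simp

definition pair_le :: "('a \<Rightarrow> 'a \<Rightarrow> bool) \<Rightarrow> ('b \<Rightarrow> 'b \<Rightarrow> bool) \<Rightarrow> 'a \<times> 'b \<Rightarrow> 'a \<times> 'b \<Rightarrow> bool" where
  "pair_le lt1 lt2 p q \<longleftrightarrow> (fst p = fst q \<or> lt1 (fst p) (fst q)) \<and> (snd p = snd q \<or> lt2 (snd p) (snd q))"

definition pair_chain :: "('a \<Rightarrow> 'a \<Rightarrow> bool) \<Rightarrow> ('b \<Rightarrow> 'b \<Rightarrow> bool) \<Rightarrow> ('a \<times> 'b) set \<Rightarrow> bool" where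
  "pair_chain lt1 lt2 C \<longleftrightarrow> (\<forall>p\<in>C. \<forall>q\<in>C. pair_le lt1 lt2 p q \<or> pair_le lt1 lt2 q p)"

lemma pair_chain_subset: "pair_chain lt1 lt2 C \<Longrightarrow> D \<subseteq> C \<Longrightarrow> pair_chain lt1 lt2 D"
  unfolding pair_chain_def by blast

text \<open>
  In a chain the least first and the least second coordinate are attained at the same point. All
  uniqueness statements about the triangulation rest on this.
\<close>

lemma pair_chain_min:
  assumes ch: "pair_chain lt1 lt2 C" and l1: "linear_on lt1 (fst ` C)" and l2: "linear_on lt2 (snd ` C)"
    and a: "a \<in> fst ` C" "\<forall>w\<in>fst ` C. w = a \<or> lt1 a w" and b: "b \<in> snd ` C" "\<forall>w\<in>snd ` C. w = b \<or> lt2 b w"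
  shows "(a, b) \<in> C"
proof -
  obtain p where p: "p \<in> C" "fst p = a" using a(1) by blast
  obtain q where q: "q \<in> C" "snd q = b" using b(1) by blast
  have fq: "fst q = a \<or> lt1 a (fst q)" and sp: "snd p = b \<or> lt2 b (snd p)" using a(2) b(2) p(1) q(1) by blast+
  have m: "fst q \<in> fst ` C" "snd p \<in> snd ` C" using p(1) q(1) by blast+
  have "pair_le lt1 lt2 p q \<or> pair_le lt1 lt2 q p" using ch p(1) q(1) unfolding pair_chain_def by blast
  then have "snd p = b \<or> fst q = a"
  proof
    assume "pair_le lt1 lt2 p q"
    then have "snd p = b \<or> lt2 (snd p) b" using q(2) unfolding pair_le_def by simp
    then show ?thesis using sp linear_on_asym[OF l2 m(2) b(1)] by argo
  next
    assume "pair_le lt1 lt2 q p"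
    then have "fst q = a \<or> lt1 (fst q) a" using p(2) unfolding pair_le_def by simp
    then show ?thesis using fq linear_on_asym[OF l1 m(1) a(1)] by argo
  qed
  then show ?thesis using p q by (metis prod.collapse)
qed

section \<open>Measures supported on chains\<close>

lemma support_iff_marginal:
  fixes w :: "'p \<Rightarrow> real"
  assumes "finite U" "\<And>p. p \<in> U \<Longrightarrow> 0 \<le> w p"
  shows "a \<in> g ` {p \<in> U. 0 < w p} \<longleftrightarrow> 0 < (\<Sum>p | p \<in> U \<and> g p = a. w p)"
proof -
  have fin: "finite {p. p \<in> U \<and> g p = a}" using assms(1) by simp
  have nn: "0 \<le> w p" if "p \<in> {p. p \<in> U \<and> g p = a}" for p using assms(2) that by simp
  have z: "(\<Sum>p | p \<in> U \<and> g p = a. w p) = 0 \<longleftrightarrow> (\<forall>p\<in>{p. p \<in> U \<and> g p = a}. w p = 0)"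
    by (rule sum_nonneg_eq_0_iff[OF fin nn])
  have "0 \<le> (\<Sum>p | p \<in> U \<and> g p = a. w p)" by (rule sum_nonneg[OF nn])
  then have "0 < (\<Sum>p | p \<in> U \<and> g p = a. w p) \<longleftrightarrow> (\<Sum>p | p \<in> U \<and> g p = a. w p) \<noteq> 0"
    by linarith
  also have "\<dots> \<longleftrightarrow> (\<exists>p\<in>{p. p \<in> U \<and> g p = a}. w p \<noteq> 0)" unfolding z by blast
  also have "\<dots> \<longleftrightarrow> a \<in> g ` {p \<in> U. 0 < w p}"
  proof
    assume "\<exists>p\<in>{p. p \<in> U \<and> g p = a}. w p \<noteq> 0"
    then obtain p where p: "p \<in> U" "g p = a" "w p \<noteq> 0" by blast
    then have "0 < w p" using assms(2)[OF p(1)] by linarith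
    then show "a \<in> g ` {p \<in> U. 0 < w p}" using p by blast
  next
    assume "a \<in> g ` {p \<in> U. 0 < w p}"
    then obtain p where "p \<in> U" "0 < w p" "a = g p" by blast
    then show "\<exists>p\<in>{p. p \<in> U \<and> g p = a}. w p \<noteq> 0" by (intro bexI[of _ p]) simp_all
  qed
  finally show ?thesis by blast
qed

lemma marginal_upd:
  fixes w :: "'p \<Rightarrow> real"
  assumes "finite U" "p0 \<in> U"
  shows "(\<Sum>p | p \<in> U \<and> g p = a. (w(p0 := w p0 - m)) p) = (\<Sum>p | p \<in> U \<and> g p = a. w p) - (if g p0 = a then m else 0)"
proof -
  have "(\<Sum>p | p \<in> U \<and> g p = a. (w(p0 := w p0 - m)) p) = (\<Sum>p | p \<in> U \<and> g p = a. w p - (if p = p0 then m else 0))"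
    by (rule sum.cong) auto
  also have "\<dots> = (\<Sum>p | p \<in> U \<and> g p = a. w p) - (if g p0 = a then m else 0)"
    using assms by (simp add: sum_subtractf sum.delta)
  finally show ?thesis .
qed

text \<open>
  Both supports contain the pair of the least coordinates; subtracting the smaller of the two weights
  at this point shrinks one of the supports and preserves the equality of the marginals.
\<close>

theorem chain_weights_unique:
  fixes u v :: "'a \<times> 'b \<Rightarrow> real"
  assumes fin: "finite U"
    and nn: "\<And>p. p \<in> U \<Longrightarrow> 0 \<le> u p" "\<And>p. p \<in> U \<Longrightarrow> 0 \<le> v p"
    and ch: "pair_chain lt1 lt2 {p \<in> U. 0 < u p}" "pair_chain lt1 lt2 {p \<in> U. 0 < v p}"
    and lin: "linear_on lt1 (fst ` {p \<in> U. 0 < u p})" "linear_on lt2 (snd ` {p \<in> U. 0 < u p})"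
    and m1: "\<And>a. (\<Sum>p | p \<in> U \<and> fst p = a. u p) = (\<Sum>p | p \<in> U \<and> fst p = a. v p)"
    and m2: "\<And>b. (\<Sum>p | p \<in> U \<and> snd p = b. u p) = (\<Sum>p | p \<in> U \<and> snd p = b. v p)"
  shows "\<forall>p\<in>U. u p = v p"
  using nn ch lin m1 m2
proof (induction "card {p \<in> U. 0 < u p} + card {p \<in> U. 0 < v p}" arbitrary: u v rule: less_induct)
  case less
  let ?S = "{p \<in> U. 0 < u p}" and ?T = "{p \<in> U. 0 < v p}"
  have s1: "fst ` ?S = fst ` ?T"
    by (rule set_eqI) (simp only: support_iff_marginal[OF fin less.prems(1)] support_iff_marginal[OF fin less.prems(2)] less.prems(7))
  have s2: "snd ` ?S = snd ` ?T"
    by (rule set_eqI) (simp only: support_iff_marginal[OF fin less.prems(1)] support_iff_marginal[OF fin less.prems(2)] less.prems(8))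
  show ?case
  proof (cases "?S = {}")
    case True
    then have "?T = {}" using s1 by blast
    show ?thesis
    proof
      fix p assume p: "p \<in> U"
      then have "\<not> 0 < u p" "\<not> 0 < v p" using True \<open>?T = {}\<close> by blast+
      then show "u p = v p" using less.prems(1,2)[OF p] by linarith
    qed
  next
    case False
    have finS: "finite ?S" "finite ?T" using fin by simp_all
    obtain a where a: "a \<in> fst ` ?S" "\<forall>w\<in>fst ` ?S. w = a \<or> lt1 a w"
      using linear_on_min[OF _ _ less.prems(5)] False finS by blast
    obtain b where b: "b \<in> snd ` ?S" "\<forall>w\<in>snd ` ?S. w = b \<or> lt2 b w"
      using linear_on_min[OF _ _ less.prems(6)] False finS by blast
    have pS: "(a, b) \<in> ?S" by (rule pair_chain_min[OF less.prems(3,5,6) a b])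
    have pT: "(a, b) \<in> ?T"
      by (rule pair_chain_min[OF less.prems(4)]) (use less.prems(5,6) a b s1 s2 in simp_all)
    define p0 where "p0 = (a, b)"
    \<comment> \<open>After subtracting this amount, one of the two supports no longer contains the point.\<close>
    define m where "m = min (u p0) (v p0)"
    have p0: "p0 \<in> U" "0 < u p0" "0 < v p0" using pS pT unfolding p0_def by simp_all
    let ?u = "u(p0 := u p0 - m)" and ?v = "v(p0 := v p0 - m)"
    have m: "0 < m" "m \<le> u p0" "m \<le> v p0" "m = u p0 \<or> m = v p0" using p0 unfolding m_def by auto
    have subS: "{p \<in> U. 0 < ?u p} \<subseteq> ?S" and subT: "{p \<in> U. 0 < ?v p} \<subseteq> ?T"
      using p0 by (auto split: if_splits)
    have "{p \<in> U. 0 < ?u p} \<subset> ?S \<or> {p \<in> U. 0 < ?v p} \<subset> ?T"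
    proof -
      from m(4) show ?thesis
      proof
        assume "m = u p0"
        then have "p0 \<notin> {p \<in> U. 0 < ?u p}" by simp
        moreover have "p0 \<in> ?S" using p0 by simp
        ultimately have "{p \<in> U. 0 < ?u p} \<subset> ?S" using subS by blast
        then show ?thesis by (rule disjI1)
      next
        assume "m = v p0"
        then have "p0 \<notin> {p \<in> U. 0 < ?v p}" by simp
        moreover have "p0 \<in> ?T" using p0 by simp
        ultimately have "{p \<in> U. 0 < ?v p} \<subset> ?T" using subT by blast
        then show ?thesis by (rule disjI2)
      qed
    qed
    then have "card {p \<in> U. 0 < ?u p} + card {p \<in> U. 0 < ?v p} < card ?S + card ?T"
      using psubset_card_mono[OF finS(1)] psubset_card_mono[OF finS(2)] card_mono[OF finS(1) subS] card_mono[OF finS(2) subT]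
      by (meson add_le_less_mono add_less_le_mono)
    then have "\<forall>p\<in>U. ?u p = ?v p"
    proof (rule less.hyps)
      show "0 \<le> ?u p" "0 \<le> ?v p" if "p \<in> U" for p
        using less.prems(1,2)[OF that] m by auto
      show "pair_chain lt1 lt2 {p \<in> U. 0 < ?u p}" by (rule pair_chain_subset[OF less.prems(3) subS])
      show "pair_chain lt1 lt2 {p \<in> U. 0 < ?v p}" by (rule pair_chain_subset[OF less.prems(4) subT])
      show "linear_on lt1 (fst ` {p \<in> U. 0 < ?u p})" by (rule linear_on_subset[OF less.prems(5) image_mono[OF subS]])
      show "linear_on lt2 (snd ` {p \<in> U. 0 < ?u p})" by (rule linear_on_subset[OF less.prems(6) image_mono[OF subS]])
      show "(\<Sum>p | p \<in> U \<and> fst p = a. ?u p) = (\<Sum>p | p \<in> U \<and> fst p = a. ?v p)" for a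
        unfolding marginal_upd[OF fin p0(1)] less.prems(7) ..
      show "(\<Sum>p | p \<in> U \<and> snd p = a. ?u p) = (\<Sum>p | p \<in> U \<and> snd p = a. ?v p)" for a
        unfolding marginal_upd[OF fin p0(1)] less.prems(8) ..
    qed
    then show ?thesis
    proof (intro ballI)
      fix p assume "\<forall>p\<in>U. ?u p = ?v p" "p \<in> U"
      then have "?u p = ?v p" by blast
      then show "u p = v p" by (cases "p = p0") simp_all
    qed
  qed
qed

text \<open>
  The north-west corner rule: put as much weight as possible on the pair of the least elements. This
  exhausts one of them, and what is left is a smaller problem.
\<close>

theorem chain_weights_exist:
  fixes f :: "'a \<Rightarrow> real" and g :: "'b \<Rightarrow> real"
  assumes "finite A" "finite B" "linear_on lt1 A" "linear_on lt2 B"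
    "\<And>a. a \<in> A \<Longrightarrow> 0 < f a" "\<And>b. b \<in> B \<Longrightarrow> 0 < g b" "sum f A = sum g B"
  shows "\<exists>D w. D \<subseteq> A \<times> B \<and> pair_chain lt1 lt2 D \<and> (\<forall>p\<in>D. 0 \<le> w p) \<and>
     (\<forall>a\<in>A. (\<Sum>p | p \<in> D \<and> fst p = a. w p) = f a) \<and> (\<forall>b\<in>B. (\<Sum>p | p \<in> D \<and> snd p = b. w p) = (g b :: real))"
  using assms
proof (induction "card A + card B" arbitrary: A B f g rule: less_induct)
  case less
  note fin = less.prems(1,2) and lin = less.prems(3,4) and pos = less.prems(5,6) and eq = less.prems(7)
  show ?case
  proof (cases "A = {} \<or> B = {}")
    case True
    have "A = {}"
    proof (rule ccontr)
      assume "A \<noteq> {}"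
      then have "0 < sum f A" using fin(1) pos(1) by (intro sum_pos) auto
      then show False using eq True \<open>A \<noteq> {}\<close> by simp
    qed
    moreover have "B = {}"
    proof (rule ccontr)
      assume "B \<noteq> {}"
      then have "0 < sum g B" using fin(2) pos(2) by (intro sum_pos) auto
      then show False using eq True \<open>B \<noteq> {}\<close> by simp
    qed
    ultimately show ?thesis by (intro exI[of _ "{}"]) (simp add: pair_chain_def)
  next
    case False
    obtain a where a: "a \<in> A" "\<forall>w\<in>A. w = a \<or> lt1 a w" using linear_on_min[OF fin(1) _ lin(1)] False by blast
    obtain b where b: "b \<in> B" "\<forall>w\<in>B. w = b \<or> lt2 b w" using linear_on_min[OF fin(2) _ lin(2)] False by blast
    define m where "m = min (f a) (g b)"
    define A' where "A' = (if f a \<le> g b then A - {a} else A)"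
    define B' where "B' = (if g b \<le> f a then B - {b} else B)"
    define f' where "f' = f(a := f a - m)"
    define g' where "g' = g(b := g b - m)"
    have sub: "A' \<subseteq> A" "B' \<subseteq> B" unfolding A'_def B'_def by auto
    have cA: "card A' + card B' < card A + card B"
    proof -
      have "f a \<le> g b \<or> g b \<le> f a" by linarith
      moreover have "card (A - {a}) < card A" "card (B - {b}) < card B" by (rule card_Diff1_less[OF fin(1) a(1)], rule card_Diff1_less[OF fin(2) b(1)])
      moreover have "card A' \<le> card A" "card B' \<le> card B" using sub fin card_mono by blast+
      ultimately show ?thesis unfolding A'_def B'_def by auto
    qed
    have mpos: "0 < m" using pos a(1) b(1) unfolding m_def by simp
    have sumA: "sum f' A' = sum f A - m"
    proof -
      have "sum f' A = (f a - m) + sum f (A - {a})" unfolding f'_def using a(1) fin(1)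
        by (simp add: sum.remove[of A a])
      also have "\<dots> = sum f A - m" using a(1) fin(1) by (simp add: sum.remove[of A a])
      finally have 1: "sum f' A = sum f A - m" .
      show ?thesis
      proof (cases "f a \<le> g b")
        case True
        then have "f' a = 0" unfolding f'_def m_def by simp
        then have "sum f' A = sum f' (A - {a})" using a(1) fin(1) by (simp add: sum.remove[of A a])
        then show ?thesis using 1 True unfolding A'_def by simp
      qed (use 1 in \<open>simp add: A'_def\<close>)
    qed
    have sumB: "sum g' B' = sum g B - m"
    proof -
      have "sum g' B = (g b - m) + sum g (B - {b})" unfolding g'_def using b(1) fin(2)
        by (simp add: sum.remove[of B b])
      also have "\<dots> = sum g B - m" using b(1) fin(2) by (simp add: sum.remove[of B b])
      finally have 1: "sum g' B = sum g B - m" .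
      show ?thesis
      proof (cases "g b \<le> f a")
        case True
        then have "g' b = 0" unfolding g'_def m_def by simp
        then have "sum g' B = sum g' (B - {b})" using b(1) fin(2) by (simp add: sum.remove[of B b])
        then show ?thesis using 1 True unfolding B'_def by simp
      qed (use 1 in \<open>simp add: B'_def\<close>)
    qed
    have posA: "0 < f' x" if "x \<in> A'" for x
      using that pos(1) sub(1) unfolding f'_def A'_def m_def by (auto split: if_splits)
    have posB: "0 < g' x" if "x \<in> B'" for x
      using that pos(2) sub(2) unfolding g'_def B'_def m_def by (auto split: if_splits)
    have "\<exists>D w. D \<subseteq> A' \<times> B' \<and> pair_chain lt1 lt2 D \<and> (\<forall>p\<in>D. 0 \<le> w p) \<and>
     (\<forall>a\<in>A'. (\<Sum>p | p \<in> D \<and> fst p = a. w p) = f' a) \<and> (\<forall>b\<in>B'. (\<Sum>p | p \<in> D \<and> snd p = b. w p) = g' b)"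
    proof (rule less.hyps[OF cA finite_subset[OF sub(1) fin(1)] finite_subset[OF sub(2) fin(2)]
          linear_on_subset[OF lin(1) sub(1)] linear_on_subset[OF lin(2) sub(2)]])
      show "sum f' A' = sum g' B'" using sumA sumB eq by simp
    qed (erule posA, erule posB)
    then obtain D w where D: "D \<subseteq> A' \<times> B'" "pair_chain lt1 lt2 D" "\<forall>p\<in>D. 0 \<le> w p"
       "\<forall>a\<in>A'. (\<Sum>p | p \<in> D \<and> fst p = a. w p) = f' a" "\<forall>b\<in>B'. (\<Sum>p | p \<in> D \<and> snd p = b. w p) = g' b"
      by blast
    have nD: "(a, b) \<notin> D"
    proof
      assume "(a, b) \<in> D"
      then have "a \<in> A'" "b \<in> B'" using D(1) by blast+
      then show False unfolding A'_def B'_def by (auto split: if_splits)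
    qed
    have finD: "finite D" 
      by (rule finite_subset[OF D(1) finite_cartesian_product[OF finite_subset[OF sub(1) fin(1)] finite_subset[OF sub(2) fin(2)]]])
    let ?D = "insert (a, b) D" and ?w = "w((a, b) := m)"
    have marg: "(\<Sum>p | p \<in> ?D \<and> h p = c. ?w p) = (\<Sum>p | p \<in> D \<and> h p = c. w p) + (if h (a, b) = c then m else 0)" for h :: "'a \<times> 'b \<Rightarrow> 'c" and c
    proof -
      have "(\<Sum>p | p \<in> D \<and> h p = c. ?w p) = (\<Sum>p | p \<in> D \<and> h p = c. w p)"
        by (rule sum.cong) (use nD in auto)
      moreover have "{p. p \<in> ?D \<and> h p = c} = (if h (a, b) = c then insert (a, b) {p. p \<in> D \<and> h p = c} else {p. p \<in> D \<and> h p = c})" by auto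
      ultimately show ?thesis using nD finD by simp
    qed
    have z1: "(\<Sum>p | p \<in> D \<and> fst p = x. w p) = f' x" if "x \<in> A" for x
    proof (cases "x \<in> A'")
      case False
      then have x: "x = a" "f a \<le> g b" using that unfolding A'_def by (auto split: if_splits)
      have "{p. p \<in> D \<and> fst p = x} = {}" using D(1) False by auto
      then have "(\<Sum>p | p \<in> D \<and> fst p = x. w p) = 0" by (simp only: sum.empty)
      moreover have "f' x = 0" using x unfolding f'_def m_def by simp
      ultimately show ?thesis by simp
    qed (use D(4) in blast)
    have z2: "(\<Sum>p | p \<in> D \<and> snd p = x. w p) = g' x" if "x \<in> B" for x
    proof (cases "x \<in> B'")
      case False
      then have x: "x = b" "g b \<le> f a" using that unfolding B'_def by (auto split: if_splits)
      have "{p. p \<in> D \<and> snd p = x} = {}" using D(1) False by auto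
      then have "(\<Sum>p | p \<in> D \<and> snd p = x. w p) = 0" by (simp only: sum.empty)
      moreover have "g' x = 0" using x unfolding g'_def m_def by simp
      ultimately show ?thesis by simp
    qed (use D(5) in blast)
    show ?thesis
    proof (intro exI[of _ ?D] exI[of _ ?w] conjI ballI)
      show "?D \<subseteq> A \<times> B" using D(1) sub a(1) b(1) by blast
      have le: "pair_le lt1 lt2 (a, b) p" if "p \<in> D" for p
      proof -
        have "p \<in> A' \<times> B'" using that D(1) by blast
        then have "fst p \<in> A'" "snd p \<in> B'" by (simp_all add: mem_Times_iff)
        then have "fst p \<in> A" "snd p \<in> B" using sub by (simp_all add: subsetD)
        then have "fst p = a \<or> lt1 a (fst p)" "snd p = b \<or> lt2 b (snd p)" using a(2) b(2) by blast+
        then show ?thesis unfolding pair_le_def by auto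
      qed
      have refl: "pair_le lt1 lt2 (a, b) (a, b)" by (simp add: pair_le_def)
      show "pair_chain lt1 lt2 ?D" unfolding pair_chain_def
      proof (intro ballI)
        fix p q assume "p \<in> ?D" "q \<in> ?D"
        then consider "p = (a, b)" "q = (a, b)" | "p = (a, b)" "q \<in> D" | "q = (a, b)" "p \<in> D" | "p \<in> D" "q \<in> D" by blast
        then show "pair_le lt1 lt2 p q \<or> pair_le lt1 lt2 q p"
          by cases (use le refl D(2) in \<open>auto simp: pair_chain_def\<close>)
      qed
      show "0 \<le> ?w p" if "p \<in> ?D" for p using that D(3) mpos by auto
      show "(\<Sum>p | p \<in> ?D \<and> fst p = x. ?w p) = f x" if "x \<in> A" for x
        unfolding marg z1[OF that] by (simp add: f'_def)
      show "(\<Sum>p | p \<in> ?D \<and> snd p = x. ?w p) = g x" if "x \<in> B" for x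
        unfolding marg z2[OF that] by (simp add: g'_def)
    qed
  qed
qed

section \<open>The staircase triangulation of a product\<close>

lemma sum_by_marginal:
  fixes g :: "'p \<Rightarrow> 'v::real_vector"
  assumes "finite U" "finite V" "g ` U \<subseteq> V"
  shows "(\<Sum>p\<in>U. w p *\<^sub>R g p) = (\<Sum>v\<in>V. (\<Sum>p | p \<in> U \<and> g p = v. w p) *\<^sub>R v)"
    and "sum w U = (\<Sum>v\<in>V. \<Sum>p | p \<in> U \<and> g p = v. w p)"
proof -
  have "(\<Sum>p\<in>U. w p *\<^sub>R g p) = (\<Sum>v\<in>V. \<Sum>p | p \<in> U \<and> g p = v. w p *\<^sub>R g p)"
    by (rule sum.group[symmetric, OF assms])
  also have "\<dots> = (\<Sum>v\<in>V. (\<Sum>p | p \<in> U \<and> g p = v. w p) *\<^sub>R v)"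
    unfolding scaleR_left.sum by (intro sum.cong refl) simp
  finally show "(\<Sum>p\<in>U. w p *\<^sub>R g p) = (\<Sum>v\<in>V. (\<Sum>p | p \<in> U \<and> g p = v. w p) *\<^sub>R v)" .
  show "sum w U = (\<Sum>v\<in>V. \<Sum>p | p \<in> U \<and> g p = v. w p)"
    by (rule sum.group[symmetric, OF assms])
qed

lemma affine_coords_unique:
  fixes W :: "'a::real_vector set"
  assumes "finite W" "\<not> affine_dependent W" "sum a W = sum b W" "(\<Sum>v\<in>W. a v *\<^sub>R v) = (\<Sum>v\<in>W. b v *\<^sub>R v)" "v \<in> W"
  shows "a v = b v"
proof (rule ccontr)
  assume "a v \<noteq> b v"
  then have "\<exists>U. sum U W = 0 \<and> (\<exists>v\<in>W. U v \<noteq> 0) \<and> (\<Sum>v\<in>W. U v *\<^sub>R v) = 0"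
    using assms(3-5) by (intro exI[of _ "\<lambda>v. a v - b v"]) (auto simp: sum_subtractf scaleR_left_diff_distrib)
  then show False using affine_dependent_explicit_finite[OF assms(1)] assms(2) by blast
qed

text \<open>
  Barycentric coordinates do not depend on the simplex used to compute them: both simplices can be
  replaced by their common face.
\<close>

lemma geometric_coords_unique:
  assumes \<Delta>: "geometric \<Delta>" and W: "W \<in> \<Delta>" "W' \<in> \<Delta>" and V: "finite V" "W \<subseteq> V" "W' \<subseteq> V"
    and nn: "\<And>v. 0 \<le> a v" "\<And>v. 0 \<le> b v" and z: "\<And>v. v \<notin> W \<Longrightarrow> a v = 0" "\<And>v. v \<notin> W' \<Longrightarrow> b v = 0"
    and s: "sum a V = 1" "sum b V = 1" and eq: "(\<Sum>v\<in>V. a v *\<^sub>R v) = (\<Sum>v\<in>V. b v *\<^sub>R v)"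
  shows "a v = b v"
proof -
  have fin: "finite W" "finite W'" using W geometricD(2)[OF \<Delta>] by blast+
  have ind: "\<not> affine_dependent W" "\<not> affine_dependent W'" using W geometricD(3)[OF \<Delta>] by blast+
  let ?x = "\<Sum>v\<in>V. a v *\<^sub>R v"
  have aW: "sum a W = 1" "(\<Sum>v\<in>W. a v *\<^sub>R v) = ?x"
    using sum.mono_neutral_left[OF V(1,2), of a] sum.mono_neutral_left[OF V(1,2), of "\<lambda>v. a v *\<^sub>R v"] z(1) s(1) by auto
  have bW: "sum b W' = 1" "(\<Sum>v\<in>W'. b v *\<^sub>R v) = ?x"
    using sum.mono_neutral_left[OF V(1,3), of b] sum.mono_neutral_left[OF V(1,3), of "\<lambda>v. b v *\<^sub>R v"] z(2) s(2) eq by auto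
  have "?x \<in> convex hull W" unfolding convex_hull_finite[OF fin(1)] using aW nn(1) by blast
  moreover have "?x \<in> convex hull W'" unfolding convex_hull_finite[OF fin(2)] using bW nn(2) by blast
  ultimately have "?x \<in> convex hull (W \<inter> W')" by (rule geometricD(5)[OF \<Delta> W])
  moreover have fi: "finite (W \<inter> W')" using fin by simp
  ultimately obtain c where c: "sum c (W \<inter> W') = 1" "(\<Sum>v\<in>W \<inter> W'. c v *\<^sub>R v) = ?x"
    unfolding convex_hull_finite[OF fi] by blast
  define c' where "c' v = (if v \<in> W \<inter> W' then c v else 0)" for v
  have restrict: "sum c' U = 1" "(\<Sum>v\<in>U. c' v *\<^sub>R v) = ?x" if U: "finite U" "W \<inter> W' \<subseteq> U" for U
  proof -
    have "sum c' U = sum c' (W \<inter> W')" by (rule sum.mono_neutral_right[OF U]) (auto simp: c'_def)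
    also have "\<dots> = sum c (W \<inter> W')" by (rule sum.cong) (simp_all add: c'_def)
    finally show "sum c' U = 1" using c(1) by simp
    have "(\<Sum>v\<in>U. c' v *\<^sub>R v) = (\<Sum>v\<in>W \<inter> W'. c' v *\<^sub>R v)" by (rule sum.mono_neutral_right[OF U]) (auto simp: c'_def)
    also have "\<dots> = (\<Sum>v\<in>W \<inter> W'. c v *\<^sub>R v)" by (rule sum.cong) (simp_all add: c'_def)
    finally show "(\<Sum>v\<in>U. c' v *\<^sub>R v) = ?x" using c(2) by simp
  qed
  note cW = restrict[OF fin(1) Int_lower1] and cW' = restrict[OF fin(2) Int_lower2]
  have "a v = c' v"
  proof (cases "v \<in> W")
    case True
    show ?thesis by (rule affine_coords_unique[OF fin(1) ind(1) _ _ True]) (simp_all add: aW cW)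
  qed (simp add: z(1) c'_def)
  moreover have "b v = c' v"
  proof (cases "v \<in> W'")
    case True
    show ?thesis by (rule affine_coords_unique[OF fin(2) ind(2) _ _ True]) (simp_all add: bW cW')
  qed (simp add: z(2) c'_def)
  ultimately show ?thesis by simp
qed

definition chain_complex :: "('a \<Rightarrow> 'a \<Rightarrow> bool) \<Rightarrow> 'a set set \<Rightarrow> ('b \<Rightarrow> 'b \<Rightarrow> bool) \<Rightarrow> 'b set set \<Rightarrow> ('a \<times> 'b) set set" where
  "chain_complex lt1 \<Delta>1 lt2 \<Delta>2 = {C. finite C \<and> fst ` C \<in> \<Delta>1 \<and> snd ` C \<in> \<Delta>2 \<and> pair_chain lt1 lt2 C}"

lemma fst_sum_scaleR: "fst (\<Sum>p\<in>U. w p *\<^sub>R p) = (\<Sum>p\<in>U. w p *\<^sub>R fst p)"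
  and snd_sum_scaleR: "snd (\<Sum>p\<in>U. w p *\<^sub>R p) = (\<Sum>p\<in>U. w p *\<^sub>R snd p)"
  for w :: "'a::real_vector \<times> 'b::real_vector \<Rightarrow> real"
  by (simp_all add: fst_sum snd_sum)

text \<open>
  A projection of a convex combination of a chain is a convex combination of the vertices of a
  simplex below, so its coefficients, the marginals, are determined by the point.
\<close>

lemma marginals_eq:
  fixes C :: "'p set" and g :: "'p \<Rightarrow> 'v::euclidean_space"
  assumes \<Delta>: "geometric \<Delta>" and C: "finite C" "finite C'" "g ` C \<in> \<Delta>" "g ` C' \<in> \<Delta>"
    and u: "\<And>p. 0 \<le> u p" "\<And>p. p \<notin> C \<Longrightarrow> u p = 0" "sum u (C \<union> C') = 1"
    and v: "\<And>p. 0 \<le> v p" "\<And>p. p \<notin> C' \<Longrightarrow> v p = 0" "sum v (C \<union> C') = 1"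
    and eq: "(\<Sum>p\<in>C \<union> C'. u p *\<^sub>R g p) = (\<Sum>p\<in>C \<union> C'. v p *\<^sub>R g p)"
  shows "(\<Sum>p | p \<in> C \<union> C' \<and> g p = a. u p) = (\<Sum>p | p \<in> C \<union> C' \<and> g p = a. v p)"
proof -
  let ?U = "C \<union> C'" and ?V = "g ` C \<union> g ` C'"
  have fU: "finite ?U" "finite ?V" "g ` ?U \<subseteq> ?V" using C(1,2) by auto
  show ?thesis
  proof (rule geometric_coords_unique[OF \<Delta> C(3,4) fU(2), where a = "\<lambda>a. \<Sum>p | p \<in> ?U \<and> g p = a. u p" and b = "\<lambda>a. \<Sum>p | p \<in> ?U \<and> g p = a. v p"])
    show "0 \<le> (\<Sum>p | p \<in> ?U \<and> g p = x. u p)" "0 \<le> (\<Sum>p | p \<in> ?U \<and> g p = x. v p)" for x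
      using u(1) v(1) by (simp_all add: sum_nonneg)
    show "(\<Sum>p | p \<in> ?U \<and> g p = x. u p) = 0" if "x \<notin> g ` C" for x
      by (rule sum.neutral) (use that u(2) in auto)
    show "(\<Sum>p | p \<in> ?U \<and> g p = x. v p) = 0" if "x \<notin> g ` C'" for x
      by (rule sum.neutral) (use that v(2) in auto)
    show "(\<Sum>x\<in>?V. \<Sum>p | p \<in> ?U \<and> g p = x. u p) = 1" using sum_by_marginal(2)[OF fU, of u] u(3) by simp
    show "(\<Sum>x\<in>?V. \<Sum>p | p \<in> ?U \<and> g p = x. v p) = 1" using sum_by_marginal(2)[OF fU, of v] v(3) by simp
    show "(\<Sum>x\<in>?V. (\<Sum>p | p \<in> ?U \<and> g p = x. u p) *\<^sub>R x) = (\<Sum>x\<in>?V. (\<Sum>p | p \<in> ?U \<and> g p = x. v p) *\<^sub>R x)"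
      using sum_by_marginal(1)[OF fU, of u] sum_by_marginal(1)[OF fU, of v] eq by simp
  qed auto
qed

theorem chain_complex_coords_unique:
  assumes \<Delta>: "geometric \<Delta>1" "geometric \<Delta>2" and lin: "\<And>W. W \<in> \<Delta>1 \<Longrightarrow> linear_on lt1 W" "\<And>W. W \<in> \<Delta>2 \<Longrightarrow> linear_on lt2 W"
    and C: "C \<in> chain_complex lt1 \<Delta>1 lt2 \<Delta>2" "C' \<in> chain_complex lt1 \<Delta>1 lt2 \<Delta>2"
    and u: "\<And>p. 0 \<le> u p" "\<And>p. p \<notin> C \<Longrightarrow> u p = 0" "sum u C = 1"
    and v: "\<And>p. 0 \<le> v p" "\<And>p. p \<notin> C' \<Longrightarrow> v p = 0" "sum v C' = 1"
    and eq: "(\<Sum>p\<in>C. u p *\<^sub>R p) = (\<Sum>p\<in>C'. v p *\<^sub>R p)"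
  shows "u p = v p"
proof -
  let ?U = "C \<union> C'"
  have Cs: "finite C" "fst ` C \<in> \<Delta>1" "snd ` C \<in> \<Delta>2" "pair_chain lt1 lt2 C"
    and Cs': "finite C'" "fst ` C' \<in> \<Delta>1" "snd ` C' \<in> \<Delta>2" "pair_chain lt1 lt2 C'"
    using C unfolding chain_complex_def by blast+
  have fU: "finite ?U" using Cs(1) Cs'(1) by simp
  have su: "sum u ?U = 1" and sv: "sum v ?U = 1"
    using sum.mono_neutral_left[OF fU, of C u] sum.mono_neutral_left[OF fU, of C' v] u(2,3) v(2,3) by auto
  have eu: "(\<Sum>p\<in>?U. u p *\<^sub>R p) = (\<Sum>p\<in>?U. v p *\<^sub>R p)"
    using sum.mono_neutral_left[OF fU, of C "\<lambda>p. u p *\<^sub>R p"] sum.mono_neutral_left[OF fU, of C' "\<lambda>p. v p *\<^sub>R p"] u(2) v(2) eq by auto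
  have e1: "(\<Sum>p\<in>?U. u p *\<^sub>R fst p) = (\<Sum>p\<in>?U. v p *\<^sub>R fst p)" using arg_cong[OF eu, of fst] by (simp only: fst_sum_scaleR)
  have e2: "(\<Sum>p\<in>?U. u p *\<^sub>R snd p) = (\<Sum>p\<in>?U. v p *\<^sub>R snd p)" using arg_cong[OF eu, of snd] by (simp only: snd_sum_scaleR)
  have subu: "{p \<in> ?U. 0 < u p} \<subseteq> C" and subv: "{p \<in> ?U. 0 < v p} \<subseteq> C'" using u(2) v(2) by force+
  have "\<forall>p\<in>?U. u p = v p"
  proof (rule chain_weights_unique[OF fU])
    show "pair_chain lt1 lt2 {p \<in> ?U. 0 < u p}" by (rule pair_chain_subset[OF Cs(4) subu])
    show "pair_chain lt1 lt2 {p \<in> ?U. 0 < v p}" by (rule pair_chain_subset[OF Cs'(4) subv])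
    show "linear_on lt1 (fst ` {p \<in> ?U. 0 < u p})" by (rule linear_on_subset[OF lin(1)[OF Cs(2)] image_mono[OF subu]])
    show "linear_on lt2 (snd ` {p \<in> ?U. 0 < u p})" by (rule linear_on_subset[OF lin(2)[OF Cs(3)] image_mono[OF subu]])
    show "(\<Sum>p | p \<in> ?U \<and> fst p = a. u p) = (\<Sum>p | p \<in> ?U \<and> fst p = a. v p)" for a
      by (rule marginals_eq[OF \<Delta>(1) Cs(1) Cs'(1) Cs(2) Cs'(2) u(1,2) su v(1,2) sv e1])
    show "(\<Sum>p | p \<in> ?U \<and> snd p = a. u p) = (\<Sum>p | p \<in> ?U \<and> snd p = a. v p)" for a
      by (rule marginals_eq[OF \<Delta>(2) Cs(1) Cs'(1) Cs(3) Cs'(3) u(1,2) su v(1,2) sv e2])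
  qed (rule u(1), rule v(1))
  then show ?thesis using u(2) v(2) by (cases "p \<in> ?U") auto
qed

text \<open>
  Two chain simplices meet in a common face because the coordinates of a point with respect to them
  have equal marginals and hence are equal.
\<close>

theorem chain_complex_geometric:
  assumes \<Delta>: "geometric \<Delta>1" "geometric \<Delta>2" and lin: "\<And>W. W \<in> \<Delta>1 \<Longrightarrow> linear_on lt1 W" "\<And>W. W \<in> \<Delta>2 \<Longrightarrow> linear_on lt2 W"
  shows "geometric (chain_complex lt1 \<Delta>1 lt2 \<Delta>2)" (is "geometric ?D")
  unfolding geometric_def
proof (intro conjI ballI allI impI)
  have "?D \<subseteq> Pow (\<Union>\<Delta>1 \<times> \<Union>\<Delta>2)"
  proof
    fix C assume "C \<in> ?D"
    then have i: "fst ` C \<in> \<Delta>1" "snd ` C \<in> \<Delta>2" unfolding chain_complex_def by blast+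
    have "C \<subseteq> fst ` C \<times> snd ` C" by force
    also have "\<dots> \<subseteq> \<Union>\<Delta>1 \<times> \<Union>\<Delta>2" by (rule Sigma_mono) (use i in blast)+
    finally show "C \<in> Pow (\<Union>\<Delta>1 \<times> \<Union>\<Delta>2)" by blast
  qed
  moreover have "finite (\<Union>\<Delta>1)" "finite (\<Union>\<Delta>2)" using geometricD(1,2)[OF \<Delta>(1)] geometricD(1,2)[OF \<Delta>(2)] by auto
  then have "finite (Pow (\<Union>\<Delta>1 \<times> \<Union>\<Delta>2))" by simp
  ultimately show "finite ?D" by (rule finite_subset)
next
  fix C assume C: "C \<in> ?D"
  then show "finite C" unfolding chain_complex_def by blast
  show "\<not> affine_dependent C"
  proof
    assume "affine_dependent C"
    then obtain U p where U: "sum U C = 0" "p \<in> C" "U p \<noteq> 0" "(\<Sum>v\<in>C. U v *\<^sub>R v) = 0"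
      using affine_dependent_explicit_finite[OF \<open>finite C\<close>] by blast
    define P where "P q = (if q \<in> C then max (U q) 0 else 0)" for q
    define N where "N q = (if q \<in> C then max (- U q) 0 else 0)" for q
    have PN: "P q - N q = U q" if "q \<in> C" for q using that by (auto simp: P_def N_def)
    have nn: "0 \<le> P q" "0 \<le> N q" for q by (auto simp: P_def N_def)
    have sPN: "sum P C = sum N C"
    proof -
      have "sum P C - sum N C = sum U C" unfolding sum_subtractf[symmetric] by (rule sum.cong) (use PN in auto)
      then show ?thesis using U(1) by simp
    qed
    have xPN: "(\<Sum>q\<in>C. P q *\<^sub>R q) = (\<Sum>q\<in>C. N q *\<^sub>R q)"
    proof -
      have "(\<Sum>q\<in>C. P q *\<^sub>R q) - (\<Sum>q\<in>C. N q *\<^sub>R q) = (\<Sum>q\<in>C. U q *\<^sub>R q)"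
        unfolding sum_subtractf[symmetric] by (rule sum.cong) (use PN in \<open>auto simp: scaleR_left_diff_distrib[symmetric]\<close>)
      then show ?thesis using U(4) by simp
    qed
    have pos: "0 < sum P C"
    proof -
      have "P p \<noteq> 0 \<or> N p \<noteq> 0" using PN[OF U(2)] U(3) by auto
      then have "0 < P p \<or> 0 < N p" using nn(1)[of p] nn(2)[of p] by linarith
      then have "0 < sum P C \<or> 0 < sum N C"
      proof
        assume "0 < P p"
        then have "0 < sum P C" by (rule sum_pos2[OF \<open>finite C\<close> U(2) _ nn(1)])
        then show ?thesis ..
      next
        assume "0 < N p"
        then have "0 < sum N C" by (rule sum_pos2[OF \<open>finite C\<close> U(2) _ nn(2)])
        then show ?thesis ..
      qed
      then show ?thesis using sPN by simp
    qed
    define s where "s = sum P C"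
    have "P p / s = N p / s"
    proof (rule chain_complex_coords_unique[OF \<Delta> lin C C, where u = "\<lambda>q. P q / s" and v = "\<lambda>q. N q / s"])
      show "sum (\<lambda>q. P q / s) C = 1" "sum (\<lambda>q. N q / s) C = 1"
        using pos sPN by (simp_all add: s_def flip: sum_divide_distrib)
      have "(\<Sum>q\<in>C. (P q / s) *\<^sub>R q) = (1 / s) *\<^sub>R (\<Sum>q\<in>C. P q *\<^sub>R q)" by (simp add: scaleR_sum_right)
      moreover have "(\<Sum>q\<in>C. (N q / s) *\<^sub>R q) = (1 / s) *\<^sub>R (\<Sum>q\<in>C. N q *\<^sub>R q)" by (simp add: scaleR_sum_right)
      ultimately show "(\<Sum>q\<in>C. (P q / s) *\<^sub>R q) = (\<Sum>q\<in>C. (N q / s) *\<^sub>R q)" using xPN by simp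
    qed (use nn pos in \<open>auto simp: s_def P_def N_def\<close>)
    then have "P p = N p" using pos by (simp add: s_def)
    then show False using PN[OF U(2)] U(3) by simp
  qed
next
  fix C B assume C: "C \<in> ?D" and B: "B \<subseteq> C"
  have "fst ` B \<in> \<Delta>1" using geometricD(4)[OF \<Delta>(1) _ image_mono[OF B]] C unfolding chain_complex_def by blast
  moreover have "snd ` B \<in> \<Delta>2" using geometricD(4)[OF \<Delta>(2) _ image_mono[OF B]] C unfolding chain_complex_def by blast
  moreover have "finite B" using C B finite_subset unfolding chain_complex_def by blast
  moreover have "pair_chain lt1 lt2 B" using C pair_chain_subset[OF _ B] unfolding chain_complex_def by blast
  ultimately show "B \<in> ?D" unfolding chain_complex_def by blast
next
  fix C B assume C: "C \<in> ?D" and B: "B \<in> ?D"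
  have fin: "finite C" "finite B" using C B unfolding chain_complex_def by blast+
  show "convex hull C \<inter> convex hull B \<subseteq> convex hull (C \<inter> B)"
  proof
    fix x assume x: "x \<in> convex hull C \<inter> convex hull B"
    obtain u where u: "\<forall>p\<in>C. 0 \<le> u p" "sum u C = 1" "(\<Sum>p\<in>C. u p *\<^sub>R p) = x"
      using x unfolding convex_hull_finite[OF fin(1)] by blast
    obtain v where v: "\<forall>p\<in>B. 0 \<le> v p" "sum v B = 1" "(\<Sum>p\<in>B. v p *\<^sub>R p) = x"
      using x unfolding convex_hull_finite[OF fin(2)] by blast
    define u' where "u' p = (if p \<in> C then u p else 0)" for p
    define v' where "v' p = (if p \<in> B then v p else 0)" for p
    have uC: "sum u' C = 1" "(\<Sum>p\<in>C. u' p *\<^sub>R p) = x" using u by (simp_all add: u'_def)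
    have vB: "sum v' B = 1" "(\<Sum>p\<in>B. v' p *\<^sub>R p) = x" using v by (simp_all add: v'_def)
    have nn: "0 \<le> u' p" "0 \<le> v' p" for p using u(1) v(1) by (simp_all add: u'_def v'_def)
    have eq: "u' p = v' p" for p
      by (rule chain_complex_coords_unique[OF \<Delta> lin C B, where u = u' and v = v'])
        (use nn uC vB in \<open>simp_all add: u'_def v'_def\<close>)
    have z: "u' p = 0" if "p \<in> C - C \<inter> B" for p
    proof -
      have "v' p = 0" using that by (simp add: v'_def)
      then show ?thesis using eq by simp
    qed
    have "sum u' (C \<inter> B) = 1" "(\<Sum>p\<in>C \<inter> B. u' p *\<^sub>R p) = x"
      using sum.mono_neutral_right[OF fin(1), of "C \<inter> B" u'] sum.mono_neutral_right[OF fin(1), of "C \<inter> B" "\<lambda>p. u' p *\<^sub>R p"] z uC by auto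
    moreover have "finite (C \<inter> B)" using fin by simp
    ultimately show "x \<in> convex hull (C \<inter> B)" using nn(1) unfolding convex_hull_finite[OF \<open>finite (C \<inter> B)\<close>] by blast
  qed
qed

lemma chain_hull_exists:
  assumes fin: "finite A" "finite B" and lin: "linear_on lt1 A" "linear_on lt2 B"
    and x: "fst p \<in> convex hull A" "snd p \<in> convex hull B"
  shows "\<exists>D\<subseteq>A \<times> B. pair_chain lt1 lt2 D \<and> p \<in> convex hull D"
proof -
  obtain f where f: "\<forall>a\<in>A. 0 \<le> f a" "sum f A = 1" "(\<Sum>a\<in>A. f a *\<^sub>R a) = fst p"
    using x(1) unfolding convex_hull_finite[OF fin(1)] by blast
  obtain g where g: "\<forall>b\<in>B. 0 \<le> g b" "sum g B = 1" "(\<Sum>b\<in>B. g b *\<^sub>R b) = snd p"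
    using x(2) unfolding convex_hull_finite[OF fin(2)] by blast
  let ?A = "{a \<in> A. 0 < f a}" and ?B = "{b \<in> B. 0 < g b}"
  have zA: "f a = 0" if "a \<in> A - ?A" for a
  proof -
    have "a \<in> A" "\<not> 0 < f a" using that by simp_all
    then show ?thesis using f(1) by (metis less_eq_real_def)
  qed
  have zA': "\<forall>a\<in>A - ?A. f a = 0" "\<forall>a\<in>A - ?A. f a *\<^sub>R a = 0" using zA by simp_all
  have subA: "?A \<subseteq> A" by blast
  have sA: "sum f ?A = 1" "(\<Sum>a\<in>?A. f a *\<^sub>R a) = fst p"
    using sum.mono_neutral_right[OF fin(1) subA zA'(1)] sum.mono_neutral_right[OF fin(1) subA zA'(2)] f(2,3)
    by simp_all
  have zB: "g b = 0" if "b \<in> B - ?B" for b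
  proof -
    have "b \<in> B" "\<not> 0 < g b" using that by simp_all
    then show ?thesis using g(1) by (metis less_eq_real_def)
  qed
  have zB': "\<forall>b\<in>B - ?B. g b = 0" "\<forall>b\<in>B - ?B. g b *\<^sub>R b = 0" using zB by simp_all
  have subB: "?B \<subseteq> B" by blast
  have sB: "sum g ?B = 1" "(\<Sum>b\<in>?B. g b *\<^sub>R b) = snd p"
    using sum.mono_neutral_right[OF fin(2) subB zB'(1)] sum.mono_neutral_right[OF fin(2) subB zB'(2)] g(2,3)
    by simp_all
  have finAB: "finite ?A" "finite ?B" using fin by simp_all
  have "\<exists>D w. D \<subseteq> ?A \<times> ?B \<and> pair_chain lt1 lt2 D \<and> (\<forall>p\<in>D. 0 \<le> w p) \<and>
     (\<forall>a\<in>?A. (\<Sum>p | p \<in> D \<and> fst p = a. w p) = f a) \<and> (\<forall>b\<in>?B. (\<Sum>p | p \<in> D \<and> snd p = b. w p) = g b)"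
    by (rule chain_weights_exist[OF finAB linear_on_subset[OF lin(1)] linear_on_subset[OF lin(2)]]) (use sA(1) sB(1) in simp_all)
  then obtain D w where D: "D \<subseteq> ?A \<times> ?B" "pair_chain lt1 lt2 D" "\<forall>p\<in>D. 0 \<le> w p"
     "\<forall>a\<in>?A. (\<Sum>p | p \<in> D \<and> fst p = a. w p) = f a" "\<forall>b\<in>?B. (\<Sum>p | p \<in> D \<and> snd p = b. w p) = g b" by blast
  have finD: "finite D" by (rule finite_subset[OF D(1)]) (use finAB in simp)
  have im: "fst ` D \<subseteq> ?A" "snd ` D \<subseteq> ?B" using D(1) by auto
  have "sum w D = 1" using sum_by_marginal(2)[OF finD finAB(1) im(1), of w] D(4) sA(1) by simp
  moreover have "(\<Sum>q\<in>D. w q *\<^sub>R q) = p"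
  proof (rule prod_eqI)
    show "fst (\<Sum>q\<in>D. w q *\<^sub>R q) = fst p"
      unfolding fst_sum_scaleR sum_by_marginal(1)[OF finD finAB(1) im(1)] using D(4) sA(2) by simp
    show "snd (\<Sum>q\<in>D. w q *\<^sub>R q) = snd p"
      unfolding snd_sum_scaleR sum_by_marginal(1)[OF finD finAB(2) im(2)] using D(5) sB(2) by simp
  qed
  ultimately have "p \<in> convex hull D" unfolding convex_hull_finite[OF finD] using D(3) by blast
  moreover have "D \<subseteq> A \<times> B" using D(1) by blast
  ultimately show ?thesis using D(2) by blast
qed

lemma fst_hull: "fst ` (convex hull C) = convex hull (fst ` C)"
  and snd_hull: "snd ` (convex hull C) = convex hull (snd ` C)"
  by (simp_all add: convex_hull_linear_image linear_fst linear_snd)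

section \<open>Tiles through vertex sets\<close>

definition hull_tile :: "'a::euclidean_space cell \<Rightarrow> 'a tile" where
  "hull_tile t = (case t of (W, R, M) \<Rightarrow> Tile (convex hull W) ((\<lambda>r. convex hull (W - {r})) ` R) (convex hull M))"

lemma aff_dim_hull_independent:
  fixes W :: "'a::euclidean_space set"
  assumes "\<not> affine_dependent W"
  shows "aff_dim (convex hull W) = int (card W) - 1"
  using aff_dim_affine_independent[OF assms] by (simp add: aff_dim_convex_hull)

lemma tile_dim_hull_tile:
  assumes "\<not> affine_dependent W"
  shows "tile_dim (hull_tile (W, R, M)) = int (card W) - 1"
  using aff_dim_hull_independent[OF assms] by (simp add: tile_dim_def hull_tile_def)

lemma inj_on_opposite_facet:
  fixes W :: "'a::euclidean_space set"
  assumes "\<not> affine_dependent W"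
  shows "inj_on (\<lambda>r. convex hull (W - {r})) W"
proof (rule inj_onI)
  fix r r' assume r: "r \<in> W" "r' \<in> W" "convex hull (W - {r}) = convex hull (W - {r'})"
  then have "W - {r} = W - {r'}" using hull_eq_iff[OF assms, of "W - {r}" "W - {r'}"] by blast
  then show "r = r'" using r by blast
qed

lemma tile_order_hull_tile:
  assumes "\<not> affine_dependent W" "R \<subseteq> W"
  shows "tile_order (hull_tile (W, R, M)) = card R"
  using card_image[OF inj_on_subset[OF inj_on_opposite_facet[OF assms(1)] assms(2)]]
  by (simp add: tile_order_def hull_tile_def)

lemma morse_tile_hull_tile:
  fixes W :: "'a::euclidean_space set"
  assumes W: "\<not> affine_dependent W" and v: "valid_tile W R M"
  shows "morse_tile (hull_tile (W, R, M))"
proof -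
  have fin: "finite W" "W \<noteq> {}" "R \<subseteq> W" "M \<subseteq> W" and M: "M \<noteq> {} \<Longrightarrow> R \<noteq> {} \<and> R \<subseteq> M \<and> card M + 2 \<le> card W"
    using v unfolding valid_tile_def by blast+
  have c: "1 \<le> card W" using fin by (simp add: Suc_leI card_gt_0_iff)
  have sx: "(int (card W) - 1) simplex convex hull W" using W by (intro simplex_convex_hull) simp
  have face: "convex hull U face_of convex hull W" if "U \<subseteq> W" for U
    using that face_of_convex_hull_affine_independent[OF W] by blast
  have "convex hull (W - {r}) \<in> facets (convex hull W)" if r: "r \<in> W" for r
  proof -
    have "\<not> affine_dependent (W - {r})" using affine_independent_subset[OF W] by blast
    then have "aff_dim (convex hull (W - {r})) = int (card (W - {r})) - 1" by (rule aff_dim_hull_independent)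
    also have "\<dots> = aff_dim (convex hull W) - 1" unfolding aff_dim_hull_independent[OF W]
      using r fin c by (simp add: card_Diff_singleton of_nat_diff)
    finally show ?thesis using face[of "W - {r}"] unfolding facets_def by blast
  qed
  then have rf: "removed_facets (hull_tile (W, R, M)) \<subseteq> facets (convex hull W)"
    using fin(3) by (auto simp: hull_tile_def)
  have "1 \<le> tile_order (hull_tile (W, R, M)) \<and> convex hull M face_of convex hull W \<and>
      aff_dim (convex hull M) \<le> tile_dim (hull_tile (W, R, M)) - 2 \<and>
      (\<forall>F\<in>(\<lambda>r. convex hull (W - {r})) ` R. \<not> convex hull M \<subseteq> F)" if ne: "convex hull M \<noteq> {}"
  proof -
    have "M \<noteq> {}" using ne by auto
    note M' = M[OF this]
    have "finite R" using fin(1,3) finite_subset by blast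
    then have "1 \<le> card R" using M' by (simp add: Suc_leI card_gt_0_iff)
    moreover have "aff_dim (convex hull M) = int (card M) - 1"
      by (rule aff_dim_hull_independent[OF affine_independent_subset[OF W fin(4)]])
    moreover have "\<not> convex hull M \<subseteq> convex hull (W - {r})" if "r \<in> R" for r
      using hull_subset_iff[OF W fin(4), of "W - {r}"] that M' by blast
    ultimately show ?thesis using face[OF fin(4)] M'
      by (auto simp: tile_order_hull_tile[OF W fin(3)] tile_dim_hull_tile[OF W])
  qed
  then show ?thesis using sx rf c unfolding morse_tile_def
    by (auto simp: hull_tile_def intro!: exI[of _ "int (card W) - 1"])
qed

lemma morse_tile_cell:
  fixes t :: "'a::euclidean_space tile"
  assumes t: "morse_tile t"
  shows "\<exists>W R M. \<not> affine_dependent W \<and> valid_tile W R M \<and> t = hull_tile (W, R, M)"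
proof -
  obtain n where n: "0 \<le> n" "n simplex tile_simplex t" using t unfolding morse_tile_def by blast
  obtain W where W: "\<not> affine_dependent W" "int (card W) = n + 1" "tile_simplex t = convex hull W"
    using n(2) unfolding simplex_def by blast
  have fin: "finite W" using W(1) aff_independent_finite by blast
  have ne: "W \<noteq> {}" using W(2) n(1) by auto
  have face: "F face_of convex hull W \<longleftrightarrow> (\<exists>c\<subseteq>W. F = convex hull c)" for F
    using face_of_convex_hull_affine_independent[OF W(1)] by blast
  have dim: "aff_dim (convex hull U) = int (card U) - 1" if "U \<subseteq> W" for U
    by (rule aff_dim_hull_independent[OF affine_independent_subset[OF W(1) that]])
  define R where "R = {r \<in> W. convex hull (W - {r}) \<in> removed_facets t}"
  have rf: "removed_facets t = (\<lambda>r. convex hull (W - {r})) ` R"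
  proof
    show "removed_facets t \<subseteq> (\<lambda>r. convex hull (W - {r})) ` R"
    proof
      fix F assume F: "F \<in> removed_facets t"
      then have "F \<in> facets (convex hull W)" using t W(3) unfolding morse_tile_def by auto
      then have "F face_of convex hull W" "aff_dim F = aff_dim (convex hull W) - 1" by (simp_all add: facets_def)
      then obtain c where c: "c \<subseteq> W" "F = convex hull c" "aff_dim F = aff_dim (convex hull W) - 1" using face by blast
      then have "int (card c) + 1 = int (card W)" using dim[OF c(1)] dim[OF order_refl] by simp
      then have "card (W - c) = 1" using c(1) fin card_Diff_subset[of c W] finite_subset by fastforce
      then obtain r where "W - c = {r}" by (auto simp: card_Suc_eq numeral_eq_Suc)
      then have "r \<in> W" "c = W - {r}" using c(1) by blast+
      then show "F \<in> (\<lambda>r. convex hull (W - {r})) ` R" using F c(2) unfolding R_def by blast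
    qed
  qed (auto simp: R_def)
  obtain M where M: "M \<subseteq> W" "morse_face t = convex hull M"
  proof (cases "morse_face t = {}")
    case True
    then show ?thesis using that[of "{}"] by simp
  next
    case False
    then have "morse_face t face_of convex hull W" using t W(3) unfolding morse_tile_def by auto
    then show ?thesis using face that by blast
  qed
  have "R \<noteq> {} \<and> R \<subseteq> M \<and> card M + 2 \<le> card W" if "M \<noteq> {}"
  proof -
    have "morse_face t \<noteq> {}" using M that by simp
    then have m: "1 \<le> tile_order t" "aff_dim (morse_face t) \<le> tile_dim t - 2" "\<forall>F\<in>removed_facets t. \<not> morse_face t \<subseteq> F"
      using t unfolding morse_tile_def by blast+
    have "R \<noteq> {}" using m(1) rf unfolding tile_order_def by auto
    moreover have "R \<subseteq> M"
    proof
      fix r assume r: "r \<in> R"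
      then have "\<not> convex hull M \<subseteq> convex hull (W - {r})" using m(3) rf M(2) by auto
      then have "\<not> M \<subseteq> W - {r}" using hull_mono by blast
      then show "r \<in> M" using M(1) by blast
    qed
    moreover have "card M + 2 \<le> card W" using m(2) dim[OF M(1)] dim[OF order_refl] M(2) W(3) by (simp add: tile_dim_def)
    ultimately show ?thesis by blast
  qed
  then have "valid_tile W R M" using fin ne M(1) unfolding valid_tile_def R_def by blast
  moreover have "t = hull_tile (W, R, M)" using rf M(2) W(3) by (cases t) (simp add: hull_tile_def)
  ultimately show ?thesis using W(1) by blast
qed

lemma critical_of_index_hull_tile:
  fixes W :: "'a::euclidean_space set"
  assumes W: "\<not> affine_dependent W" and v: "valid_tile W R M"
  shows "critical_of_index (hull_tile (W, R, M)) k \<longleftrightarrow> critical_tile W R M k"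
proof -
  have fin: "finite W" "W \<noteq> {}" "R \<subseteq> W" "M \<subseteq> W" and M: "M \<noteq> {} \<Longrightarrow> R \<noteq> {} \<and> R \<subseteq> M \<and> card M + 2 \<le> card W"
    using v unfolding valid_tile_def by blast+
  have finR: "finite R" "finite M" using fin finite_subset by blast+
  have dM: "aff_dim (convex hull M) = int (card M) - 1"
    by (rule aff_dim_hull_independent[OF affine_independent_subset[OF W fin(4)]])
  have c: "1 \<le> card W" using fin by (simp add: Suc_leI card_gt_0_iff)
  have mf: "morse_face (hull_tile (W, R, M)) = convex hull M" by (simp add: hull_tile_def)
  have 1: "card R = 0 \<longleftrightarrow> R = {}" using finR by simp
  have 2: "int (card R) = int (card W) - 1 + 1 \<and> int k = int (card W) - 1 \<longleftrightarrow> R = W \<and> Suc k = card W"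
    using card_subset_eq[OF fin(1,3)] c by auto
  have 3: "1 \<le> card R \<and> int (card R) \<le> int (card W) - 1 - 1 \<and> int (card M) - 1 = int (card R) - 1 \<and> k = card R \<longleftrightarrow>
     M \<noteq> {} \<and> R = M \<and> k = card R"
  proof
    assume h: "1 \<le> card R \<and> int (card R) \<le> int (card W) - 1 - 1 \<and> int (card M) - 1 = int (card R) - 1 \<and> k = card R"
    then have "card M = card R" "M \<noteq> {}" by auto
    then show "M \<noteq> {} \<and> R = M \<and> k = card R" using M card_subset_eq[OF finR(2), of R] h by auto
  next
    assume h: "M \<noteq> {} \<and> R = M \<and> k = card R"
    then have "card R + 2 \<le> card W" using M by blast
    moreover have "1 \<le> card R" using h finR by (simp add: Suc_leI card_gt_0_iff)
    ultimately show "1 \<le> card R \<and> int (card R) \<le> int (card W) - 1 - 1 \<and> int (card M) - 1 = int (card R) - 1 \<and> k = card R"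
      using h by auto
  qed
  show ?thesis
    unfolding critical_of_index_def critical_tile_def tile_order_hull_tile[OF W fin(3)] tile_dim_hull_tile[OF W] mf dM 1 2 3 ..
qed

lemma tile_set_hull_tile:
  assumes \<Delta>: "geometric \<Delta>" and W: "W \<in> \<Delta>" and RM: "R \<subseteq> W" "M \<subseteq> W" and U: "U \<in> \<Delta>" "x \<in> convex hull U"
  shows "x \<in> tile_set (hull_tile (W, R, M)) \<longleftrightarrow> in_cell (W, R, M) (carrier \<Delta> x)"
proof -
  have h: "x \<in> convex hull V \<longleftrightarrow> carrier \<Delta> x \<subseteq> V" if "V \<subseteq> W" for V
    by (rule in_hull_iff_carrier[OF \<Delta> U geometricD(4)[OF \<Delta> W that]])
  have "x \<in> tile_set (hull_tile (W, R, M)) \<longleftrightarrow>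
     x \<in> convex hull W \<and> (\<forall>r\<in>R. x \<notin> convex hull (W - {r})) \<and> x \<notin> convex hull M"
    by (simp add: tile_set_def hull_tile_def)
  also have "\<dots> \<longleftrightarrow> carrier \<Delta> x \<subseteq> W \<and> (\<forall>r\<in>R. \<not> carrier \<Delta> x \<subseteq> W - {r}) \<and> \<not> carrier \<Delta> x \<subseteq> M"
    using h[OF order_refl] h[OF Diff_subset] h[OF RM(2)] by simp
  also have "\<dots> \<longleftrightarrow> in_cell (W, R, M) (carrier \<Delta> x)"
    unfolding in_cell_def prod.case using RM(1) by blast
  finally show ?thesis .
qed

text \<open>
  A tile contains the relative interior of its simplex, which is dense in it.
\<close>

lemma closure_tile_set:
  fixes t :: "'a::euclidean_space tile"
  assumes t: "morse_tile t"
  shows "tile_simplex t \<subseteq> closure (tile_set t)" "tile_set t \<noteq> {}"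
proof -
  obtain n where n: "0 \<le> n" "n simplex tile_simplex t" using t unfolding morse_tile_def by blast
  have conv: "convex (tile_simplex t)" using n(2) convex_simplex by blast
  have ne: "tile_simplex t \<noteq> {}" using n by auto
  have ad: "0 \<le> aff_dim (tile_simplex t)" using n aff_dim_simplex by blast
  have "rel_interior (tile_simplex t) \<inter> F = {}" if F: "F \<in> removed_facets t" for F
  proof -
    have "F face_of tile_simplex t" "aff_dim F = aff_dim (tile_simplex t) - 1"
      using t F unfolding morse_tile_def facets_def by blast+
    moreover from this(2) have "F \<noteq> tile_simplex t" by auto
    ultimately show ?thesis using face_of_disjoint_rel_interior[of F "tile_simplex t"] by blast
  qed
  moreover have "rel_interior (tile_simplex t) \<inter> morse_face t = {}"
  proof (cases "morse_face t = {}")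
    case False
    then have "morse_face t face_of tile_simplex t" "aff_dim (morse_face t) \<le> tile_dim t - 2"
      using t unfolding morse_tile_def by blast+
    moreover from this(2) have "morse_face t \<noteq> tile_simplex t" unfolding tile_dim_def by auto
    ultimately show ?thesis using face_of_disjoint_rel_interior[of "morse_face t" "tile_simplex t"] by blast
  qed simp
  ultimately have sub: "rel_interior (tile_simplex t) \<subseteq> tile_set t"
    using rel_interior_subset[of "tile_simplex t"] unfolding tile_set_def by blast
  have "closure (rel_interior (tile_simplex t)) = closure (tile_simplex t)" using convex_closure_rel_interior[OF conv] .
  then show "tile_simplex t \<subseteq> closure (tile_set t)" using closure_mono[OF sub] closure_subset by blast
  show "tile_set t \<noteq> {}" using sub rel_interior_eq_empty[OF conv] ne by blast
qed


lemma linear_on_enumerate: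
  assumes "finite W" "W \<noteq> {}" "linear_on lt W"
  shows "\<exists>\<nu>. bij_betw \<nu> {..card W - 1} W \<and> (\<forall>i\<le>card W - 1. \<forall>j\<le>card W - 1. i < j \<longrightarrow> lt (\<nu> i) (\<nu> j))"
proof -
  have "\<exists>vs. set vs = W \<and> distinct vs \<and> sorted_wrt lt vs"
    using assms(1,3)
  proof (induction "card W" arbitrary: W)
    case 0
    then show ?case by (intro exI[of _ "[]"]) simp
  next
    case (Suc n)
    then have "W \<noteq> {}" by auto
    then obtain m where m: "m \<in> W" "\<forall>w\<in>W. w = m \<or> lt m w" using linear_on_min[OF Suc.prems(1) _ Suc.prems(2)] by blast
    have "\<exists>vs. set vs = W - {m} \<and> distinct vs \<and> sorted_wrt lt vs"
      by (rule Suc.hyps(1)) (use Suc.hyps(2) Suc.prems m(1) linear_on_subset[OF Suc.prems(2)] in auto)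
    then obtain vs where vs: "set vs = W - {m}" "distinct vs" "sorted_wrt lt vs" by blast
    have "\<forall>w\<in>set vs. lt m w" using vs(1) m(2) by blast
    then show ?case using vs m(1) by (intro exI[of _ "m # vs"]) auto
  qed
  then obtain vs where vs: "set vs = W" "distinct vs" "sorted_wrt lt vs" by blast
  have len: "length vs = card W" using distinct_card[OF vs(2)] vs(1) by simp
  have pos: "0 < card W" using assms by (simp add: card_gt_0_iff)
  then have "{..card W - 1} = {..<length vs}" using len by auto
  then have "bij_betw ((!) vs) {..card W - 1} W" using bij_betw_nth[OF vs(2)] vs(1) by simp
  moreover have "lt (vs ! i) (vs ! j)" if "j \<le> card W - 1" "i < j" for i j
    by (rule sorted_wrt_nth_less[OF vs(3) that(2)]) (use that len pos in simp)
  ultimately show ?thesis by blast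
qed

lemma upper_segment:
  fixes M :: "nat set"
  assumes "M \<subseteq> {..n}" "\<And>i j. i \<in> M \<Longrightarrow> i < j \<Longrightarrow> j \<le> n \<Longrightarrow> j \<in> M"
  shows "M = {Suc n - card M..n}"
proof (cases "M = {}")
  case False
  define a where "a = Min M"
  have fin: "finite M" using assms(1) finite_subset by blast
  have a: "a \<in> M" "\<And>i. i \<in> M \<Longrightarrow> a \<le> i" unfolding a_def using fin False by auto
  have "M = {a..n}"
  proof
    show "{a..n} \<subseteq> M"
    proof
      fix j assume "j \<in> {a..n}"
      then show "j \<in> M" using assms(2)[OF a(1), of j] a(1) by (cases "a = j") auto
    qed
  qed (use a(2) assms(1) in auto)
  moreover have "a \<le> n" using a(1) assms(1) by auto
  ultimately show ?thesis by simp
qed simp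

lemma inj_image_cell:
  assumes "inj_on g A" "P \<subseteq> A" "R \<subseteq> P" "M \<subseteq> P"
  shows "valid_tile (g ` P) (g ` R) (g ` M) \<longleftrightarrow> valid_tile P R M"
    and "critical_tile (g ` P) (g ` R) (g ` M) k \<longleftrightarrow> critical_tile P R M k"
    and "C \<subseteq> A \<Longrightarrow> in_cell (g ` P, g ` R, g ` M) (g ` C) \<longleftrightarrow> in_cell (P, R, M) C"
    and "card (g ` P) = card P" "card (g ` R) = card R"
proof -
  have i: "inj_on g P" using assms(1,2) inj_on_subset by blast
  have sub: "g ` X \<subseteq> g ` Y \<longleftrightarrow> X \<subseteq> Y" if "X \<subseteq> A" "Y \<subseteq> A" for X Y
    by (rule inj_on_image_subset_iff[OF assms(1) that])
  have RM: "R \<subseteq> A" "M \<subseteq> A" using assms by blast+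
  have eq: "g ` X = g ` Y \<longleftrightarrow> X = Y" if "X \<subseteq> A" "Y \<subseteq> A" for X Y
    by (rule inj_on_image_eq_iff[OF assms(1) that])
  have c: "card (g ` X) = card X" if "X \<subseteq> A" for X
    by (rule card_image[OF inj_on_subset[OF assms(1) that]])
  show "card (g ` P) = card P" "card (g ` R) = card R" using c assms(2) RM by blast+
  show "valid_tile (g ` P) (g ` R) (g ` M) \<longleftrightarrow> valid_tile P R M"
    unfolding valid_tile_def image_is_empty sub[OF RM(1) assms(2)] sub[OF RM(2) assms(2)] sub[OF RM]
      c[OF assms(2)] c[OF RM(2)] finite_image_iff[OF i] ..
  show "critical_tile (g ` P) (g ` R) (g ` M) k \<longleftrightarrow> critical_tile P R M k"
    unfolding critical_tile_def image_is_empty eq[OF RM(1) assms(2)] eq[OF RM] c[OF assms(2)] c[OF RM(1)] ..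
  show "in_cell (g ` P, g ` R, g ` M) (g ` C) \<longleftrightarrow> in_cell (P, R, M) C" if C: "C \<subseteq> A"
    unfolding in_cell_def prod.case sub[OF RM(1) C] sub[OF C assms(2)] sub[OF C RM(2)] ..
qed

text \<open>
  Numbering the vertices in increasing order turns the Morse face into a final segment, because it is closed upwards.
\<close>

lemma enumerate_tile:
  assumes v: "valid_tile W R M" and lin: "linear_on lt W" and up: "\<forall>v\<in>W - M. \<forall>w\<in>M. lt v w"
  shows "\<exists>\<nu> R' a. bij_betw \<nu> {..card W - 1} W \<and>
    (\<forall>i j. i \<le> card W - 1 \<longrightarrow> j \<le> card W - 1 \<longrightarrow> i < j \<longrightarrow> lt (\<nu> i) (\<nu> j)) \<and>
    factor_tile (card W - 1) R' a \<and> \<nu> ` R' = R \<and> card R' = card R \<and>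
    (\<forall>d. critical_index (card W - 1) R' a d \<longleftrightarrow> critical_tile W R M d) \<and>
    (\<forall>D. D \<subseteq> {..card W - 1} \<longrightarrow> (admits (card W - 1) R' a D \<and> D \<noteq> {} \<longleftrightarrow> in_cell (W, R, M) (\<nu> ` D)))"
proof -
  have fin: "finite W" "W \<noteq> {}" "R \<subseteq> W" "M \<subseteq> W" and M: "M \<noteq> {} \<Longrightarrow> R \<noteq> {} \<and> R \<subseteq> M \<and> card M + 2 \<le> card W"
    using v unfolding valid_tile_def by blast+
  define n where "n = card W - 1"
  obtain \<nu> where \<nu>: "bij_betw \<nu> {..n} W" "\<And>i j. i \<le> n \<Longrightarrow> j \<le> n \<Longrightarrow> i < j \<Longrightarrow> lt (\<nu> i) (\<nu> j)"
    using linear_on_enumerate[OF fin(1,2) lin] unfolding n_def by blast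
  have inj: "inj_on \<nu> {..n}" and im: "\<nu> ` {..n} = W" using \<nu>(1) unfolding bij_betw_def by blast+
  have cW: "card W = Suc n" using fin(1,2) unfolding n_def by (simp add: card_gt_0_iff)
  define R' where "R' = {i \<in> {..n}. \<nu> i \<in> R}"
  define M' where "M' = {i \<in> {..n}. \<nu> i \<in> M}"
  have sub: "R' \<subseteq> {..n}" "M' \<subseteq> {..n}" unfolding R'_def M'_def by blast+
  have R: "\<nu> ` R' = R" and M'M: "\<nu> ` M' = M" unfolding R'_def M'_def using im fin(3,4) by blast+
  note tr = inj_image_cell[OF inj order_refl sub, unfolded im R M'M]
  have cR: "card R' = card R" using card_image[OF inj_on_subset[OF inj sub(1)]] R by simp
  have upM: "j \<in> M'" if "i \<in> M'" "i < j" "j \<le> n" for i j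
  proof (rule ccontr)
    assume "j \<notin> M'"
    then have j: "\<nu> j \<in> W - M" using that(3) im unfolding M'_def by auto
    have i: "\<nu> i \<in> M" "i \<le> n" using that(1) unfolding M'_def by auto
    have "lt (\<nu> j) (\<nu> i)" using up j i(1) by blast
    moreover have "lt (\<nu> i) (\<nu> j)" by (rule \<nu>(2)[OF i(2) that(3,2)])
    ultimately show False using linear_on_asym[OF lin, of "\<nu> i" "\<nu> j"] i(1) j fin(4) by blast
  qed
  define a where "a = Suc n - card M'"
  have M'a: "M' = {a..n}" unfolding a_def by (rule upper_segment[OF sub(2) upM])
  have v': "valid_tile {..n} R' {a..n}" using tr(1) v M'a by simp
  then have v2: "{a..n} \<noteq> {} \<Longrightarrow> R' \<noteq> {} \<and> R' \<subseteq> {a..n} \<and> card {a..n} + 2 \<le> card {..n}" unfolding valid_tile_def by blast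
  have ft: "factor_tile n R' a"
  proof (cases "a \<le> n")
    case True
    then show ?thesis using v2 sub(1) unfolding factor_tile_def by auto
  next
    case False
    then have "a = Suc n" unfolding a_def by simp
    then show ?thesis using sub(1) unfolding factor_tile_def by simp
  qed
  have crit: "critical_index n R' a d \<longleftrightarrow> critical_tile W R M d" for d
  proof -
    have "critical_index n R' a d \<longleftrightarrow> critical_tile {..n} R' {a..n} d"
    proof (cases "a \<le> n")
      case True
      then have R2: "R' \<noteq> {}" "R' \<subseteq> {a..n}" "2 \<le> a" using ft unfolding factor_tile_def by auto
      then have n0: "R' \<noteq> {..n}" by auto
      have "card {a..n} = Suc n - a" by simp
      moreover have "{a..n} \<noteq> {}" "a \<noteq> Suc n" using True by auto
      ultimately show ?thesis unfolding critical_tile_def critical_index_def using R2(1) n0 True by metis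
    next
      case False
      then have "a = Suc n" "{a..n} = {}" "card {..n} = Suc n" unfolding a_def by auto
      then show ?thesis unfolding critical_tile_def critical_index_def using False by (metis nat.inject)
    qed
    then show ?thesis using tr(2) M'a by simp
  qed
  have adm: "admits n R' a D \<and> D \<noteq> {} \<longleftrightarrow> in_cell (W, R, M) (\<nu> ` D)" if D: "D \<subseteq> {..n}" for D
  proof -
    have "in_cell (W, R, M) (\<nu> ` D) \<longleftrightarrow> in_cell ({..n}, R', M') D" by (rule tr(3)[OF D])
    also have "\<dots> \<longleftrightarrow> admits n R' a D \<and> D \<noteq> {}" unfolding in_cell_def admits_def prod.case M'a using D by blast
    finally show ?thesis by blast
  qed
  show ?thesis unfolding n_def[symmetric]
  proof (intro exI[of _ \<nu>] exI[of _ R'] exI[of _ a] conjI)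
    show "\<forall>i j. i \<le> n \<longrightarrow> j \<le> n \<longrightarrow> i < j \<longrightarrow> lt (\<nu> i) (\<nu> j)" using \<nu>(2) by blast
    show "\<forall>d. critical_index n R' a d \<longleftrightarrow> critical_tile W R M d" by (intro allI) (rule crit)
    show "\<forall>D. D \<subseteq> {..n} \<longrightarrow> (admits n R' a D \<and> D \<noteq> {} \<longleftrightarrow> in_cell (W, R, M) (\<nu> ` D))"
      by (intro allI impI) (rule adm)
  qed (rule \<nu>(1), rule ft, rule R, rule cR)
qed

text \<open>
  The subdivision of the product of numbered tiles, transported back along the numberings of the vertices.
\<close>

theorem product_cells:
  fixes W1 :: "'a set" and W2 :: "'b set"
  assumes v1: "valid_tile W1 R1 M1" and lin1: "linear_on lt1 W1" and up1: "\<forall>v\<in>W1 - M1. \<forall>w\<in>M1. lt1 v w"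
    and v2: "valid_tile W2 R2 M2" and lin2: "linear_on lt2 W2" and up2: "\<forall>v\<in>W2 - M2. \<forall>w\<in>M2. lt2 v w"
  shows "\<exists>L.
    (\<forall>(P, R, M)\<in>set L. valid_tile P R M \<and> P \<subseteq> W1 \<times> W2 \<and> pair_chain lt1 lt2 P \<and> Suc (card P) = card W1 + card W2 \<and>
        (\<forall>p\<in>P - M. \<forall>q\<in>M. pair_le lt1 lt2 p q)) \<and>
    (\<forall>C. C \<subseteq> W1 \<times> W2 \<and> pair_chain lt1 lt2 C \<and> in_cell (W1, R1, M1) (fst ` C) \<and> in_cell (W2, R2, M2) (snd ` C) \<longrightarrow>
        (\<exists>A t B. L = A @ t # B \<and> in_cell t C \<and> (\<forall>g\<in>set A. \<not> C \<subseteq> fst g) \<and> (\<forall>g\<in>set B. \<not> in_cell g C))) \<and>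
    (\<forall>t\<in>set L. \<forall>C. in_cell t C \<longrightarrow> in_cell (W1, R1, M1) (fst ` C) \<and> in_cell (W2, R2, M2) (snd ` C)) \<and>
    (\<forall>d. critical_count L d = of_bool (\<exists>d1 d2. critical_tile W1 R1 M1 d1 \<and> critical_tile W2 R2 M2 d2 \<and> d = d1 + d2)) \<and>
    (\<forall>d. order_count L d = product_order (card W1 - 1) (card W2 - 1) (card R1) (card R2) d)"
proof -
  obtain \<nu>1 S1 a1 where e: "bij_betw \<nu>1 {..card W1 - 1} W1"
    "\<forall>i j. i \<le> card W1 - 1 \<longrightarrow> j \<le> card W1 - 1 \<longrightarrow> i < j \<longrightarrow> lt1 (\<nu>1 i) (\<nu>1 j)"
    "factor_tile (card W1 - 1) S1 a1" "\<nu>1 ` S1 = R1" "card S1 = card R1"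
    "\<forall>d. critical_index (card W1 - 1) S1 a1 d \<longleftrightarrow> critical_tile W1 R1 M1 d"
    "\<forall>D. D \<subseteq> {..card W1 - 1} \<longrightarrow> (admits (card W1 - 1) S1 a1 D \<and> D \<noteq> {} \<longleftrightarrow> in_cell (W1, R1, M1) (\<nu>1 ` D))"
    using enumerate_tile[OF v1 lin1 up1] by (elim exE conjE)
  have e1: "bij_betw \<nu>1 {..card W1 - 1} W1"
    "\<And>i j. i \<le> card W1 - 1 \<Longrightarrow> j \<le> card W1 - 1 \<Longrightarrow> i < j \<Longrightarrow> lt1 (\<nu>1 i) (\<nu>1 j)"
    "factor_tile (card W1 - 1) S1 a1" "\<nu>1 ` S1 = R1" "card S1 = card R1"
    "\<And>d. critical_index (card W1 - 1) S1 a1 d \<longleftrightarrow> critical_tile W1 R1 M1 d"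
    "\<And>D. D \<subseteq> {..card W1 - 1} \<Longrightarrow> admits (card W1 - 1) S1 a1 D \<and> D \<noteq> {} \<longleftrightarrow> in_cell (W1, R1, M1) (\<nu>1 ` D)"
    using e by simp_all
  obtain \<nu>2 S2 a2 where e: "bij_betw \<nu>2 {..card W2 - 1} W2"
    "\<forall>i j. i \<le> card W2 - 1 \<longrightarrow> j \<le> card W2 - 1 \<longrightarrow> i < j \<longrightarrow> lt2 (\<nu>2 i) (\<nu>2 j)"
    "factor_tile (card W2 - 1) S2 a2" "\<nu>2 ` S2 = R2" "card S2 = card R2"
    "\<forall>d. critical_index (card W2 - 1) S2 a2 d \<longleftrightarrow> critical_tile W2 R2 M2 d"
    "\<forall>D. D \<subseteq> {..card W2 - 1} \<longrightarrow> (admits (card W2 - 1) S2 a2 D \<and> D \<noteq> {} \<longleftrightarrow> in_cell (W2, R2, M2) (\<nu>2 ` D))"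
    using enumerate_tile[OF v2 lin2 up2] by (elim exE conjE)
  have e2: "bij_betw \<nu>2 {..card W2 - 1} W2"
    "\<And>i j. i \<le> card W2 - 1 \<Longrightarrow> j \<le> card W2 - 1 \<Longrightarrow> i < j \<Longrightarrow> lt2 (\<nu>2 i) (\<nu>2 j)"
    "factor_tile (card W2 - 1) S2 a2" "\<nu>2 ` S2 = R2" "card S2 = card R2"
    "\<And>d. critical_index (card W2 - 1) S2 a2 d \<longleftrightarrow> critical_tile W2 R2 M2 d"
    "\<And>D. D \<subseteq> {..card W2 - 1} \<Longrightarrow> admits (card W2 - 1) S2 a2 D \<and> D \<noteq> {} \<longleftrightarrow> in_cell (W2, R2, M2) (\<nu>2 ` D)"
    using e by simp_all
  define n1 n2 where n: "n1 = card W1 - 1" "n2 = card W2 - 1"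
  note e1 = e1[folded n] and e2 = e2[folded n]
  have c: "card W1 = Suc n1" "card W2 = Suc n2" using v1 v2 unfolding n valid_tile_def by (simp_all add: card_gt_0_iff)
  obtain L0 where L0: "subdivides n1 S1 a1 n2 S2 a2 L0"
    "\<And>d. critical_count L0 d = of_bool (\<exists>d1 d2. critical_index n1 S1 a1 d1 \<and> critical_index n2 S2 a2 d2 \<and> d = d1 + d2)"
    "\<And>d. order_count L0 d = product_order n1 n2 (card S1) (card S2) d"
    using product_cells_exist[OF e1(3) e2(3)] unfolding subdivides_well_def by blast
  define g where "g p = (\<nu>1 (fst p), \<nu>2 (snd p))" for p
  let ?G = "{..n1} \<times> {..n2}"
  have inj1: "inj_on \<nu>1 {..n1}" and im1: "\<nu>1 ` {..n1} = W1" and inj2: "inj_on \<nu>2 {..n2}" and im2: "\<nu>2 ` {..n2} = W2"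
    using e1(1) e2(1) unfolding bij_betw_def by blast+
  have inj: "inj_on g ?G"
    using inj1 inj2 unfolding g_def inj_on_def by (simp add: prod_eq_iff mem_Times_iff)
  have im: "g ` ?G = W1 \<times> W2"
  proof -
    have "g ` ?G = (\<nu>1 ` {..n1}) \<times> (\<nu>2 ` {..n2})" unfolding g_def by force
    then show ?thesis unfolding im1 im2 .
  qed
  have fg: "fst ` g ` C = \<nu>1 ` fst ` C" "snd ` g ` C = \<nu>2 ` snd ` C" for C
    unfolding g_def by (simp_all add: image_image)
  have le1: "\<nu>1 i = \<nu>1 j \<or> lt1 (\<nu>1 i) (\<nu>1 j) \<longleftrightarrow> i \<le> j" if "i \<le> n1" "j \<le> n1" for i j
  proof -
    have m: "\<nu>1 i \<in> W1" "\<nu>1 j \<in> W1" using that im1 by auto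
    consider "i < j" | "i = j" | "j < i" by linarith
    then show ?thesis
    proof cases
      case 3
      then have "lt1 (\<nu>1 j) (\<nu>1 i)" using e1(2) that by blast
      then have "\<not> lt1 (\<nu>1 i) (\<nu>1 j)" using linear_on_asym[OF lin1 m(2,1)] by blast
      moreover have "\<nu>1 i \<noteq> \<nu>1 j" using inj_onD[OF inj1, of i j] that 3 by auto
      ultimately show ?thesis using 3 by simp
    qed (use e1(2) that in auto)
  qed
  have le2: "\<nu>2 i = \<nu>2 j \<or> lt2 (\<nu>2 i) (\<nu>2 j) \<longleftrightarrow> i \<le> j" if "i \<le> n2" "j \<le> n2" for i j
  proof -
    have m: "\<nu>2 i \<in> W2" "\<nu>2 j \<in> W2" using that im2 by auto
    consider "i < j" | "i = j" | "j < i" by linarith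
    then show ?thesis
    proof cases
      case 3
      then have "lt2 (\<nu>2 j) (\<nu>2 i)" using e2(2) that by blast
      then have "\<not> lt2 (\<nu>2 i) (\<nu>2 j)" using linear_on_asym[OF lin2 m(2,1)] by blast
      moreover have "\<nu>2 i \<noteq> \<nu>2 j" using inj_onD[OF inj2, of i j] that 3 by auto
      ultimately show ?thesis using 3 by simp
    qed (use e2(2) that in auto)
  qed
  have ple: "pair_le lt1 lt2 (g p) (g q) \<longleftrightarrow> fst p \<le> fst q \<and> snd p \<le> snd q" if "p \<in> ?G" "q \<in> ?G" for p q
    using le1[of "fst p" "fst q"] le2[of "snd p" "snd q"] that unfolding pair_le_def g_def by (simp add: mem_Times_iff)
  have pch: "pair_chain lt1 lt2 (g ` C) \<longleftrightarrow> chain2 C" if "C \<subseteq> ?G" for C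
  proof -
    have "pair_le lt1 lt2 (g p) (g q) \<longleftrightarrow> fst p \<le> fst q \<and> snd p \<le> snd q" if "p \<in> C" "q \<in> C" for p q
      by (rule ple) (use that \<open>C \<subseteq> ?G\<close> in blast)+
    then show ?thesis unfolding pair_chain_def chain2_def by simp
  qed
  define h where "h t = (case t of (P, R, M) \<Rightarrow> (g ` P, g ` R, g ` M))" for t
  have cell0: "valid_tile P R M" "P \<subseteq> ?G" "chain2 P" "card P = Suc (n1 + n2)" "\<forall>p\<in>P - M. \<forall>q\<in>M. fst p \<le> fst q \<and> snd p \<le> snd q"
     "R \<subseteq> P" "M \<subseteq> P" if "(P, R, M) \<in> set L0" for P R M
    using subdivides_cell[OF L0(1) that] unfolding valid_tile_def by blast+
  have adm: "admits n1 S1 a1 (fst ` C) \<and> admits n2 S2 a2 (snd ` C) \<longleftrightarrow>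
      in_cell (W1, R1, M1) (fst ` g ` C) \<and> in_cell (W2, R2, M2) (snd ` g ` C)" if "C \<subseteq> ?G" "C \<noteq> {}" for C
  proof -
    have "fst ` C \<subseteq> {..n1}" "snd ` C \<subseteq> {..n2}" "fst ` C \<noteq> {}" "snd ` C \<noteq> {}" using that by auto
    then show ?thesis unfolding fg using e1(7) e2(7) by blast
  qed
  have hcell: "in_cell (h t) (g ` C) \<longleftrightarrow> in_cell t C" if "t \<in> set L0" "C \<subseteq> ?G" for t C
  proof -
    obtain P R M where t: "t = (P, R, M)" by (cases t)
    show ?thesis unfolding t h_def prod.case
      by (rule inj_image_cell(3)[OF inj]) (use cell0[of P R M] that t in blast)+
  qed
  have pre: "C = g ` {p \<in> ?G. g p \<in> C}" if "C \<subseteq> W1 \<times> W2" for C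
    using that unfolding im[symmetric] by blast
  have cond1: "\<forall>(P, R, M)\<in>set (map h L0). valid_tile P R M \<and> P \<subseteq> W1 \<times> W2 \<and> pair_chain lt1 lt2 P \<and> Suc (card P) = card W1 + card W2 \<and>
        (\<forall>p\<in>P - M. \<forall>q\<in>M. pair_le lt1 lt2 p q)"
  proof
    fix t assume "t \<in> set (map h L0)"
    then obtain u where u: "u \<in> set L0" "t = h u" by auto
    obtain P R M where uP: "u = (P, R, M)" by (cases u)
    note c0 = cell0[OF u(1)[unfolded uP]]
    note tr = inj_image_cell[OF inj c0(2,6,7)]
    have "g ` P \<subseteq> W1 \<times> W2" using c0(2) im by blast
    moreover have "pair_chain lt1 lt2 (g ` P)" using pch[OF c0(2)] c0(3) by blast
    moreover have "pair_le lt1 lt2 p q" if pq: "p \<in> g ` P - g ` M" "q \<in> g ` M" for p q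
    proof -
      obtain p' where p': "p = g p'" "p' \<in> P - M" using pq(1) by blast
      obtain q' where q': "q = g q'" "q' \<in> M" using pq(2) by blast
      have "p' \<in> ?G" "q' \<in> ?G" using p'(2) q'(2) c0(2,7) by blast+
      from ple[OF this] show ?thesis unfolding p'(1) q'(1) using c0(5) p'(2) q'(2) by blast
    qed
    ultimately show "case t of (P, R, M) \<Rightarrow> valid_tile P R M \<and> P \<subseteq> W1 \<times> W2 \<and> pair_chain lt1 lt2 P \<and> Suc (card P) = card W1 + card W2 \<and>
        (\<forall>p\<in>P - M. \<forall>q\<in>M. pair_le lt1 lt2 p q)"
      unfolding u(2) uP h_def prod.case tr(1,4) using c0(1,4) c by simp
  qed
  have cond2: "\<exists>A t B. map h L0 = A @ t # B \<and> in_cell t C \<and> (\<forall>g\<in>set A. \<not> C \<subseteq> fst g) \<and> (\<forall>g\<in>set B. \<not> in_cell g C)"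
    if C: "C \<subseteq> W1 \<times> W2" "pair_chain lt1 lt2 C" "in_cell (W1, R1, M1) (fst ` C)" "in_cell (W2, R2, M2) (snd ` C)" for C
  proof -
    define C0 where "C0 = {p \<in> ?G. g p \<in> C}"
    have C0: "C0 \<subseteq> ?G" and gC: "C = g ` C0" using pre[OF C(1)] unfolding C0_def by blast+
    have "C \<noteq> {}" using C(3) unfolding in_cell_def by auto
    then have ne: "C0 \<noteq> {}" using gC by blast
    have ch: "chain2 C0" using pch[OF C0] C(2) gC by simp
    have "admits n1 S1 a1 (fst ` C0) \<and> admits n2 S2 a2 (snd ` C0)" using adm[OF C0 ne] C(3,4) gC by simp
    then obtain A t B where L: "L0 = A @ t # B" "in_cell t C0" "\<forall>g\<in>set A. \<not> C0 \<subseteq> fst g" "\<forall>g\<in>set B. \<not> in_cell g C0"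
      using subdivides_select[OF L0(1) ne ch C0] by blast
    have mem: "t \<in> set L0" "\<And>u. u \<in> set A \<Longrightarrow> u \<in> set L0" "\<And>u. u \<in> set B \<Longrightarrow> u \<in> set L0" using L(1) by auto
    have "in_cell (h t) C" unfolding gC hcell[OF mem(1) C0] by (rule L(2))
    moreover have "\<not> C \<subseteq> fst (h u)" if u: "u \<in> set A" for u
    proof -
      obtain P R M where uP: "u = (P, R, M)" by (cases u)
      have "P \<subseteq> ?G" using cell0 mem(2)[OF u] uP by blast
      then have "g ` C0 \<subseteq> g ` P \<longleftrightarrow> C0 \<subseteq> P" by (rule inj_on_image_subset_iff[OF inj C0])
      moreover have "\<not> C0 \<subseteq> P" using bspec[OF L(3) u] uP by simp
      ultimately show ?thesis unfolding gC uP h_def prod.case fst_conv by simp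
    qed
    moreover have "\<not> in_cell (h u) C" if u: "u \<in> set B" for u
      unfolding gC hcell[OF mem(3)[OF u] C0] using L(4) u by blast
    ultimately show ?thesis
      using L(1) by (intro exI[of _ "map h A"] exI[of _ "h t"] exI[of _ "map h B"]) auto
  qed
  have cond3: "in_cell (W1, R1, M1) (fst ` C) \<and> in_cell (W2, R2, M2) (snd ` C)" if t: "t \<in> set (map h L0)" and C: "in_cell t C" for t C
  proof -
    obtain u where u: "u \<in> set L0" "t = h u" using t by auto
    obtain P R M where uP: "u = (P, R, M)" by (cases u)
    have "C \<subseteq> g ` P" "C \<noteq> {}" using C unfolding u(2) uP h_def in_cell_def by auto
    moreover have "P \<subseteq> ?G" using cell0 u(1) uP by blast
    ultimately have CW: "C \<subseteq> W1 \<times> W2" using im by blast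
    define C0 where "C0 = {p \<in> ?G. g p \<in> C}"
    have C0: "C0 \<subseteq> ?G" and gC: "C = g ` C0" using pre[OF CW] unfolding C0_def by blast+
    have ne: "C0 \<noteq> {}" using gC \<open>C \<noteq> {}\<close> by blast
    have "in_cell u C0" using C unfolding u(2) gC hcell[OF u(1) C0] .
    then show ?thesis using subdivides_admits[OF L0(1) u(1)] adm[OF C0 ne] gC by blast
  qed
  have cond4: "critical_count (map h L0) d = critical_count L0 d" "order_count (map h L0) d = order_count L0 d" for d
  proof -
    show "critical_count (map h L0) d = critical_count L0 d" unfolding critical_count_def count_if_map
    proof (rule count_if_cong)
      fix u assume u: "u \<in> set L0"
      obtain P R M where uP: "u = (P, R, M)" by (cases u)
      note c0 = cell0[OF u[unfolded uP]]
      show "((\<lambda>(P, R, M). critical_tile P R M d) \<circ> h) u = (case u of (P, R, M) \<Rightarrow> critical_tile P R M d)"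
        unfolding uP h_def comp_def prod.case by (rule inj_image_cell(2)[OF inj c0(2,6,7)])
    qed
    show "order_count (map h L0) d = order_count L0 d" unfolding order_count_def count_if_map
    proof (rule count_if_cong)
      fix u assume u: "u \<in> set L0"
      obtain P R M where uP: "u = (P, R, M)" by (cases u)
      note c0 = cell0[OF u[unfolded uP]]
      show "((\<lambda>(P, R, M). card R = d) \<circ> h) u = (case u of (P, R, M) \<Rightarrow> card R = d)"
        unfolding uP h_def comp_def prod.case inj_image_cell(5)[OF inj c0(2,6,7)] ..
    qed
  qed
  show ?thesis
  proof (intro exI[of _ "map h L0"] conjI)
    show "\<forall>d. critical_count (map h L0) d = of_bool (\<exists>d1 d2. critical_tile W1 R1 M1 d1 \<and> critical_tile W2 R2 M2 d2 \<and> d = d1 + d2)"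
      unfolding cond4 L0(2) e1(6) e2(6) by blast
    show "\<forall>d. order_count (map h L0) d = product_order (card W1 - 1) (card W2 - 1) (card R1) (card R2) d"
      unfolding cond4 L0(3) e1(5) e2(5) n by blast
  qed (use cond1 cond2 cond3 in blast)+
qed

section \<open>The tiles of the product\<close>

text \<open>
  What the geometry needs to know about the list of tiles cutting up a product of two tiles; the
  second clause is the half-open decomposition together with its order.
\<close>

definition product_list :: "('a \<Rightarrow> 'a \<Rightarrow> bool) \<Rightarrow> ('b \<Rightarrow> 'b \<Rightarrow> bool) \<Rightarrow> 'a cell \<Rightarrow> 'b cell \<Rightarrow> ('a \<times> 'b) cell list \<Rightarrow> bool" where
  "product_list lt1 lt2 c1 c2 L \<longleftrightarrow>
    (\<forall>(P, R, M)\<in>set L. valid_tile P R M \<and> P \<subseteq> fst c1 \<times> fst c2 \<and> pair_chain lt1 lt2 P \<and> Suc (card P) = card (fst c1) + card (fst c2) \<and>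
        (\<forall>p\<in>P - M. \<forall>q\<in>M. pair_le lt1 lt2 p q)) \<and>
    (\<forall>C. C \<subseteq> fst c1 \<times> fst c2 \<and> pair_chain lt1 lt2 C \<and> in_cell c1 (fst ` C) \<and> in_cell c2 (snd ` C) \<longrightarrow>
        (\<exists>A t B. L = A @ t # B \<and> in_cell t C \<and> (\<forall>g\<in>set A. \<not> C \<subseteq> fst g) \<and> (\<forall>g\<in>set B. \<not> in_cell g C))) \<and>
    (\<forall>t\<in>set L. \<forall>C. in_cell t C \<longrightarrow> in_cell c1 (fst ` C) \<and> in_cell c2 (snd ` C))"

definition good_cell :: "('a \<Rightarrow> 'a \<Rightarrow> bool) \<Rightarrow> 'a cell \<Rightarrow> bool" where
  "good_cell lt c \<longleftrightarrow> (case c of (W, R, M) \<Rightarrow> valid_tile W R M \<and> (\<forall>v\<in>W - M. \<forall>w\<in>M. lt v w))"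

lemma distinct_map_by_split:
  assumes "\<And>u. u \<in> set L \<Longrightarrow> \<exists>A B. L = A @ u # B \<and> f u \<notin> f ` set A \<and> f u \<notin> f ` set B"
  shows "distinct (map f L)"
  unfolding distinct_conv_nth
proof (intro allI impI)
  fix i j assume ij: "i < length (map f L)" "j < length (map f L)" "i \<noteq> j"
  have "L ! i \<in> set L" using ij(1) by simp
  then obtain A B where L: "L = A @ L ! i # B" "f (L ! i) \<notin> f ` set A" "f (L ! i) \<notin> f ` set B" using assms by blast
  have pos: "k = length A" if k: "k < length L" "f (L ! k) = f (L ! i)" for k
  proof (rule ccontr)
    assume "k \<noteq> length A"
    then consider "k < length A" | "length A < k" by linarith
    then have "L ! k \<in> set A \<or> L ! k \<in> set B"
    proof cases
      case 1
      then have "L ! k = A ! k" by (subst L(1)) (simp add: nth_append)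
      then show ?thesis using 1 by simp
    next
      case 2
      have "length L = length A + Suc (length B)" by (subst L(1)) simp
      then have b: "k - Suc (length A) < length B" using 2 k(1) by linarith
      have "L ! k = B ! (k - Suc (length A))" using 2 by (subst L(1)) (simp add: nth_append nth_Cons')
      then show ?thesis using b by simp
    qed
    then show False using L(2,3) k(2) by (metis imageI)
  qed
  have "i = length A" using pos[of i] ij(1) by simp
  then show "map f L ! i \<noteq> map f L ! j" using pos[of j] ij by auto
qed

locale product_tiling =
  fixes \<Delta>1 :: "'a::euclidean_space set set" and lt1 and \<tau>1 :: "'a tile set" and S1 :: "'a set" and c1 :: "'a tile \<Rightarrow> 'a cell"
    and \<Delta>2 :: "'b::euclidean_space set set" and lt2 and \<tau>2 :: "'b tile set" and S2 :: "'b set" and c2 :: "'b tile \<Rightarrow> 'b cell"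
    and PL :: "'a tile \<Rightarrow> 'b tile \<Rightarrow> ('a \<times> 'b) cell list"
  assumes geo: "geometric \<Delta>1" "geometric \<Delta>2"
    and lin: "\<And>W. W \<in> \<Delta>1 \<Longrightarrow> linear_on lt1 W" "\<And>W. W \<in> \<Delta>2 \<Longrightarrow> linear_on lt2 W"
    and cells1: "\<And>t. t \<in> \<tau>1 \<Longrightarrow> fst (c1 t) \<in> \<Delta>1 \<and> good_cell lt1 (c1 t) \<and> t = hull_tile (c1 t)"
    and cells2: "\<And>t. t \<in> \<tau>2 \<Longrightarrow> fst (c2 t) \<in> \<Delta>2 \<and> good_cell lt2 (c2 t) \<and> t = hull_tile (c2 t)"
    and PL: "\<And>t u. t \<in> \<tau>1 \<Longrightarrow> u \<in> \<tau>2 \<Longrightarrow> product_list lt1 lt2 (c1 t) (c2 u) (PL t u)"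
    and dis: "disjoint_family_on tile_set \<tau>1" "disjoint_family_on tile_set \<tau>2"
    and un: "\<Union>(tile_set ` \<tau>1) = S1" "\<Union>(tile_set ` \<tau>2) = S2"
    and skeleton: "\<And>j::nat. closedin (top_of_set S1) (\<Union>(tile_set ` {t\<in>\<tau>1. int j \<le> tile_dim t}))"
      "\<And>j::nat. closedin (top_of_set S2) (\<Union>(tile_set ` {t\<in>\<tau>2. int j \<le> tile_dim t}))"
    and cover: "\<And>W. W \<in> \<Delta>1 \<Longrightarrow> convex hull W \<subseteq> closure S1" "\<And>W. W \<in> \<Delta>2 \<Longrightarrow> convex hull W \<subseteq> closure S2"
    and critical: "\<And>t u k. t \<in> \<tau>1 \<Longrightarrow> u \<in> \<tau>2 \<Longrightarrow> critical_count (PL t u) k =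
        of_bool (\<exists>i j. critical_of_index t i \<and> critical_of_index u j \<and> k = i + j)"
    and orders: "\<And>t u k. t \<in> \<tau>1 \<Longrightarrow> u \<in> \<tau>2 \<Longrightarrow> order_count (PL t u) k =
        product_order (nat (tile_dim t)) (nat (tile_dim u)) (tile_order t) (tile_order u) k"
begin

abbreviation \<Delta> where "\<Delta> \<equiv> chain_complex lt1 \<Delta>1 lt2 \<Delta>2"

definition \<tau> where "\<tau> = (\<Union>t\<in>\<tau>1. \<Union>u\<in>\<tau>2. hull_tile ` set (PL t u))"

lemma geo_prod: "geometric \<Delta>"
  by (rule chain_complex_geometric[OF geo lin])

text \<open>
  The carrier of a point of the product is a chain whose projections contain the carriers of the two coordinates.
  A smaller chain supported on these carriers exists by \<open>chain_hull_exists\<close>, so the projections are equal to them.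
\<close>

lemma carrier_prod:
  assumes "D \<in> \<Delta>" "p \<in> convex hull D"
  shows "fst ` carrier \<Delta> p = carrier \<Delta>1 (fst p)" "snd ` carrier \<Delta> p = carrier \<Delta>2 (snd p)"
    "fst ` D \<in> \<Delta>1" "fst p \<in> convex hull (fst ` D)" "snd ` D \<in> \<Delta>2" "snd p \<in> convex hull (snd ` D)"
proof -
  have h: "fst q \<in> convex hull (fst ` E)" "snd q \<in> convex hull (snd ` E)" if "q \<in> convex hull E" for q :: "'a \<times> 'b" and E
    using that fst_hull[of E] snd_hull[of E] by blast+
  show D: "fst ` D \<in> \<Delta>1" "fst p \<in> convex hull (fst ` D)" "snd ` D \<in> \<Delta>2" "snd p \<in> convex hull (snd ` D)"
    using assms h unfolding chain_complex_def by blast+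
  note c = carrier_in[OF geo_prod assms]
  have c': "fst ` carrier \<Delta> p \<in> \<Delta>1" "snd ` carrier \<Delta> p \<in> \<Delta>2" using c(1) unfolding chain_complex_def by blast+
  have s1: "carrier \<Delta>1 (fst p) \<subseteq> fst ` carrier \<Delta> p"
    using in_hull_iff_carrier[OF geo(1) D(1,2) c'(1)] h(1)[OF c(2)] by blast
  have s2: "carrier \<Delta>2 (snd p) \<subseteq> snd ` carrier \<Delta> p"
    using in_hull_iff_carrier[OF geo(2) D(3,4) c'(2)] h(2)[OF c(2)] by blast
  note d1 = carrier_in[OF geo(1) D(1,2)] and d2 = carrier_in[OF geo(2) D(3,4)]
  have f: "finite (carrier \<Delta>1 (fst p))" "finite (carrier \<Delta>2 (snd p))"
    using geometricD(2)[OF geo(1) d1(1)] geometricD(2)[OF geo(2) d2(1)] by blast+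
  obtain E where E: "E \<subseteq> carrier \<Delta>1 (fst p) \<times> carrier \<Delta>2 (snd p)" "pair_chain lt1 lt2 E" "p \<in> convex hull E"
    using chain_hull_exists[OF f lin(1)[OF d1(1)] lin(2)[OF d2(1)] d1(2) d2(2)] by blast
  have im: "fst ` E \<subseteq> carrier \<Delta>1 (fst p)" "snd ` E \<subseteq> carrier \<Delta>2 (snd p)" using E(1) by auto
  have "finite E" by (rule finite_subset[OF E(1)]) (use f in simp)
  then have "E \<in> \<Delta>"
    using geometricD(4)[OF geo(1) d1(1) im(1)] geometricD(4)[OF geo(2) d2(1) im(2)] E(2) unfolding chain_complex_def by blast
  then have "carrier \<Delta> p \<subseteq> E" using in_hull_iff_carrier[OF geo_prod assms] E(3) by blast
  then have "fst ` carrier \<Delta> p \<subseteq> carrier \<Delta>1 (fst p)" "snd ` carrier \<Delta> p \<subseteq> carrier \<Delta>2 (snd p)" using im by blast+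
  then show "fst ` carrier \<Delta> p = carrier \<Delta>1 (fst p)" "snd ` carrier \<Delta> p = carrier \<Delta>2 (snd p)" using s1 s2 by blast+
qed

lemma in_tile1: "t \<in> \<tau>1 \<Longrightarrow> U \<in> \<Delta>1 \<Longrightarrow> x \<in> convex hull U \<Longrightarrow> x \<in> tile_set t \<longleftrightarrow> in_cell (c1 t) (carrier \<Delta>1 x)"
proof -
  assume t: "t \<in> \<tau>1" and U: "U \<in> \<Delta>1" "x \<in> convex hull U"
  obtain W R M where c: "c1 t = (W, R, M)" by (cases "c1 t")
  have t': "W \<in> \<Delta>1" "valid_tile W R M" "t = hull_tile (W, R, M)" using cells1[OF t] c by (simp_all add: good_cell_def)
  show ?thesis using tile_set_hull_tile[OF geo(1) t'(1) _ _ U, of R M] t'(2,3) c unfolding valid_tile_def by simp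
qed

lemma in_tile2: "t \<in> \<tau>2 \<Longrightarrow> U \<in> \<Delta>2 \<Longrightarrow> x \<in> convex hull U \<Longrightarrow> x \<in> tile_set t \<longleftrightarrow> in_cell (c2 t) (carrier \<Delta>2 x)"
proof -
  assume t: "t \<in> \<tau>2" and U: "U \<in> \<Delta>2" "x \<in> convex hull U"
  obtain W R M where c: "c2 t = (W, R, M)" by (cases "c2 t")
  have t': "W \<in> \<Delta>2" "valid_tile W R M" "t = hull_tile (W, R, M)" using cells2[OF t] c by (simp_all add: good_cell_def)
  show ?thesis using tile_set_hull_tile[OF geo(2) t'(1) _ _ U, of R M] t'(2,3) c unfolding valid_tile_def by simp
qed

lemma PL_cell:
  assumes t: "t \<in> \<tau>1" and u: "u \<in> \<tau>2" and v: "(P, R, M) \<in> set (PL t u)"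
  shows "valid_tile P R M" "P \<in> \<Delta>" "P \<subseteq> fst (c1 t) \<times> fst (c2 u)" "Suc (card P) = card (fst (c1 t)) + card (fst (c2 u))"
    "\<forall>p\<in>P - M. \<forall>q\<in>M. pair_le lt1 lt2 p q" "\<not> affine_dependent P" "R \<subseteq> P" "M \<subseteq> P"
proof -
  have "\<forall>(P, R, M)\<in>set (PL t u). valid_tile P R M \<and> P \<subseteq> fst (c1 t) \<times> fst (c2 u) \<and> pair_chain lt1 lt2 P \<and> Suc (card P) = card (fst (c1 t)) + card (fst (c2 u)) \<and>
        (\<forall>p\<in>P - M. \<forall>q\<in>M. pair_le lt1 lt2 p q)"
    using PL[OF t u] unfolding product_list_def by (rule conjunct1)
  from bspec[OF this v] have p: "valid_tile P R M" "P \<subseteq> fst (c1 t) \<times> fst (c2 u)" "pair_chain lt1 lt2 P" "Suc (card P) = card (fst (c1 t)) + card (fst (c2 u))"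
        "\<forall>p\<in>P - M. \<forall>q\<in>M. pair_le lt1 lt2 p q" unfolding prod.case by blast+
  have "fst ` P \<subseteq> fst (c1 t)" "snd ` P \<subseteq> fst (c2 u)" using p(2) by auto
  then have "fst ` P \<in> \<Delta>1" "snd ` P \<in> \<Delta>2" using geometricD(4)[OF geo(1)] geometricD(4)[OF geo(2)] cells1[OF t] cells2[OF u] by blast+
  then show P: "P \<in> \<Delta>" using p(1,3) unfolding chain_complex_def valid_tile_def by blast
  show "valid_tile P R M" "P \<subseteq> fst (c1 t) \<times> fst (c2 u)" "Suc (card P) = card (fst (c1 t)) + card (fst (c2 u))"
    "\<forall>p\<in>P - M. \<forall>q\<in>M. pair_le lt1 lt2 p q" by (rule p)+
  show "\<not> affine_dependent P" by (rule geometricD(3)[OF geo_prod P])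
  show "R \<subseteq> P" "M \<subseteq> P" using p(1) unfolding valid_tile_def by blast+
qed

lemma in_PL_tile:
  assumes t: "t \<in> \<tau>1" and u: "u \<in> \<tau>2" and v: "v \<in> set (PL t u)" and D: "D \<in> \<Delta>" "p \<in> convex hull D"
  shows "p \<in> tile_set (hull_tile v) \<longleftrightarrow> in_cell v (carrier \<Delta> p)"
    and "p \<in> convex hull (fst v) \<longleftrightarrow> carrier \<Delta> p \<subseteq> fst v"
proof -
  obtain P R M where c: "v = (P, R, M)" by (cases v)
  note P = PL_cell[OF t u v[unfolded c]]
  show "p \<in> tile_set (hull_tile v) \<longleftrightarrow> in_cell v (carrier \<Delta> p)"
    unfolding c by (rule tile_set_hull_tile[OF geo_prod P(2,7,8) D])
  show "p \<in> convex hull (fst v) \<longleftrightarrow> carrier \<Delta> p \<subseteq> fst v"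
    unfolding c fst_conv by (rule in_hull_iff_carrier[OF geo_prod D P(2)])
qed

lemma tile_set_subset_hull: "tile_set (hull_tile v) \<subseteq> convex hull (fst v)"
  by (cases v) (auto simp: tile_set_def hull_tile_def)

lemma PL_tile_subset:
  assumes t: "t \<in> \<tau>1" and u: "u \<in> \<tau>2" and v: "v \<in> set (PL t u)"
  shows "tile_set (hull_tile v) \<subseteq> tile_set t \<times> tile_set u"
proof
  fix p assume p: "p \<in> tile_set (hull_tile v)"
  obtain P R M where c: "v = (P, R, M)" by (cases v)
  note P = PL_cell[OF t u v[unfolded c]]
  have pP: "p \<in> convex hull P" using p tile_set_subset_hull[of v] c by auto
  have "in_cell v (carrier \<Delta> p)" using in_PL_tile(1)[OF t u v P(2) pP] p by blast
  then have "in_cell (c1 t) (fst ` carrier \<Delta> p) \<and> in_cell (c2 u) (snd ` carrier \<Delta> p)"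
    using PL[OF t u] v unfolding product_list_def by blast
  note i = this[unfolded carrier_prod(1,2)[OF P(2) pP]]
  note cp = carrier_prod(3-6)[OF P(2) pP]
  have "fst p \<in> tile_set t" "snd p \<in> tile_set u"
    using in_tile1[OF t cp(1,2)] in_tile2[OF u cp(3,4)] i by blast+
  then show "p \<in> tile_set t \<times> tile_set u" by (simp add: mem_Times_iff)
qed

lemma product_hull:
  assumes "W1 \<in> \<Delta>1" "W2 \<in> \<Delta>2" "p \<in> (convex hull W1) \<times> (convex hull W2)"
  shows "\<exists>D\<in>\<Delta>. D \<subseteq> W1 \<times> W2 \<and> p \<in> convex hull D"
proof -
  have f: "finite W1" "finite W2" using geometricD(2)[OF geo(1) assms(1)] geometricD(2)[OF geo(2) assms(2)] by blast+
  have "fst p \<in> convex hull W1" "snd p \<in> convex hull W2" using assms(3) by auto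
  then obtain D where D: "D \<subseteq> W1 \<times> W2" "pair_chain lt1 lt2 D" "p \<in> convex hull D"
    using chain_hull_exists[OF f lin(1)[OF assms(1)] lin(2)[OF assms(2)]] by blast
  have im: "fst ` D \<subseteq> W1" "snd ` D \<subseteq> W2" using D(1) by auto
  have "finite D" by (rule finite_subset[OF D(1)]) (use f in simp)
  then have "D \<in> \<Delta>"
    using geometricD(4)[OF geo(1) assms(1) im(1)] geometricD(4)[OF geo(2) assms(2) im(2)] D(2) unfolding chain_complex_def by blast
  then show ?thesis using D by blast
qed

lemma PL_select:
  assumes t: "t \<in> \<tau>1" and u: "u \<in> \<tau>2" and p: "p \<in> tile_set t \<times> tile_set u"
  shows "\<exists>A v B. PL t u = A @ v # B \<and> p \<in> tile_set (hull_tile v) \<and>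
     (\<forall>g\<in>set A. p \<notin> convex hull (fst g)) \<and> (\<forall>g\<in>set B. p \<notin> tile_set (hull_tile g))"
proof -
  have W: "fst (c1 t) \<in> \<Delta>1" "fst (c2 u) \<in> \<Delta>2" "t = hull_tile (c1 t)" "u = hull_tile (c2 u)" using cells1[OF t] cells2[OF u] by blast+
  have "p \<in> (convex hull (fst (c1 t))) \<times> (convex hull (fst (c2 u)))"
    using p tile_set_subset_hull W(3,4) by (metis (no_types, lifting) Sigma_mono subsetD)
  then obtain D where D: "D \<in> \<Delta>" "D \<subseteq> fst (c1 t) \<times> fst (c2 u)" "p \<in> convex hull D" using product_hull[OF W(1,2)] by blast
  let ?C = "carrier \<Delta> p"
  have CD: "?C \<subseteq> D" using in_hull_iff_carrier[OF geo_prod D(1,3) D(1)] D(3) by blast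
  have CW: "?C \<subseteq> fst (c1 t) \<times> fst (c2 u)" using CD D(2) by blast
  have ch: "pair_chain lt1 lt2 ?C" using carrier_in(1)[OF geo_prod D(1,3)] unfolding chain_complex_def by blast
  note cp = carrier_prod[OF D(1,3)]
  have "fst p \<in> tile_set t" "snd p \<in> tile_set u" using p by auto
  then have i: "in_cell (c1 t) (fst ` ?C)" "in_cell (c2 u) (snd ` ?C)"
    using in_tile1[OF t cp(3,4)] in_tile2[OF u cp(5,6)] unfolding cp(1,2) by blast+
  obtain A v B where L: "PL t u = A @ v # B" "in_cell v ?C" "\<forall>g\<in>set A. \<not> ?C \<subseteq> fst g" "\<forall>g\<in>set B. \<not> in_cell g ?C"
    using PL[OF t u] CW ch i unfolding product_list_def by meson
  have mem: "v \<in> set (PL t u)" "\<And>g. g \<in> set A \<Longrightarrow> g \<in> set (PL t u)" "\<And>g. g \<in> set B \<Longrightarrow> g \<in> set (PL t u)" using L(1) by auto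
  have "p \<in> tile_set (hull_tile v)" using in_PL_tile(1)[OF t u mem(1) D(1,3)] L(2) by blast
  moreover have "\<forall>g\<in>set A. p \<notin> convex hull (fst g)" using in_PL_tile(2)[OF t u mem(2) D(1,3)] L(3) by blast
  moreover have "\<forall>g\<in>set B. p \<notin> tile_set (hull_tile g)" using in_PL_tile(1)[OF t u mem(3) D(1,3)] L(4) by blast
  ultimately show ?thesis using L(1) by blast
qed

lemma PL_unique:
  assumes t: "t \<in> \<tau>1" and u: "u \<in> \<tau>2" and v: "v \<in> set (PL t u)" "p \<in> tile_set (hull_tile v)"
  shows "\<exists>A B. PL t u = A @ v # B \<and> (\<forall>g\<in>set A. p \<notin> convex hull (fst g)) \<and> (\<forall>g\<in>set B. p \<notin> tile_set (hull_tile g))"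
proof -
  have "p \<in> tile_set t \<times> tile_set u" using PL_tile_subset[OF t u v(1)] v(2) by blast
  then obtain A w B where L: "PL t u = A @ w # B" "p \<in> tile_set (hull_tile w)"
     "\<forall>g\<in>set A. p \<notin> convex hull (fst g)" "\<forall>g\<in>set B. p \<notin> tile_set (hull_tile g)"
    using PL_select[OF t u] by blast
  have "v \<notin> set A" using L(3) v(2) tile_set_subset_hull[of v] by blast
  moreover have "v \<notin> set B" using L(4) v(2) by blast
  ultimately have "v = w" using v(1) L(1) by auto
  then show ?thesis using L by blast
qed

lemma morse_tile_PL:
  assumes "t \<in> \<tau>1" "u \<in> \<tau>2" "v \<in> set (PL t u)"
  shows "morse_tile (hull_tile v)"
proof -
  obtain P R M where c: "v = (P, R, M)" by (cases v)
  note P = PL_cell[OF assms(1,2) assms(3)[unfolded c]]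
  show ?thesis unfolding c by (rule morse_tile_hull_tile[OF P(6,1)])
qed

lemma PL_tile_unique:
  assumes t: "t \<in> \<tau>1" "u \<in> \<tau>2" "v \<in> set (PL t u)" and t': "t' \<in> \<tau>1" "u' \<in> \<tau>2" "v' \<in> set (PL t' u')"
    and p: "p \<in> tile_set (hull_tile v)" "p \<in> tile_set (hull_tile v')"
  shows "t = t' \<and> u = u' \<and> v = v'"
proof -
  have p': "p \<in> tile_set t \<times> tile_set u" "p \<in> tile_set t' \<times> tile_set u'"
    using PL_tile_subset[OF t] PL_tile_subset[OF t'] p by blast+
  have "fst p \<in> tile_set t \<inter> tile_set t'" "snd p \<in> tile_set u \<inter> tile_set u'" using p' by auto
  then have tu: "t = t'" "u = u'"
    using disjoint_family_onD[OF dis(1) t(1) t'(1)] disjoint_family_onD[OF dis(2) t(2) t'(2)] by blast+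
  obtain A B where L: "PL t u = A @ v # B" "\<forall>g\<in>set A. p \<notin> convex hull (fst g)" "\<forall>g\<in>set B. p \<notin> tile_set (hull_tile g)"
    using PL_unique[OF t p(1)] by blast
  have "v' \<notin> set A" using L(2) p(2) tile_set_subset_hull[of v'] by blast
  moreover have "v' \<notin> set B" using L(3) p(2) by blast
  ultimately have "v = v'" using t'(3) tu L(1) by auto
  then show ?thesis using tu by blast
qed

lemma distinct_PL:
  assumes "t \<in> \<tau>1" "u \<in> \<tau>2"
  shows "distinct (map hull_tile (PL t u))"
proof (rule distinct_map_by_split)
  fix v assume v: "v \<in> set (PL t u)"
  obtain p where p: "p \<in> tile_set (hull_tile v)" using closure_tile_set(2)[OF morse_tile_PL[OF assms v]] by blast
  obtain A B where L: "PL t u = A @ v # B" "\<forall>g\<in>set A. p \<notin> convex hull (fst g)" "\<forall>g\<in>set B. p \<notin> tile_set (hull_tile g)"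
    using PL_unique[OF assms v p] by blast
  have "hull_tile v \<notin> hull_tile ` set A" 
  proof
    assume "hull_tile v \<in> hull_tile ` set A"
    then obtain g where g: "hull_tile v = hull_tile g" "g \<in> set A" by blast
    have "p \<in> tile_set (hull_tile g)" using p unfolding g(1) .
    then show False using L(2) g(2) tile_set_subset_hull[of g] by blast
  qed
  moreover have "hull_tile v \<notin> hull_tile ` set B" 
  proof
    assume "hull_tile v \<in> hull_tile ` set B"
    then obtain g where g: "hull_tile v = hull_tile g" "g \<in> set B" by blast
    have "p \<in> tile_set (hull_tile g)" using p unfolding g(1) .
    then show False using L(3) g(2) by blast
  qed
  ultimately show "\<exists>A B. PL t u = A @ v # B \<and> hull_tile v \<notin> hull_tile ` set A \<and> hull_tile v \<notin> hull_tile ` set B"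
    using L(1) by blast
qed

text \<open>
  A point in the closed simplex of some tile of the initial segment belongs to this tile or to an earlier one,
  because no tile before the one containing the point has the point in its closed simplex.
\<close>

lemma PL_prefix_closed:
  assumes t: "t \<in> \<tau>1" and u: "u \<in> \<tau>2" and L: "PL t u = A @ B"
  shows "\<Union>(tile_set ` hull_tile ` set A) = (tile_set t \<times> tile_set u) \<inter> (\<Union>v\<in>set A. convex hull (fst v))"
proof
  have mem: "v \<in> set (PL t u)" if "v \<in> set A" for v using that L by simp
  show "\<Union>(tile_set ` hull_tile ` set A) \<subseteq> (tile_set t \<times> tile_set u) \<inter> (\<Union>v\<in>set A. convex hull (fst v))"
    using PL_tile_subset[OF t u mem] tile_set_subset_hull by blast
  show "(tile_set t \<times> tile_set u) \<inter> (\<Union>v\<in>set A. convex hull (fst v)) \<subseteq> \<Union>(tile_set ` hull_tile ` set A)"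
  proof
    fix p assume "p \<in> (tile_set t \<times> tile_set u) \<inter> (\<Union>v\<in>set A. convex hull (fst v))"
    then obtain v where p: "p \<in> tile_set t \<times> tile_set u" "v \<in> set A" "p \<in> convex hull (fst v)" by blast
    obtain A' w B' where L': "PL t u = A' @ w # B'" "p \<in> tile_set (hull_tile w)" "\<forall>g\<in>set A'. p \<notin> convex hull (fst g)"
      using PL_select[OF t u p(1)] by blast
    have "v \<notin> set A'" using L'(3) p(3) by blast
    have "A @ B = A' @ w # B'" using L L'(1) by simp
    then consider us where "A @ us = A'" | us where "A = A' @ us" "us @ B = w # B'"
      unfolding append_eq_append_conv2 by blast
    then have "w \<in> set A"
    proof cases
      case 1
      then show ?thesis using p(2) \<open>v \<notin> set A'\<close> by auto
    next
      case (2 us)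
      then show ?thesis using p(2) \<open>v \<notin> set A'\<close> by (cases us) auto
    qed
    then show "p \<in> \<Union>(tile_set ` hull_tile ` set A)" using L'(2) by blast
  qed
qed

end

section \<open>The product tiling is tame and primitive\<close>

context product_tiling
begin

definition T where "T = (\<lambda>C. convex hull C) ` \<Delta>"

lemma tile_dims:
  assumes t: "t \<in> \<tau>1" and u: "u \<in> \<tau>2"
  shows "tile_dim t = int (card (fst (c1 t))) - 1" "tile_dim u = int (card (fst (c2 u))) - 1" "0 \<le> tile_dim t" "0 \<le> tile_dim u"
proof -
  obtain W R M where c: "c1 t = (W, R, M)" by (cases "c1 t")
  obtain W' R' M' where c': "c2 u = (W', R', M')" by (cases "c2 u")
  have a: "W \<in> \<Delta>1" "valid_tile W R M" "t = hull_tile (W, R, M)" using cells1[OF t] c by (simp_all add: good_cell_def)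
  have a': "W' \<in> \<Delta>2" "valid_tile W' R' M'" "u = hull_tile (W', R', M')" using cells2[OF u] c' by (simp_all add: good_cell_def)
  have d: "tile_dim t = int (card W) - 1" unfolding a(3) by (rule tile_dim_hull_tile[OF geometricD(3)[OF geo(1) a(1)]])
  have d': "tile_dim u = int (card W') - 1" unfolding a'(3) by (rule tile_dim_hull_tile[OF geometricD(3)[OF geo(2) a'(1)]])
  have "finite W" "W \<noteq> {}" "finite W'" "W' \<noteq> {}" using a(2) a'(2) unfolding valid_tile_def by blast+
  then have "1 \<le> card W" "1 \<le> card W'" by (simp_all add: Suc_leI card_gt_0_iff)
  then show "tile_dim t = int (card (fst (c1 t))) - 1" "tile_dim u = int (card (fst (c2 u))) - 1" "0 \<le> tile_dim t" "0 \<le> tile_dim u"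
    using d d' c c' by simp_all
qed

lemma tile_dim_PL:
  assumes t: "t \<in> \<tau>1" and u: "u \<in> \<tau>2" and v: "v \<in> set (PL t u)"
  shows "tile_dim (hull_tile v) = tile_dim t + tile_dim u"
proof -
  obtain P R M where c: "v = (P, R, M)" by (cases v)
  note P = PL_cell[OF t u v[unfolded c]]
  have "tile_dim (hull_tile v) = int (card P) - 1" unfolding c by (rule tile_dim_hull_tile[OF P(6)])
  moreover have "int (card P) + 1 = int (card (fst (c1 t))) + int (card (fst (c2 u)))" using P(4) by linarith
  ultimately show ?thesis using tile_dims[OF t u] by linarith
qed

lemma \<tau>_iff: "w \<in> \<tau> \<longleftrightarrow> (\<exists>t\<in>\<tau>1. \<exists>u\<in>\<tau>2. \<exists>v\<in>set (PL t u). w = hull_tile v)"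
  unfolding \<tau>_def by auto

lemma PL_Union:
  assumes "t \<in> \<tau>1" "u \<in> \<tau>2"
  shows "\<Union>(tile_set ` hull_tile ` set (PL t u)) = tile_set t \<times> tile_set u"
proof
  show "\<Union>(tile_set ` hull_tile ` set (PL t u)) \<subseteq> tile_set t \<times> tile_set u" using PL_tile_subset[OF assms] by blast
  show "tile_set t \<times> tile_set u \<subseteq> \<Union>(tile_set ` hull_tile ` set (PL t u))"
  proof
    fix p assume "p \<in> tile_set t \<times> tile_set u"
    then obtain A v B where "PL t u = A @ v # B" "p \<in> tile_set (hull_tile v)" using PL_select[OF assms] by blast
    then show "p \<in> \<Union>(tile_set ` hull_tile ` set (PL t u))" by auto
  qed
qed

lemma PL_nonempty:
  assumes "t \<in> \<tau>1" "u \<in> \<tau>2"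
  shows "PL t u \<noteq> []"
proof
  assume "PL t u = []"
  then have "tile_set t \<times> tile_set u = {}" using PL_Union[OF assms] by simp
  moreover obtain W R M where c: "c1 t = (W, R, M)" by (cases "c1 t")
  moreover obtain W' R' M' where c': "c2 u = (W', R', M')" by (cases "c2 u")
  moreover have a: "W \<in> \<Delta>1" "valid_tile W R M" "t = hull_tile (W, R, M)" using cells1[OF assms(1)] c by (simp_all add: good_cell_def)
  moreover have a': "W' \<in> \<Delta>2" "valid_tile W' R' M'" "u = hull_tile (W', R', M')" using cells2[OF assms(2)] c' by (simp_all add: good_cell_def)
  ultimately show False
    using closure_tile_set(2)[OF morse_tile_hull_tile[OF geometricD(3)[OF geo(1) a(1)] a(2)]]
      closure_tile_set(2)[OF morse_tile_hull_tile[OF geometricD(3)[OF geo(2) a'(1)] a'(2)]] by simp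
qed

text \<open>
  The dimension of a product tile is the sum of the dimensions of its factors, so the condition \<open>\<ge> j\<close> splits into
  finitely many pairs of conditions on the factors.
\<close>

lemma skeleton_Union:
  fixes j :: nat
  shows "\<Union>(tile_set ` {w\<in>\<tau>. int j \<le> tile_dim w}) =
    (\<Union>i\<le>j. \<Union>(tile_set ` {t\<in>\<tau>1. int i \<le> tile_dim t}) \<times> \<Union>(tile_set ` {u\<in>\<tau>2. int (j - i) \<le> tile_dim u}))" (is "?L = ?R")
proof
  show "?L \<subseteq> ?R"
  proof
    fix p assume "p \<in> ?L"
    then obtain w where w: "w \<in> \<tau>" "int j \<le> tile_dim w" "p \<in> tile_set w" by blast
    then obtain t u v where v: "t \<in> \<tau>1" "u \<in> \<tau>2" "v \<in> set (PL t u)" "w = hull_tile v" unfolding \<tau>_iff by blast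
    have pm: "p \<in> tile_set t \<times> tile_set u" using PL_tile_subset[OF v(1-3)] w(3) v(4) by blast
    have d: "int j \<le> tile_dim t + tile_dim u" using w(2) tile_dim_PL[OF v(1-3)] v(4) by simp
    \<comment> \<open>The first factor contributes as much of j as its dimension allows.\<close>
    let ?i = "min j (nat (tile_dim t))"
    have i: "int ?i \<le> tile_dim t" "int (j - ?i) \<le> tile_dim u" "?i \<le> j" using tile_dims(3,4)[OF v(1,2)] d by linarith+
    have "p \<in> \<Union>(tile_set ` {t\<in>\<tau>1. int ?i \<le> tile_dim t}) \<times> \<Union>(tile_set ` {u\<in>\<tau>2. int (j - ?i) \<le> tile_dim u})"
      using pm v(1,2) i(1,2) by blast
    then show "p \<in> ?R" using i(3) by blast
  qed
  show "?R \<subseteq> ?L"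
  proof
    fix p assume "p \<in> ?R"
    then obtain i where i: "i \<le> j" "p \<in> \<Union>(tile_set ` {t\<in>\<tau>1. int i \<le> tile_dim t}) \<times> \<Union>(tile_set ` {u\<in>\<tau>2. int (j - i) \<le> tile_dim u})" by blast
    then obtain t u where t: "t \<in> \<tau>1" "int i \<le> tile_dim t" "u \<in> \<tau>2" "int (j - i) \<le> tile_dim u" "p \<in> tile_set t \<times> tile_set u" by blast
    have "p \<in> \<Union>(tile_set ` hull_tile ` set (PL t u))" using PL_Union[OF t(1,3)] t(5) by blast
    then obtain v where v: "v \<in> set (PL t u)" "p \<in> tile_set (hull_tile v)" by blast
    have "hull_tile v \<in> \<tau>" using t v unfolding \<tau>_iff by blast
    moreover have "int j \<le> tile_dim (hull_tile v)" using tile_dim_PL[OF t(1,3) v(1)] t(2,4) i(1) by linarith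
    ultimately show "p \<in> ?L" using v(2) by blast
  qed
qed

lemma \<tau>_disjoint:
  assumes "w \<in> \<tau>" "w' \<in> \<tau>" "w \<noteq> w'"
  shows "tile_set w \<inter> tile_set w' = {}"
proof (rule ccontr)
  assume "tile_set w \<inter> tile_set w' \<noteq> {}"
  then obtain p where p: "p \<in> tile_set w" "p \<in> tile_set w'" by blast
  obtain t u v where v: "t \<in> \<tau>1" "u \<in> \<tau>2" "v \<in> set (PL t u)" "w = hull_tile v" using assms(1) unfolding \<tau>_iff by blast
  obtain t' u' v' where v': "t' \<in> \<tau>1" "u' \<in> \<tau>2" "v' \<in> set (PL t' u')" "w' = hull_tile v'" using assms(2) unfolding \<tau>_iff by blast
  have "v = v'" using PL_tile_unique[OF v(1-3) v'(1-3) p[unfolded v(4) v'(4)]] by blast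
  then show False using assms(3) v(4) v'(4) by blast
qed

lemma morse_tiling_\<tau>: "morse_tiling T (S1 \<times> S2) \<tau>"
  unfolding morse_tiling_def
proof (intro conjI ballI allI)
  fix w assume "w \<in> \<tau>"
  then obtain t u v where v: "t \<in> \<tau>1" "u \<in> \<tau>2" "v \<in> set (PL t u)" "w = hull_tile v" unfolding \<tau>_iff by blast
  show "morse_tile w" unfolding v(4) by (rule morse_tile_PL[OF v(1-3)])
  obtain P R M where c: "v = (P, R, M)" by (cases v)
  have "P \<in> \<Delta>" by (rule PL_cell(2)[OF v(1,2) v(3)[unfolded c]])
  then show "tile_simplex w \<in> T" unfolding v(4) c T_def hull_tile_def by simp
next
  show "disjoint_family_on tile_set \<tau>" unfolding disjoint_family_on_def using \<tau>_disjoint by blast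
next
  have "\<Union>(tile_set ` \<tau>) = (\<Union>t\<in>\<tau>1. \<Union>u\<in>\<tau>2. \<Union>(tile_set ` hull_tile ` set (PL t u)))" unfolding \<tau>_def by blast
  also have "\<dots> = (\<Union>t\<in>\<tau>1. \<Union>u\<in>\<tau>2. tile_set t \<times> tile_set u)" using PL_Union by simp
  also have "\<dots> = \<Union>(tile_set ` \<tau>1) \<times> \<Union>(tile_set ` \<tau>2)" by blast
  finally show "\<Union>(tile_set ` \<tau>) = S1 \<times> S2" unfolding un .
next
  fix j :: nat
  show "closedin (top_of_set (S1 \<times> S2)) (\<Union>(tile_set ` {w\<in>\<tau>. int j \<le> tile_dim w}))"
    unfolding skeleton_Union
    by (rule closedin_Union) (auto simp del: of_nat_diff intro!: closedin_Times skeleton)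
qed

lemma hull_in_cell: "D \<subseteq> W1 \<times> W2 \<Longrightarrow> convex hull D \<subseteq> (convex hull W1) \<times> (convex hull W2)"
proof
  fix p assume D: "D \<subseteq> W1 \<times> W2" and p: "p \<in> convex hull D"
  have "fst ` D \<subseteq> W1" "snd ` D \<subseteq> W2" using D by auto
  moreover have "fst p \<in> convex hull (fst ` D)" "snd p \<in> convex hull (snd ` D)"
    using fst_hull[of D] snd_hull[of D] p by blast+
  ultimately have "fst p \<in> convex hull W1" "snd p \<in> convex hull W2" using hull_mono by blast+
  then show "p \<in> (convex hull W1) \<times> (convex hull W2)" by (simp add: mem_Times_iff)
qed

lemma underlying_T: "underlying_complex T (S1 \<times> S2) = T"
proof -
  have "convex hull D \<subseteq> closure (S1 \<times> S2)" if D: "D \<in> \<Delta>" for D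
  proof -
    have "fst ` D \<in> \<Delta>1" "snd ` D \<in> \<Delta>2" using D unfolding chain_complex_def by blast+
    then have "convex hull (fst ` D) \<subseteq> closure S1" "convex hull (snd ` D) \<subseteq> closure S2" using cover by blast+
    moreover have "convex hull D \<subseteq> (convex hull (fst ` D)) \<times> (convex hull (snd ` D))"
      by (rule hull_in_cell[OF subset_fst_snd])
    ultimately show ?thesis unfolding closure_Times by blast
  qed
  then show ?thesis unfolding underlying_complex_def T_def by blast
qed

lemma segment_in_T:
  assumes "closed_segment p q \<in> T"
  shows "{p, q} \<in> \<Delta>"
proof -
  obtain C where C: "C \<in> \<Delta>" "convex hull {p, q} = convex hull C" using assms unfolding T_def segment_convex_hull by blast
  have v: "vertices (convex hull {p, q}) = {p, q}" by (rule vertices_hull[OF affine_independent_2])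
  have w: "vertices (convex hull C) = C" by (rule vertices_hull[OF geometricD(3)[OF geo_prod C(1)]])
  have "C = {p, q}" by (rule trans[OF w[symmetric] v[unfolded C(2)]])
  then show ?thesis using C(1) by (rule subst)
qed

lemma pair_le_antisym:
  assumes "C \<in> \<Delta>" "p \<in> C" "q \<in> C" "pair_le lt1 lt2 p q" "pair_le lt1 lt2 q p"
  shows "p = q"
proof -
  have D: "fst ` C \<in> \<Delta>1" "snd ` C \<in> \<Delta>2" using assms(1) unfolding chain_complex_def by blast+
  note l = lin(1)[OF D(1)] lin(2)[OF D(2)]
  have m: "fst p \<in> fst ` C" "fst q \<in> fst ` C" "snd p \<in> snd ` C" "snd q \<in> snd ` C" using assms(2,3) by blast+
  have "fst p = fst q" using linear_on_asym[OF l(1) m(1,2)] assms(4,5) unfolding pair_le_def by argo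
  moreover have "snd p = snd q" using linear_on_asym[OF l(2) m(3,4)] assms(4,5) unfolding pair_le_def by argo
  ultimately show ?thesis by (rule prod_eqI)
qed

lemma pair_le_trans:
  assumes "C \<in> \<Delta>" "p \<in> C" "q \<in> C" "r \<in> C" "pair_le lt1 lt2 p q" "pair_le lt1 lt2 q r"
  shows "pair_le lt1 lt2 p r"
proof -
  have D: "fst ` C \<in> \<Delta>1" "snd ` C \<in> \<Delta>2" using assms(1) unfolding chain_complex_def by blast+
  note l = lin(1)[OF D(1)] lin(2)[OF D(2)]
  have m: "fst p \<in> fst ` C" "fst q \<in> fst ` C" "fst r \<in> fst ` C" "snd p \<in> snd ` C" "snd q \<in> snd ` C" "snd r \<in> snd ` C"
    using assms(2-4) by blast+
  have "fst p = fst r \<or> lt1 (fst p) (fst r)"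
    using linear_onD(3)[OF l(1) m(1-3)] assms(5,6) unfolding pair_le_def by metis
  moreover have "snd p = snd r \<or> lt2 (snd p) (snd r)"
    using linear_onD(3)[OF l(2) m(4-6)] assms(5,6) unfolding pair_le_def by metis
  ultimately show ?thesis unfolding pair_le_def by blast
qed

text \<open>
  Edges are oriented along the product order. Triangles are chains, hence not cyclic.
\<close>

lemma tame_\<tau>: "tame T (S1 \<times> S2) \<tau>"
proof -
  let ?A = "{(p, q). p \<noteq> q \<and> closed_segment p q \<in> T \<and> pair_le lt1 lt2 p q}"
  have ch: "pair_le lt1 lt2 p q \<or> pair_le lt1 lt2 q p" if "C \<in> \<Delta>" "p \<in> C" "q \<in> C" for C p q
    using that unfolding chain_complex_def pair_chain_def by blast
  have E: "edge_orientation T ?A" unfolding edge_orientation_def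
  proof (intro conjI allI impI)
    show "\<forall>(a, b)\<in>?A. a \<noteq> b \<and> closed_segment a b \<in> T" by blast
    fix a b :: "'a \<times> 'b" assume ab: "a \<noteq> b \<and> closed_segment a b \<in> T"
    then have d: "{a, b} \<in> \<Delta>" using segment_in_T by blast
    have "closed_segment b a \<in> T" using ab by (simp add: closed_segment_commute)
    moreover have "pair_le lt1 lt2 a b \<or> pair_le lt1 lt2 b a" by (rule ch[OF d]) simp_all
    moreover have "\<not> (pair_le lt1 lt2 a b \<and> pair_le lt1 lt2 b a)" using pair_le_antisym[OF d, of a b] ab by blast
    ultimately show "(a, b) \<in> ?A \<longleftrightarrow> (b, a) \<notin> ?A" using ab by blast
  qed
  have cyc: "\<not> (\<exists>a\<in>vertices X. \<exists>b\<in>vertices X. \<exists>c\<in>vertices X. (a, b) \<in> ?A \<and> (b, c) \<in> ?A \<and> (c, a) \<in> ?A)" if X: "X \<in> T" for X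
  proof
    obtain C where C: "C \<in> \<Delta>" "X = convex hull C" using X unfolding T_def by blast
    have v: "vertices X = C" unfolding C(2) by (rule vertices_hull[OF geometricD(3)[OF geo_prod C(1)]])
    assume "\<exists>a\<in>vertices X. \<exists>b\<in>vertices X. \<exists>c\<in>vertices X. (a, b) \<in> ?A \<and> (b, c) \<in> ?A \<and> (c, a) \<in> ?A"
    then obtain a b c where abc: "a \<in> C" "b \<in> C" "c \<in> C" "pair_le lt1 lt2 a b" "pair_le lt1 lt2 b c" "pair_le lt1 lt2 c a" "c \<noteq> a"
      unfolding v by blast
    have "pair_le lt1 lt2 a c" by (rule pair_le_trans[OF C(1) abc(1-5)])
    then show False using pair_le_antisym[OF C(1) abc(3,1,6)] abc(7) by blast
  qed
  have up: "(x, y) \<in> ?A" if w: "w \<in> \<tau>" and x: "x \<in> vertices (tile_simplex w) - morse_face w" and y: "y \<in> vertices (morse_face w)" for w x y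
  proof -
    obtain t u v where v: "t \<in> \<tau>1" "u \<in> \<tau>2" "v \<in> set (PL t u)" "w = hull_tile v" using w unfolding \<tau>_iff by blast
    obtain P R M where c: "v = (P, R, M)" by (cases v)
    note P = PL_cell[OF v(1,2) v(3)[unfolded c]]
    have s: "tile_simplex w = convex hull P" "morse_face w = convex hull M" unfolding v(4) c hull_tile_def by simp_all
    have "vertices (tile_simplex w) = P" unfolding s by (rule vertices_hull[OF P(6)])
    moreover have "vertices (morse_face w) = M" unfolding s by (rule vertices_hull[OF affine_independent_subset[OF P(6,8)]])
    ultimately have xy: "x \<in> P" "x \<notin> convex hull M" "y \<in> M" using x y s(2) by blast+
    have xM: "x \<notin> M" using xy(2) hull_inc by fast
    have "pair_le lt1 lt2 x y" using P(5) xy(1,3) xM by blast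
    moreover have "{x, y} \<in> \<Delta>" by (rule geometricD(4)[OF geo_prod P(2)]) (use xy P(8) in blast)
    then have "closed_segment x y \<in> T" unfolding T_def segment_convex_hull by blast
    ultimately show ?thesis using xy(3) xM by blast
  qed
  show ?thesis unfolding tame_def underlying_T
    by (rule exI[of _ ?A], intro conjI ballI impI, rule E, rule cyc, assumption, rule up)
qed

lemma primitive_T:
  "primitive_triangulation (product_cells ((\<lambda>W. convex hull W) ` \<Delta>1) ((\<lambda>W. convex hull W) ` \<Delta>2)) T"
  (is "primitive_triangulation ?C T")
  unfolding primitive_triangulation_def
proof (intro conjI ballI)
  have cell: "\<exists>U\<subseteq>T. (convex hull W1) \<times> (convex hull W2) = \<Union>U" if W: "W1 \<in> \<Delta>1" "W2 \<in> \<Delta>2" for W1 W2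
  proof (intro exI conjI)
    let ?U = "(\<lambda>C. convex hull C) ` {D \<in> \<Delta>. D \<subseteq> W1 \<times> W2}"
    show "?U \<subseteq> T" unfolding T_def by blast
    show "(convex hull W1) \<times> (convex hull W2) = \<Union>?U"
    proof (intro subset_antisym subsetI)
      fix p assume "p \<in> (convex hull W1) \<times> (convex hull W2)"
      then obtain D where "D \<in> \<Delta>" "D \<subseteq> W1 \<times> W2" "p \<in> convex hull D" using product_hull[OF W] by blast
      then show "p \<in> \<Union>?U" by blast
    next
      fix p assume "p \<in> \<Union>?U"
      then obtain D where "D \<subseteq> W1 \<times> W2" "p \<in> convex hull D" by blast
      then show "p \<in> (convex hull W1) \<times> (convex hull W2)" using hull_in_cell[of D W1 W2] by blast
    qed
  qed
  have mem: "X \<in> ?C \<longleftrightarrow> (\<exists>W1\<in>\<Delta>1. \<exists>W2\<in>\<Delta>2. X = (convex hull W1) \<times> (convex hull W2))" for X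
    unfolding product_cells_def by blast
  show "simplicial_complex T" unfolding T_def by (rule geometric_simplicial_complex[OF geo_prod])
  show c: "\<exists>U\<subseteq>T. X = \<Union>U" if "X \<in> ?C" for X using that cell unfolding mem by blast
  have "\<Union>T \<subseteq> \<Union>?C"
  proof
    fix p assume "p \<in> \<Union>T"
    then obtain D where D: "D \<in> \<Delta>" "p \<in> convex hull D" unfolding T_def by blast
    have "fst ` D \<in> \<Delta>1" "snd ` D \<in> \<Delta>2" using D(1) unfolding chain_complex_def by blast+
    moreover have "p \<in> (convex hull (fst ` D)) \<times> (convex hull (snd ` D))" using hull_in_cell[OF subset_fst_snd] D(2) by blast
    ultimately show "p \<in> \<Union>?C" using mem by blast
  qed
  then show "\<Union>T = \<Union>?C" using c by blast
  have "{x} \<in> T \<longleftrightarrow> {x} \<in> ?C" for x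
  proof
    assume "{x} \<in> T"
    then obtain D where D: "D \<in> \<Delta>" "{x} = convex hull D" unfolding T_def by blast
    have "D \<noteq> {}" using D(2) by auto
    moreover have "D \<subseteq> {x}" unfolding D(2) by (rule hull_subset)
    ultimately have "D = {x}" by blast
    then have "{fst x} \<in> \<Delta>1" "{snd x} \<in> \<Delta>2" using D(1) unfolding chain_complex_def by simp_all
    moreover have "{x} = (convex hull {fst x}) \<times> (convex hull {snd x})" by (simp add: prod_eq_iff)
    ultimately show "{x} \<in> ?C" unfolding mem by blast
  next
    assume "{x} \<in> ?C"
    then obtain W1 W2 where W: "W1 \<in> \<Delta>1" "W2 \<in> \<Delta>2" "{x} = (convex hull W1) \<times> (convex hull W2)" unfolding mem by blast
    have ne: "W1 \<noteq> {}" "W2 \<noteq> {}" using W(3) by auto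
    have sub: "W1 \<times> W2 \<subseteq> {x}" unfolding W(3) using hull_subset[of W1 convex] hull_subset[of W2 convex] by blast
    then have "W1 = {fst x}" "W2 = {snd x}" using ne by auto
    then have "fst ` {x} \<in> \<Delta>1" "snd ` {x} \<in> \<Delta>2" using W(1,2) by simp_all
    moreover have "pair_chain lt1 lt2 {x}" unfolding pair_chain_def pair_le_def by simp
    ultimately have "{x} \<in> \<Delta>" unfolding chain_complex_def by blast
    then have "convex hull {x} \<in> T" unfolding T_def by (rule imageI)
    then show "{x} \<in> T" by simp
  qed
  then show "{x. {x} \<in> T} = {x. {x} \<in> ?C}" by blast
qed

end

section \<open>Critical vector and h-vector of the product\<close>

text \<open>
  The symmetry of binomial coefficients, including the range where they vanish.
\<close>

lemma choose_from_reflect: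
  assumes "k \<le> a" "d + d' = a + k'"
  shows "choose_from (a - k) d k = choose_from (a - k) d' k'"
proof -
  consider "d < k" | "a < d" | "k \<le> d" "d \<le> a" by linarith
  then show ?thesis
  proof cases
    case 1
    then have "k' \<le> d'" "a - k < d' - k'" using assms by linarith+
    then show ?thesis using 1 by (simp add: choose_from_def binomial_eq_0)
  next
    case 2
    then have "\<not> k' \<le> d'" "k \<le> d" "a - k < d - k" using assms by linarith+
    then show ?thesis by (simp add: choose_from_def binomial_eq_0)
  next
    case 3
    then have "k' \<le> d'" "d - k \<le> a - k" "(a - k) - (d - k) = d' - k'" using assms by linarith+
    then show ?thesis using 3(1) binomial_symmetric[of "d - k" "a - k"] by (simp add: choose_from_def)
  qed
qed

text \<open>
  Complementing both orders exchanges the two factors of \<open>path_count\<close>.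
\<close>

lemma product_order_reflect:
  assumes "k1 \<le> n1 + 1" "k2 \<le> n2 + 1" "d \<le> n1 + n2 + 1"
  shows "product_order n1 n2 (n1 + 1 - k1) (n2 + 1 - k2) (n1 + n2 + 1 - d) = product_order n1 n2 k1 k2 d"
proof -
  consider "n1 = 0 \<or> n2 = 0" | "0 < n1" "0 < n2" "k1 = 0" "k2 = Suc n2" | "0 < n1" "0 < n2" "k1 = Suc n1" "k2 = 0"
    | "0 < n1" "0 < n2" "\<not> (k1 = 0 \<and> k2 = Suc n2)" "\<not> (k1 = Suc n1 \<and> k2 = 0)" by blast
  then show ?thesis
  proof cases
    case 1
    have "n1 + n2 + 1 - d = n2 + 1 - k2 \<longleftrightarrow> d = k2" if "n1 = 0" using assms that by linarith
    moreover have "n1 + n2 + 1 - d = n1 + 1 - k1 \<longleftrightarrow> d = k1" if "n2 = 0" using assms that by linarith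
    ultimately show ?thesis using 1 unfolding product_order_def by (cases "n1 = 0") simp_all
  next
    case 2
    have "n1 + n2 + 1 - d = n1 \<longleftrightarrow> d = Suc n2" "n1 + n2 + 1 - d = Suc n1 \<longleftrightarrow> d = n2" using assms by linarith+
    then show ?thesis using 2 unfolding product_order_def by simp
  next
    case 3
    have "n1 + n2 + 1 - d = n2 \<longleftrightarrow> d = Suc n1" "n1 + n2 + 1 - d = Suc n2 \<longleftrightarrow> d = n1" using assms by linarith+
    then show ?thesis using 3 unfolding product_order_def by simp
  next
    case 4
    have le: "k2 \<le> n2 + k1" "k1 \<le> n1 + k2" using 4(3,4) assms(1,2) by linarith+
    have m: "n1 + (n2 + 1 - k2) - (n1 + 1 - k1) = n2 + k1 - k2" "n2 + (n1 + 1 - k1) - (n2 + 1 - k2) = n1 + k2 - k1"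
      using le assms(1,2) by linarith+
    have s: "d + (n1 + n2 + 1 - d) = n2 + k1 + (n1 + 1 - k1)" "d + (n1 + n2 + 1 - d) = n1 + k2 + (n2 + 1 - k2)"
      using assms by linarith+
    have "path_count n1 n2 (n1 + 1 - k1) (n2 + 1 - k2) (n1 + n2 + 1 - d) = path_count n1 n2 k1 k2 d"
      unfolding path_count_def m choose_from_reflect[OF le(1) s(1), symmetric] choose_from_reflect[OF le(2) s(2), symmetric]
      by (rule mult.commute)
    moreover have "\<not> (n1 + 1 - k1 = 0 \<and> n2 + 1 - k2 = Suc n2)" "\<not> (n1 + 1 - k1 = Suc n1 \<and> n2 + 1 - k2 = 0)"
      using 4(3,4) assms(1,2) by linarith+
    moreover have "product_order n1 n2 a b c = path_count n1 n2 a b c"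
      if "\<not> (a = 0 \<and> b = Suc n2)" "\<not> (a = Suc n1 \<and> b = 0)" for a b c
      using that 4(1,2) by (auto simp: product_order_def)
    ultimately show ?thesis using 4(3,4) by metis
  qed
qed

lemma palindromic_iff: "palindromic (map f [0..<Suc m]) \<longleftrightarrow> (\<forall>k\<le>m. f k = f (m - k))"
  unfolding palindromic_def by (auto simp: nth_map_upt less_Suc_eq_le simp del: upt_Suc)

lemma palindromic_sum:
  fixes f :: "nat \<Rightarrow> nat"
  assumes fin: "finite X" and le: "\<And>t. t \<in> X \<Longrightarrow> g t \<le> m" and sym: "\<And>k. k \<le> m \<Longrightarrow> card {t\<in>X. g t = k} = card {t\<in>X. g t = m - k}"
  shows "(\<Sum>t\<in>X. f (g t)) = (\<Sum>t\<in>X. f (m - g t))"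
proof -
  have group: "(\<Sum>t\<in>X. h (g t)) = (\<Sum>k\<le>m. card {t\<in>X. g t = k} * h k)" for h :: "nat \<Rightarrow> nat"
  proof -
    have "(\<Sum>t\<in>X. h (g t)) = (\<Sum>k\<le>m. \<Sum>t\<in>{t\<in>X. g t = k}. h (g t))"
      by (rule sum.group[symmetric]) (use fin le in auto)
    also have "\<dots> = (\<Sum>k\<le>m. card {t\<in>X. g t = k} * h k)" by (rule sum.cong) simp_all
    finally show ?thesis .
  qed
  have "(\<Sum>t\<in>X. f (g t)) = (\<Sum>k\<le>m. card {t\<in>X. g t = k} * f k)" by (rule group)
  also have "\<dots> = (\<Sum>k\<le>m. card {t\<in>X. g t = m - k} * f (m - k))"
    using sum.atLeastAtMost_rev[of "\<lambda>k. card {t\<in>X. g t = k} * f k" 0 m]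
    by (simp only: atMost_atLeast0 add_0_right)
  also have "\<dots> = (\<Sum>k\<le>m. card {t\<in>X. g t = k} * f (m - k))"
  proof (rule sum.cong[OF refl])
    fix k assume "k \<in> {..m}"
    then show "card {t\<in>X. g t = m - k} * f (m - k) = card {t\<in>X. g t = k} * f (m - k)" using sym[of k] by simp
  qed
  also have "\<dots> = (\<Sum>t\<in>X. f (m - g t))" by (rule group[symmetric])
  finally show ?thesis .
qed

lemma tiling_dim_eq:
  assumes "finite X" "t \<in> X" "0 \<le> tile_dim t" "\<And>u. u \<in> X \<Longrightarrow> tile_dim u \<le> tile_dim t"
  shows "tiling_dim X = tile_dim t"
  unfolding tiling_dim_def by (rule Max_eqI) (use assms in auto)

lemma top_tile_exists:
  assumes "finite X" "X \<noteq> {}"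
  shows "\<exists>t\<in>X. \<forall>u\<in>X. tile_dim u \<le> tile_dim t"
proof -
  have "Max (tile_dim ` X) \<in> tile_dim ` X" by (rule Max_in) (use assms in auto)
  then obtain t where t: "t \<in> X" "tile_dim t = Max (tile_dim ` X)" by force
  have "tile_dim u \<le> tile_dim t" if "u \<in> X" for u unfolding t(2) by (rule Max_ge) (use assms that in auto)
  then show ?thesis using t(1) by blast
qed

lemma vectors_empty:
  "c_vector ({} :: 'a::euclidean_space tile set) = []" "palindromic (h_vector ({} :: 'a::euclidean_space tile set))"
proof -
  have "tiling_dim ({} :: 'a tile set) = -1" unfolding tiling_dim_def by simp
  then show "c_vector ({} :: 'a tile set) = []" "palindromic (h_vector ({} :: 'a tile set))"
    unfolding c_vector_def h_vector_def palindromic_def by simp_all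
qed

context product_tiling
begin

lemma card_tiles:
  assumes fin: "finite \<tau>1" "finite \<tau>2"
  shows "card {w\<in>\<tau>. Q w} = (\<Sum>t\<in>\<tau>1. \<Sum>u\<in>\<tau>2. count_if (\<lambda>v. Q (hull_tile v)) (PL t u))"
proof -
  let ?X = "\<lambda>p. {w \<in> hull_tile ` set (PL (fst p) (snd p)). Q w}"
  have "{w\<in>\<tau>. Q w} = (\<Union>p\<in>\<tau>1 \<times> \<tau>2. ?X p)"
  proof (intro subset_antisym subsetI)
    fix w assume "w \<in> {w\<in>\<tau>. Q w}"
    then obtain t u v where w: "t \<in> \<tau>1" "u \<in> \<tau>2" "v \<in> set (PL t u)" "w = hull_tile v" "Q w" unfolding \<tau>_iff by blast
    show "w \<in> (\<Union>p\<in>\<tau>1 \<times> \<tau>2. ?X p)" by (rule UN_I[of "(t, u)"]) (simp_all add: w(1-3,5) imageI flip: w(4), simp add: w(3,4))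
  next
    fix w assume "w \<in> (\<Union>p\<in>\<tau>1 \<times> \<tau>2. ?X p)"
    then obtain p where p: "p \<in> \<tau>1 \<times> \<tau>2" "w \<in> ?X p" by blast
    have "fst p \<in> \<tau>1" "snd p \<in> \<tau>2" using p(1) by auto
    then show "w \<in> {w\<in>\<tau>. Q w}" using p(2) unfolding \<tau>_iff by blast
  qed
  then have "card {w\<in>\<tau>. Q w} = card (\<Union>p\<in>\<tau>1 \<times> \<tau>2. ?X p)" by (rule arg_cong)
  also have "\<dots> = (\<Sum>p\<in>\<tau>1 \<times> \<tau>2. card (?X p))"
  proof (rule card_UN_disjoint)
    show "finite (\<tau>1 \<times> \<tau>2)" using fin by simp
    show "\<forall>p\<in>\<tau>1 \<times> \<tau>2. finite (?X p)" by simp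
    show "\<forall>p\<in>\<tau>1 \<times> \<tau>2. \<forall>q\<in>\<tau>1 \<times> \<tau>2. p \<noteq> q \<longrightarrow> ?X p \<inter> ?X q = {}"
    proof (intro ballI impI, rule ccontr)
      fix p q assume p: "p \<in> \<tau>1 \<times> \<tau>2" and q: "q \<in> \<tau>1 \<times> \<tau>2" and pq: "p \<noteq> q" and ne: "?X p \<inter> ?X q \<noteq> {}"
      from ne obtain v v' where v: "v \<in> set (PL (fst p) (snd p))" "v' \<in> set (PL (fst q) (snd q))" "hull_tile v = hull_tile v'" by blast
      have m: "fst p \<in> \<tau>1" "snd p \<in> \<tau>2" "fst q \<in> \<tau>1" "snd q \<in> \<tau>2" using p q by auto
      obtain x where x: "x \<in> tile_set (hull_tile v)"
        using closure_tile_set(2)[OF morse_tile_PL[OF m(1,2) v(1)]] by blast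
      have "fst p = fst q \<and> snd p = snd q \<and> v = v'" by (rule PL_tile_unique[OF m(1,2) v(1) m(3,4) v(2) x x[unfolded v(3)]])
      then show False using pq by (simp add: prod_eq_iff)
    qed
  qed
  also have "\<dots> = (\<Sum>p\<in>\<tau>1 \<times> \<tau>2. count_if (\<lambda>v. Q (hull_tile v)) (PL (fst p) (snd p)))"
  proof (rule sum.cong[OF refl])
    fix p assume "p \<in> \<tau>1 \<times> \<tau>2"
    then have d: "distinct (map hull_tile (PL (fst p) (snd p)))" by (intro distinct_PL) auto
    have "?X p = set (filter Q (map hull_tile (PL (fst p) (snd p))))" by auto
    then have "card (?X p) = card (set (filter Q (map hull_tile (PL (fst p) (snd p)))))" by (rule arg_cong)
    also have "\<dots> = length (filter Q (map hull_tile (PL (fst p) (snd p))))" by (rule distinct_card[OF distinct_filter[OF d]])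
    also have "\<dots> = count_if (\<lambda>v. Q (hull_tile v)) (PL (fst p) (snd p))" unfolding count_if_def filter_map length_map comp_def ..
    finally show "card (?X p) = count_if (\<lambda>v. Q (hull_tile v)) (PL (fst p) (snd p))" .
  qed
  also have "\<dots> = (\<Sum>t\<in>\<tau>1. \<Sum>u\<in>\<tau>2. count_if (\<lambda>v. Q (hull_tile v)) (PL t u))"
    unfolding sum.cartesian_product by (rule sum.cong) auto
  finally show ?thesis .
qed

lemma card_critical_tiles:
  assumes fin: "finite \<tau>1" "finite \<tau>2"
  shows "card {w\<in>\<tau>. critical_of_index w k} =
    (\<Sum>t\<in>\<tau>1. \<Sum>u\<in>\<tau>2. of_bool (\<exists>i j. critical_of_index t i \<and> critical_of_index u j \<and> k = i + j))"
  unfolding card_tiles[OF fin]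
proof (intro sum.cong refl)
  fix t u assume tu: "t \<in> \<tau>1" "u \<in> \<tau>2"
  have "count_if (\<lambda>v. critical_of_index (hull_tile v) k) (PL t u) = critical_count (PL t u) k"
    unfolding critical_count_def count_if_def
  proof (rule arg_cong[of _ _ length], rule filter_cong[OF refl])
    fix v assume v: "v \<in> set (PL t u)"
    obtain P R M where c: "v = (P, R, M)" by (cases v)
    note P = PL_cell[OF tu v[unfolded c]]
    show "critical_of_index (hull_tile v) k = (case v of (P, R, M) \<Rightarrow> critical_tile P R M k)"
      unfolding c prod.case by (rule critical_of_index_hull_tile[OF P(6,1)])
  qed
  then show "count_if (\<lambda>v. critical_of_index (hull_tile v) k) (PL t u) =
      of_bool (\<exists>i j. critical_of_index t i \<and> critical_of_index u j \<and> k = i + j)" using critical[OF tu] by simp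
qed

lemma card_order_tiles:
  assumes fin: "finite \<tau>1" "finite \<tau>2"
  shows "card {w\<in>\<tau>. tile_order w = k} =
    (\<Sum>t\<in>\<tau>1. \<Sum>u\<in>\<tau>2. product_order (nat (tile_dim t)) (nat (tile_dim u)) (tile_order t) (tile_order u) k)"
  unfolding card_tiles[OF fin]
proof (intro sum.cong refl)
  fix t u assume tu: "t \<in> \<tau>1" "u \<in> \<tau>2"
  have "count_if (\<lambda>v. tile_order (hull_tile v) = k) (PL t u) = order_count (PL t u) k"
    unfolding order_count_def count_if_def
  proof (rule arg_cong[of _ _ length], rule filter_cong[OF refl])
    fix v assume v: "v \<in> set (PL t u)"
    obtain P R M where c: "v = (P, R, M)" by (cases v)
    note P = PL_cell[OF tu v[unfolded c]]
    show "(tile_order (hull_tile v) = k) = (case v of (P, R, M) \<Rightarrow> card R = k)"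
      unfolding c prod.case tile_order_hull_tile[OF P(6,7)] ..
  qed
  then show "count_if (\<lambda>v. tile_order (hull_tile v) = k) (PL t u) =
      product_order (nat (tile_dim t)) (nat (tile_dim u)) (tile_order t) (tile_order u) k" using orders[OF tu] by simp
qed

lemma finite_\<tau>: "finite \<tau>1 \<Longrightarrow> finite \<tau>2 \<Longrightarrow> finite \<tau>"
  unfolding \<tau>_def by simp

lemma tiling_dim_\<tau>:
  assumes fin: "finite \<tau>1" "finite \<tau>2" and t: "t \<in> \<tau>1" "\<forall>t'\<in>\<tau>1. tile_dim t' \<le> tile_dim t"
    and u: "u \<in> \<tau>2" "\<forall>u'\<in>\<tau>2. tile_dim u' \<le> tile_dim u"
  shows "tiling_dim \<tau>1 = tile_dim t" "tiling_dim \<tau>2 = tile_dim u" "tiling_dim \<tau> = tile_dim t + tile_dim u"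
    "0 \<le> tile_dim t" "0 \<le> tile_dim u"
proof -
  show d: "0 \<le> tile_dim t" "0 \<le> tile_dim u" using tile_dims(3,4)[OF t(1) u(1)] .
  show "tiling_dim \<tau>1 = tile_dim t" by (rule tiling_dim_eq[OF fin(1) t(1) d(1)]) (use t(2) in blast)
  show "tiling_dim \<tau>2 = tile_dim u" by (rule tiling_dim_eq[OF fin(2) u(1) d(2)]) (use u(2) in blast)
  obtain v where v: "v \<in> set (PL t u)" using PL_nonempty[OF t(1) u(1)] by (cases "PL t u") auto
  have w: "hull_tile v \<in> \<tau>" using v t(1) u(1) unfolding \<tau>_iff by blast
  have vd: "tile_dim (hull_tile v) = tile_dim t + tile_dim u" by (rule tile_dim_PL[OF t(1) u(1) v])
  have "tile_dim w' \<le> tile_dim (hull_tile v)" if "w' \<in> \<tau>" for w'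
  proof -
    obtain t' u' v' where v': "t' \<in> \<tau>1" "u' \<in> \<tau>2" "v' \<in> set (PL t' u')" "w' = hull_tile v'" using \<open>w' \<in> \<tau>\<close> unfolding \<tau>_iff by blast
    have "tile_dim t' \<le> tile_dim t" "tile_dim u' \<le> tile_dim u" using t(2) u(2) v'(1,2) by blast+
    then show ?thesis unfolding vd v'(4) tile_dim_PL[OF v'(1-3)] by linarith
  qed
  then show "tiling_dim \<tau> = tile_dim t + tile_dim u"
    using tiling_dim_eq[OF finite_\<tau>[OF fin] w] vd d by simp
qed

lemma \<tau>_empty: "\<tau>1 = {} \<or> \<tau>2 = {} \<Longrightarrow> \<tau> = {}"
  unfolding \<tau>_def by auto

lemma morse_tile_factors: "t \<in> \<tau>1 \<Longrightarrow> morse_tile t" "u \<in> \<tau>2 \<Longrightarrow> morse_tile u"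
proof -
  show "morse_tile t" if t: "t \<in> \<tau>1"
  proof -
    obtain W R M where c: "c1 t = (W, R, M)" by (cases "c1 t")
    have a: "W \<in> \<Delta>1" "valid_tile W R M" "t = hull_tile (W, R, M)" using cells1[OF t] c by (simp_all add: good_cell_def)
    show ?thesis unfolding a(3) by (rule morse_tile_hull_tile[OF geometricD(3)[OF geo(1) a(1)] a(2)])
  qed
  show "morse_tile u" if u: "u \<in> \<tau>2"
  proof -
    obtain W R M where c: "c2 u = (W, R, M)" by (cases "c2 u")
    have a: "W \<in> \<Delta>2" "valid_tile W R M" "u = hull_tile (W, R, M)" using cells2[OF u] c by (simp_all add: good_cell_def)
    show ?thesis unfolding a(3) by (rule morse_tile_hull_tile[OF geometricD(3)[OF geo(2) a(1)] a(2)])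
  qed
qed

end

lemma tile_dim_nonneg: "morse_tile t \<Longrightarrow> 0 \<le> tile_dim t"
  unfolding morse_tile_def tile_dim_def using aff_dim_simplex by fastforce

lemma critical_index_unique:
  assumes "morse_tile t" "critical_of_index t i" "critical_of_index t j"
  shows "i = j"
  using assms(2,3) tile_dim_nonneg[OF assms(1)] unfolding critical_of_index_def by linarith

lemma critical_index_le:
  assumes "morse_tile t" "critical_of_index t i"
  shows "int i \<le> tile_dim t"
  using assms(2) tile_dim_nonneg[OF assms(1)] unfolding critical_of_index_def by linarith

lemma tile_order_le:
  assumes "morse_tile t"
  shows "tile_order t \<le> nat (tile_dim t) + 1"
proof -
  obtain W R M where c: "\<not> affine_dependent W" "valid_tile W R M" "t = hull_tile (W, R, M)" using morse_tile_cell[OF assms] by blast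
  have v: "finite W" "R \<subseteq> W" "W \<noteq> {}" using c(2) unfolding valid_tile_def by blast+
  have "card R \<le> card W" "1 \<le> card W" using v by (simp_all add: card_mono Suc_leI card_gt_0_iff)
  then show ?thesis unfolding c(3) tile_order_hull_tile[OF c(1) v(2)] tile_dim_hull_tile[OF c(1)] by linarith
qed

lemma of_bool_sum_index:
  fixes k :: nat
  assumes i: "\<And>i i'. P i \<Longrightarrow> P i' \<Longrightarrow> i = i'"
  shows "(of_bool (\<exists>i j. P i \<and> Q j \<and> k = i + j) :: nat) = (\<Sum>i\<le>k. of_bool (P i) * of_bool (Q (k - i)))"
proof (cases "\<exists>i j. P i \<and> Q j \<and> k = i + j")
  case True
  then obtain i j where ij: "P i" "Q j" "k = i + j" by blast
  have "(\<Sum>l\<le>k. of_bool (P l) * of_bool (Q (k - l)) :: nat) = (\<Sum>l\<le>k. if l = i then 1 else 0)"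
  proof (rule sum.cong[OF refl])
    fix l
    show "(of_bool (P l) * of_bool (Q (k - l)) :: nat) = (if l = i then 1 else 0)"
    proof (cases "l = i")
      case False
      then have "\<not> P l" using i[OF ij(1)] by metis
      then show ?thesis using False by simp
    next
      case True
      then have "k - l = j" using ij(3) by simp
      then show ?thesis using True ij(1,2) by simp
    qed
  qed
  also have "\<dots> = 1" using ij(3) by simp
  finally show ?thesis using True by simp
next
  case False
  then have "\<not> (P l \<and> Q (k - l))" if "l \<le> k" for l using that le_add_diff_inverse by metis
  then have "(\<Sum>l\<le>k. of_bool (P l) * of_bool (Q (k - l)) :: nat) = 0" by (intro sum.neutral) auto
  then show ?thesis using False by simp
qed

context product_tiling
begin

lemma c_vector_\<tau>:
  assumes fin: "finite \<tau>1" "finite \<tau>2"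
  shows "c_vector \<tau> = vector_product (c_vector \<tau>1) (c_vector \<tau>2)"
proof (cases "\<tau>1 = {} \<or> \<tau>2 = {}")
  case True
  then have "c_vector \<tau>1 = [] \<or> c_vector \<tau>2 = []" by (auto simp: vectors_empty(1))
  then show ?thesis using \<tau>_empty[OF True] vectors_empty(1) by (auto simp: vector_product_def)
next
  case False
  then obtain t u where t: "t \<in> \<tau>1" "\<forall>t'\<in>\<tau>1. tile_dim t' \<le> tile_dim t" and u: "u \<in> \<tau>2" "\<forall>u'\<in>\<tau>2. tile_dim u' \<le> tile_dim u"
    using top_tile_exists[OF fin(1)] top_tile_exists[OF fin(2)] by blast
  note dim = tiling_dim_\<tau>[OF fin t u]
  obtain m1 m2 where m: "tile_dim t = int m1" "tile_dim u = int m2" using dim(4,5) nonneg_int_cases by metis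
  define f1 f2 where "f1 k = card {t\<in>\<tau>1. critical_of_index t k}" and "f2 k = card {t\<in>\<tau>2. critical_of_index t k}" for k
  have z1: "f1 k = 0" if "m1 < k" for k
  proof -
    have "{t\<in>\<tau>1. critical_of_index t k} = {}"
      using critical_index_le[OF morse_tile_factors(1)] t(2) m(1) that by fastforce
    then show ?thesis unfolding f1_def by (metis card.empty)
  qed
  have z2: "f2 k = 0" if "m2 < k" for k
  proof -
    have "{t\<in>\<tau>2. critical_of_index t k} = {}"
      using critical_index_le[OF morse_tile_factors(2)] u(2) m(2) that by fastforce
    then show ?thesis unfolding f2_def by (metis card.empty)
  qed
  have n: "nat (int m1 + 1) = Suc m1" "nat (int m2 + 1) = Suc m2" "nat (int m1 + int m2 + 1) = Suc (m1 + m2)" by simp_all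
  have v: "c_vector \<tau>1 = map f1 [0..<Suc m1]" "c_vector \<tau>2 = map f2 [0..<Suc m2]"
    unfolding c_vector_def f1_def f2_def dim(1,2) m n by (rule refl)+
  have "card {w\<in>\<tau>. critical_of_index w k} = (\<Sum>i\<le>k. f1 i * f2 (k - i))" for k
  proof -
    have s: "(\<Sum>x\<in>X. of_bool (critical_of_index x i)) = card {x\<in>X. critical_of_index x i}" if "finite X" for X :: "'c::euclidean_space tile set" and i
      using that by (simp add: sum.If_cases of_bool_def Int_def)
    have "card {w\<in>\<tau>. critical_of_index w k} =
      (\<Sum>t\<in>\<tau>1. \<Sum>u\<in>\<tau>2. \<Sum>i\<le>k. of_bool (critical_of_index t i) * of_bool (critical_of_index u (k - i)))"
      unfolding card_critical_tiles[OF fin]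
      by (intro sum.cong refl of_bool_sum_index) (rule critical_index_unique[OF morse_tile_factors(1)])
    also have "\<dots> = (\<Sum>t\<in>\<tau>1. \<Sum>i\<le>k. \<Sum>u\<in>\<tau>2. of_bool (critical_of_index t i) * of_bool (critical_of_index u (k - i)))"
      by (intro sum.cong refl sum.swap)
    also have "\<dots> = (\<Sum>i\<le>k. \<Sum>t\<in>\<tau>1. \<Sum>u\<in>\<tau>2. of_bool (critical_of_index t i) * of_bool (critical_of_index u (k - i)))"
      by (rule sum.swap)
    also have "\<dots> = (\<Sum>i\<le>k. f1 i * f2 (k - i))"
      unfolding f1_def f2_def s[OF fin(1), symmetric] s[OF fin(2), symmetric] sum_product by (rule refl)
    finally show ?thesis .
  qed
  then have "c_vector \<tau> = map (\<lambda>k. \<Sum>i\<le>k. f1 i * f2 (k - i)) [0..<Suc (m1 + m2)]"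
    unfolding c_vector_def dim(3) m n by presburger
  also have "\<dots> = vector_product (map f1 [0..<Suc m1]) (map f2 [0..<Suc m2])"
  proof -
    have "(\<Sum>i\<le>k. f1 i * f2 (k - i)) =
        (\<Sum>j | j \<le> k \<and> j < Suc m1 \<and> k - j < Suc m2. map f1 [0..<Suc m1] ! j * map f2 [0..<Suc m2] ! (k - j))" for k
    proof (rule sym, rule sum.mono_neutral_cong_left)
      show "\<forall>i\<in>{..k} - {j. j \<le> k \<and> j < Suc m1 \<and> k - j < Suc m2}. f1 i * f2 (k - i) = 0"
      proof
        fix i assume "i \<in> {..k} - {j. j \<le> k \<and> j < Suc m1 \<and> k - j < Suc m2}"
        then have "m1 < i \<or> m2 < k - i" by auto
        then show "f1 i * f2 (k - i) = 0" using z1[of i] z2[of "k - i"] by auto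
      qed
    qed (auto simp: nth_map_upt simp del: upt_Suc)
    moreover have "length (map f1 [0..<Suc m1]) + length (map f2 [0..<Suc m2]) - 1 = Suc (m1 + m2)" by simp
    ultimately show ?thesis unfolding vector_product_def by (simp del: upt_Suc)
  qed
  finally show ?thesis unfolding v .
qed

lemma palindromic_\<tau>:
  assumes fin: "finite \<tau>1" "finite \<tau>2" and pure: "pure_dimensional \<tau>1" "pure_dimensional \<tau>2"
    and pal: "palindromic (h_vector \<tau>1)" "palindromic (h_vector \<tau>2)"
  shows "palindromic (h_vector \<tau>)"
proof (cases "\<tau>1 = {} \<or> \<tau>2 = {}")
  case True
  then show ?thesis using \<tau>_empty vectors_empty(2) by simp
next
  case False
  then obtain t u where t: "t \<in> \<tau>1" "\<forall>t'\<in>\<tau>1. tile_dim t' \<le> tile_dim t" and u: "u \<in> \<tau>2" "\<forall>u'\<in>\<tau>2. tile_dim u' \<le> tile_dim u"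
    using top_tile_exists[OF fin(1)] top_tile_exists[OF fin(2)] by blast
  note dim = tiling_dim_\<tau>[OF fin t u]
  obtain m1 m2 where m: "tile_dim t = int m1" "tile_dim u = int m2" using dim(4,5) nonneg_int_cases by metis
  have d1: "nat (tile_dim x) = m1" if "x \<in> \<tau>1" for x
    using pure(1) t(1) that m(1) unfolding pure_dimensional_def by (metis nat_int)
  have d2: "nat (tile_dim x) = m2" if "x \<in> \<tau>2" for x
    using pure(2) u(1) that m(2) unfolding pure_dimensional_def by (metis nat_int)
  have n: "nat (int m1 + 2) = Suc (m1 + 1)" "nat (int m2 + 2) = Suc (m2 + 1)" "nat (int m1 + int m2 + 2) = Suc (m1 + m2 + 1)" by simp_all
  have p1: "\<forall>k\<le>m1 + 1. card {t\<in>\<tau>1. tile_order t = k} = card {t\<in>\<tau>1. tile_order t = m1 + 1 - k}"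
    using pal(1) unfolding h_vector_def dim(1) m n palindromic_iff .
  have p2: "\<forall>k\<le>m2 + 1. card {t\<in>\<tau>2. tile_order t = k} = card {t\<in>\<tau>2. tile_order t = m2 + 1 - k}"
    using pal(2) unfolding h_vector_def dim(2) m n palindromic_iff .
  have o1: "tile_order x \<le> m1 + 1" if "x \<in> \<tau>1" for x using tile_order_le[OF morse_tile_factors(1)[OF that]] d1[OF that] by simp
  have o2: "tile_order x \<le> m2 + 1" if "x \<in> \<tau>2" for x using tile_order_le[OF morse_tile_factors(2)[OF that]] d2[OF that] by simp
  have c: "card {w\<in>\<tau>. tile_order w = k} = (\<Sum>t\<in>\<tau>1. \<Sum>u\<in>\<tau>2. product_order m1 m2 (tile_order t) (tile_order u) k)" for k
    unfolding card_order_tiles[OF fin] by (intro sum.cong refl) (simp add: d1 d2)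
  have sym: "card {w\<in>\<tau>. tile_order w = k} = card {w\<in>\<tau>. tile_order w = m1 + m2 + 1 - k}" if k: "k \<le> m1 + m2 + 1" for k
  proof -
    let ?k = "m1 + m2 + 1 - k"
    have "card {w\<in>\<tau>. tile_order w = k} =
      (\<Sum>t\<in>\<tau>1. \<Sum>u\<in>\<tau>2. product_order m1 m2 (m1 + 1 - tile_order t) (m2 + 1 - tile_order u) ?k)"
      unfolding c by (intro sum.cong refl product_order_reflect[symmetric] o1 o2 k)
    also have "\<dots> = (\<Sum>t\<in>\<tau>1. \<Sum>u\<in>\<tau>2. product_order m1 m2 (m1 + 1 - tile_order t) (tile_order u) ?k)"
    proof (rule sum.cong[OF refl])
      fix t
      show "(\<Sum>u\<in>\<tau>2. product_order m1 m2 (m1 + 1 - tile_order t) (m2 + 1 - tile_order u) ?k) =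
          (\<Sum>u\<in>\<tau>2. product_order m1 m2 (m1 + 1 - tile_order t) (tile_order u) ?k)"
        by (rule palindromic_sum[OF fin(2) o2 p2[rule_format], symmetric,
            where f = "\<lambda>b. product_order m1 m2 (m1 + 1 - tile_order t) b ?k"])
    qed
    also have "\<dots> = card {w\<in>\<tau>. tile_order w = ?k}"
      unfolding c by (rule palindromic_sum[OF fin(1) o1 p1[rule_format], symmetric, where f = "\<lambda>a. \<Sum>u\<in>\<tau>2. product_order m1 m2 a (tile_order u) ?k"])
    finally show ?thesis .
  qed
  show ?thesis unfolding h_vector_def dim(3) m n palindromic_iff by (intro allI impI, rule sym)
qed

end

section \<open>Shellings\<close>

text \<open>
  The order in which a shelling adds its tiles; the filtration is recovered as the unions of the initial
  segments.
\<close>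

definition shelling_list :: "'a::euclidean_space set \<Rightarrow> 'a tile set \<Rightarrow> 'a tile list \<Rightarrow> bool" where
  "shelling_list S X ts \<longleftrightarrow> set ts = X \<and> distinct ts \<and>
     (\<forall>A B. ts = A @ B \<longrightarrow> closedin (top_of_set S) (\<Union>(tile_set ` set A)))"

lemma shelling_list_of_morse_shelling:
  assumes sh: "morse_shelling K S X N F"
  shows "\<exists>ts. shelling_list S X ts"
proof -
  have mt: "morse_tiling K S X" and F0: "F 0 = {}" and FN: "F N = S"
    and step: "\<And>i. i < N \<Longrightarrow> F i \<subset> F (Suc i)" "\<And>i. i < N \<Longrightarrow> closedin (top_of_set S) (F (Suc i))"
      "\<And>i. i < N \<Longrightarrow> \<exists>t\<in>X. F (Suc i) - F i = tile_set t"
    using sh unfolding morse_shelling_def morse_tiled_subset_def by blast+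
  have dis: "t = t'" if "t \<in> X" "t' \<in> X" "x \<in> tile_set t" "x \<in> tile_set t'" for t t' x
    using mt that disjoint_family_onD[of tile_set X t t'] unfolding morse_tiling_def by blast
  have ne: "tile_set t \<noteq> {}" if "t \<in> X" for t
    using mt that closure_tile_set(2) unfolding morse_tiling_def by blast
  obtain g where g: "\<And>i. i < N \<Longrightarrow> g i \<in> X \<and> F (Suc i) - F i = tile_set (g i)" using step(3) by metis
  have cov: "F i = \<Union>(tile_set ` g ` {..<i})" if "i \<le> N" for i
    using that
  proof (induction i)
    case 0
    then show ?case using F0 by simp
  next
    case (Suc i)
    then have i: "i < N" by simp
    have "F (Suc i) = F i \<union> (F (Suc i) - F i)" using step(1)[OF i] by blast
    also have "\<dots> = \<Union>(tile_set ` g ` {..<i}) \<union> tile_set (g i)" using g[OF i] Suc.IH i by simp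
    also have "\<dots> = \<Union>(tile_set ` g ` {..<Suc i})" unfolding lessThan_Suc by auto
    finally show ?case .
  qed
  let ?ts = "map g [0..<N]"
  have set: "set ?ts = X"
  proof
    show "set ?ts \<subseteq> X" using g by auto
    show "X \<subseteq> set ?ts"
    proof
      fix t assume t: "t \<in> X"
      obtain x where x: "x \<in> tile_set t" using ne[OF t] by blast
      have "x \<in> S" using mt t x unfolding morse_tiling_def by blast
      then have "x \<in> \<Union>(tile_set ` g ` {..<N})" using cov[of N] FN by simp
      then obtain i where i: "i < N" "x \<in> tile_set (g i)" by auto
      then have "t = g i" using dis[OF t _ x] g[OF i(1)] by blast
      then show "t \<in> set ?ts" using i(1) by simp
    qed
  qed
  have "g i \<noteq> g j" if ij: "i < j" "j < N" for i j
  proof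
    assume eq: "g i = g j"
    obtain x where x: "x \<in> tile_set (g j)" using ne g[OF ij(2)] by blast
    then have "x \<in> F (Suc j) - F j" using g[OF ij(2)] by simp
    moreover have "x \<in> tile_set (g i)" using x eq by simp
    then have "x \<in> \<Union>(tile_set ` g ` {..<j})" using ij(1) by blast
    then have "x \<in> F j" using cov[of j] ij(2) by simp
    ultimately show False by blast
  qed
  then have "inj_on g {0..<N}" by (intro linorder_inj_onI) (auto simp: atLeastLessThan_iff)
  then have "distinct ?ts" by (simp add: distinct_map)
  moreover have "closedin (top_of_set S) (\<Union>(tile_set ` set A))" if A: "?ts = A @ B" for A B
  proof -
    have l: "length A \<le> N" using arg_cong[OF A, of length] by simp
    have "A = take (length A) ?ts" unfolding A by simp
    also have "\<dots> = map g [0..<length A]" using l by (simp add: take_map)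
    finally have "set A = g ` {..<length A}" by (metis atLeast_upt list.set_map)
    then have U: "\<Union>(tile_set ` set A) = F (length A)" using cov[OF l] by simp
    show ?thesis
    proof (cases "length A")
      case 0
      then show ?thesis unfolding U by (simp add: F0)
    next
      case (Suc i)
      then show ?thesis unfolding U using step(2)[of i] l by simp
    qed
  qed
  ultimately show ?thesis using set unfolding shelling_list_def by blast
qed

lemma morse_shelling_of_list:
  assumes mt: "morse_tiling K S X" and ts: "shelling_list S X ts"
  shows "morse_shelling K S X (length ts) (\<lambda>i. \<Union>(tile_set ` set (take i ts)))"
  unfolding morse_shelling_def
proof (intro conjI allI impI)
  have set: "set ts = X" and d: "distinct ts" and cl: "\<And>A B. ts = A @ B \<Longrightarrow> closedin (top_of_set S) (\<Union>(tile_set ` set A))"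
    using ts unfolding shelling_list_def by blast+
  show "morse_tiling K S X" by (rule mt)
  show "\<Union>(tile_set ` set (take 0 ts)) = {}" by simp
  show "\<Union>(tile_set ` set (take (length ts) ts)) = S" using mt set unfolding morse_tiling_def by simp
  fix i assume i: "i < length ts"
  have tk: "set (take (Suc i) ts) = insert (ts ! i) (set (take i ts))" unfolding take_Suc_conv_app_nth[OF i] by simp
  have tm: "ts ! i \<in> X" "set (take i ts) \<subseteq> X" using nth_mem[OF i] set_take_subset[of i ts] set by simp_all
  have notin: "ts ! i \<notin> set (take i ts)"
  proof -
    have "distinct (take (Suc i) ts)" using d by simp
    then show ?thesis unfolding take_Suc_conv_app_nth[OF i] by simp
  qed
  have "tile_set (ts ! i) \<inter> tile_set u = {}" if "u \<in> set (take i ts)" for u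
    using mt tm notin that disjoint_family_onD[of tile_set X "ts ! i" u] unfolding morse_tiling_def by blast
  then have dj: "tile_set (ts ! i) \<inter> \<Union>(tile_set ` set (take i ts)) = {}" by blast
  have ne: "tile_set (ts ! i) \<noteq> {}" using mt tm(1) closure_tile_set(2) unfolding morse_tiling_def by blast
  have U: "\<Union>(tile_set ` set (take (Suc i) ts)) = tile_set (ts ! i) \<union> \<Union>(tile_set ` set (take i ts))" unfolding tk by simp
  show "\<Union>(tile_set ` set (take i ts)) \<subset> \<Union>(tile_set ` set (take (Suc i) ts))" unfolding U using dj ne by blast
  show "\<exists>t\<in>X. \<Union>(tile_set ` set (take (Suc i) ts)) - \<Union>(tile_set ` set (take i ts)) = tile_set t"
    unfolding U using dj tm(1) by blast
  have "set (take (Suc i) ts) \<subseteq> X" using set_take_subset[of "Suc i" ts] set by simp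
  then show "morse_tiled_subset S X (\<Union>(tile_set ` set (take (Suc i) ts)))"
    unfolding morse_tiled_subset_def using cl[OF append_take_drop_id[symmetric]] by blast
qed

text \<open>
  The left-hand side is the part already shelled within two nested rows and columns. The right-hand side is visibly closed when
  \<open>X\<close>, \<open>X \<union> x\<close>, \<open>Y\<close>, \<open>Y \<union> y\<close> and \<open>Z\<close> are.
\<close>

lemma product_staircase:
  fixes X x S1 :: "'a set" and Y y S2 :: "'b set"
  assumes "X \<subseteq> S1" "x \<subseteq> S1" "Y \<subseteq> S2" "y \<subseteq> S2"
  shows "X \<times> S2 \<union> (x \<times> Y \<union> (x \<times> y) \<inter> Z) =
    X \<times> S2 \<union> (X \<union> x) \<times> Y \<union> ((X \<union> x) \<times> (Y \<union> y)) \<inter> ((S1 \<times> S2) \<inter> Z)"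
proof (rule set_eqI)
  fix p :: "'a \<times> 'b"
  obtain a b where p: "p = (a, b)" by (cases p)
  have "a \<in> X \<Longrightarrow> a \<in> S1" "a \<in> x \<Longrightarrow> a \<in> S1" "b \<in> Y \<Longrightarrow> b \<in> S2" "b \<in> y \<Longrightarrow> b \<in> S2" using assms by blast+
  then show "p \<in> X \<times> S2 \<union> (x \<times> Y \<union> (x \<times> y) \<inter> Z) \<longleftrightarrow>
    p \<in> X \<times> S2 \<union> (X \<union> x) \<times> Y \<union> ((X \<union> x) \<times> (Y \<union> y)) \<inter> ((S1 \<times> S2) \<inter> Z)"
    unfolding p Un_iff Int_iff mem_Sigma_iff by argo
qed

lemma concat_map_prefix:
  assumes "concat (map f xs) = A @ B"
  shows "A = [] \<or> (\<exists>ys x zs a b. xs = ys @ x # zs \<and> f x = a @ b \<and> A = concat (map f ys) @ a)"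
  using assms
proof (induction xs arbitrary: A)
  case (Cons y xs)
  then have "f y @ concat (map f xs) = A @ B" by simp
  then consider us where "f y = A @ us" | us where "A = f y @ us" "concat (map f xs) = us @ B"
    unfolding append_eq_append_conv2 by blast
  then show ?case
  proof cases
    case (1 us)
    have "y # xs = [] @ y # xs \<and> f y = A @ us \<and> A = concat (map f []) @ A" using 1 by simp
    then show ?thesis by blast
  next
    case (2 us)
    show ?thesis
    proof (cases "us = []")
      case True
      have "y # xs = [] @ y # xs \<and> f y = f y @ [] \<and> A = concat (map f []) @ f y" using 2 True by simp
      then show ?thesis by blast
    next
      case False
      then obtain ys x zs a b where h: "xs = ys @ x # zs" "f x = a @ b" "us = concat (map f ys) @ a" using Cons.IH[OF 2(2)] by blast
      have "y # xs = (y # ys) @ x # zs \<and> f x = a @ b \<and> A = concat (map f (y # ys)) @ a" using h 2(1) by simp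
      then show ?thesis by blast
    qed
  qed
qed simp

lemma distinct_concat_map:
  assumes "distinct xs" "\<And>x. x \<in> set xs \<Longrightarrow> distinct (f x)"
    "\<And>x y. x \<in> set xs \<Longrightarrow> y \<in> set xs \<Longrightarrow> x \<noteq> y \<Longrightarrow> set (f x) \<inter> set (f y) = {}"
  shows "distinct (concat (map f xs))"
  using assms
proof (induction xs)
  case (Cons x xs)
  have "distinct (concat (map f xs))" by (rule Cons.IH) (use Cons.prems in auto)
  moreover have "distinct (f x)" using Cons.prems(2) by simp
  moreover have "set (f x) \<inter> set (f y) = {}" if y: "y \<in> set xs" for y
    by (rule Cons.prems(3)) (use Cons.prems(1) y in auto)
  then have "set (f x) \<inter> set (concat (map f xs)) = {}" by auto
  ultimately show ?case by simp
qed simp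

context product_tiling
begin

definition product_shelling :: "'a tile list \<Rightarrow> 'b tile list \<Rightarrow> ('a \<times> 'b) tile list" where
  "product_shelling ts us = concat (map (\<lambda>t. concat (map (\<lambda>u. map hull_tile (PL t u)) us)) ts)"

lemma row_Union:
  assumes "t \<in> \<tau>1" "set us \<subseteq> \<tau>2"
  shows "\<Union>(tile_set ` set (concat (map (\<lambda>u. map hull_tile (PL t u)) us))) = tile_set t \<times> \<Union>(tile_set ` set us)"
  using assms(2)
proof (induction us)
  case (Cons u us)
  have "\<Union>(tile_set ` set (concat (map (\<lambda>u. map hull_tile (PL t u)) (u # us)))) =
     \<Union>(tile_set ` hull_tile ` set (PL t u)) \<union> \<Union>(tile_set ` set (concat (map (\<lambda>u. map hull_tile (PL t u)) us)))"
    by (simp add: image_Un)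
  also have "\<dots> = tile_set t \<times> \<Union>(tile_set ` set (u # us))"
    using Cons PL_Union[OF assms(1), of u] by (simp add: Sigma_Un_distrib2)
  finally show ?case .
qed simp

lemma rows_Union:
  assumes "set ts \<subseteq> \<tau>1" "set us \<subseteq> \<tau>2"
  shows "\<Union>(tile_set ` set (product_shelling ts us)) = \<Union>(tile_set ` set ts) \<times> \<Union>(tile_set ` set us)"
  using assms(1)
proof (induction ts)
  case (Cons t ts)
  have "\<Union>(tile_set ` set (product_shelling (t # ts) us)) =
     \<Union>(tile_set ` set (concat (map (\<lambda>u. map hull_tile (PL t u)) us))) \<union> \<Union>(tile_set ` set (product_shelling ts us))"
    unfolding product_shelling_def by (simp only: list.map concat.simps set_append image_Un Union_Un_distrib)
  also have "\<dots> = tile_set t \<times> \<Union>(tile_set ` set us) \<union> \<Union>(tile_set ` set ts) \<times> \<Union>(tile_set ` set us)"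
    using row_Union[of t us] Cons assms(2) by simp
  also have "\<dots> = \<Union>(tile_set ` set (t # ts)) \<times> \<Union>(tile_set ` set us)" by auto
  finally show ?case .
qed (simp add: product_shelling_def)

lemma closed_hulls:
  assumes "t \<in> \<tau>1" "u \<in> \<tau>2" "set A \<subseteq> set (PL t u)"
  shows "closed (\<Union>v\<in>set A. convex hull (fst v))"
proof (rule closed_UN)
  show "\<forall>v\<in>set A. closed (convex hull (fst v))"
  proof
    fix v assume "v \<in> set A"
    then have v: "v \<in> set (PL t u)" using assms(3) by blast
    obtain P R M where c: "v = (P, R, M)" by (cases v)
    have "finite P" by (rule geometricD(2)[OF geo_prod PL_cell(2)[OF assms(1,2) v[unfolded c]]])
    then show "closed (convex hull (fst v))" unfolding c fst_conv
      by (intro compact_imp_closed compact_convex_hull finite_imp_compact)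
  qed
qed simp

text \<open>
  Lexicographic order: first by the tiles of the first factor, then by those of the second, then along
  the list of each product of tiles.
\<close>

lemma shelling_list_product:
  assumes ts: "shelling_list S1 \<tau>1 ts" and us: "shelling_list S2 \<tau>2 us"
  shows "shelling_list (S1 \<times> S2) \<tau> (product_shelling ts us)"
proof -
  have t: "set ts = \<tau>1" "distinct ts" "\<And>A B. ts = A @ B \<Longrightarrow> closedin (top_of_set S1) (\<Union>(tile_set ` set A))"
    using ts unfolding shelling_list_def by blast+
  have u: "set us = \<tau>2" "distinct us" "\<And>A B. us = A @ B \<Longrightarrow> closedin (top_of_set S2) (\<Union>(tile_set ` set A))"
    using us unfolding shelling_list_def by blast+
  have set: "set (product_shelling ts us) = \<tau>" unfolding product_shelling_def \<tau>_def by (simp add: t(1) u(1))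
  have apart: "t = t' \<and> u = u'" if m: "t \<in> \<tau>1" "u \<in> \<tau>2" "t' \<in> \<tau>1" "u' \<in> \<tau>2"
    and w: "w \<in> hull_tile ` set (PL t u)" "w \<in> hull_tile ` set (PL t' u')" for t u t' u' w
  proof -
    obtain v v' where v: "v \<in> set (PL t u)" "v' \<in> set (PL t' u')" "w = hull_tile v" "w = hull_tile v'" using w by blast
    obtain x where x: "x \<in> tile_set w" using closure_tile_set(2)[OF morse_tile_PL[OF m(1,2) v(1)]] v(3) by blast
    show ?thesis using PL_tile_unique[OF m(1,2) v(1) m(3,4) v(2) x[unfolded v(3)] x[unfolded v(4)]] by blast
  qed
  have "distinct (product_shelling ts us)" unfolding product_shelling_def
  proof (rule distinct_concat_map[OF t(2)])
    show "distinct (concat (map (\<lambda>u. map hull_tile (PL x u)) us))" if x: "x \<in> set ts" for x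
    proof (rule distinct_concat_map[OF u(2)])
      show "distinct (map hull_tile (PL x y))" if "y \<in> set us" for y
        by (rule distinct_PL) (use x that t(1) u(1) in blast)+
      show "set (map hull_tile (PL x y)) \<inter> set (map hull_tile (PL x z)) = {}" if "y \<in> set us" "z \<in> set us" "y \<noteq> z" for y z
      proof (rule ccontr)
        assume "set (map hull_tile (PL x y)) \<inter> set (map hull_tile (PL x z)) \<noteq> {}"
        then obtain w where w: "w \<in> hull_tile ` set (PL x y)" "w \<in> hull_tile ` set (PL x z)" by auto
        have "x \<in> \<tau>1" "y \<in> \<tau>2" "z \<in> \<tau>2" using x that t(1) u(1) by blast+
        then show False using apart[of x y x z w] w that(3) by blast
      qed
    qed
    show "set (concat (map (\<lambda>u. map hull_tile (PL x u)) us)) \<inter> set (concat (map (\<lambda>u. map hull_tile (PL y u)) us)) = {}"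
      if xy: "x \<in> set ts" "y \<in> set ts" "x \<noteq> y" for x y
    proof (rule ccontr)
      assume "set (concat (map (\<lambda>u. map hull_tile (PL x u)) us)) \<inter> set (concat (map (\<lambda>u. map hull_tile (PL y u)) us)) \<noteq> {}"
      then obtain w z z' where w: "w \<in> hull_tile ` set (PL x z)" "w \<in> hull_tile ` set (PL y z')" "z \<in> set us" "z' \<in> set us" by auto
      have "x \<in> \<tau>1" "y \<in> \<tau>1" "z \<in> \<tau>2" "z' \<in> \<tau>2" using xy(1,2) w(3,4) t(1) u(1) by blast+
      then show False using apart[of x z y z' w] w(1,2) xy(3) by blast
    qed
  qed
  moreover have "closedin (top_of_set (S1 \<times> S2)) (\<Union>(tile_set ` set A))" if AB: "product_shelling ts us = A @ B" for A B
  proof (cases "A = []")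
    case False
    then obtain ts1 x ts2 a b where x: "ts = ts1 @ x # ts2" "concat (map (\<lambda>u. map hull_tile (PL x u)) us) = a @ b"
        "A = product_shelling ts1 us @ a"
      using concat_map_prefix[OF AB[unfolded product_shelling_def]] unfolding product_shelling_def by blast
    let ?X = "\<Union>(tile_set ` set ts1)" and ?X' = "\<Union>(tile_set ` set (ts1 @ [x]))"
    have xm: "x \<in> \<tau>1" "set ts1 \<subseteq> \<tau>1" using x(1) t(1) by auto
    have clX: "closedin (top_of_set S1) ?X" by (rule t(3)[OF x(1)])
    have clX': "closedin (top_of_set S1) ?X'" by (rule t(3)[of _ ts2]) (simp add: x(1))
    have U1: "\<Union>(tile_set ` set (product_shelling ts1 us)) = ?X \<times> S2"
      using rows_Union[OF xm(2)] u(1) un(2) by simp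
    have UA: "\<Union>(tile_set ` set A) = ?X \<times> S2 \<union> \<Union>(tile_set ` set a)"
      unfolding x(3) set_append image_Un Union_Un_distrib U1 ..
    show ?thesis
    proof (cases "a = []")
      case True
      show ?thesis unfolding UA True by (simp add: closedin_Times[OF clX])
    next
      case False
      then obtain us1 y us2 a' b' where y: "us = us1 @ y # us2" "map hull_tile (PL x y) = a' @ b'"
          "a = concat (map (\<lambda>u. map hull_tile (PL x u)) us1) @ a'"
        using concat_map_prefix[OF x(2)] by blast
      let ?Y = "\<Union>(tile_set ` set us1)" and ?Y' = "\<Union>(tile_set ` set (us1 @ [y]))"
      have ym: "y \<in> \<tau>2" "set us1 \<subseteq> \<tau>2" using y(1) u(1) by auto
      have clY: "closedin (top_of_set S2) ?Y" by (rule u(3)[OF y(1)])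
      have clY': "closedin (top_of_set S2) ?Y'" by (rule u(3)[of _ us2]) (simp add: y(1))
      obtain A'' B'' where L: "PL x y = A'' @ B''" "a' = map hull_tile A''"
        using y(2) unfolding map_eq_append_conv by blast
      let ?Z = "\<Union>v\<in>set A''. convex hull (fst v)"
      have "closed ?Z" by (rule closed_hulls[OF xm(1) ym(1)]) (simp add: L(1))
      then have clZ: "closedin (top_of_set (S1 \<times> S2)) ((S1 \<times> S2) \<inter> ?Z)" by (rule closedin_closed_Int)
      have Ua: "\<Union>(tile_set ` set a') = (tile_set x \<times> tile_set y) \<inter> ?Z"
        unfolding L(2) set_map by (rule PL_prefix_closed[OF xm(1) ym(1) L(1)])
      have "\<Union>(tile_set ` set a) = tile_set x \<times> ?Y \<union> (tile_set x \<times> tile_set y) \<inter> ?Z"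
        unfolding y(3) set_append image_Un Union_Un_distrib Ua row_Union[OF xm(1) ym(2)] ..
      then have UA': "\<Union>(tile_set ` set A) = ?X \<times> S2 \<union> (tile_set x \<times> ?Y \<union> (tile_set x \<times> tile_set y) \<inter> ?Z)"
        unfolding UA by simp
      have sX: "?X' = ?X \<union> tile_set x" "?Y' = ?Y \<union> tile_set y" by auto
      have sub: "?X \<subseteq> S1" "tile_set x \<subseteq> S1" "?Y \<subseteq> S2" "tile_set y \<subseteq> S2" using un xm ym by blast+
      have "\<Union>(tile_set ` set A) = ?X \<times> S2 \<union> ?X' \<times> ?Y \<union> (?X' \<times> ?Y') \<inter> ((S1 \<times> S2) \<inter> ?Z)"
        unfolding UA' sX by (rule product_staircase[OF sub])
      moreover have "closedin (top_of_set (S1 \<times> S2)) (?X \<times> S2)" by (rule closedin_Times[OF clX]) simp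
      moreover have "closedin (top_of_set (S1 \<times> S2)) (?X' \<times> ?Y)" by (rule closedin_Times[OF clX' clY])
      moreover have "closedin (top_of_set (S1 \<times> S2)) ((?X' \<times> ?Y') \<inter> ((S1 \<times> S2) \<inter> ?Z))"
        by (rule closedin_Int[OF closedin_Times[OF clX' clY'] clZ])
      ultimately show ?thesis by (simp only: closedin_Un)
    qed
  qed simp
  ultimately show ?thesis using set unfolding shelling_list_def by blast
qed

end

section \<open>The factors, and the theorem\<close>

lemma simplicial_complex_underlying:
  assumes "simplicial_complex K"
  shows "simplicial_complex (underlying_complex K S)"
  unfolding simplicial_complex_def
proof (intro conjI ballI allI impI)
  have K: "finite K" "\<And>X. X \<in> K \<Longrightarrow> \<exists>n. n simplex X" "\<And>F X. X \<in> K \<and> F face_of X \<Longrightarrow> F \<in> K"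
    "\<And>X Y. X \<in> K \<and> Y \<in> K \<Longrightarrow> X \<inter> Y face_of X"
    using assms unfolding simplicial_complex_def by blast+
  show "finite (underlying_complex K S)" unfolding underlying_complex_def using K(1) by simp
  show "\<exists>n. n simplex X" if "X \<in> underlying_complex K S" for X
    using that K(2) unfolding underlying_complex_def by blast
  show "F \<in> underlying_complex K S" if "X \<in> underlying_complex K S \<and> F face_of X" for F X
  proof -
    have "X \<in> K" "X \<subseteq> closure S" "F face_of X" using that unfolding underlying_complex_def by blast+
    moreover from this have "F \<subseteq> closure S" using face_of_imp_subset by blast
    ultimately show ?thesis using K(3) unfolding underlying_complex_def by blast
  qed
  show "X \<inter> Y face_of X" if "X \<in> underlying_complex K S \<and> Y \<in> underlying_complex K S" for X Y
    by (rule K(4)) (use that in \<open>simp add: underlying_complex_def\<close>)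
qed

text \<open>
  Two vertices of a simplex span an edge, which is oriented; three span a triangle, which is not cyclic. Hence
  the orientation is transitive on the vertices of every simplex.
\<close>

lemma tame_factor:
  assumes K: "simplicial_complex K" and mt: "morse_tiling K S X" and tm: "tame K S X"
  shows "\<exists>\<Delta> lt. geometric \<Delta> \<and> (\<lambda>W. convex hull W) ` \<Delta> = underlying_complex K S \<and> (\<forall>W\<in>\<Delta>. linear_on lt W) \<and>
     (\<forall>t\<in>X. \<exists>c. fst c \<in> \<Delta> \<and> good_cell lt c \<and> t = hull_tile c)"
proof -
  let ?U = "underlying_complex K S"
  let ?D = "{W. finite W \<and> \<not> affine_dependent W \<and> convex hull W \<in> ?U}"
  note U = simplicial_complex_geometric[OF simplicial_complex_underlying[OF K, of S]]
  obtain A where A: "edge_orientation ?U A"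
    "\<forall>\<Delta>\<in>?U. 2 simplex \<Delta> \<longrightarrow> \<not> (\<exists>a\<in>vertices \<Delta>. \<exists>b\<in>vertices \<Delta>. \<exists>c\<in>vertices \<Delta>. (a, b) \<in> A \<and> (b, c) \<in> A \<and> (c, a) \<in> A)"
    "\<forall>t\<in>X. morse_face t \<noteq> {} \<longrightarrow> (\<forall>v \<in> vertices (tile_simplex t) - morse_face t. \<forall>w \<in> vertices (morse_face t). (v, w) \<in> A)"
    using tm unfolding tame_def by blast
  let ?lt = "\<lambda>a b. (a, b) \<in> A"
  have irr: "(a, a) \<notin> A" for a using A(1) unfolding edge_orientation_def by blast
  have orient: "(a, b) \<in> A \<longleftrightarrow> (b, a) \<notin> A" if "a \<noteq> b" "{a, b} \<in> ?D" for a b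
  proof -
    have "closed_segment a b \<in> ?U" using that(2) unfolding segment_convex_hull by blast
    then show ?thesis using A(1) that(1) unfolding edge_orientation_def by blast
  qed
  have lin: "linear_on ?lt W" if W: "W \<in> ?D" for W
  proof (rule linear_onI)
    show "(a, a) \<notin> A" for a by (rule irr)
    show "a = b \<or> (a, b) \<in> A \<or> (b, a) \<in> A" if "a \<in> W" "b \<in> W" for a b
    proof (cases "a = b")
      case False
      have "{a, b} \<in> ?D" by (rule geometricD(4)[OF U(1) W]) (use that in blast)
      then show ?thesis using orient[OF False] by blast
    qed simp
    show "(a, c) \<in> A" if m: "a \<in> W" "b \<in> W" "c \<in> W" and ab: "(a, b) \<in> A" and bc: "(b, c) \<in> A" for a b c
    proof (rule ccontr)
      assume n: "(a, c) \<notin> A"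
      have ne: "a \<noteq> b" "b \<noteq> c" using ab bc irr by blast+
      have pair: "{x, y} \<in> ?D" if "x \<in> W" "y \<in> W" for x y
        by (rule geometricD(4)[OF U(1) W]) (use that in blast)
      have "a \<noteq> c" using ab bc orient[OF ne(1) pair[OF m(1,2)]] by blast
      then have ca: "(c, a) \<in> A" using n orient[OF _ pair[OF m(1,3)]] by blast
      have T: "{a, b, c} \<in> ?D" by (rule geometricD(4)[OF U(1) W]) (use m in blast)
      have ind: "\<not> affine_dependent {a, b, c}" using T by blast
      have "int (card {a, b, c}) = 2 + 1" using ne \<open>a \<noteq> c\<close> by simp
      then have "2 simplex convex hull {a, b, c}" unfolding simplex_def using ind by blast
      moreover have "convex hull {a, b, c} \<in> ?U" using T by blast
      ultimately have "\<not> (\<exists>x\<in>{a, b, c}. \<exists>y\<in>{a, b, c}. \<exists>z\<in>{a, b, c}. (x, y) \<in> A \<and> (y, z) \<in> A \<and> (z, x) \<in> A)"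
        using A(2) vertices_hull[OF ind] by metis
      then show False using ab bc ca by blast
    qed
  qed
  have "\<exists>c. fst c \<in> ?D \<and> good_cell ?lt c \<and> t = hull_tile c" if t: "t \<in> X" for t
  proof -
    have m: "morse_tile t" "tile_simplex t \<in> K" "tile_set t \<subseteq> S" using mt t unfolding morse_tiling_def by blast+
    obtain W R M where c: "\<not> affine_dependent W" "valid_tile W R M" "t = hull_tile (W, R, M)" using morse_tile_cell[OF m(1)] by blast
    have s: "tile_simplex t = convex hull W" "morse_face t = convex hull M" unfolding c(3) hull_tile_def by simp_all
    have fin: "finite W" "M \<subseteq> W" using c(2) unfolding valid_tile_def by blast+
    have "tile_simplex t \<subseteq> closure S" using closure_tile_set(1)[OF m(1)] closure_mono[OF m(3)] by (rule subset_trans)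
    then have "convex hull W \<in> ?U" using m(2) unfolding s(1) underlying_complex_def by blast
    then have W: "W \<in> ?D" using fin(1) c(1) by blast
    have "(v, w) \<in> A" if v: "v \<in> W - M" and w: "w \<in> M" for v w
    proof -
      have "M \<subseteq> W - {v}" using fin(2) v by blast
      then have nv: "v \<notin> convex hull M" using notin_hull_remove[OF c(1), of v] v hull_mono[of M "W - {v}" convex] by blast
      have "morse_face t \<noteq> {}" using w unfolding s(2) by auto
      moreover have "v \<in> vertices (tile_simplex t) - morse_face t" unfolding s vertices_hull[OF c(1)] using v nv by blast
      moreover have "w \<in> vertices (morse_face t)" unfolding s(2) vertices_hull[OF affine_independent_subset[OF c(1) fin(2)]] by (rule w)
      ultimately show ?thesis using A(3) t by blast
    qed
    then have "good_cell ?lt (W, R, M)" using c(2) unfolding good_cell_def by simp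
    then show ?thesis using W c(3) by (intro exI[of _ "(W, R, M)"]) simp
  qed
  then show ?thesis using U lin by (intro exI[of _ ?D] exI[of _ ?lt]) simp
qed

lemma finite_tiling:
  assumes \<Delta>: "geometric \<Delta>" and X: "\<forall>t\<in>X. \<exists>c. fst c \<in> \<Delta> \<and> good_cell lt c \<and> t = hull_tile c"
  shows "finite X"
proof -
  have "X \<subseteq> hull_tile ` (\<Union>W\<in>\<Delta>. {W} \<times> Pow W \<times> Pow W)"
  proof
    fix t assume "t \<in> X"
    then obtain c where c: "fst c \<in> \<Delta>" "good_cell lt c" "t = hull_tile c" using X by blast
    obtain W R M where s: "c = (W, R, M)" by (cases c)
    have "W \<in> \<Delta>" using c(1) s by simp
    moreover have "R \<subseteq> W" "M \<subseteq> W" using c(2) s unfolding good_cell_def valid_tile_def by simp_all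
    ultimately show "t \<in> hull_tile ` (\<Union>W\<in>\<Delta>. {W} \<times> Pow W \<times> Pow W)" unfolding c(3) s by blast
  qed
  moreover have "finite (\<Union>W\<in>\<Delta>. {W} \<times> Pow W \<times> Pow W)"
    using geometricD(1,2)[OF \<Delta>] by (intro finite_UN_I finite_cartesian_product) simp_all
  ultimately show ?thesis by (meson finite_imageI finite_subset)
qed

lemma product_list_exists:
  assumes g1: "geometric \<Delta>1" "fst c1 \<in> \<Delta>1" "good_cell lt1 c1" and l1: "linear_on lt1 (fst c1)"
    and g2: "geometric \<Delta>2" "fst c2 \<in> \<Delta>2" "good_cell lt2 c2" and l2: "linear_on lt2 (fst c2)"
  shows "\<exists>L. product_list lt1 lt2 c1 c2 L \<and>
     (\<forall>k. critical_count L k =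
        of_bool (\<exists>i j. critical_of_index (hull_tile c1) i \<and> critical_of_index (hull_tile c2) j \<and> k = i + j)) \<and>
     (\<forall>k. order_count L k = product_order (nat (tile_dim (hull_tile c1))) (nat (tile_dim (hull_tile c2)))
        (tile_order (hull_tile c1)) (tile_order (hull_tile c2)) k)"
proof -
  obtain W1 R1 M1 where c1: "c1 = (W1, R1, M1)" by (cases c1)
  obtain W2 R2 M2 where c2: "c2 = (W2, R2, M2)" by (cases c2)
  have v1: "valid_tile W1 R1 M1" "\<forall>v\<in>W1 - M1. \<forall>w\<in>M1. lt1 v w" "R1 \<subseteq> W1" "linear_on lt1 W1"
    using g1(3) l1 unfolding c1 good_cell_def valid_tile_def by simp_all
  have v2: "valid_tile W2 R2 M2" "\<forall>v\<in>W2 - M2. \<forall>w\<in>M2. lt2 v w" "R2 \<subseteq> W2" "linear_on lt2 W2"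
    using g2(3) l2 unfolding c2 good_cell_def valid_tile_def by simp_all
  have i1: "\<not> affine_dependent W1" using geometricD(3)[OF g1(1,2)] unfolding c1 by simp
  have i2: "\<not> affine_dependent W2" using geometricD(3)[OF g2(1,2)] unfolding c2 by simp
  have d1: "nat (tile_dim (hull_tile (W1, R1, M1))) = card W1 - 1" unfolding tile_dim_hull_tile[OF i1] by linarith
  have d2: "nat (tile_dim (hull_tile (W2, R2, M2))) = card W2 - 1" unfolding tile_dim_hull_tile[OF i2] by linarith
  show ?thesis
    unfolding c1 c2 product_list_def fst_conv d1 d2 tile_order_hull_tile[OF i1 v1(3)] tile_order_hull_tile[OF i2 v2(3)]
      critical_of_index_hull_tile[OF i1 v1(1)] critical_of_index_hull_tile[OF i2 v2(1)] conj_assoc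
    by (rule product_cells[OF v1(1,4,2) v2(1,4,2)])
qed

theorem theorem3p8:
  fixes K1 :: "'a::euclidean_space set set" and S1 :: "'a set"
    and K2 :: "'b::euclidean_space set set" and S2 :: "'b set"
    and \<tau>1 :: "'a tile set" and \<tau>2 :: "'b tile set"
  assumes "simplicial_complex K1" and "simplicial_complex K2"
    and "morse_tiling K1 S1 \<tau>1" and "tame K1 S1 \<tau>1"
    and "morse_tiling K2 S2 \<tau>2" and "tame K2 S2 \<tau>2"
  shows
    "(\<exists>(T :: ('a \<times> 'b) set set) \<tau>.
        primitive_triangulation
          (product_cells (underlying_complex K1 S1) (underlying_complex K2 S2)) T \<and>
        morse_tiling T (S1 \<times> S2) \<tau> \<and> tame T (S1 \<times> S2) \<tau> \<and>
        c_vector \<tau> = vector_product (c_vector \<tau>1) (c_vector \<tau>2) \<and>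
        (pure_dimensional \<tau>1 \<and> pure_dimensional \<tau>2 \<and>
         palindromic (h_vector \<tau>1) \<and> palindromic (h_vector \<tau>2) \<longrightarrow>
         palindromic (h_vector \<tau>))) \<and>
     ((\<exists>N1 F1. morse_shelling K1 S1 \<tau>1 N1 F1) \<and> (\<exists>N2 F2. morse_shelling K2 S2 \<tau>2 N2 F2) \<longrightarrow>
      (\<exists>(T :: ('a \<times> 'b) set set) \<tau> N F.
        primitive_triangulation
          (product_cells (underlying_complex K1 S1) (underlying_complex K2 S2)) T \<and>
        morse_shelling T (S1 \<times> S2) \<tau> N F \<and> tame T (S1 \<times> S2) \<tau> \<and>
        c_vector \<tau> = vector_product (c_vector \<tau>1) (c_vector \<tau>2) \<and>
        (pure_dimensional \<tau>1 \<and> pure_dimensional \<tau>2 \<and>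
         palindromic (h_vector \<tau>1) \<and> palindromic (h_vector \<tau>2) \<longrightarrow>
         palindromic (h_vector \<tau>))))"
proof -
  obtain \<Delta>1 lt1 where f1: "geometric \<Delta>1" "(\<lambda>W. convex hull W) ` \<Delta>1 = underlying_complex K1 S1"
      "\<forall>W\<in>\<Delta>1. linear_on lt1 W" "\<forall>t\<in>\<tau>1. \<exists>c. fst c \<in> \<Delta>1 \<and> good_cell lt1 c \<and> t = hull_tile c"
    using tame_factor[OF assms(1,3,4)] by blast
  obtain \<Delta>2 lt2 where f2: "geometric \<Delta>2" "(\<lambda>W. convex hull W) ` \<Delta>2 = underlying_complex K2 S2"
      "\<forall>W\<in>\<Delta>2. linear_on lt2 W" "\<forall>t\<in>\<tau>2. \<exists>c. fst c \<in> \<Delta>2 \<and> good_cell lt2 c \<and> t = hull_tile c"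
    using tame_factor[OF assms(2,5,6)] by blast
  have fin: "finite \<tau>1" "finite \<tau>2" using finite_tiling[OF f1(1,4)] finite_tiling[OF f2(1,4)] by blast+
  obtain c1 where c1: "\<And>t. t \<in> \<tau>1 \<Longrightarrow> fst (c1 t) \<in> \<Delta>1 \<and> good_cell lt1 (c1 t) \<and> t = hull_tile (c1 t)"
    using f1(4) by metis
  obtain c2 where c2: "\<And>t. t \<in> \<tau>2 \<Longrightarrow> fst (c2 t) \<in> \<Delta>2 \<and> good_cell lt2 (c2 t) \<and> t = hull_tile (c2 t)"
    using f2(4) by metis
  define Q where "Q t u L \<longleftrightarrow> product_list lt1 lt2 (c1 t) (c2 u) L \<and>
      (\<forall>k. critical_count L k = of_bool (\<exists>i j. critical_of_index t i \<and> critical_of_index u j \<and> k = i + j)) \<and>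
      (\<forall>k. order_count L k = product_order (nat (tile_dim t)) (nat (tile_dim u)) (tile_order t) (tile_order u) k)" for t u L
  have ex: "\<exists>L. Q t u L" if tu: "t \<in> \<tau>1" "u \<in> \<tau>2" for t u
  proof -
    have t: "fst (c1 t) \<in> \<Delta>1" "good_cell lt1 (c1 t)" "hull_tile (c1 t) = t" using c1[OF tu(1)] by simp_all
    have u: "fst (c2 u) \<in> \<Delta>2" "good_cell lt2 (c2 u)" "hull_tile (c2 u) = u" using c2[OF tu(2)] by simp_all
    have l: "linear_on lt1 (fst (c1 t))" "linear_on lt2 (fst (c2 u))" using f1(3) f2(3) t(1) u(1) by blast+
    show ?thesis using product_list_exists[OF f1(1) t(1,2) l(1) f2(1) u(1,2) l(2)] unfolding t(3) u(3) Q_def .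
  qed
  define PL where "PL t u = (SOME L. Q t u L)" for t u
  have PL: "Q t u (PL t u)" if "t \<in> \<tau>1" "u \<in> \<tau>2" for t u unfolding PL_def by (rule someI_ex[OF ex[OF that]])
  note mt1 = assms(3)[unfolded morse_tiling_def] and mt2 = assms(5)[unfolded morse_tiling_def]
  have cover1: "convex hull W \<subseteq> closure S1" if "W \<in> \<Delta>1" for W
  proof -
    have "convex hull W \<in> underlying_complex K1 S1" using f1(2) that by blast
    then show ?thesis unfolding underlying_complex_def by blast
  qed
  have cover2: "convex hull W \<subseteq> closure S2" if "W \<in> \<Delta>2" for W
  proof -
    have "convex hull W \<in> underlying_complex K2 S2" using f2(2) that by blast
    then show ?thesis unfolding underlying_complex_def by blast
  qed
  interpret P: product_tiling \<Delta>1 lt1 \<tau>1 S1 c1 \<Delta>2 lt2 \<tau>2 S2 c2 PL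
  proof
    show "geometric \<Delta>1" "geometric \<Delta>2" by (rule f1(1), rule f2(1))
    show "linear_on lt1 W" if "W \<in> \<Delta>1" for W using f1(3) that by blast
    show "linear_on lt2 W" if "W \<in> \<Delta>2" for W using f2(3) that by blast
    show "disjoint_family_on tile_set \<tau>1" "disjoint_family_on tile_set \<tau>2"
      "\<Union>(tile_set ` \<tau>1) = S1" "\<Union>(tile_set ` \<tau>2) = S2"
      using mt1 mt2 by blast+
    show "closedin (top_of_set S1) (\<Union>(tile_set ` {t\<in>\<tau>1. int j \<le> tile_dim t}))" for j using mt1 by blast
    show "closedin (top_of_set S2) (\<Union>(tile_set ` {t\<in>\<tau>2. int j \<le> tile_dim t}))" for j using mt2 by blast
    show "fst (c1 t) \<in> \<Delta>1 \<and> good_cell lt1 (c1 t) \<and> t = hull_tile (c1 t)" if "t \<in> \<tau>1" for t by (rule c1[OF that])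
    show "fst (c2 t) \<in> \<Delta>2 \<and> good_cell lt2 (c2 t) \<and> t = hull_tile (c2 t)" if "t \<in> \<tau>2" for t by (rule c2[OF that])
    show "product_list lt1 lt2 (c1 t) (c2 u) (PL t u)" if "t \<in> \<tau>1" "u \<in> \<tau>2" for t u
      using PL[OF that] unfolding Q_def by (rule conjunct1)
    show "convex hull W \<subseteq> closure S1" if "W \<in> \<Delta>1" for W by (rule cover1[OF that])
    show "convex hull W \<subseteq> closure S2" if "W \<in> \<Delta>2" for W by (rule cover2[OF that])
    show "critical_count (PL t u) k = of_bool (\<exists>i j. critical_of_index t i \<and> critical_of_index u j \<and> k = i + j)"
      if "t \<in> \<tau>1" "u \<in> \<tau>2" for t u k using conjunct1[OF conjunct2[OF PL[OF that, unfolded Q_def]]] by (rule spec)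
    show "order_count (PL t u) k = product_order (nat (tile_dim t)) (nat (tile_dim u)) (tile_order t) (tile_order u) k"
      if "t \<in> \<tau>1" "u \<in> \<tau>2" for t u k using conjunct2[OF conjunct2[OF PL[OF that, unfolded Q_def]]] by (rule spec)
  qed
  have prim: "primitive_triangulation (product_cells (underlying_complex K1 S1) (underlying_complex K2 S2)) P.T"
    using P.primitive_T unfolding f1(2) f2(2) .
  have pal: "pure_dimensional \<tau>1 \<and> pure_dimensional \<tau>2 \<and> palindromic (h_vector \<tau>1) \<and> palindromic (h_vector \<tau>2) \<longrightarrow>
      palindromic (h_vector P.\<tau>)" using P.palindromic_\<tau>[OF fin] by blast
  have shell: "\<exists>N F. morse_shelling P.T (S1 \<times> S2) P.\<tau> N F"
    if h: "(\<exists>N1 F1. morse_shelling K1 S1 \<tau>1 N1 F1) \<and> (\<exists>N2 F2. morse_shelling K2 S2 \<tau>2 N2 F2)"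
  proof -
    obtain ts us where "shelling_list S1 \<tau>1 ts" "shelling_list S2 \<tau>2 us"
      using h shelling_list_of_morse_shelling by metis
    then show ?thesis using morse_shelling_of_list[OF P.morse_tiling_\<tau> P.shelling_list_product] by blast
  qed
  show ?thesis
  proof (intro conjI impI)
    show "\<exists>(T :: ('a \<times> 'b) set set) \<tau>.
        primitive_triangulation (product_cells (underlying_complex K1 S1) (underlying_complex K2 S2)) T \<and>
        morse_tiling T (S1 \<times> S2) \<tau> \<and> tame T (S1 \<times> S2) \<tau> \<and>
        c_vector \<tau> = vector_product (c_vector \<tau>1) (c_vector \<tau>2) \<and>
        (pure_dimensional \<tau>1 \<and> pure_dimensional \<tau>2 \<and>
         palindromic (h_vector \<tau>1) \<and> palindromic (h_vector \<tau>2) \<longrightarrow> palindromic (h_vector \<tau>))"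
      by (rule exI[of _ P.T], rule exI[of _ P.\<tau>]) (intro conjI prim P.morse_tiling_\<tau> P.tame_\<tau> P.c_vector_\<tau>[OF fin] pal)
    assume "(\<exists>N1 F1. morse_shelling K1 S1 \<tau>1 N1 F1) \<and> (\<exists>N2 F2. morse_shelling K2 S2 \<tau>2 N2 F2)"
    then obtain N F where NF: "morse_shelling P.T (S1 \<times> S2) P.\<tau> N F" using shell by blast
    show "\<exists>(T :: ('a \<times> 'b) set set) \<tau> N F.
        primitive_triangulation (product_cells (underlying_complex K1 S1) (underlying_complex K2 S2)) T \<and>
        morse_shelling T (S1 \<times> S2) \<tau> N F \<and> tame T (S1 \<times> S2) \<tau> \<and>
        c_vector \<tau> = vector_product (c_vector \<tau>1) (c_vector \<tau>2) \<and>
        (pure_dimensional \<tau>1 \<and> pure_dimensional \<tau>2 \<and>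
         palindromic (h_vector \<tau>1) \<and> palindromic (h_vector \<tau>2) \<longrightarrow> palindromic (h_vector \<tau>))"
      by (rule exI[of _ P.T], rule exI[of _ P.\<tau>], rule exI[of _ N], rule exI[of _ F])
        (intro conjI prim NF P.tame_\<tau> P.c_vector_\<tau>[OF fin] pal)
  qed
qed

end
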